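(* Assume conditions (A1), (A2), (A3) and (A4) stated in the context. Then $$\varepsilon^{-1}(\hat\theta_{n,\varepsilon}-\theta_0)\longrightarrow I^{-1}(\theta_0)\,S(\theta_0)\quad\text{in } P_{\theta_0}\text{-probability}$$ as $\varepsilon\to0$, $n\to\infty$ and $n\varepsilon\to\infty$, where $$S(\theta_0):=\left(\int_0^1(\partial_{\theta_1}b)^T(X^0_s,\theta_0)\,dL_s,\ \dots,\ \int_0^1(\partial_{\theta_p}b)^T(X^0_s,\theta_0)\,dL_s\right)^T .$$
   Context: Lévy process. On a filtered probability space $(\Omega,\mathcal F,\mathbb P)$ with right-continuous increasing filtration $(\mathcal F_t)_{t\ge 0}$, let $(L_t)_{t\ge0}$ be the $\mathbb R^d$-valued Lévy process $$L_t=at+\sigma B_t+\int_0^t\int_{|z|\le 1}z\,\tilde N(ds,dz)+\int_0^t\int_{|z|>1}z\,N(ds,dz),$$ where $a\in\mathbb R^d$, $\sigma=(\sigma_{ij})$ is a real $d\times r$ matrix, $B=(B^1,\dots,B^r)$ is a standard $r$-dimensional Brownian motion, $N$ is a Poisson random measure on $\mathbb R_+\times(\mathbb R^d\setminus\{0\})$, independent of $B$, with characteristic (intensity) measure $dt\,\nu(dz)$, $\tilde N(ds,dz)=N(ds,dz)-ds\,\nu(dz)$, and $\nu$ is a Lévy measure, i.e. $\int_{\mathbb R^d\setminus\{0\}}(|z|^2\wedge1)\,\nu(dz)<\infty$. No moment condition is imposed on $L$. Model. $\Theta=\bar\Theta_0$ is the closure of an open bounded convex set $\Theta_0\subset\mathbb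 R^p$, $b=(b_1,\dots,b_d):\mathbb R^d\times\Theta\to\mathbb R^d$ is a known function, $x_0\in\mathbb R^d$, $\varepsilon\in(0,1]$, and $\theta_0\in\Theta_0$ is the true parameter value. Under the true parameter, $X$ (which depends on $\varepsilon$) is the unique strong solution of $dX_t=b(X_t,\theta_0)\,dt+\varepsilon\,dL_t$, $t\in[0,1]$, $X_0=x_0$; $P_{\theta_0}$ denotes the underlying probability when the parameter value is $\theta_0$. The process is observed at $t_k=k/n$, $k=1,\dots,n$ (with $t_0=0$), and $\Delta t_{k-1}=t_k-t_{k-1}=1/n$. The deterministic function $X^0$ solves $dX^0_t=b(X^0_t,\theta_0)\,dt$, $X^0_0=x_0$. The limits in $\varepsilon$ and $n$ are taken simultaneously. Least squares estimator. $\hat\theta_{n,\varepsilon}:=\arg\min_{\theta\in\Theta}\Psi_{n,\varepsilon}(\theta)$, where $$\Psi_{n,\varepsilon}(\theta)=\sum_{k=1}^n\frac{|X_{t_k}-X_{t_{k-1}}-b(X_{t_{k-1}},\theta)\,\Delta t_{k-1}|^2}{\varepsilon^2\,\Delta t_{k-1}}.$$ Function classes. $C^{k,l}(\mathbb R^d\times\Theta;\mathbb R)$ is the space of functions $f:\mathbb R^d\times\Theta\to\mathbb R$ that are $k$ times continuously differentiable in $x$ and $l$ times continuously differentiable in $\theta$. $C^{k,l}_\uparrow(\mathbb R^d\times\Theta;\mathbb R)$ is the class of $f\in C^{k,l}(\mathbb R^d\times\Theta;\mathbb R)$ such that, for universal positive constants $C,\lambda$, $\sup_{\theta\in\Theta}|\partial_\theta^\alpha\partial_x^\beta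 f(x,\theta)|\le C(1+|x|)^\lambda$ for all $x$ and all multi-indices $\alpha=(\alpha_1,\dots,\alpha_p)$, $\beta=(\beta_1,\dots,\beta_d)$ with $0\le\sum_i\alpha_i\le l$ and $0\le\sum_i\beta_i\le k$. Conditions. (A1) There is a constant $K_0>0$ such that $|b(x,\theta)-b(y,\theta)|\le K_0|x-y|$ and $|b(x,\theta)|\le K_0(1+|x|)$ for all $x,y\in\mathbb R^d$, $\theta\in\Theta$. (A2) Each component $b_i$ of $b$ belongs to $C^{2,3}_\uparrow(\mathbb R^d\times\Theta;\mathbb R)$. (A3) For $\theta\in\Theta$: $\theta\ne\theta_0$ if and only if $b(X^0_t,\theta)\ne b(X^0_t,\theta_0)$ for at least one $t\in[0,1]$. (A4) The $p\times p$ matrix $I(\theta_0)=(I^{ij}(\theta_0))_{1\le i,j\le p}$ is positive definite, where $I^{ij}(\theta)=\int_0^1(\partial_{\theta_i}b)^T(X^0_s,\theta)\,\partial_{\theta_j}b(X^0_s,\theta)\,ds$. Here $T$ denotes transpose, and $\int_0^1(\partial_{\theta_i}b)^T(X^0_s,\theta_0)\,dL_s=\sum_{j=1}^d\int_0^1\partial_{\theta_i}b_j(X^0_s,\theta_0)\,dL^j_s$ with $L^j$ the $j$-th component of $L$. *)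

theory Defs
  imports "HOL-Probability.Probability"
begin

definition tendsto_in_prob ::
    "'w measure \<Rightarrow> ('i \<Rightarrow> 'w \<Rightarrow> 'b::metric_space) \<Rightarrow> ('w \<Rightarrow> 'b) \<Rightarrow> 'i filter \<Rightarrow> bool" where
  "tendsto_in_prob M Y Z G \<longleftrightarrow>
     (\<forall>\<eta>>0. ((\<lambda>i. measure M {\<omega> \<in> space M. dist (Y i \<omega>) (Z \<omega>) > \<eta>}) \<longlongrightarrow> 0) G)"

definition cadlag_on :: "real set \<Rightarrow> (real \<Rightarrow> 'b::metric_space) \<Rightarrow> bool" where
  "cadlag_on I f \<longleftrightarrow>
     (\<forall>t\<in>I. (f \<longlongrightarrow> f t) (at t within I \<inter> {t<..}) \<and>
            (\<exists>l. (f \<longlongrightarrow> l) (at t within I \<inter> {..<t})))"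

definition pos_definite :: "real ^ 'n ^ 'n \<Rightarrow> bool" where
  "pos_definite A \<longleftrightarrow> transpose A = A \<and> (\<forall>v. v \<noteq> 0 \<longrightarrow> v \<bullet> (A *v v) > 0)"


subsection \<open>The driving noise\<close>

text \<open>Time runs through \<open>[0, \<infinity>)\<close>; values at negative times are never used.\<close>

definition filtered_space :: "'w measure \<Rightarrow> (real \<Rightarrow> 'w measure) \<Rightarrow> bool" where
  "filtered_space M F \<longleftrightarrow>
     prob_space M \<and>
     (\<forall>t\<ge>0. subalgebra M (F t)) \<and>
     (\<forall>s t. 0 \<le> s \<and> s \<le> t \<longrightarrow> sets (F s) \<subseteq> sets (F t)) \<and>
     (\<forall>t\<ge>0. sets (F t) = (\<Inter>s\<in>{t<..}. sets (F s)))"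

text \<open>The events generated by a family of random variables.\<close>

definition gen_events :: "'w measure \<Rightarrow> 'b measure \<Rightarrow> 'i set \<Rightarrow> ('i \<Rightarrow> 'w \<Rightarrow> 'b) \<Rightarrow> 'w set set" where
  "gen_events M K I Y = sigma_sets (space M) {Y i -` A \<inter> space M | i A. i \<in> I \<and> A \<in> sets K}"

definition brownian_motion ::
    "'w measure \<Rightarrow> (real \<Rightarrow> 'w measure) \<Rightarrow> (real \<Rightarrow> 'w \<Rightarrow> real ^ 'r) \<Rightarrow> bool" where
  "brownian_motion M F B \<longleftrightarrow>
     (\<forall>t\<ge>0. B t \<in> borel_measurable (F t)) \<and>
     (AE \<omega> in M. B 0 \<omega> = 0) \<and>
     (AE \<omega> in M. continuous_on {0..} (\<lambda>t. B t \<omega>)) \<and>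
     (\<forall>s t. 0 \<le> s \<and> s < t \<longrightarrow>
        distributed M lborel (\<lambda>\<omega>. B t \<omega> - B s \<omega>)
          (\<lambda>x. ennreal (\<Prod>i\<in>UNIV. normal_density 0 (sqrt (t - s)) (x $ i))) \<and>
        prob_space.indep_set M (sets (F s))
          (gen_events M borel {()} (\<lambda>_ \<omega>. B t \<omega> - B s \<omega>)))"

text \<open>A Levy measure is a measure on the space of nonzero vectors.\<close>

definition levy_measure :: "(real ^ 'd) measure \<Rightarrow> bool" where
  "levy_measure \<nu> \<longleftrightarrow>
     space \<nu> = - {0} \<and> sets \<nu> = sets (restrict_space borel (- {0})) \<and>
     (\<integral>\<^sup>+ z. ennreal (min ((norm z)\<^sup>2) 1) \<partial>\<nu>) < \<infinity>"

definition jump_intensity :: "(real ^ 'd) measure \<Rightarrow> (real \<times> (real ^ 'd)) measure" where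
  "jump_intensity \<nu> = restrict_space lborel {0..} \<Otimes>\<^sub>M \<nu>"

text \<open>Poisson random measure with intensity \<open>\<mu>\<close> on a space of (time, mark) pairs, relative to
  the filtration: the points up to time \<open>t\<close> are known at time \<open>t\<close>, the later ones are independent
  of it.\<close>

definition poisson_random_measure ::
    "'w measure \<Rightarrow> (real \<Rightarrow> 'w measure) \<Rightarrow> ('w \<Rightarrow> (real \<times> 'z) measure) \<Rightarrow> (real \<times> 'z) measure \<Rightarrow> bool"
  where
  "poisson_random_measure M F N \<mu> \<longleftrightarrow>
     (\<forall>\<omega>\<in>space M. space (N \<omega>) = space \<mu> \<and> sets (N \<omega>) = sets \<mu>) \<and>
     (\<forall>A\<in>sets \<mu>. (\<lambda>\<omega>. emeasure (N \<omega>) A) \<in> borel_measurable M) \<and>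
     (\<forall>A\<in>sets \<mu>. emeasure \<mu> A < \<infinity> \<longrightarrow>
        (\<forall>k::nat. measure M {\<omega> \<in> space M. emeasure (N \<omega>) A = of_nat k}
                  = measure \<mu> A ^ k / fact k * exp (- measure \<mu> A))) \<and>
     (\<forall>A\<in>sets \<mu>. emeasure \<mu> A = \<infinity> \<longrightarrow> (AE \<omega> in M. emeasure (N \<omega>) A = \<infinity>)) \<and>
     (\<forall>(m::nat) A. (\<forall>i<m. A i \<in> sets \<mu>) \<and> disjoint_family_on A {..<m} \<longrightarrow>
        prob_space.indep_vars M (\<lambda>_. borel) (\<lambda>i \<omega>. emeasure (N \<omega>) (A i)) {..<m}) \<and>
     (\<forall>t\<ge>0. \<forall>A\<in>sets \<mu>. A \<subseteq> {..t} \<times> UNIV \<longrightarrow>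
        (\<lambda>\<omega>. emeasure (N \<omega>) A) \<in> borel_measurable (F t)) \<and>
     (\<forall>t\<ge>0. prob_space.indep_set M (sets (F t))
        (gen_events M borel {A \<in> sets \<mu>. A \<subseteq> {t<..} \<times> UNIV} (\<lambda>A \<omega>. emeasure (N \<omega>) A)))"

text \<open>The compensated small-jump integral \<open>\<integral>\<^sub>0\<^sup>t \<integral>\<^bsub>|z| \<le> 1\<^esub> z (N - ds \<nu>)(ds,dz)\<close> is the
  mean-square limit, as \<open>\<delta> \<down> 0\<close>, of the compensated integrals over \<open>\<delta> < |z| \<le> 1\<close>, a region of
  finite intensity; a version with cadlag paths is taken.\<close>

definition small_jumps ::
    "'w measure \<Rightarrow> ('w \<Rightarrow> (real \<times> (real ^ 'd)) measure) \<Rightarrow> (real ^ 'd) measure \<Rightarrow>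
     (real \<Rightarrow> 'w \<Rightarrow> real ^ 'd) \<Rightarrow> bool" where
  "small_jumps M N \<nu> J \<longleftrightarrow>
     (\<forall>t\<ge>0. J t \<in> borel_measurable M) \<and>
     (AE \<omega> in M. cadlag_on {0..} (\<lambda>t. J t \<omega>)) \<and>
     (\<forall>t\<ge>0. ((\<lambda>\<delta>. \<integral>\<^sup>+ \<omega>. ennreal ((norm (J t \<omega> -
           ((LINT u : {0<..t} \<times> {z. \<delta> < norm z \<and> norm z \<le> 1} | N \<omega>. snd u) -
            (LINT u : {0<..t} \<times> {z. \<delta> < norm z \<and> norm z \<le> 1} | jump_intensity \<nu>. snd u))))\<^sup>2) \<partial>M)
         \<longlongrightarrow> 0) (at_right 0))"

definition levy_process ::
    "'w measure \<Rightarrow> (real \<Rightarrow> 'w measure) \<Rightarrow> real ^ 'd \<Rightarrow> real ^ 'r ^ 'd \<Rightarrow>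
     (real \<Rightarrow> 'w \<Rightarrow> real ^ 'r) \<Rightarrow> ('w \<Rightarrow> (real \<times> (real ^ 'd)) measure) \<Rightarrow> (real ^ 'd) measure \<Rightarrow>
     (real \<Rightarrow> 'w \<Rightarrow> real ^ 'd) \<Rightarrow> bool" where
  "levy_process M F a \<sigma> B N \<nu> L \<longleftrightarrow>
     levy_measure \<nu> \<and>
     brownian_motion M F B \<and>
     poisson_random_measure M F N (jump_intensity \<nu>) \<and>
     prob_space.indep_set M
       (gen_events M borel {0..} B)
       (gen_events M borel (sets (jump_intensity \<nu>)) (\<lambda>A \<omega>. emeasure (N \<omega>) A)) \<and>
     (\<forall>t\<ge>0. L t \<in> borel_measurable (F t)) \<and>
     (AE \<omega> in M. cadlag_on {0..} (\<lambda>t. L t \<omega>)) \<and>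
     (\<exists>J. small_jumps M N \<nu> J \<and>
        (AE \<omega> in M. \<forall>t\<ge>0. L t \<omega> = t *\<^sub>R a + \<sigma> *v B t \<omega> + J t \<omega> +
           (LINT u : {0<..t} \<times> {z. norm z > 1} | N \<omega>. snd u)))"


subsection \<open>Stochastic integrals\<close>

text \<open>A simple integrand on \<open>(0, T]\<close> is \<open>\<Sum>i<m. \<xi>\<^sub>i 1\<^bsub>(\<tau>\<^sub>i, \<tau>\<^sub>i\<^sub>+\<^sub>1]\<^esub>\<close> with deterministic times
  \<open>0 = \<tau>\<^sub>0 < \<dots> < \<tau>\<^sub>m = T\<close> and bounded, \<open>F \<tau>\<^sub>i\<close>-measurable \<open>\<xi>\<^sub>i\<close>.\<close>

definition simple_integrand ::
    "'w measure \<Rightarrow> (real \<Rightarrow> 'w measure) \<Rightarrow> real \<Rightarrow> nat \<Rightarrow> (nat \<Rightarrow> real) \<Rightarrow>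
     (nat \<Rightarrow> 'w \<Rightarrow> 'b::euclidean_space) \<Rightarrow> bool" where
  "simple_integrand M F T m \<tau> \<xi> \<longleftrightarrow>
     \<tau> 0 = 0 \<and> \<tau> m = T \<and>
     (\<forall>i<m. \<tau> i < \<tau> (Suc i) \<and> \<xi> i \<in> borel_measurable (F (\<tau> i)) \<and> bounded (\<xi> i ` space M))"

definition simple_process ::
    "nat \<Rightarrow> (nat \<Rightarrow> real) \<Rightarrow> (nat \<Rightarrow> 'w \<Rightarrow> 'b::euclidean_space) \<Rightarrow> real \<Rightarrow> 'w \<Rightarrow> 'b" where
  "simple_process m \<tau> \<xi> s \<omega> = (\<Sum>i<m. indicator {\<tau> i<..\<tau> (Suc i)} s *\<^sub>R \<xi> i \<omega>)"

definition simple_integral ::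
    "nat \<Rightarrow> (nat \<Rightarrow> real) \<Rightarrow> (nat \<Rightarrow> 'w \<Rightarrow> 'b::euclidean_space) \<Rightarrow> (real \<Rightarrow> 'w \<Rightarrow> 'b) \<Rightarrow> 'w \<Rightarrow> real" where
  "simple_integral m \<tau> \<xi> Z \<omega> = (\<Sum>i<m. \<xi> i \<omega> \<bullet> (Z (\<tau> (Suc i)) \<omega> - Z (\<tau> i) \<omega>))"

text \<open>\<open>has_stoch_integral M F H Z T Y\<close>: the random variable \<open>Y\<close> is a version of
  \<open>\<integral>\<^sub>0\<^sup>T H\<^sup>\<top> dZ = \<Sum>j. \<integral>\<^sub>0\<^sup>T H\<^sub>j dZ\<^sub>j\<close> for an integrand \<open>H\<close> with continuous adapted paths and a
  semimartingale \<open>Z\<close>. The integral is the extension of the elementary one by continuity, from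
  uniform convergence in probability of the integrands to convergence in probability; it is unique
  up to null events, whence the relational formulation.\<close>

definition has_stoch_integral ::
    "'w measure \<Rightarrow> (real \<Rightarrow> 'w measure) \<Rightarrow> (real \<Rightarrow> 'w \<Rightarrow> 'b::euclidean_space) \<Rightarrow>
     (real \<Rightarrow> 'w \<Rightarrow> 'b) \<Rightarrow> real \<Rightarrow> ('w \<Rightarrow> real) \<Rightarrow> bool" where
  "has_stoch_integral M F H Z T Y \<longleftrightarrow>
     (\<forall>t\<in>{0..T}. H t \<in> borel_measurable (F t)) \<and>
     (\<forall>\<omega>\<in>space M. continuous_on {0..T} (\<lambda>t. H t \<omega>)) \<and>
     Y \<in> borel_measurable M \<and>
     (\<forall>(m :: nat \<Rightarrow> nat) (\<tau> :: nat \<Rightarrow> nat \<Rightarrow> real) (\<xi> :: nat \<Rightarrow> nat \<Rightarrow> 'w \<Rightarrow> 'b).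
        (\<forall>k. simple_integrand M F T (m k) (\<tau> k) (\<xi> k)) \<and>
        (\<forall>\<eta>>0. (\<lambda>k. measure M {\<omega> \<in> space M.
            \<exists>s\<in>{0<..T}. dist (simple_process (m k) (\<tau> k) (\<xi> k) s \<omega>) (H s \<omega>) > \<eta>}) \<longlonglongrightarrow> 0)
        \<longrightarrow> tendsto_in_prob M (\<lambda>k. simple_integral (m k) (\<tau> k) (\<xi> k) Z) Y sequentially)"


subsection \<open>The small-noise model and its least squares contrast\<close>

text \<open>Strong solution on \<open>[0,1]\<close> of \<open>dX\<^sub>t = \<beta>(X\<^sub>t) dt + \<epsilon> dL\<^sub>t\<close>, \<open>X\<^sub>0 = x0\<close>. The noise is additive,
  so the equation is pathwise.\<close>

definition strong_solution ::
    "'w measure \<Rightarrow> (real \<Rightarrow> 'w measure) \<Rightarrow> (real ^ 'd \<Rightarrow> real ^ 'd) \<Rightarrow> real \<Rightarrow>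
     (real \<Rightarrow> 'w \<Rightarrow> real ^ 'd) \<Rightarrow> real ^ 'd \<Rightarrow> (real \<Rightarrow> 'w \<Rightarrow> real ^ 'd) \<Rightarrow> bool" where
  "strong_solution M F \<beta> \<epsilon> L x0 X \<longleftrightarrow>
     (\<forall>t\<in>{0..1}. X t \<in> borel_measurable (F t)) \<and>
     (AE \<omega> in M. cadlag_on {0..1} (\<lambda>t. X t \<omega>) \<and>
        (\<forall>t\<in>{0..1}. ((\<lambda>s. \<beta> (X s \<omega>)) has_integral (X t \<omega> - x0 - \<epsilon> *\<^sub>R L t \<omega>)) {0..t}))"

definition ode_solution ::
    "(real ^ 'd \<Rightarrow> real ^ 'd) \<Rightarrow> real ^ 'd \<Rightarrow> (real \<Rightarrow> real ^ 'd) \<Rightarrow> bool" where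
  "ode_solution \<beta> x0 x \<longleftrightarrow>
     x 0 = x0 \<and> (\<forall>t\<in>{0..1}. (x has_vector_derivative \<beta> (x t)) (at t within {0..1}))"

definition lse_contrast ::
    "(real ^ 'd \<Rightarrow> real ^ 'p \<Rightarrow> real ^ 'd) \<Rightarrow> nat \<Rightarrow> real \<Rightarrow> (real \<Rightarrow> real ^ 'd) \<Rightarrow> real ^ 'p \<Rightarrow> real" where
  "lse_contrast b n \<epsilon> x \<theta> =
     (\<Sum>k = 1..n. (norm (x (real k / real n) - x (real (k - 1) / real n)
          - (1 / real n) *\<^sub>R b (x (real (k - 1) / real n)) \<theta>))\<^sup>2 / (\<epsilon>\<^sup>2 * (1 / real n)))"

definition partial_theta ::
    "(real ^ 'd \<Rightarrow> real ^ 'p \<Rightarrow> real ^ 'd) \<Rightarrow> 'p \<Rightarrow> real ^ 'd \<Rightarrow> real ^ 'p \<Rightarrow> real ^ 'd" where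
  "partial_theta b i x \<theta> = vector_derivative (\<lambda>h. b x (\<theta> + h *\<^sub>R axis i 1)) (at 0)"

definition info_matrix ::
    "(real ^ 'd \<Rightarrow> real ^ 'p \<Rightarrow> real ^ 'd) \<Rightarrow> (real \<Rightarrow> real ^ 'd) \<Rightarrow> real ^ 'p \<Rightarrow> real ^ 'p ^ 'p" where
  "info_matrix b X0 \<theta> =
     (\<chi> i j. integral {0..1} (\<lambda>s. partial_theta b i (X0 s) \<theta> \<bullet> partial_theta b j (X0 s) \<theta>))"


subsection \<open>The function classes\<close>

text \<open>\<open>D \<alpha> \<beta>\<close> is \<open>\<partial>\<^sub>\<theta>\<^sup>\<alpha> \<partial>\<^sub>x\<^sup>\<beta> f\<close> for multi-indices of order at most \<open>l\<close> and \<open>k\<close>. As usual for a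
  closed parameter set that is the closure of its interior, the derivatives in \<open>\<theta>\<close> are taken at
  interior points and extend continuously to the boundary; this determines \<open>D \<alpha> \<beta>\<close> on \<open>\<Theta>\<close>.\<close>

definition derivative_family ::
    "nat \<Rightarrow> nat \<Rightarrow> (real ^ 'p) set \<Rightarrow> (real ^ 'd \<Rightarrow> real ^ 'p \<Rightarrow> real) \<Rightarrow>
     (('p \<Rightarrow> nat) \<Rightarrow> ('d \<Rightarrow> nat) \<Rightarrow> real ^ 'd \<Rightarrow> real ^ 'p \<Rightarrow> real) \<Rightarrow> bool" where
  "derivative_family k l \<Theta> f D \<longleftrightarrow>
     (\<forall>x. \<forall>\<theta>\<in>\<Theta>. D (\<lambda>_. 0) (\<lambda>_. 0) x \<theta> = f x \<theta>) \<and>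
     (\<forall>\<alpha> \<beta>. sum \<alpha> UNIV \<le> l \<and> sum \<beta> UNIV \<le> k \<longrightarrow>
        continuous_on (UNIV \<times> \<Theta>) (\<lambda>(x, \<theta>). D \<alpha> \<beta> x \<theta>)) \<and>
     (\<forall>\<alpha> \<beta> i. sum \<alpha> UNIV \<le> l \<and> sum \<beta> UNIV < k \<longrightarrow> (\<forall>x. \<forall>\<theta>\<in>\<Theta>.
        ((\<lambda>h. D \<alpha> \<beta> (x + h *\<^sub>R axis i 1) \<theta>) has_real_derivative
          D \<alpha> (\<beta>(i := Suc (\<beta> i))) x \<theta>) (at 0))) \<and>
     (\<forall>\<alpha> \<beta> j. sum \<alpha> UNIV < l \<and> sum \<beta> UNIV \<le> k \<longrightarrow> (\<forall>x. \<forall>\<theta>\<in>interior \<Theta>.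
        ((\<lambda>h. D \<alpha> \<beta> x (\<theta> + h *\<^sub>R axis j 1)) has_real_derivative
          D (\<alpha>(j := Suc (\<alpha> j))) \<beta> x \<theta>) (at 0)))"

definition C_up ::
    "nat \<Rightarrow> nat \<Rightarrow> (real ^ 'p) set \<Rightarrow> (real ^ 'd \<Rightarrow> real ^ 'p \<Rightarrow> real) set" where
  "C_up k l \<Theta> = {f. \<exists>D. derivative_family k l \<Theta> f D \<and>
     (\<exists>C>0. \<exists>q>0. \<forall>\<alpha> \<beta>. sum \<alpha> UNIV \<le> l \<and> sum \<beta> UNIV \<le> k \<longrightarrow>
        (\<forall>x. \<forall>\<theta>\<in>\<Theta>. \<bar>D \<alpha> \<beta> x \<theta>\<bar> \<le> C * (1 + norm x) powr q))}"

end

theory Submission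
  imports Defs
begin

text \<open>Subtracting the contrast at the true value gives
  \<open>\<epsilon>\<^sup>2 (\<Psi>(\<theta>) - \<Psi>(\<theta>\<^sub>0)) = q(\<theta>) - 2 \<epsilon> S \<bullet> v + o(|v|\<^sup>2) + 2 \<epsilon> (o(|v|) + O(|v|\<^sup>2))\<close> with \<open>v = \<theta> - \<theta>\<^sub>0\<close> and \<open>q\<close> the
  squared \<open>L\<^sup>2\<close> distance of the drifts along \<open>X\<^sup>0\<close>, uniformly in \<open>\<theta>\<close> on an event of probability close
  to one. Identifiability makes \<open>q\<close> coercive, so the minimiser has \<open>|v| = O(\<epsilon>)\<close>, and comparing it with
  \<open>\<theta>\<^sub>0 + \<epsilon> I\<^sup>-\<^sup>1 S\<close> gives the limit.

  No moments of \<open>L\<close> are needed because discarding the jumps beyond a large radius changes \<open>L\<close> on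
  \<open>[0,1]\<close> only with small probability and leaves a Lipschitz drift plus square-integrable martingale
  increments \<open>W\<close>. Uniformity in \<open>\<theta>\<close> costs no entropy argument: a second-order expansion along dyadic
  refinements bounds \<open>\<Sum>f(X) \<Delta>W\<close> by one random constant times the \<open>C\<^sup>2\<close> size of \<open>f\<close>, simultaneously
  for all \<open>f\<close>.\<close>

section \<open>Discrete stochastic sums, uniformly over smooth integrands\<close>

text \<open>The minimiser is a function of the whole path, so inserting it into the contrast gives
  noise sums whose integrands are not adapted; this is why a bound valid for every integrand on one
  event is sought. Two derivatives in \<open>x\<close> suffice: splitting an interval of length
  \<open>H\<close> creates an error of mean order \<open>H * sqrt H\<close>, and two halves together
  carry only about \<open>1 / sqrt 2\<close> of it, so the errors of all refinements are summable.
  After linearisation in the parameter the drift remainder has a C^2 size of the order of the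
  squared parameter distance, and a merely bounded noise factor in front of that square is harmless:
  it comes multiplied by \<open>\<epsilon>\<close> and is absorbed by coercivity.

  Truncation level, radii and Lipschitz constants depend on the tolerated probability but not on
  \<open>n\<close> or \<open>\<epsilon>\<close>, so they can be fixed before the limit is taken. The
  growth of \<open>n * \<epsilon>\<close> pays for the Euler error of the drift, of order
  \<open>1 / n\<close> against noise of order \<open>\<epsilon>\<close>. Conditional expectations
  are replaced throughout by integrals against bounded weights measurable in the past.\<close>

lemma borel_measurable_nth [measurable (raw)]:
  "f \<in> borel_measurable N \<Longrightarrow> (\<lambda>\<omega>. f \<omega> $ i :: real) \<in> borel_measurable N"
  unfolding cart_eq_inner_axis by (intro borel_measurable_inner) auto

text \<open>Both parts are at most two thirds of the whole and
  \<open>sqrt (2 / 3) \<le> 5 / 6\<close>. The point is that \<open>5 / 6 < 1\<close>: this is the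
  geometric gain per refinement in \<open>local_expansion\<close>.\<close>

lemma power_three_halves_split:
  fixes a b :: real
  assumes "0 \<le> a" "0 \<le> b" "3 * a \<le> 2 * (a + b)" "3 * b \<le> 2 * (a + b)"
  shows "a * sqrt a + b * sqrt b \<le> 5 / 6 * ((a + b) * sqrt (a + b))"
proof -
  have *: "sqrt x \<le> 5 / 6 * sqrt (a + b)" if "3 * x \<le> 2 * (a + b)" "0 \<le> x" for x
  proof (rule real_le_lsqrt)
    show "x \<le> (5 / 6 * sqrt (a + b))\<^sup>2" using that assms by (simp add: power_mult_distrib power2_eq_square)
  qed (use assms that in auto)
  have "a * sqrt a + b * sqrt b \<le> a * (5 / 6 * sqrt (a + b)) + b * (5 / 6 * sqrt (a + b))"
    using assms by (intro add_mono mult_left_mono *) auto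
  then show ?thesis by (simp add: algebra_simps)
qed

text \<open>Four inequalities with one constant stand in for differentiability. They are what the
  expansion along \<open>X\<close> uses, and they scale linearly in \<open>K\<close>, so a
  parameter-dependent family of functions is measured by a single number. \<open>Df\<close> is just
  a witness vector field.\<close>

definition C2_on :: "real \<Rightarrow> real \<Rightarrow> ('a::real_inner \<Rightarrow> real) \<Rightarrow> ('a \<Rightarrow> 'a) \<Rightarrow> bool" where
  "C2_on R K f Df \<longleftrightarrow> (\<forall>x\<in>cball 0 R. \<bar>f x\<bar> \<le> K \<and> norm (Df x) \<le> K \<and>
     (\<forall>y\<in>cball 0 R. \<bar>f y - f x - Df x \<bullet> (y - x)\<bar> \<le> K * (norm (y - x))\<^sup>2 \<and>
        norm (Df y - Df x) \<le> K * norm (y - x)))"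

section \<open>Martingale transforms on a time grid\<close>

text \<open>\<open>W\<close> is a martingale on a grid of step \<open>h\<close> with variance at
  most \<open>C\<close> per unit time, its conditional moments being expressed by integrals against
  bounded weights known at time \<open>k\<close>. \<open>var\<close> covers increments of arbitrary
  length because the dyadic argument needs the conditional variance over whole blocks.\<close>

locale discrete_noise = prob_space M for M :: "'w measure" +
  fixes A :: "nat \<Rightarrow> 'w measure" and W :: "nat \<Rightarrow> 'w \<Rightarrow> real ^ 'd" and h C :: real
  assumes sub: "subalgebra M (A k)"
    and A_mono: "k \<le> l \<Longrightarrow> sets (A k) \<subseteq> sets (A l)"
    and W_meas: "W k \<in> borel_measurable (A k)"
    and W_sq: "k < l \<Longrightarrow> integrable M (\<lambda>\<omega>. (norm (W l \<omega> - W k \<omega>))\<^sup>2)"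
    and mean0: "k < l \<Longrightarrow> \<xi> \<in> borel_measurable (A k) \<Longrightarrow> (\<And>\<omega>. \<omega> \<in> space M \<Longrightarrow> \<bar>\<xi> \<omega>\<bar> \<le> c) \<Longrightarrow>
       (\<integral>\<omega>. \<xi> \<omega> * ((W l \<omega> - W k \<omega>) $ i) \<partial>M) = 0"
    and var: "k < l \<Longrightarrow> \<xi> \<in> borel_measurable (A k) \<Longrightarrow> (\<And>\<omega>. \<omega> \<in> space M \<Longrightarrow> \<bar>\<xi> \<omega>\<bar> \<le> c) \<Longrightarrow>
       (\<integral>\<omega>. \<xi> \<omega> * (norm (W l \<omega> - W k \<omega>))\<^sup>2 \<partial>M) \<le> C * (real (l - k) * h) * (\<integral>\<omega>. \<bar>\<xi> \<omega>\<bar> \<partial>M)"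
    and h_pos: "0 < h" and C_nonneg: "0 \<le> C"
begin

lemma A_space: "space (A k) = space M"
  using sub[of k] by (simp add: subalgebra_def)

lemma meas_mono: "f \<in> borel_measurable (A k) \<Longrightarrow> k \<le> l \<Longrightarrow> f \<in> borel_measurable (A l)"
  using A_mono[of k l] by (auto simp: measurable_def A_space)

lemma meas_M: "f \<in> borel_measurable (A k) \<Longrightarrow> f \<in> borel_measurable M"
  using measurable_from_subalg[OF sub] by blast

lemma W_meas_M [measurable]: "W k \<in> borel_measurable M"
  using W_meas meas_M by blast

lemma sets_M: "G \<in> sets (A k) \<Longrightarrow> G \<in> sets M"
  using sub[of k] by (auto simp: subalgebra_def)

lemma integrable_bdd:
  assumes "\<xi> \<in> borel_measurable M" "\<And>\<omega>. \<omega> \<in> space M \<Longrightarrow> \<bar>\<xi> \<omega>\<bar> \<le> (c::real)"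
  shows "integrable M \<xi>"
  using assms by (intro integrable_const_bound[where B=c]) (auto simp: AE_I2)

lemma sq_int:
  assumes "k \<le> l" "\<xi> \<in> borel_measurable M" "\<And>\<omega>. \<omega> \<in> space M \<Longrightarrow> \<bar>\<xi> \<omega>\<bar> \<le> (c::real)"
  shows "integrable M (\<lambda>\<omega>. \<xi> \<omega> * (norm (W l \<omega> - W k \<omega>))\<^sup>2)"
proof (cases "k = l")
  case False
  then have "k < l" using assms by simp
  show ?thesis
  proof (rule Bochner_Integration.integrable_bound[OF integrable_mult_left[OF W_sq[OF \<open>k<l\<close>], of c]])
    show "(\<lambda>\<omega>. \<xi> \<omega> * (norm (W l \<omega> - W k \<omega>))\<^sup>2) \<in> borel_measurable M"
      using assms(2) by measurable
    show "AE \<omega> in M. norm (\<xi> \<omega> * (norm (W l \<omega> - W k \<omega>))\<^sup>2) \<le> norm ((norm (W l \<omega> - W k \<omega>))\<^sup>2 * c)"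
      using assms(3) by (intro AE_I2) (auto simp: abs_mult mult.commute intro!: mult_right_mono order_trans[OF _ abs_ge_self])
  qed
qed auto

lemma var':
  assumes "k \<le> l" "\<xi> \<in> borel_measurable (A k)" "\<And>\<omega>. \<omega> \<in> space M \<Longrightarrow> \<bar>\<xi> \<omega>\<bar> \<le> c"
  shows "(\<integral>\<omega>. \<xi> \<omega> * (norm (W l \<omega> - W k \<omega>))\<^sup>2 \<partial>M) \<le> C * (real (l - k) * h) * (\<integral>\<omega>. \<bar>\<xi> \<omega>\<bar> \<partial>M)"
  using var[of k l \<xi> c] assms by (cases "k = l") auto

text \<open>Cross terms vanish because the past sum times the current weight is an admissible test
  variable in \<open>mean0\<close>. Admissibility means boundedness, and this is what
  \<open>loc\<close> provides: wherever \<open>\<eta> e\<close> is nonzero, the path of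
  \<open>W\<close> up to \<open>e\<close> lies in a fixed ball, so the past sum is bounded
  there.\<close>

lemma transform_L2:
  fixes \<eta> :: "nat \<Rightarrow> 'w \<Rightarrow> real" and i :: 'd
  assumes meas: "\<And>k. \<eta> k \<in> borel_measurable (A k)"
    and bdd: "\<And>k \<omega>. \<omega> \<in> space M \<Longrightarrow> \<bar>\<eta> k \<omega>\<bar> \<le> c"
    and loc: "\<And>k j \<omega>. \<omega> \<in> space M \<Longrightarrow> j \<le> k \<Longrightarrow> \<eta> k \<omega> \<noteq> 0 \<Longrightarrow> norm (W j \<omega>) \<le> R"
    and me: "m \<le> e"
  defines "S \<equiv> \<lambda>e \<omega>. \<Sum>k\<in>{m..<e}. \<eta> k \<omega> * ((W (Suc k) \<omega> - W k \<omega>) $ i)"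
  shows "integrable M (\<lambda>\<omega>. (S e \<omega>)\<^sup>2) \<and>
    (\<integral>\<omega>. (S e \<omega>)\<^sup>2 \<partial>M) \<le> C * h * (\<Sum>k\<in>{m..<e}. \<integral>\<omega>. (\<eta> k \<omega>)\<^sup>2 \<partial>M)"
  using me
proof (induction e rule: dec_induct)
  case base
  then show ?case by (simp add: S_def)
next
  case (step e)
  have c0: "0 \<le> c" using not_empty bdd by (meson abs_ge_zero all_not_in_conv order_trans)
  define d where "d \<omega> = (W (Suc e) \<omega> - W e \<omega>) $ i" for \<omega>
  have [measurable]: "d \<in> borel_measurable M" unfolding d_def by measurable
  have etaM [measurable]: "\<eta> k \<in> borel_measurable M" for k using meas meas_M by blast
  have S_A: "S e \<in> borel_measurable (A e)"
    unfolding S_def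
  proof (intro borel_measurable_sum borel_measurable_times)
    fix k assume k: "k \<in> {m..<e}"
    show "\<eta> k \<in> borel_measurable (A e)" using meas_mono[OF meas, of k e] k by auto
    have [measurable]: "W (Suc k) \<in> borel_measurable (A e)" "W k \<in> borel_measurable (A e)"
      using meas_mono[OF W_meas] k by auto
    show "(\<lambda>\<omega>. (W (Suc k) \<omega> - W k \<omega>) $ i) \<in> borel_measurable (A e)"
      by (intro borel_measurable_nth) measurable
  qed
  have SM [measurable]: "S e \<in> borel_measurable M" using S_A meas_M by blast
  \<comment> \<open>A crude bound: on the support of the weight every earlier increment is at most
    \<open>2 * R\<close>. It grows with the number of steps, but it only makes
    \<open>S e * \<eta> e\<close> a legal test variable and secures integrability; it does not enter
    the estimate.\<close>
  define B where "B = real (e - m) * (c * (2 * R)) * c"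
  have bound: "\<bar>S e \<omega> * \<eta> e \<omega>\<bar> \<le> \<bar>B\<bar>" if w: "\<omega> \<in> space M" for \<omega>
  proof (cases "\<eta> e \<omega> = 0")
    case False
    have "\<bar>S e \<omega>\<bar> \<le> (\<Sum>k\<in>{m..<e}. c * (2 * R))"
      unfolding S_def
    proof (rule order_trans[OF sum_abs], rule sum_mono)
      fix k assume k: "k \<in> {m..<e}"
      have "\<bar>(W (Suc k) \<omega> - W k \<omega>) $ i\<bar> \<le> norm (W (Suc k) \<omega> - W k \<omega>)"
        using component_le_norm_cart by blast
      also have "\<dots> \<le> norm (W (Suc k) \<omega>) + norm (W k \<omega>)" by (rule norm_triangle_ineq4)
      also have "\<dots> \<le> 2 * R" using loc[OF w _ False, of "Suc k"] loc[OF w _ False, of k] k by auto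
      finally show "\<bar>\<eta> k \<omega> * (W (Suc k) \<omega> - W k \<omega>) $ i\<bar> \<le> c * (2 * R)"
        using bdd[OF w, of k] c0 by (auto simp: abs_mult intro!: mult_mono)
    qed
    also have "\<dots> = real (e - m) * (c * (2 * R))" by simp
    finally have *: "\<bar>S e \<omega>\<bar> \<le> real (e - m) * (c * (2 * R))" .
    have "\<bar>S e \<omega>\<bar> * \<bar>\<eta> e \<omega>\<bar> \<le> B" unfolding B_def
      by (rule mult_mono[OF * bdd[OF w] order_trans[OF abs_ge_zero *] abs_ge_zero])
    then show ?thesis by (simp add: abs_mult)
  qed simp
  have zero: "(\<integral>\<omega>. (S e \<omega> * \<eta> e \<omega>) * d \<omega> \<partial>M) = 0"
    unfolding d_def by (rule mean0[where c="\<bar>B\<bar>"]) (use S_A meas bound in auto)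
  have etasq: "\<bar>\<eta> e \<omega> * \<eta> e \<omega>\<bar> \<le> c * c" if "\<omega> \<in> space M" for \<omega>
    unfolding abs_mult by (rule mult_mono) (use bdd[OF that] c0 in auto)
  have int1: "integrable M (\<lambda>\<omega>. \<eta> e \<omega> * \<eta> e \<omega> * (norm (W (Suc e) \<omega> - W e \<omega>))\<^sup>2)"
    by (rule sq_int[OF le_SucI[OF order_refl] _ etasq]) measurable
  have dsq: "(d \<omega>)\<^sup>2 \<le> (norm (W (Suc e) \<omega> - W e \<omega>))\<^sup>2" for \<omega>
    using power_mono[OF component_le_norm_cart[of "W (Suc e) \<omega> - W e \<omega>" i] abs_ge_zero, of 2]
    unfolding d_def by (simp only: power2_abs)
  have int2: "integrable M (\<lambda>\<omega>. (\<eta> e \<omega>)\<^sup>2 * (d \<omega>)\<^sup>2)"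
  proof (rule Bochner_Integration.integrable_bound[OF int1])
    show "AE \<omega> in M. norm ((\<eta> e \<omega>)\<^sup>2 * (d \<omega>)\<^sup>2) \<le> norm (\<eta> e \<omega> * \<eta> e \<omega> * (norm (W (Suc e) \<omega> - W e \<omega>))\<^sup>2)"
    proof (rule AE_I2)
      fix \<omega>
      have nn: "0 \<le> (\<eta> e \<omega>)\<^sup>2 * y\<^sup>2" for y by simp
      have "(\<eta> e \<omega>)\<^sup>2 * (d \<omega>)\<^sup>2 \<le> (\<eta> e \<omega>)\<^sup>2 * (norm (W (Suc e) \<omega> - W e \<omega>))\<^sup>2"
        by (rule mult_left_mono[OF dsq]) simp
      then show "norm ((\<eta> e \<omega>)\<^sup>2 * (d \<omega>)\<^sup>2) \<le> norm (\<eta> e \<omega> * \<eta> e \<omega> * (norm (W (Suc e) \<omega> - W e \<omega>))\<^sup>2)"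
        unfolding real_norm_def power2_eq_square[of "\<eta> e \<omega>", symmetric] abs_of_nonneg[OF nn] .
    qed
  qed measurable
  have dle: "\<bar>x\<bar> \<le> 1 + x\<^sup>2" for x :: real
    using sum_squares_bound[of "\<bar>x\<bar>" 1] zero_le_power2[of x] unfolding power2_abs by simp
  have int3: "integrable M (\<lambda>\<omega>. (S e \<omega> * \<eta> e \<omega>) * d \<omega>)"
  proof (rule Bochner_Integration.integrable_bound)
    show "integrable M (\<lambda>\<omega>. \<bar>B\<bar> + \<bar>B\<bar> * (norm (W (Suc e) \<omega> - W e \<omega>))\<^sup>2)"
      by (intro Bochner_Integration.integrable_add integrable_mult_right W_sq) auto
    show "AE \<omega> in M. norm (S e \<omega> * \<eta> e \<omega> * d \<omega>) \<le> norm (\<bar>B\<bar> + \<bar>B\<bar> * (norm (W (Suc e) \<omega> - W e \<omega>))\<^sup>2)"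
    proof (rule AE_I2)
      fix \<omega> assume w: "\<omega> \<in> space M"
      have "\<bar>d \<omega>\<bar> \<le> 1 + (norm (W (Suc e) \<omega> - W e \<omega>))\<^sup>2"
        using component_le_norm_cart[of "W (Suc e) \<omega> - W e \<omega>" i] dle[of "norm (W (Suc e) \<omega> - W e \<omega>)"]
        unfolding d_def by simp
      then have "\<bar>S e \<omega> * \<eta> e \<omega>\<bar> * \<bar>d \<omega>\<bar> \<le> \<bar>B\<bar> * (1 + (norm (W (Suc e) \<omega> - W e \<omega>))\<^sup>2)"
        using bound[OF w] by (intro mult_mono) auto
      then show "norm (S e \<omega> * \<eta> e \<omega> * d \<omega>) \<le> norm (\<bar>B\<bar> + \<bar>B\<bar> * (norm (W (Suc e) \<omega> - W e \<omega>))\<^sup>2)"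
        unfolding real_norm_def abs_mult[of "S e \<omega> * \<eta> e \<omega>"] distrib_left mult_1_right
        by (rule order_trans[OF _ abs_ge_self])
    qed
  qed measurable
  have expand: "(S (Suc e) \<omega>)\<^sup>2 = (S e \<omega>)\<^sup>2 + 2 * (S e \<omega> * \<eta> e \<omega> * d \<omega>) + (\<eta> e \<omega>)\<^sup>2 * (d \<omega>)\<^sup>2" for \<omega>
    using step.hyps unfolding S_def d_def by (simp add: power2_eq_square algebra_simps)
  have IH: "integrable M (\<lambda>\<omega>. (S e \<omega>)\<^sup>2)"
    "(\<integral>\<omega>. (S e \<omega>)\<^sup>2 \<partial>M) \<le> C * h * (\<Sum>k\<in>{m..<e}. \<integral>\<omega>. (\<eta> k \<omega>)\<^sup>2 \<partial>M)" using step.IH by auto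
  have "(\<integral>\<omega>. (\<eta> e \<omega>)\<^sup>2 * (d \<omega>)\<^sup>2 \<partial>M) \<le> (\<integral>\<omega>. (\<eta> e \<omega> * \<eta> e \<omega>) * (norm (W (Suc e) \<omega> - W e \<omega>))\<^sup>2 \<partial>M)"
    by (rule integral_mono[OF int2 int1]) (unfold power2_eq_square[of "\<eta> e _", symmetric], rule mult_left_mono[OF dsq], simp)
  also have "\<dots> \<le> C * (real (Suc e - e) * h) * (\<integral>\<omega>. \<bar>\<eta> e \<omega> * \<eta> e \<omega>\<bar> \<partial>M)"
    by (rule var[OF lessI borel_measurable_times[OF meas meas] etasq])
  finally have last: "(\<integral>\<omega>. (\<eta> e \<omega>)\<^sup>2 * (d \<omega>)\<^sup>2 \<partial>M) \<le> C * h * (\<integral>\<omega>. (\<eta> e \<omega>)\<^sup>2 \<partial>M)"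
    by (simp add: abs_mult power2_eq_square)
  have "(\<integral>\<omega>. (S (Suc e) \<omega>)\<^sup>2 \<partial>M) = (\<integral>\<omega>. (S e \<omega>)\<^sup>2 \<partial>M) + (\<integral>\<omega>. (\<eta> e \<omega>)\<^sup>2 * (d \<omega>)\<^sup>2 \<partial>M)"
    unfolding expand using IH int2 int3 zero by simp
  moreover have "integrable M (\<lambda>\<omega>. (S (Suc e) \<omega>)\<^sup>2)"
    unfolding expand by (intro Bochner_Integration.integrable_add IH(1) int2 integrable_mult_right int3)
  ultimately show ?case
    using IH(2) last step.hyps by (simp add: distrib_left)
qed

end

text \<open>The decreasing events \<open>G k\<close> localise without a stopping time: nothing is assumed of the
  process once it has left them.\<close>

locale discrete_diffusion = discrete_noise M A W h C
  for M :: "'w measure" and A and W :: "nat \<Rightarrow> 'w \<Rightarrow> real ^ 'd" and h C +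
  fixes X :: "nat \<Rightarrow> 'w \<Rightarrow> real ^ 'd" and G :: "nat \<Rightarrow> 'w set" and R c :: real
  assumes X_meas: "X k \<in> borel_measurable (A k)"
    and G_sets: "G k \<in> sets (A k)"
    and G_anti: "k \<le> l \<Longrightarrow> G l \<subseteq> G k"
    and X_bdd: "j \<le> k \<Longrightarrow> \<omega> \<in> G k \<Longrightarrow> norm (X j \<omega>) \<le> R"
    and W_bdd: "j \<le> k \<Longrightarrow> \<omega> \<in> G k \<Longrightarrow> norm (W j \<omega>) \<le> R"
    and X_incr: "i \<le> j \<Longrightarrow> j \<le> k \<Longrightarrow> \<omega> \<in> G k \<Longrightarrow>
       norm (X j \<omega> - X i \<omega>) \<le> c * (real (j - i) * h) + norm (W j \<omega> - W i \<omega>)"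
    and R_nonneg: "0 \<le> R" and c_nonneg: "0 \<le> c"
begin

definition chi :: "nat \<Rightarrow> 'w \<Rightarrow> real" where "chi k = indicator (G k)"

lemma chi_meas: "chi k \<in> borel_measurable (A k)"
  unfolding chi_def using G_sets by measurable

lemma chi_M [measurable]: "chi k \<in> borel_measurable M"
  using chi_meas meas_M by blast

lemma X_M [measurable]: "X k \<in> borel_measurable M"
  using X_meas meas_M by blast

lemma chi_cases: "chi k \<omega> = 0 \<or> chi k \<omega> = 1 \<and> \<omega> \<in> G k"
  by (auto simp: chi_def indicator_def)

text \<open>Bound on the mean square of an increment of \<open>X\<close> per unit time:
  \<open>(a + b)\<^sup>2 \<le> 2 * a\<^sup>2 + 2 * b\<^sup>2\<close> separates a drift of speed
  \<open>c\<close> from the noise.\<close>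

definition "C1 = 2 * c\<^sup>2 + 2 * C"

lemma C1_nonneg: "0 \<le> C1" using C_nonneg by (simp add: C1_def)

lemma incr_bdd: "\<bar>chi m \<omega> * (norm (X m \<omega> - X s \<omega>))\<^sup>2\<bar> \<le> (2 * R)\<^sup>2" if "s \<le> m"
proof -
  have "norm (X m \<omega> - X s \<omega>) \<le> 2 * R" if "\<omega> \<in> G m"
    using X_bdd[OF _ that, of m] X_bdd[OF _ that, of s] \<open>s \<le> m\<close> norm_triangle_ineq4[of "X m \<omega>" "X s \<omega>"] by auto
  then have "\<omega> \<in> G m \<Longrightarrow> (norm (X m \<omega> - X s \<omega>))\<^sup>2 \<le> (2 * R)\<^sup>2" by (intro power_mono) auto
  then show ?thesis using chi_cases[of m \<omega>] by auto
qed

lemma incr_int: "s \<le> m \<Longrightarrow> integrable M (\<lambda>\<omega>. chi m \<omega> * (norm (X m \<omega> - X s \<omega>))\<^sup>2)"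
  by (rule integrable_bdd[OF _ incr_bdd]) measurable

text \<open>The drift contributes the square of \<open>c\<close> times the length, which is linear
  in the length only for lengths at most 1; this is the origin of the length restriction here and
  below. The increment bound for \<open>X\<close> is available on \<open>G m\<close>, so
  \<open>chi m\<close> has to stand inside the integral.\<close>

lemma incr_L2:
  assumes sm: "s \<le> m" and H: "real (m - s) * h \<le> 1"
  shows "(\<integral>\<omega>. chi m \<omega> * (norm (X m \<omega> - X s \<omega>))\<^sup>2 \<partial>M) \<le> C1 * (real (m - s) * h)"
proof -
  let ?H = "real (m - s) * h"
  have H0: "0 \<le> ?H" using h_pos by simp
  have WI: "integrable M (\<lambda>\<omega>. 1 * (norm (W m \<omega> - W s \<omega>))\<^sup>2)"
    by (rule sq_int[OF sm]) auto
  have W1: "(\<integral>\<omega>. 1 * (norm (W m \<omega> - W s \<omega>))\<^sup>2 \<partial>M) \<le> C * ?H * (\<integral>\<omega>. \<bar>1\<bar> \<partial>M)"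
    by (rule var'[OF sm, where c=1]) auto
  have "(\<integral>\<omega>. chi m \<omega> * (norm (X m \<omega> - X s \<omega>))\<^sup>2 \<partial>M) \<le>
      (\<integral>\<omega>. 2 * (c * ?H)\<^sup>2 + 2 * (norm (W m \<omega> - W s \<omega>))\<^sup>2 \<partial>M)"
  proof (rule integral_mono[OF incr_int[OF sm]])
    show "integrable M (\<lambda>\<omega>. 2 * (c * ?H)\<^sup>2 + 2 * (norm (W m \<omega> - W s \<omega>))\<^sup>2)" using WI by simp
    fix \<omega>
    show "chi m \<omega> * (norm (X m \<omega> - X s \<omega>))\<^sup>2 \<le> 2 * (c * ?H)\<^sup>2 + 2 * (norm (W m \<omega> - W s \<omega>))\<^sup>2"
    proof (cases "\<omega> \<in> G m")
      case True
      have "(norm (X m \<omega> - X s \<omega>))\<^sup>2 \<le> (c * ?H + norm (W m \<omega> - W s \<omega>))\<^sup>2"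
        using X_incr[OF sm _ True] by (intro power_mono) auto
      also have "\<dots> \<le> 2 * (c * ?H)\<^sup>2 + 2 * (norm (W m \<omega> - W s \<omega>))\<^sup>2"
        using sum_squares_bound[of "c * ?H" "norm (W m \<omega> - W s \<omega>)"] by (simp add: power2_sum)
      finally show ?thesis using True by (simp add: chi_def)
    qed (simp add: chi_def)
  qed
  also have "\<dots> = 2 * (c * ?H)\<^sup>2 + 2 * (\<integral>\<omega>. (norm (W m \<omega> - W s \<omega>))\<^sup>2 \<partial>M)"
    using WI by (simp add: prob_space)
  also have "\<dots> \<le> 2 * c\<^sup>2 * ?H + 2 * (C * ?H)"
  proof -
    have "(c * ?H)\<^sup>2 \<le> c\<^sup>2 * ?H" unfolding power_mult_distrib[of c ?H] power2_eq_square[of ?H]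
      by (rule mult_left_mono[OF mult_left_le[OF H H0]]) simp
    then show ?thesis using W1 by (simp add: prob_space)
  qed
  finally show ?thesis by (simp add: C1_def algebra_simps)
qed

text \<open>A discrete iterated integral of \<open>X - X m\<close> against coordinate
  \<open>i\<close> of \<open>W\<close>, the second-order term that accompanies the gradient in a
  stochastic Taylor expansion. The cut-off \<open>chi k\<close> stands in every summand to keep the
  weights adapted and bounded.\<close>

definition area :: "'d \<Rightarrow> nat \<Rightarrow> nat \<Rightarrow> 'w \<Rightarrow> real ^ 'd" where
  "area i m e \<omega> = (\<Sum>k\<in>{m..<e}. (chi k \<omega> * (W (Suc k) \<omega> - W k \<omega>) $ i) *\<^sub>R (X k \<omega> - X m \<omega>))"

definition "C2 = real (DIM(real ^ 'd)) * (C * C1)"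

lemma C2_nonneg: "0 \<le> C2" using C_nonneg C1_nonneg by (simp add: C2_def)

lemma area_M [measurable]: "area i m e \<in> borel_measurable M"
  unfolding area_def by measurable

text \<open>Each coordinate is a martingale transform whose weight has second moment at most
  \<open>C1\<close> times the length, by \<open>incr_L2\<close>; summing over the block gives the
  square of the length. \<open>C2\<close> adds a factor for the number of coordinates.\<close>

lemma area_L2:
  assumes me: "m \<le> e" and H: "real (e - m) * h \<le> 1"
  shows "integrable M (\<lambda>\<omega>. (norm (area i m e \<omega>))\<^sup>2) \<and>
    (\<integral>\<omega>. (norm (area i m e \<omega>))\<^sup>2 \<partial>M) \<le> C2 * (real (e - m) * h)\<^sup>2"
proof -
  let ?H = "real (e - m) * h"
  define \<eta> where "\<eta> b k \<omega> = (if m \<le> k then chi k \<omega> * ((X k \<omega> - X m \<omega>) \<bullet> b) else 0)" for b k \<omega>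
  have eta_le: "(\<eta> b k \<omega>)\<^sup>2 \<le> chi k \<omega> * (norm (X k \<omega> - X m \<omega>))\<^sup>2" if "b \<in> Basis" "m \<le> k" for b k \<omega>
  proof -
    have "((X k \<omega> - X m \<omega>) \<bullet> b)\<^sup>2 \<le> (norm (X k \<omega> - X m \<omega>))\<^sup>2"
      using Basis_le_norm[OF that(1), of "X k \<omega> - X m \<omega>"] by (metis abs_le_square_iff abs_norm_cancel)
    then show ?thesis using chi_cases[of k \<omega>] that by (auto simp: \<eta>_def)
  qed
  have *: "integrable M (\<lambda>\<omega>. (area i m e \<omega> \<bullet> b)\<^sup>2) \<and> (\<integral>\<omega>. (area i m e \<omega> \<bullet> b)\<^sup>2 \<partial>M) \<le> C * C1 * ?H\<^sup>2"
    if b: "b \<in> Basis" for b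
  proof -
    have eq: "area i m e \<omega> \<bullet> b = (\<Sum>k\<in>{m..<e}. \<eta> b k \<omega> * ((W (Suc k) \<omega> - W k \<omega>) $ i))" for \<omega>
      unfolding area_def \<eta>_def inner_sum_left by (intro sum.cong) auto
    have meas: "\<eta> b k \<in> borel_measurable (A k)" for k
    proof (cases "m \<le> k")
      case True
      have [measurable]: "X k \<in> borel_measurable (A k)" "X m \<in> borel_measurable (A k)" "chi k \<in> borel_measurable (A k)"
        using X_meas meas_mono[OF X_meas True] chi_meas by auto
      show ?thesis unfolding \<eta>_def using True by simp
    qed (simp add: \<eta>_def[abs_def])
    have bdd: "\<bar>\<eta> b k \<omega>\<bar> \<le> 2 * R" for k \<omega>
    proof (cases "m \<le> k")
      case True
      have "(\<eta> b k \<omega>)\<^sup>2 \<le> (2 * R)\<^sup>2"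
        using eta_le[OF b True, of \<omega>] incr_bdd[OF True, of \<omega>] by linarith
      then show ?thesis using R_nonneg abs_le_square_iff[of "\<eta> b k \<omega>" "2 * R"] by simp
    qed (simp add: \<eta>_def R_nonneg)
    have loc: "norm (W j \<omega>) \<le> R" if "j \<le> k" "\<eta> b k \<omega> \<noteq> 0" for j k \<omega>
      using that chi_cases[of k \<omega>] W_bdd[of j k \<omega>] by (auto simp: \<eta>_def split: if_splits)
    have main: "integrable M (\<lambda>\<omega>. (area i m e \<omega> \<bullet> b)\<^sup>2) \<and>
      (\<integral>\<omega>. (area i m e \<omega> \<bullet> b)\<^sup>2 \<partial>M) \<le> C * h * (\<Sum>k\<in>{m..<e}. \<integral>\<omega>. (\<eta> b k \<omega>)\<^sup>2 \<partial>M)"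
      unfolding eq by (rule transform_L2[OF meas bdd loc me])
    have each: "(\<integral>\<omega>. (\<eta> b k \<omega>)\<^sup>2 \<partial>M) \<le> C1 * ?H" if k: "k \<in> {m..<e}" for k
    proof -
      have mk: "m \<le> k" using k by simp
      have kH: "real (k - m) * h \<le> ?H" using k h_pos by (intro mult_right_mono) auto
      have [measurable]: "\<eta> b k \<in> borel_measurable M" using meas meas_M by blast
      have "integrable M (\<lambda>\<omega>. (\<eta> b k \<omega>)\<^sup>2)"
      proof (rule integrable_bdd[where c="(2*R)\<^sup>2"])
        show "\<bar>(\<eta> b k \<omega>)\<^sup>2\<bar> \<le> (2 * R)\<^sup>2" for \<omega>
          using eta_le[OF b mk, of \<omega>] incr_bdd[OF mk, of \<omega>] unfolding abs_power2 by linarith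
      qed measurable
      then have "(\<integral>\<omega>. (\<eta> b k \<omega>)\<^sup>2 \<partial>M) \<le> (\<integral>\<omega>. chi k \<omega> * (norm (X k \<omega> - X m \<omega>))\<^sup>2 \<partial>M)"
        using incr_int[OF mk] eta_le[OF b mk] by (intro integral_mono) auto
      also have "\<dots> \<le> C1 * (real (k - m) * h)" using kH H by (intro incr_L2[OF mk]) auto
      also have "\<dots> \<le> C1 * ?H" using kH C1_nonneg by (intro mult_left_mono) auto
      finally show ?thesis .
    qed
    have "C * h * (\<Sum>k\<in>{m..<e}. \<integral>\<omega>. (\<eta> b k \<omega>)\<^sup>2 \<partial>M) \<le> C * h * (\<Sum>k\<in>{m..<e}. C1 * ?H)"
      using C_nonneg h_pos by (intro mult_left_mono sum_mono each) auto
    also have "\<dots> = C * C1 * ?H\<^sup>2" using me by (simp add: power2_eq_square of_nat_diff)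
    finally show ?thesis using main by auto
  qed
  have nrm: "(norm (area i m e \<omega>))\<^sup>2 = (\<Sum>b\<in>Basis. (area i m e \<omega> \<bullet> b)\<^sup>2)" for \<omega>
    unfolding power2_norm_eq_inner euclidean_inner[of "area i m e \<omega>" "area i m e \<omega>"] by (simp add: power2_eq_square)
  have "(\<integral>\<omega>. (norm (area i m e \<omega>))\<^sup>2 \<partial>M) = (\<Sum>b\<in>Basis. \<integral>\<omega>. (area i m e \<omega> \<bullet> b)\<^sup>2 \<partial>M)"
    unfolding nrm using * by (intro Bochner_Integration.integral_sum) auto
  also have "\<dots> \<le> (\<Sum>b\<in>(Basis::(real^'d) set). C * C1 * ?H\<^sup>2)" using * by (intro sum_mono) auto
  also have "\<dots> = C2 * ?H\<^sup>2" by (simp add: C2_def)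
  finally show ?thesis unfolding nrm using * by auto
qed

text \<open>The defect of the second-order Riemann sums when an interval is split at \<open>m\<close>. The increment
  over \<open>{m..e}\<close> is conditionally small given the past, which makes the defect of order 3/2 in the
  length, hence summable over dyadic refinements.\<close>

definition defect :: "'d \<Rightarrow> nat \<Rightarrow> nat \<Rightarrow> nat \<Rightarrow> 'w \<Rightarrow> real" where
  "defect i s m e \<omega> = chi m \<omega> * (norm (X m \<omega> - X s \<omega>))\<^sup>2 * norm (W e \<omega> - W m \<omega>) +
     chi m \<omega> * norm (X m \<omega> - X s \<omega>) * norm (area i m e \<omega>)"

text \<open>\<open>C1 * (1 + C)\<close> comes from the first term of \<open>defect\<close> and
  \<open>C1 + C2\<close> from the second, both after balancing with the weight
  \<open>sqrt H\<close>.\<close>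

definition "C3 = C1 * (1 + C) + C1 + C2"

lemma C3_nonneg: "0 \<le> C3" using C_nonneg C1_nonneg C2_nonneg by (simp add: C3_def)

lemma am_gm_weighted: "2 * (a * b) \<le> r * a\<^sup>2 + b\<^sup>2 / r" if "0 < r" for a b r :: real
proof -
  have "r * a\<^sup>2 + b\<^sup>2 / r - 2 * (a * b) = (r * a - b)\<^sup>2 / r"
    using that by (simp add: power2_eq_square field_simps)
  also have "\<dots> \<ge> 0" using that by simp
  finally show ?thesis by simp
qed

text \<open>Balancing with \<open>sqrt H\<close> turns products into squares. The variable
  \<open>\<xi>\<close> has mean of order \<open>H\<close> and gains a factor \<open>sqrt H\<close>;
  \<open>\<xi>\<close> times the squared later increment has mean of order \<open>H\<^sup>2\<close>,
  because the later variance is conditional on the past of \<open>m\<close>, and loses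
  \<open>sqrt H\<close>. The area behaves like the latter, so everything is of order
  \<open>H * sqrt H\<close>.\<close>

lemma defect_L1:
  assumes sm: "s < m" and me: "m < e" and H: "real (e - s) * h \<le> 1"
  shows "integrable M (defect i s m e) \<and>
    (\<integral>\<omega>. defect i s m e \<omega> \<partial>M) \<le> C3 * ((real (e - s) * h) * sqrt (real (e - s) * h))"
proof -
  define H where "H = real (e - s) * h"
  have H0: "0 < H" using h_pos sm me by (simp add: H_def)
  have H1: "real (m - s) * h \<le> H" "real (e - m) * h \<le> H" "H \<le> 1"
    using h_pos sm me H unfolding H_def by (auto intro!: mult_right_mono)
  define \<xi> where "\<xi> \<omega> = chi m \<omega> * (norm (X m \<omega> - X s \<omega>))\<^sup>2" for \<omega>
  have xi0: "0 \<le> \<xi> \<omega>" for \<omega> using chi_cases[of m \<omega>] by (auto simp: \<xi>_def)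
  have xi_meas: "\<xi> \<in> borel_measurable (A m)"
  proof -
    have [measurable]: "X m \<in> borel_measurable (A m)" "X s \<in> borel_measurable (A m)" "chi m \<in> borel_measurable (A m)"
      using X_meas meas_mono[OF X_meas, of s m] sm chi_meas by auto
    show ?thesis unfolding \<xi>_def by measurable
  qed
  have xi_M [measurable]: "\<xi> \<in> borel_measurable M" using xi_meas meas_M by blast
  have xi_bdd: "\<bar>\<xi> \<omega>\<bar> \<le> (2 * R)\<^sup>2" for \<omega> unfolding \<xi>_def using incr_bdd[of s m] sm by simp
  have xi_int: "integrable M \<xi>" by (rule integrable_bdd[OF _ xi_bdd]) measurable
  have xi_le: "(\<integral>\<omega>. \<xi> \<omega> \<partial>M) \<le> C1 * H"
    unfolding \<xi>_def using incr_L2[of s m] sm H1 C1_nonneg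
    by (meson less_imp_le mult_left_mono order_trans)
  have var: "(\<integral>\<omega>. \<xi> \<omega> * (norm (W e \<omega> - W m \<omega>))\<^sup>2 \<partial>M) \<le> C * H * (C1 * H)"
  proof -
    have "(\<integral>\<omega>. \<xi> \<omega> * (norm (W e \<omega> - W m \<omega>))\<^sup>2 \<partial>M) \<le> C * (real (e - m) * h) * (\<integral>\<omega>. \<bar>\<xi> \<omega>\<bar> \<partial>M)"
      using me by (intro var'[OF _ xi_meas xi_bdd]) auto
    also have "\<dots> \<le> C * H * (C1 * H)"
      using xi_le H1 H0 C_nonneg C1_nonneg xi0 h_pos by (intro mult_mono mult_left_mono) auto
    finally show ?thesis .
  qed
  have var_int: "integrable M (\<lambda>\<omega>. \<xi> \<omega> * (norm (W e \<omega> - W m \<omega>))\<^sup>2)"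
    using me by (intro sq_int[OF _ _ xi_bdd]) auto
  have area: "integrable M (\<lambda>\<omega>. (norm (area i m e \<omega>))\<^sup>2)" "(\<integral>\<omega>. (norm (area i m e \<omega>))\<^sup>2 \<partial>M) \<le> C2 * H\<^sup>2"
  proof -
    have "(real (e - m) * h)\<^sup>2 \<le> H\<^sup>2" using H1 h_pos by (intro power_mono) auto
    then have "C2 * (real (e - m) * h)\<^sup>2 \<le> C2 * H\<^sup>2" using C2_nonneg by (intro mult_left_mono)
    moreover have "real (e - m) * h \<le> 1" using H1 by linarith
    ultimately show "integrable M (\<lambda>\<omega>. (norm (area i m e \<omega>))\<^sup>2)"
        "(\<integral>\<omega>. (norm (area i m e \<omega>))\<^sup>2 \<partial>M) \<le> C2 * H\<^sup>2"
      using area_L2[of m e i] me by auto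
  qed
  define B where "B \<omega> = (\<xi> \<omega> * sqrt H + \<xi> \<omega> * (norm (W e \<omega> - W m \<omega>))\<^sup>2 / sqrt H) +
     (\<xi> \<omega> * sqrt H + (norm (area i m e \<omega>))\<^sup>2 / sqrt H)" for \<omega>
  have B_int: "integrable M B"
    unfolding B_def using xi_int var_int area by (intro Bochner_Integration.integrable_add integrable_mult_left integrable_divide)
  have defect_B: "0 \<le> defect i s m e \<omega> \<and> defect i s m e \<omega> \<le> B \<omega>" for \<omega>
  proof (cases "\<omega> \<in> G m")
    case True
    let ?x = "norm (X m \<omega> - X s \<omega>)" and ?w = "norm (W e \<omega> - W m \<omega>)" and ?a = "norm (area i m e \<omega>)"
    have "?w \<le> sqrt H + ?w\<^sup>2 / sqrt H"
    proof -
      have "2 * ?w \<le> sqrt H + ?w\<^sup>2 / sqrt H" using am_gm_weighted[of "sqrt H" 1 ?w] H0 by simp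
      then show ?thesis using norm_ge_zero[of "W e \<omega> - W m \<omega>"] by linarith
    qed
    then have "?x\<^sup>2 * ?w \<le> ?x\<^sup>2 * (sqrt H + ?w\<^sup>2 / sqrt H)" by (intro mult_left_mono) auto
    moreover have "?x * ?a \<le> ?x\<^sup>2 * sqrt H + ?a\<^sup>2 / sqrt H"
    proof -
      have "2 * (?x * ?a) \<le> ?x\<^sup>2 * sqrt H + ?a\<^sup>2 / sqrt H"
        using am_gm_weighted[of "sqrt H" ?x ?a] H0 by (simp add: mult.commute)
      moreover have "0 \<le> ?x * ?a" by simp
      ultimately show ?thesis by linarith
    qed
    ultimately show ?thesis using True by (simp add: defect_def B_def \<xi>_def chi_def algebra_simps)
  next
    case False
    then show ?thesis using H0 by (simp add: defect_def B_def \<xi>_def chi_def)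
  qed
  have [measurable]: "defect i s m e \<in> borel_measurable M" unfolding defect_def by measurable
  have int: "integrable M (defect i s m e)"
  proof (rule Bochner_Integration.integrable_bound[OF B_int])
    show "AE \<omega> in M. norm (defect i s m e \<omega>) \<le> norm (B \<omega>)"
    proof (rule AE_I2)
      show "norm (defect i s m e \<omega>) \<le> norm (B \<omega>)" for \<omega> using defect_B[of \<omega>] by simp
    qed
  qed measurable
  have "(\<integral>\<omega>. defect i s m e \<omega> \<partial>M) \<le> (\<integral>\<omega>. B \<omega> \<partial>M)"
    using defect_B by (intro integral_mono int B_int) auto
  also have "\<dots> = ((\<integral>\<omega>. \<xi> \<omega> \<partial>M) * sqrt H + (\<integral>\<omega>. \<xi> \<omega> * (norm (W e \<omega> - W m \<omega>))\<^sup>2 \<partial>M) / sqrt H) +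
     ((\<integral>\<omega>. \<xi> \<omega> \<partial>M) * sqrt H + (\<integral>\<omega>. (norm (area i m e \<omega>))\<^sup>2 \<partial>M) / sqrt H)"
    unfolding B_def using xi_int var_int area by simp
  also have "\<dots> \<le> (C1 * H * sqrt H + C * H * (C1 * H) / sqrt H) + (C1 * H * sqrt H + C2 * H\<^sup>2 / sqrt H)"
    using H0 xi_le var area by (intro add_mono mult_right_mono divide_right_mono) auto
  also have "\<dots> = C3 * (H * sqrt H)"
  proof -
    obtain r where r: "sqrt H = r" "0 < r" "H = r * r"
      using H0 by (metis real_sqrt_gt_zero real_sqrt_mult_self abs_of_pos)
    have "C * H * (C1 * H) / sqrt H = C * C1 * (H * sqrt H)" "C2 * H\<^sup>2 / sqrt H = C2 * (H * sqrt H)"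
      using r(2) unfolding r(1) unfolding r(3) by (simp_all add: power2_eq_square field_simps)
    then show ?thesis by (simp add: C3_def algebra_simps)
  qed
  finally show ?thesis using int H_def by auto
qed

text \<open>Chen's relation for iterated sums: moving the base point of the later block from
  \<open>X m\<close> to \<open>X s\<close> adds the increment of \<open>W\<close> times the
  displacement. On \<open>G e\<close> every cut-off up to \<open>e\<close> equals one, since the
  events decrease.\<close>

lemma area_split:
  assumes sm: "s \<le> m" and me: "m \<le> e" and G: "\<omega> \<in> G e"
  shows "area i s e \<omega> = area i s m \<omega> + area i m e \<omega> + ((W e \<omega> - W m \<omega>) $ i) *\<^sub>R (X m \<omega> - X s \<omega>)"
proof -
  have chi: "chi k \<omega> = 1" if "k \<in> {m..<e}" for k using G_anti[of k e] G that by (auto simp: chi_def)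
  have "area i s e \<omega> = area i s m \<omega> + (\<Sum>k\<in>{m..<e}. (chi k \<omega> * (W (Suc k) \<omega> - W k \<omega>) $ i) *\<^sub>R (X k \<omega> - X s \<omega>))"
    unfolding area_def by (rule sum.atLeastLessThan_concat[OF sm me, symmetric])
  also have "(\<Sum>k\<in>{m..<e}. (chi k \<omega> * (W (Suc k) \<omega> - W k \<omega>) $ i) *\<^sub>R (X k \<omega> - X s \<omega>)) =
      (\<Sum>k\<in>{m..<e}. (chi k \<omega> * (W (Suc k) \<omega> - W k \<omega>) $ i) *\<^sub>R (X k \<omega> - X m \<omega>) +
        (W (Suc k) \<omega> - W k \<omega>) $ i *\<^sub>R (X m \<omega> - X s \<omega>))"
    using chi by (intro sum.cong) (auto simp: algebra_simps)
  also have "\<dots> = area i m e \<omega> + (\<Sum>k\<in>{m..<e}. W (Suc k) \<omega> $ i - W k \<omega> $ i) *\<^sub>R (X m \<omega> - X s \<omega>)"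
    by (simp add: area_def sum.distrib scaleR_sum_left)
  also have "(\<Sum>k\<in>{m..<e}. W (Suc k) \<omega> $ i - W k \<omega> $ i) = (W e \<omega> - W m \<omega>) $ i"
    using sum_Suc_diff'[OF me, of "\<lambda>k. W k \<omega> $ i"] by simp
  finally show ?thesis by simp
qed

lemma local_expansion:
  assumes "s \<le> e" and "real (e - s) * h \<le> 1"
  shows "\<exists>T. integrable M T \<and> (\<forall>\<omega>. 0 \<le> T \<omega>) \<and>
     (\<integral>\<omega>. T \<omega> \<partial>M) \<le> 6 * C3 * ((real (e - s) * h) * sqrt (real (e - s) * h)) \<and>
     (\<forall>\<omega>\<in>G e. \<forall>K f Df. C2_on R K f Df \<longrightarrow>
        \<bar>(\<Sum>k\<in>{s..<e}. f (X k \<omega>) * (W (Suc k) \<omega> - W k \<omega>) $ i)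
          - f (X s \<omega>) * (W e \<omega> - W s \<omega>) $ i - Df (X s \<omega>) \<bullet> area i s e \<omega>\<bar> \<le> K * T \<omega>)"
  using assms
proof (induction "e - s" arbitrary: s e rule: less_induct)
  case less
  show ?case
  proof (cases "e - s \<le> 1")
    case True
    \<comment> \<open>With at most one step the sum is exactly the leading term, and the only
      possible summand of the area contains \<open>X s - X s = 0\<close>.\<close>
    then have "e = s \<or> e = Suc s" using less.prems by linarith
    then show ?thesis using C3_nonneg h_pos by (intro exI[of _ "\<lambda>_. 0"]) (auto simp: area_def)
  next
    case False
    define m where "m = (s + e) div 2"
    have sm: "s < m" and me: "m < e" using False by (auto simp: m_def)
    \<comment> \<open>Integer halving is worst for three steps, where the longer piece is exactly
      two thirds of the whole; hence the ratio two thirds and not one half.\<close>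
    have third: "3 * (m - s) \<le> 2 * (e - s)" "3 * (e - m) \<le> 2 * (e - s)" using False by (auto simp: m_def)
    define Ha Hb H where "Ha = real (m - s) * h" and "Hb = real (e - m) * h" and "H = real (e - s) * h"
    have Hsum: "Ha + Hb = H" unfolding Ha_def Hb_def H_def using sm me by (simp add: algebra_simps of_nat_diff)
    have Hnn: "0 \<le> Ha" "0 \<le> Hb" using h_pos by (auto simp: Ha_def Hb_def)
    have H1: "H \<le> 1" using less.prems by (simp add: H_def)
    have Hthird: "3 * Ha \<le> 2 * (Ha + Hb)" "3 * Hb \<le> 2 * (Ha + Hb)"
    proof -
      have "real (3 * (m - s)) * h \<le> real (2 * (e - s)) * h" "real (3 * (e - m)) * h \<le> real (2 * (e - s)) * h"
        using third h_pos by (auto intro!: mult_right_mono simp del: of_nat_mult)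
      then show "3 * Ha \<le> 2 * (Ha + Hb)" "3 * Hb \<le> 2 * (Ha + Hb)"
        unfolding Hsum unfolding Ha_def Hb_def H_def by simp_all
    qed
    have le1: "Ha \<le> 1" "Hb \<le> 1" using Hsum Hnn H1 by auto
    obtain Ta where Ta: "integrable M Ta" "\<And>\<omega>. 0 \<le> Ta \<omega>" "(\<integral>\<omega>. Ta \<omega> \<partial>M) \<le> 6 * C3 * (Ha * sqrt Ha)"
      "\<And>\<omega> K f Df. \<omega> \<in> G m \<Longrightarrow> C2_on R K f Df \<Longrightarrow> \<bar>(\<Sum>k\<in>{s..<m}. f (X k \<omega>) * (W (Suc k) \<omega> - W k \<omega>) $ i)
          - f (X s \<omega>) * (W m \<omega> - W s \<omega>) $ i - Df (X s \<omega>) \<bullet> area i s m \<omega>\<bar> \<le> K * Ta \<omega>"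
      using less.hyps[of m s, OF _ less_imp_le[OF sm] le1(1)[unfolded Ha_def]] sm me unfolding Ha_def by fastforce
    obtain Tb where Tb: "integrable M Tb" "\<And>\<omega>. 0 \<le> Tb \<omega>" "(\<integral>\<omega>. Tb \<omega> \<partial>M) \<le> 6 * C3 * (Hb * sqrt Hb)"
      "\<And>\<omega> K f Df. \<omega> \<in> G e \<Longrightarrow> C2_on R K f Df \<Longrightarrow> \<bar>(\<Sum>k\<in>{m..<e}. f (X k \<omega>) * (W (Suc k) \<omega> - W k \<omega>) $ i)
          - f (X m \<omega>) * (W e \<omega> - W m \<omega>) $ i - Df (X m \<omega>) \<bullet> area i m e \<omega>\<bar> \<le> K * Tb \<omega>"
      using less.hyps[of e m, OF _ less_imp_le[OF me] le1(2)[unfolded Hb_def]] sm me unfolding Hb_def by fastforce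
    have D: "integrable M (defect i s m e)" "(\<integral>\<omega>. defect i s m e \<omega> \<partial>M) \<le> C3 * (H * sqrt H)"
      using defect_L1[OF sm me, of i] less.prems unfolding H_def by auto
    have D0: "0 \<le> defect i s m e \<omega>" for \<omega> using chi_cases[of m \<omega>] by (auto simp: defect_def)
    let ?T = "\<lambda>\<omega>. Ta \<omega> + Tb \<omega> + defect i s m e \<omega>"
    show ?thesis
    proof (intro exI[of _ ?T] conjI allI ballI impI)
      show "integrable M ?T" using Ta Tb D by auto
      show "0 \<le> ?T \<omega>" for \<omega> using Ta Tb D0 by (simp add: add_nonneg_nonneg)
      have "(\<integral>\<omega>. ?T \<omega> \<partial>M) \<le> 6 * C3 * (Ha * sqrt Ha) + 6 * C3 * (Hb * sqrt Hb) + C3 * (H * sqrt H)"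
        using Ta Tb D by simp
      also have "\<dots> = 6 * C3 * (Ha * sqrt Ha + Hb * sqrt Hb) + C3 * (H * sqrt H)" by (simp add: algebra_simps)
      also have "\<dots> \<le> 6 * C3 * (5 / 6 * (H * sqrt H)) + C3 * (H * sqrt H)"
        using power_three_halves_split[OF Hnn Hthird] C3_nonneg unfolding Hsum by (intro add_mono[OF mult_left_mono order_refl]) auto
      finally show "(\<integral>\<omega>. ?T \<omega> \<partial>M) \<le> 6 * C3 * ((real (e - s) * h) * sqrt (real (e - s) * h))"
        unfolding H_def[symmetric] by (simp add: algebra_simps)
    next
      fix \<omega> K and f :: "real ^ 'd \<Rightarrow> real" and Df
      assume G: "\<omega> \<in> G e" and f: "C2_on R K f Df"
      have Gm: "\<omega> \<in> G m" using G G_anti[of m e] me by auto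
      have xs: "X s \<omega> \<in> cball 0 R" "X m \<omega> \<in> cball 0 R" using X_bdd[OF _ Gm] sm by auto
      let ?wsm = "(W m \<omega> - W s \<omega>) $ i" and ?wme = "(W e \<omega> - W m \<omega>) $ i" and ?x = "X m \<omega> - X s \<omega>"
      have T1: "\<bar>f (X m \<omega>) - f (X s \<omega>) - Df (X s \<omega>) \<bullet> ?x\<bar> \<le> K * (norm ?x)\<^sup>2"
        and T2: "norm (Df (X m \<omega>) - Df (X s \<omega>)) \<le> K * norm ?x"
        using f xs unfolding C2_on_def by blast+
      have d1: "\<bar>(f (X m \<omega>) - f (X s \<omega>) - Df (X s \<omega>) \<bullet> ?x) * ?wme\<bar> \<le> K * ((norm ?x)\<^sup>2 * norm (W e \<omega> - W m \<omega>))"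
        using mult_mono[OF T1 component_le_norm_cart[of "W e \<omega> - W m \<omega>" i]] order_trans[OF abs_ge_zero T1]
        by (simp add: abs_mult mult.assoc)
      have d2: "\<bar>(Df (X m \<omega>) - Df (X s \<omega>)) \<bullet> area i m e \<omega>\<bar> \<le> K * (norm ?x * norm (area i m e \<omega>))"
        using Cauchy_Schwarz_ineq2[of "Df (X m \<omega>) - Df (X s \<omega>)" "area i m e \<omega>"]
          mult_right_mono[OF T2 norm_ge_zero[of "area i m e \<omega>"]] by (simp add: mult.assoc)
      have dd: "defect i s m e \<omega> = (norm ?x)\<^sup>2 * norm (W e \<omega> - W m \<omega>) + norm ?x * norm (area i m e \<omega>)"
        using Gm by (simp add: defect_def chi_def)
      have area: "area i s e \<omega> = area i s m \<omega> + area i m e \<omega> + ?wme *\<^sub>R ?x"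
        using area_split[OF _ _ G, of s m i] sm me by simp
      have sum: "(\<Sum>k\<in>{s..<e}. f (X k \<omega>) * (W (Suc k) \<omega> - W k \<omega>) $ i) =
          (\<Sum>k\<in>{s..<m}. f (X k \<omega>) * (W (Suc k) \<omega> - W k \<omega>) $ i) + (\<Sum>k\<in>{m..<e}. f (X k \<omega>) * (W (Suc k) \<omega> - W k \<omega>) $ i)"
        by (rule sum.atLeastLessThan_concat[OF less_imp_le[OF sm] less_imp_le[OF me], symmetric])
      define p q where "p = (\<Sum>k\<in>{s..<m}. f (X k \<omega>) * (W (Suc k) \<omega> - W k \<omega>) $ i)"
        and "q = (\<Sum>k\<in>{m..<e}. f (X k \<omega>) * (W (Suc k) \<omega> - W k \<omega>) $ i)"
      \<comment> \<open>Chen's relation cancels the term with \<open>Df (X s) \<bullet> ?x\<close>.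
        What is left beyond the errors of the halves is a Taylor remainder against the later
        increment and a gradient difference against the later area, which are the two parts of
        \<open>defect\<close>.\<close>
      have eq: "p + q - f (X s \<omega>) * (W e \<omega> - W s \<omega>) $ i - Df (X s \<omega>) \<bullet> area i s e \<omega> =
         (p - f (X s \<omega>) * ?wsm - Df (X s \<omega>) \<bullet> area i s m \<omega>) + (q - f (X m \<omega>) * ?wme - Df (X m \<omega>) \<bullet> area i m e \<omega>)
         + (f (X m \<omega>) - f (X s \<omega>) - Df (X s \<omega>) \<bullet> ?x) * ?wme + (Df (X m \<omega>) - Df (X s \<omega>)) \<bullet> area i m e \<omega>"
        unfolding area by (simp add: inner_add_right inner_diff_left algebra_simps)
      have "\<bar>p + q - f (X s \<omega>) * (W e \<omega> - W s \<omega>) $ i - Df (X s \<omega>) \<bullet> area i s e \<omega>\<bar> \<le>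
          K * Ta \<omega> + K * Tb \<omega> + K * ((norm ?x)\<^sup>2 * norm (W e \<omega> - W m \<omega>)) + K * (norm ?x * norm (area i m e \<omega>))"
        unfolding eq using Ta(4)[OF Gm f] Tb(4)[OF G f] d1 d2 unfolding p_def q_def by linarith
      then show "\<bar>(\<Sum>k\<in>{s..<e}. f (X k \<omega>) * (W (Suc k) \<omega> - W k \<omega>) $ i) - f (X s \<omega>) * (W e \<omega> - W s \<omega>) $ i - Df (X s \<omega>) \<bullet> area i s e \<omega>\<bar> \<le> K * ?T \<omega>"
        unfolding sum dd p_def q_def by (simp add: algebra_simps)
    qed
  qed
qed

text \<open>Over the full grid the expansion leaves \<open>f (X 0)\<close> times the total increment
  and the gradient against the total area. Bounding each norm by one plus its square keeps
  \<open>Q\<close> integrable, with a mean bound that depends neither on \<open>n\<close> nor on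
  \<open>f\<close>.\<close>

lemma uniform_sum_bound:
  assumes n: "real n * h \<le> 1"
  shows "\<exists>Q. integrable M Q \<and> (\<forall>\<omega>. 0 \<le> Q \<omega>) \<and> (\<integral>\<omega>. Q \<omega> \<partial>M) \<le> 2 + C + C2 + 6 * C3 \<and>
     (\<forall>\<omega>\<in>G n. \<forall>K f Df. C2_on R K f Df \<longrightarrow>
        \<bar>\<Sum>k<n. f (X k \<omega>) * (W (Suc k) \<omega> - W k \<omega>) $ i\<bar> \<le> K * Q \<omega>)"
proof -
  obtain T where T: "integrable M T" "\<And>\<omega>. 0 \<le> T \<omega>" "(\<integral>\<omega>. T \<omega> \<partial>M) \<le> 6 * C3 * ((real n * h) * sqrt (real n * h))"
     "\<And>\<omega> K f Df. \<omega>\<in>G n \<Longrightarrow> C2_on R K f Df \<Longrightarrow>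
        \<bar>(\<Sum>k\<in>{0..<n}. f (X k \<omega>) * (W (Suc k) \<omega> - W k \<omega>) $ i)
          - f (X 0 \<omega>) * (W n \<omega> - W 0 \<omega>) $ i - Df (X 0 \<omega>) \<bullet> area i 0 n \<omega>\<bar> \<le> K * T \<omega>"
    using local_expansion[of 0 n i] n by auto
  have H0: "0 \<le> real n * h" using h_pos by simp
  have HH: "(real n * h) * sqrt (real n * h) \<le> 1"
    using mult_mono[of "real n * h" 1 "sqrt (real n * h)" 1] n H0 by simp
  let ?w = "\<lambda>\<omega>. norm (W n \<omega> - W 0 \<omega>)" and ?a = "\<lambda>\<omega>. norm (area i 0 n \<omega>)"
  have wI: "integrable M (\<lambda>\<omega>. 1 * (?w \<omega>)\<^sup>2)" by (rule sq_int) auto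
  have "(\<integral>\<omega>. 1 * (?w \<omega>)\<^sup>2 \<partial>M) \<le> C * (real (n - 0) * h) * (\<integral>\<omega>. \<bar>1\<bar> \<partial>M)" by (rule var'[where c=1]) auto
  then have w: "(\<integral>\<omega>. (?w \<omega>)\<^sup>2 \<partial>M) \<le> C" using mult_left_mono[OF n C_nonneg] by (simp add: prob_space)
  have a: "integrable M (\<lambda>\<omega>. (?a \<omega>)\<^sup>2)" "(\<integral>\<omega>. (?a \<omega>)\<^sup>2 \<partial>M) \<le> C2"
  proof -
    have "C2 * (real n * h)\<^sup>2 \<le> C2 * 1" using n H0 C2_nonneg by (intro mult_left_mono) (auto simp: power_le_one)
    then show "integrable M (\<lambda>\<omega>. (?a \<omega>)\<^sup>2)" "(\<integral>\<omega>. (?a \<omega>)\<^sup>2 \<partial>M) \<le> C2" using area_L2[of 0 n i] n by auto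
  qed
  have dle: "x \<le> 1 + x\<^sup>2" for x :: real
  proof -
    have "2 * x \<le> x\<^sup>2 + 1" using sum_squares_bound[of x 1] by simp
    then show ?thesis using zero_le_power2[of x] by linarith
  qed
  let ?Q = "\<lambda>\<omega>. (1 + (?w \<omega>)\<^sup>2) + (1 + (?a \<omega>)\<^sup>2) + T \<omega>"
  show ?thesis
  proof (intro exI[of _ ?Q] conjI allI ballI impI)
    show "integrable M ?Q" using wI a T by auto
    show "0 \<le> ?Q \<omega>" for \<omega> using T by (simp add: add_nonneg_nonneg)
    have "(\<integral>\<omega>. ?Q \<omega> \<partial>M) = (1 + (\<integral>\<omega>. (?w \<omega>)\<^sup>2 \<partial>M)) + (1 + (\<integral>\<omega>. (?a \<omega>)\<^sup>2 \<partial>M)) + (\<integral>\<omega>. T \<omega> \<partial>M)"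
      using wI a T by (simp add: prob_space)
    moreover have "6 * C3 * ((real n * h) * sqrt (real n * h)) \<le> 6 * C3" using HH C3_nonneg by (intro mult_left_le) auto
    ultimately show "(\<integral>\<omega>. ?Q \<omega> \<partial>M) \<le> 2 + C + C2 + 6 * C3" using w a T by linarith
  next
    fix \<omega> K and f :: "real ^ 'd \<Rightarrow> real" and Df assume G: "\<omega> \<in> G n" and f: "C2_on R K f Df"
    have "X 0 \<omega> \<in> cball 0 R" using X_bdd[OF _ G, of 0] by auto
    then have fb: "\<bar>f (X 0 \<omega>)\<bar> \<le> K" "norm (Df (X 0 \<omega>)) \<le> K" using f by (auto simp: C2_on_def)
    have "\<bar>f (X 0 \<omega>) * (W n \<omega> - W 0 \<omega>) $ i\<bar> \<le> K * (1 + (?w \<omega>)\<^sup>2)" unfolding abs_mult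
      by (rule mult_mono[OF fb(1) order_trans[OF component_le_norm_cart dle]]) (use fb in auto)
    moreover have "\<bar>Df (X 0 \<omega>) \<bullet> area i 0 n \<omega>\<bar> \<le> K * (1 + (?a \<omega>)\<^sup>2)"
      by (rule order_trans[OF Cauchy_Schwarz_ineq2 mult_mono[OF fb(2) dle]]) (use fb in \<open>auto intro: order_trans[OF abs_ge_zero fb(1)]\<close>)
    ultimately have "\<bar>\<Sum>k\<in>{0..<n}. f (X k \<omega>) * (W (Suc k) \<omega> - W k \<omega>) $ i\<bar> \<le> K * (1 + (?w \<omega>)\<^sup>2) + K * (1 + (?a \<omega>)\<^sup>2) + K * T \<omega>"
      using T(4)[OF G f] by linarith
    then show "\<bar>\<Sum>k<n. f (X k \<omega>) * (W (Suc k) \<omega> - W k \<omega>) $ i\<bar> \<le> K * ?Q \<omega>"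
      by (simp add: algebra_simps atLeast0LessThan)
  qed
qed

end

section \<open>Truncation of a Levy process\<close>

text \<open>The conditional statements that \<open>Y\<close> has mean zero and second moment at most
  \<open>v\<close> given \<open>\<Sigma>\<close>, tested on bounded weights. Weights are nonnegative
  so that the inequality for squares survives pointwise majorisation in sums and limits.\<close>

definition centred_incr :: "'w measure \<Rightarrow> 'w measure \<Rightarrow> real \<Rightarrow> ('w \<Rightarrow> real) \<Rightarrow> bool" where
  "centred_incr M \<Sigma> v Y \<longleftrightarrow> Y \<in> borel_measurable M \<and> integrable M (\<lambda>\<omega>. (Y \<omega>)\<^sup>2) \<and>
     (\<forall>\<xi>\<in>borel_measurable \<Sigma>. \<forall>c. (\<forall>\<omega>\<in>space M. 0 \<le> \<xi> \<omega> \<and> \<xi> \<omega> \<le> c) \<longrightarrow>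
        (\<integral>\<omega>. \<xi> \<omega> * Y \<omega> \<partial>M) = 0 \<and> (\<integral>\<omega>. \<xi> \<omega> * (Y \<omega>)\<^sup>2 \<partial>M) \<le> v * (\<integral>\<omega>. \<xi> \<omega> \<partial>M))"

section \<open>Calculus of centred increments\<close>

locale sub_prob = prob_space M for M :: "'w measure" +
  fixes \<Sigma> :: "'w measure"
  assumes subalg: "subalgebra M \<Sigma>"
begin

lemma sub_M: "f \<in> borel_measurable \<Sigma> \<Longrightarrow> f \<in> borel_measurable M"
  using measurable_from_subalg[OF subalg] by blast

lemma abs_le_1_sq: "\<bar>x\<bar> \<le> 1 + x\<^sup>2" for x :: real
proof -
  have "2 * \<bar>x\<bar> \<le> x\<^sup>2 + 1" using sum_squares_bound[of "\<bar>x\<bar>" 1] by simp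
  then show ?thesis using zero_le_power2[of x] by linarith
qed

lemma int_xi_sq:
  assumes "\<xi> \<in> borel_measurable M" "\<forall>\<omega>\<in>space M. \<bar>\<xi> \<omega>\<bar> \<le> (c::real)"
    and "Y \<in> borel_measurable M" "integrable M (\<lambda>\<omega>. (Y \<omega>)\<^sup>2)"
  shows "integrable M (\<lambda>\<omega>. \<xi> \<omega> * (Y \<omega>)\<^sup>2)" "integrable M (\<lambda>\<omega>. \<xi> \<omega> * Y \<omega>)" "integrable M \<xi>" "integrable M Y"
proof -
  note [measurable] = assms(1,3)
  have *: "\<bar>\<xi> \<omega>\<bar> * y \<le> \<bar>c\<bar> * y" if "\<omega> \<in> space M" "0 \<le> y" for \<omega> y
    using bspec[OF assms(2) that(1)] that(2) by (intro mult_right_mono) auto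
  show "integrable M (\<lambda>\<omega>. \<xi> \<omega> * (Y \<omega>)\<^sup>2)"
  proof (rule Bochner_Integration.integrable_bound[OF integrable_mult_right[OF assms(4), of "\<bar>c\<bar>"]])
    show "AE \<omega> in M. norm (\<xi> \<omega> * (Y \<omega>)\<^sup>2) \<le> norm (\<bar>c\<bar> * (Y \<omega>)\<^sup>2)"
      using *[OF _ zero_le_power2] by (intro AE_I2) (simp add: abs_mult)
  qed measurable
  show "integrable M (\<lambda>\<omega>. \<xi> \<omega> * Y \<omega>)"
  proof (rule Bochner_Integration.integrable_bound)
    show "integrable M (\<lambda>\<omega>. \<bar>c\<bar> * (1 + (Y \<omega>)\<^sup>2))" using assms(4) by simp
    show "AE \<omega> in M. norm (\<xi> \<omega> * Y \<omega>) \<le> norm (\<bar>c\<bar> * (1 + (Y \<omega>)\<^sup>2))"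
    proof (rule AE_I2)
      fix \<omega> assume "\<omega> \<in> space M"
      then have "\<bar>\<xi> \<omega>\<bar> * \<bar>Y \<omega>\<bar> \<le> \<bar>c\<bar> * (1 + (Y \<omega>)\<^sup>2)"
        using assms(2) abs_le_1_sq by (intro mult_mono) (auto intro: order_trans[OF _ abs_ge_self])
      then show "norm (\<xi> \<omega> * Y \<omega>) \<le> norm (\<bar>c\<bar> * (1 + (Y \<omega>)\<^sup>2))" by (simp add: abs_mult)
    qed
  qed measurable
  show "integrable M \<xi>"
    by (rule integrable_const_bound[where B=c]) (use assms in \<open>auto intro!: AE_I2\<close>)
  show "integrable M Y"
  proof (rule Bochner_Integration.integrable_bound)
    show "integrable M (\<lambda>\<omega>. 1 + (Y \<omega>)\<^sup>2)" using assms(4) by simp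
    show "AE \<omega> in M. norm (Y \<omega>) \<le> norm (1 + (Y \<omega>)\<^sup>2)"
      using abs_le_1_sq by (intro AE_I2) simp
  qed measurable
qed

lemma sq_sum_le: "(x + y)\<^sup>2 \<le> 2 * x\<^sup>2 + 2 * y\<^sup>2" for x y :: real
  using sum_squares_bound[of x y] by (simp add: power2_sum)

lemma int_sq_add:
  assumes "Y \<in> borel_measurable M" "integrable M (\<lambda>\<omega>. (Y \<omega>)\<^sup>2)" "Z \<in> borel_measurable M" "integrable M (\<lambda>\<omega>. (Z \<omega>)\<^sup>2)"
  shows "integrable M (\<lambda>\<omega>. (Y \<omega> + Z \<omega> :: real)\<^sup>2)"
proof (rule Bochner_Integration.integrable_bound)
  note [measurable] = assms(1,3)
  show "integrable M (\<lambda>\<omega>. 2 * (Y \<omega>)\<^sup>2 + 2 * (Z \<omega>)\<^sup>2)" using assms by simp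
  show "AE \<omega> in M. norm ((Y \<omega> + Z \<omega>)\<^sup>2) \<le> norm (2 * (Y \<omega>)\<^sup>2 + 2 * (Z \<omega>)\<^sup>2)"
    using sq_sum_le by (intro AE_I2) simp
qed (use assms in measurable)

text \<open>The summands may be dependent, so the mixed term is removed by
  \<open>(x + y)\<^sup>2 \<le> 2 * x\<^sup>2 + 2 * y\<^sup>2\<close>; this is the source of the
  factors 2.\<close>

lemma centred_incr_add:
  assumes Y: "centred_incr M \<Sigma> v Y" and Z: "centred_incr M \<Sigma> w Z"
  shows "centred_incr M \<Sigma> (2 * v + 2 * w) (\<lambda>\<omega>. Y \<omega> + Z \<omega>)"
  unfolding centred_incr_def
proof (intro conjI ballI allI impI)
  have Ym: "Y \<in> borel_measurable M" "integrable M (\<lambda>\<omega>. (Y \<omega>)\<^sup>2)"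
    and Zm: "Z \<in> borel_measurable M" "integrable M (\<lambda>\<omega>. (Z \<omega>)\<^sup>2)"
    using Y Z by (auto simp: centred_incr_def)
  note [measurable] = Ym(1) Zm(1)
  show "(\<lambda>\<omega>. Y \<omega> + Z \<omega>) \<in> borel_measurable M" by measurable
  show YZ: "integrable M (\<lambda>\<omega>. (Y \<omega> + Z \<omega>)\<^sup>2)" by (rule int_sq_add[OF Ym Zm])
  fix \<xi> :: "'w \<Rightarrow> real" and c :: real assume xi: "\<xi> \<in> borel_measurable \<Sigma>" and c: "\<forall>\<omega>\<in>space M. 0 \<le> \<xi> \<omega> \<and> \<xi> \<omega> \<le> c"
  have b: "\<forall>\<omega>\<in>space M. \<bar>\<xi> \<omega>\<bar> \<le> c" using c by auto
  note i = int_xi_sq[OF sub_M[OF xi] b]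
  have YE: "(\<integral>\<omega>. \<xi> \<omega> * Y \<omega> \<partial>M) = 0" "(\<integral>\<omega>. \<xi> \<omega> * (Y \<omega>)\<^sup>2 \<partial>M) \<le> v * (\<integral>\<omega>. \<xi> \<omega> \<partial>M)"
    and ZE: "(\<integral>\<omega>. \<xi> \<omega> * Z \<omega> \<partial>M) = 0" "(\<integral>\<omega>. \<xi> \<omega> * (Z \<omega>)\<^sup>2 \<partial>M) \<le> w * (\<integral>\<omega>. \<xi> \<omega> \<partial>M)"
    using Y Z xi c unfolding centred_incr_def by blast+
  show "(\<integral>\<omega>. \<xi> \<omega> * (Y \<omega> + Z \<omega>) \<partial>M) = 0"
    using YE(1) ZE(1) i(2)[OF Ym] i(2)[OF Zm] by (simp add: distrib_left)
  have "(\<integral>\<omega>. \<xi> \<omega> * (Y \<omega> + Z \<omega>)\<^sup>2 \<partial>M) \<le> (\<integral>\<omega>. 2 * (\<xi> \<omega> * (Y \<omega>)\<^sup>2) + 2 * (\<xi> \<omega> * (Z \<omega>)\<^sup>2) \<partial>M)"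
  proof (rule integral_mono)
    show "integrable M (\<lambda>\<omega>. \<xi> \<omega> * (Y \<omega> + Z \<omega>)\<^sup>2)" using i(1)[OF _ YZ] by simp
    show "integrable M (\<lambda>\<omega>. 2 * (\<xi> \<omega> * (Y \<omega>)\<^sup>2) + 2 * (\<xi> \<omega> * (Z \<omega>)\<^sup>2))"
      using i(1)[OF Ym] i(1)[OF Zm] by simp
    fix \<omega> assume "\<omega> \<in> space M"
    then have "\<xi> \<omega> * (Y \<omega> + Z \<omega>)\<^sup>2 \<le> \<xi> \<omega> * (2 * (Y \<omega>)\<^sup>2 + 2 * (Z \<omega>)\<^sup>2)"
      using c sq_sum_le by (intro mult_left_mono) auto
    then show "\<xi> \<omega> * (Y \<omega> + Z \<omega>)\<^sup>2 \<le> 2 * (\<xi> \<omega> * (Y \<omega>)\<^sup>2) + 2 * (\<xi> \<omega> * (Z \<omega>)\<^sup>2)" by (simp add: algebra_simps)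
  qed
  also have "\<dots> = 2 * (\<integral>\<omega>. \<xi> \<omega> * (Y \<omega>)\<^sup>2 \<partial>M) + 2 * (\<integral>\<omega>. \<xi> \<omega> * (Z \<omega>)\<^sup>2 \<partial>M)"
    using i(1)[OF Ym] i(1)[OF Zm] by simp
  finally show "(\<integral>\<omega>. \<xi> \<omega> * (Y \<omega> + Z \<omega>)\<^sup>2 \<partial>M) \<le> (2 * v + 2 * w) * (\<integral>\<omega>. \<xi> \<omega> \<partial>M)"
    using YE(2) ZE(2) by (simp add: distrib_right)
qed

lemma centred_incr_scale:
  assumes Y: "centred_incr M \<Sigma> v Y"
  shows "centred_incr M \<Sigma> (a\<^sup>2 * v) (\<lambda>\<omega>. a * Y \<omega>)"
  unfolding centred_incr_def
proof (intro conjI ballI allI impI)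
  have Ym: "Y \<in> borel_measurable M" "integrable M (\<lambda>\<omega>. (Y \<omega>)\<^sup>2)" using Y by (auto simp: centred_incr_def)
  note [measurable] = Ym(1)
  show "(\<lambda>\<omega>. a * Y \<omega>) \<in> borel_measurable M" by measurable
  show "integrable M (\<lambda>\<omega>. (a * Y \<omega>)\<^sup>2)" using Ym(2) by (simp add: power_mult_distrib)
  fix \<xi> :: "'w \<Rightarrow> real" and c :: real assume xi: "\<xi> \<in> borel_measurable \<Sigma>" and c: "\<forall>\<omega>\<in>space M. 0 \<le> \<xi> \<omega> \<and> \<xi> \<omega> \<le> c"
  have YE: "(\<integral>\<omega>. \<xi> \<omega> * Y \<omega> \<partial>M) = 0" "(\<integral>\<omega>. \<xi> \<omega> * (Y \<omega>)\<^sup>2 \<partial>M) \<le> v * (\<integral>\<omega>. \<xi> \<omega> \<partial>M)"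
    using Y xi c unfolding centred_incr_def by blast+
  have "(\<integral>\<omega>. \<xi> \<omega> * (a * Y \<omega>) \<partial>M) = (\<integral>\<omega>. a * (\<xi> \<omega> * Y \<omega>) \<partial>M)" by (simp add: ac_simps)
  then show "(\<integral>\<omega>. \<xi> \<omega> * (a * Y \<omega>) \<partial>M) = 0" using YE by simp
  have "(\<integral>\<omega>. \<xi> \<omega> * (a * Y \<omega>)\<^sup>2 \<partial>M) = (\<integral>\<omega>. a\<^sup>2 * (\<xi> \<omega> * (Y \<omega>)\<^sup>2) \<partial>M)"
    by (simp add: power_mult_distrib ac_simps)
  also have "\<dots> = a\<^sup>2 * (\<integral>\<omega>. \<xi> \<omega> * (Y \<omega>)\<^sup>2 \<partial>M)" by simp
  finally show "(\<integral>\<omega>. \<xi> \<omega> * (a * Y \<omega>)\<^sup>2 \<partial>M) \<le> a\<^sup>2 * v * (\<integral>\<omega>. \<xi> \<omega> \<partial>M)"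
    using mult_left_mono[OF YE(2), of "a\<^sup>2"] by (simp add: mult.assoc)
qed

lemma centred_incr_zero: "centred_incr M \<Sigma> 0 (\<lambda>_. 0)"
  by (simp add: centred_incr_def)

lemma centred_incr_mono:
  assumes Y: "centred_incr M \<Sigma> v Y" and vw: "v \<le> w"
  shows "centred_incr M \<Sigma> w Y"
  unfolding centred_incr_def
proof (intro conjI ballI allI impI)
  fix \<xi> :: "'w \<Rightarrow> real" and c :: real assume xi: "\<xi> \<in> borel_measurable \<Sigma>" and c: "\<forall>\<omega>\<in>space M. 0 \<le> \<xi> \<omega> \<and> \<xi> \<omega> \<le> c"
  have YE: "(\<integral>\<omega>. \<xi> \<omega> * Y \<omega> \<partial>M) = 0" "(\<integral>\<omega>. \<xi> \<omega> * (Y \<omega>)\<^sup>2 \<partial>M) \<le> v * (\<integral>\<omega>. \<xi> \<omega> \<partial>M)"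
    using Y xi c unfolding centred_incr_def by blast+
  have "0 \<le> (\<integral>\<omega>. \<xi> \<omega> \<partial>M)" using c by (intro integral_nonneg_AE AE_I2) auto
  then show "(\<integral>\<omega>. \<xi> \<omega> * Y \<omega> \<partial>M) = 0" "(\<integral>\<omega>. \<xi> \<omega> * (Y \<omega>)\<^sup>2 \<partial>M) \<le> w * (\<integral>\<omega>. \<xi> \<omega> \<partial>M)"
    using YE mult_right_mono[OF vw, of "\<integral>\<omega>. \<xi> \<omega> \<partial>M"] by linarith+
qed (use Y in \<open>auto simp: centred_incr_def\<close>)

lemma centred_incr_cong:
  assumes Y: "centred_incr M \<Sigma> v Y" and Z: "Z \<in> borel_measurable M" and eq: "AE \<omega> in M. Y \<omega> = Z \<omega>"
  shows "centred_incr M \<Sigma> v Z"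
  unfolding centred_incr_def
proof (intro conjI ballI allI impI)
  have Ym: "Y \<in> borel_measurable M" "integrable M (\<lambda>\<omega>. (Y \<omega>)\<^sup>2)" using Y by (auto simp: centred_incr_def)
  note [measurable] = Ym(1) Z
  show "Z \<in> borel_measurable M" by measurable
  have "integrable M (\<lambda>\<omega>. (Z \<omega>)\<^sup>2) \<longleftrightarrow> integrable M (\<lambda>\<omega>. (Y \<omega>)\<^sup>2)"
    using eq by (intro integrable_cong_AE) auto
  then show "integrable M (\<lambda>\<omega>. (Z \<omega>)\<^sup>2)" using Ym by simp
  fix \<xi> :: "'w \<Rightarrow> real" and c :: real assume xi: "\<xi> \<in> borel_measurable \<Sigma>" and c: "\<forall>\<omega>\<in>space M. 0 \<le> \<xi> \<omega> \<and> \<xi> \<omega> \<le> c"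
  note [measurable] = sub_M[OF xi]
  have YE: "(\<integral>\<omega>. \<xi> \<omega> * Y \<omega> \<partial>M) = 0" "(\<integral>\<omega>. \<xi> \<omega> * (Y \<omega>)\<^sup>2 \<partial>M) \<le> v * (\<integral>\<omega>. \<xi> \<omega> \<partial>M)"
    using Y xi c unfolding centred_incr_def by blast+
  have "(\<integral>\<omega>. \<xi> \<omega> * Z \<omega> \<partial>M) = (\<integral>\<omega>. \<xi> \<omega> * Y \<omega> \<partial>M)"
    using eq by (intro integral_cong_AE) auto
  moreover have "(\<integral>\<omega>. \<xi> \<omega> * (Z \<omega>)\<^sup>2 \<partial>M) = (\<integral>\<omega>. \<xi> \<omega> * (Y \<omega>)\<^sup>2 \<partial>M)"
    using eq by (intro integral_cong_AE) auto
  ultimately show "(\<integral>\<omega>. \<xi> \<omega> * Z \<omega> \<partial>M) = 0" "(\<integral>\<omega>. \<xi> \<omega> * (Z \<omega>)\<^sup>2 \<partial>M) \<le> v * (\<integral>\<omega>. \<xi> \<omega> \<partial>M)"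
    using YE by auto
qed

text \<open>Iterating the two-term rule doubles the constant once per summand, hence the power of
  two.\<close>

lemma centred_incr_sum:
  assumes fin: "finite I" and Y: "\<And>i. i \<in> I \<Longrightarrow> centred_incr M \<Sigma> (v i) (Y i)"
    and v: "\<And>i. i \<in> I \<Longrightarrow> 0 \<le> v i"
  shows "centred_incr M \<Sigma> (2 ^ card I * (\<Sum>i\<in>I. v i)) (\<lambda>\<omega>. \<Sum>i\<in>I. Y i \<omega>)"
  using fin Y v
proof (induction I rule: finite_induct)
  case empty
  then show ?case by (simp add: centred_incr_zero)
next
  case (insert i I)
  have "centred_incr M \<Sigma> (2 * v i + 2 * (2 ^ card I * (\<Sum>i\<in>I. v i))) (\<lambda>\<omega>. Y i \<omega> + (\<Sum>i\<in>I. Y i \<omega>))"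
    using insert by (intro centred_incr_add) auto
  moreover have "2 * v i \<le> 2 * 2 ^ card I * v i"
    using insert.prems(2)[of i] mult_right_mono[of 1 "2 ^ card I" "2 * v i"] by simp
  then have "2 * v i + 2 * (2 ^ card I * (\<Sum>i\<in>I. v i)) \<le> 2 ^ card (insert i I) * (\<Sum>i\<in>insert i I. v i)"
    using insert.hyps by (simp add: algebra_simps)
  ultimately show ?case using insert.hyps by (simp add: centred_incr_mono)
qed

lemma half_le: "2 * x \<le> k \<Longrightarrow> 0 \<le> x \<Longrightarrow> x \<le> k" for x k :: real
  by linarith

text \<open>Prepares the mean-square limit that defines the small jumps. The bound passes through
  \<open>Y\<^sup>2 \<le> 2 * Z\<^sup>2 + 2 * (Y - Z)\<^sup>2\<close>, which costs a factor 2; the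
  weights are bounded, so the second term disappears in the limit.\<close>

lemma centred_incr_limit:
  assumes Y: "Y \<in> borel_measurable M"
    and lim: "\<And>e. 0 < e \<Longrightarrow> \<exists>Z. centred_incr M \<Sigma> v Z \<and> integrable M (\<lambda>\<omega>. (Y \<omega> - Z \<omega>)\<^sup>2) \<and> (\<integral>\<omega>. (Y \<omega> - Z \<omega>)\<^sup>2 \<partial>M) \<le> e"
  shows "centred_incr M \<Sigma> (2 * v) Y"
  unfolding centred_incr_def
proof (intro conjI ballI allI impI)
  note [measurable] = Y
  show "Y \<in> borel_measurable M" by fact
  have mono: "integrable M (\<lambda>\<omega>. (Y \<omega>)\<^sup>2)"
  proof -
    obtain Z where Z: "centred_incr M \<Sigma> v Z" "integrable M (\<lambda>\<omega>. (Y \<omega> - Z \<omega>)\<^sup>2)" using lim[of 1] by auto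
    have [measurable]: "Z \<in> borel_measurable M" and "integrable M (\<lambda>\<omega>. (Z \<omega>)\<^sup>2)" using Z by (auto simp: centred_incr_def)
    then have "integrable M (\<lambda>\<omega>. ((Y \<omega> - Z \<omega>) + Z \<omega>)\<^sup>2)" using Z by (intro int_sq_add) auto
    then show ?thesis by simp
  qed
  then show "integrable M (\<lambda>\<omega>. (Y \<omega>)\<^sup>2)" .
  fix \<xi> :: "'w \<Rightarrow> real" and c :: real assume xi: "\<xi> \<in> borel_measurable \<Sigma>" and c: "\<forall>\<omega>\<in>space M. 0 \<le> \<xi> \<omega> \<and> \<xi> \<omega> \<le> c"
  have b: "\<forall>\<omega>\<in>space M. \<bar>\<xi> \<omega>\<bar> \<le> c" using c by auto
  obtain \<omega>0 where "\<omega>0 \<in> space M" using not_empty by blast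
  then have c0: "0 \<le> c" using c by force
  note i = int_xi_sq[OF sub_M[OF xi] b]
  note [measurable] = sub_M[OF xi]
  show "(\<integral>\<omega>. \<xi> \<omega> * Y \<omega> \<partial>M) = 0"
  proof -
    \<comment> \<open>The approximation is taken with squared error \<open>e\<^sup>2\<close>,
      because \<open>\<bar>Y - Z\<bar> \<le> e + (Y - Z)\<^sup>2 / e\<close> then has mean at most
      \<open>2 * e\<close>.\<close>
    have "\<bar>\<integral>\<omega>. \<xi> \<omega> * Y \<omega> \<partial>M\<bar> \<le> e * (2 * c)" if e: "0 < e" for e
    proof -
      obtain Z where Z: "centred_incr M \<Sigma> v Z" and D: "integrable M (\<lambda>\<omega>. (Y \<omega> - Z \<omega>)\<^sup>2)" "(\<integral>\<omega>. (Y \<omega> - Z \<omega>)\<^sup>2 \<partial>M) \<le> e\<^sup>2"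
        using lim[of "e\<^sup>2"] e by auto
      have [measurable]: "Z \<in> borel_measurable M" and Z2: "integrable M (\<lambda>\<omega>. (Z \<omega>)\<^sup>2)" using Z by (auto simp: centred_incr_def)
      have ZE: "(\<integral>\<omega>. \<xi> \<omega> * Z \<omega> \<partial>M) = 0" using Z xi c unfolding centred_incr_def by blast
      have "(\<integral>\<omega>. \<xi> \<omega> * Y \<omega> \<partial>M) = (\<integral>\<omega>. \<xi> \<omega> * Y \<omega> - \<xi> \<omega> * Z \<omega> \<partial>M)"
        using i(2)[OF Y mono] i(2)[OF _ Z2] ZE by simp
      also have "\<bar>\<dots>\<bar> \<le> (\<integral>\<omega>. \<bar>\<xi> \<omega> * Y \<omega> - \<xi> \<omega> * Z \<omega>\<bar> \<partial>M)" by (rule integral_abs_bound)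
      also have "\<dots> \<le> (\<integral>\<omega>. c * (e + (Y \<omega> - Z \<omega>)\<^sup>2 / e) \<partial>M)"
      proof (rule integral_mono)
        show "integrable M (\<lambda>\<omega>. \<bar>\<xi> \<omega> * Y \<omega> - \<xi> \<omega> * Z \<omega>\<bar>)" using i(2)[OF Y mono] i(2)[OF _ Z2] by simp
        show "integrable M (\<lambda>\<omega>. c * (e + (Y \<omega> - Z \<omega>)\<^sup>2 / e))" using D by simp
        fix \<omega> assume w: "\<omega> \<in> space M"
        have "2 * \<bar>Y \<omega> - Z \<omega>\<bar> \<le> e + (Y \<omega> - Z \<omega>)\<^sup>2 / e"
        proof -
          have "e + (Y \<omega> - Z \<omega>)\<^sup>2 / e - 2 * \<bar>Y \<omega> - Z \<omega>\<bar> = (e - \<bar>Y \<omega> - Z \<omega>\<bar>)\<^sup>2 / e"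
            using e by (simp add: power2_eq_square field_simps abs_mult_self_eq)
          also have "\<dots> \<ge> 0" using e by simp
          finally show ?thesis by simp
        qed
        from half_le[OF this abs_ge_zero] have "\<bar>Y \<omega> - Z \<omega>\<bar> \<le> e + (Y \<omega> - Z \<omega>)\<^sup>2 / e" .
        then have "\<bar>\<xi> \<omega>\<bar> * \<bar>Y \<omega> - Z \<omega>\<bar> \<le> c * (e + (Y \<omega> - Z \<omega>)\<^sup>2 / e)" using bspec[OF b w] c0 by (intro mult_mono) auto
        then show "\<bar>\<xi> \<omega> * Y \<omega> - \<xi> \<omega> * Z \<omega>\<bar> \<le> c * (e + (Y \<omega> - Z \<omega>)\<^sup>2 / e)"
          by (simp add: abs_mult[symmetric] right_diff_distrib)
      qed
      also have "\<dots> = c * (e + (\<integral>\<omega>. (Y \<omega> - Z \<omega>)\<^sup>2 \<partial>M) / e)" using D by (simp add: prob_space)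
      also have "\<dots> \<le> c * (e + e)"
        using D(2) e c0 by (intro mult_left_mono add_left_mono) (auto simp: divide_le_eq power2_eq_square)
      finally show ?thesis by (simp add: algebra_simps)
    qed
    note small = this
    have "\<bar>\<integral>\<omega>. \<xi> \<omega> * Y \<omega> \<partial>M\<bar> \<le> 0"
    proof (rule field_le_epsilon)
      fix e :: real assume e: "0 < e"
      have "\<bar>\<integral>\<omega>. \<xi> \<omega> * Y \<omega> \<partial>M\<bar> \<le> e / (2 * c + 1) * (2 * c)" using e c0 by (intro small) auto
      also have "\<dots> \<le> e" using e c0 by (simp add: divide_le_eq)
      finally show "\<bar>\<integral>\<omega>. \<xi> \<omega> * Y \<omega> \<partial>M\<bar> \<le> 0 + e" by simp
    qed
    then show ?thesis by simp
  qed
  show "(\<integral>\<omega>. \<xi> \<omega> * (Y \<omega>)\<^sup>2 \<partial>M) \<le> 2 * v * (\<integral>\<omega>. \<xi> \<omega> \<partial>M)"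
  proof (rule field_le_epsilon)
    fix e :: real assume e: "0 < e"
    define e' where "e' = e / (2 * c + 1)"
    have e': "0 < e'" "2 * (c * e') \<le> e" using e c0 by (auto simp: e'_def divide_le_eq)
    obtain Z where Z: "centred_incr M \<Sigma> v Z" and D: "integrable M (\<lambda>\<omega>. (Y \<omega> - Z \<omega>)\<^sup>2)" "(\<integral>\<omega>. (Y \<omega> - Z \<omega>)\<^sup>2 \<partial>M) \<le> e'"
      using lim[of e'] e' by auto
    have Zm [measurable]: "Z \<in> borel_measurable M" and Z2: "integrable M (\<lambda>\<omega>. (Z \<omega>)\<^sup>2)" using Z by (auto simp: centred_incr_def)
    have ZE: "(\<integral>\<omega>. \<xi> \<omega> * (Z \<omega>)\<^sup>2 \<partial>M) \<le> v * (\<integral>\<omega>. \<xi> \<omega> \<partial>M)" using Z xi c unfolding centred_incr_def by blast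
    have "(\<integral>\<omega>. \<xi> \<omega> * (Y \<omega>)\<^sup>2 \<partial>M) \<le> (\<integral>\<omega>. 2 * (\<xi> \<omega> * (Z \<omega>)\<^sup>2) + 2 * (c * (Y \<omega> - Z \<omega>)\<^sup>2) \<partial>M)"
    proof (rule integral_mono)
      show "integrable M (\<lambda>\<omega>. \<xi> \<omega> * (Y \<omega>)\<^sup>2)" by (rule i(1)[OF Y mono])
      show "integrable M (\<lambda>\<omega>. 2 * (\<xi> \<omega> * (Z \<omega>)\<^sup>2) + 2 * (c * (Y \<omega> - Z \<omega>)\<^sup>2))"
        using i(1)[OF Zm Z2] D by simp
      fix \<omega> assume w: "\<omega> \<in> space M"
      have "(Y \<omega>)\<^sup>2 \<le> 2 * (Z \<omega>)\<^sup>2 + 2 * (Y \<omega> - Z \<omega>)\<^sup>2" using sq_sum_le[of "Z \<omega>" "Y \<omega> - Z \<omega>"] by simp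
      then have "\<xi> \<omega> * (Y \<omega>)\<^sup>2 \<le> \<xi> \<omega> * (2 * (Z \<omega>)\<^sup>2 + 2 * (Y \<omega> - Z \<omega>)\<^sup>2)" using c w by (intro mult_left_mono) auto
      moreover have "\<xi> \<omega> * (Y \<omega> - Z \<omega>)\<^sup>2 \<le> c * (Y \<omega> - Z \<omega>)\<^sup>2" using c w by (intro mult_right_mono) auto
      ultimately show "\<xi> \<omega> * (Y \<omega>)\<^sup>2 \<le> 2 * (\<xi> \<omega> * (Z \<omega>)\<^sup>2) + 2 * (c * (Y \<omega> - Z \<omega>)\<^sup>2)"
        unfolding distrib_left by linarith
    qed
    also have "\<dots> = 2 * (\<integral>\<omega>. \<xi> \<omega> * (Z \<omega>)\<^sup>2 \<partial>M) + 2 * (c * (\<integral>\<omega>. (Y \<omega> - Z \<omega>)\<^sup>2 \<partial>M))"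
      using i(1)[OF Zm Z2] D by simp
    also have "\<dots> \<le> 2 * (v * (\<integral>\<omega>. \<xi> \<omega> \<partial>M)) + e"
      using ZE e'(2) mult_left_mono[OF D(2) c0] by linarith
    finally show "(\<integral>\<omega>. \<xi> \<omega> * (Y \<omega>)\<^sup>2 \<partial>M) \<le> 2 * v * (\<integral>\<omega>. \<xi> \<omega> \<partial>M) + e" by simp
  qed
qed

lemma case_bool_const: "case_bool x x = (\<lambda>_. x)"
  by (rule ext) (simp split: bool.split)

text \<open>Stated for \<open>ennreal\<close> values, so that integrals against a random measure can
  be multiplied before anything is known about their integrability.\<close>

lemma nn_indep_mult:
  fixes \<xi> Z :: "'w \<Rightarrow> ennreal"
  assumes ind: "indep_set (sets \<Sigma>) (sets \<Sigma>')" and sub': "subalgebra M \<Sigma>'"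
    and xi: "\<xi> \<in> borel_measurable \<Sigma>" and Z: "Z \<in> borel_measurable \<Sigma>'"
  shows "(\<integral>\<^sup>+\<omega>. \<xi> \<omega> * Z \<omega> \<partial>M) = (\<integral>\<^sup>+\<omega>. \<xi> \<omega> \<partial>M) * (\<integral>\<^sup>+\<omega>. Z \<omega> \<partial>M)"
proof -
  have sp: "space \<Sigma> = space M" "space \<Sigma>' = space M" using subalg sub' by (auto simp: subalgebra_def)
  have m [measurable]: "\<xi> \<in> borel_measurable M" "Z \<in> borel_measurable M"
    using sub_M[OF xi] measurable_from_subalg[OF sub' Z] by auto
  have 1: "sigma_sets (space M) {\<xi> -` A \<inter> space M | A. A \<in> sets borel} \<subseteq> sets \<Sigma>"
    unfolding sp(1)[symmetric] by (rule sets.sigma_sets_subset) (auto intro: measurable_sets[OF xi])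
  have 2: "sigma_sets (space M) {Z -` A \<inter> space M | A. A \<in> sets borel} \<subseteq> sets \<Sigma>'"
    unfolding sp(2)[symmetric] by (rule sets.sigma_sets_subset) (auto intro: measurable_sets[OF Z])
  have "indep_var borel \<xi> borel Z"
    unfolding indep_var_eq
  proof (intro conjI m indep_setI)
    show "sigma_sets (space M) {\<xi> -` A \<inter> space M | A. A \<in> sets borel} \<subseteq> events"
      using 1 subalg by (auto simp: subalgebra_def)
    show "sigma_sets (space M) {Z -` A \<inter> space M | A. A \<in> sets borel} \<subseteq> events"
      using 2 sub' by (auto simp: subalgebra_def)
    fix a b assume "a \<in> sigma_sets (space M) {\<xi> -` A \<inter> space M | A. A \<in> sets borel}"
      and "b \<in> sigma_sets (space M) {Z -` A \<inter> space M | A. A \<in> sets borel}"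
    then have "a \<in> sets \<Sigma>" "b \<in> sets \<Sigma>'" using 1 2 by blast+
    then show "prob (a \<inter> b) = prob a * prob b" by (rule indep_setD[OF ind])
  qed
  then have "indep_vars (\<lambda>_. borel) (case_bool \<xi> Z) UNIV"
    unfolding indep_var_def case_bool_const .
  from indep_vars_nn_integral[OF _ this] show ?thesis by (simp add: UNIV_bool mult.commute)
qed

end

section \<open>Poisson counts and the Campbell formulas\<close>

text \<open>The weights satisfy \<open>(k + 1) * P (k + 1) = l * P k\<close>, so multiplication by
  the index shifts the series; doing this once or twice gives the first two moments.\<close>

lemma poisson_sums:
  fixes l :: real
  defines "P \<equiv> \<lambda>k. l ^ k / fact k * exp (- l)"
  shows "P sums 1" "(\<lambda>k. real k * P k) sums l" "(\<lambda>k. (real k)\<^sup>2 * P k) sums (l\<^sup>2 + l)"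
proof -
  have "(\<lambda>k. l ^ k /\<^sub>R fact k) sums exp l" by (rule exp_converges)
  from sums_mult2[OF this, of "exp (- l)"] show 1: "P sums 1"
    by (simp add: P_def divide_inverse mult.commute exp_minus_inverse)
  have step: "real (Suc k) * P (Suc k) = l * P k" for k
    unfolding P_def by (simp add: field_simps del: of_nat_Suc)
  have "(\<lambda>k. real (Suc k) * P (Suc k)) sums (l * 1)" unfolding step by (rule sums_mult[OF 1])
  then show 2: "(\<lambda>k. real k * P k) sums l" using sums_Suc[of "\<lambda>k. real k * P k" l] by simp
  have "(real (Suc k))\<^sup>2 * P (Suc k) = l * (real k * P k) + l * P k" for k
  proof -
    have "(real (Suc k))\<^sup>2 * P (Suc k) = real (Suc k) * (l * P k)" unfolding power2_eq_square step[symmetric] by simp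
    then show ?thesis by (simp add: algebra_simps)
  qed
  then have "(\<lambda>k. (real (Suc k))\<^sup>2 * P (Suc k)) sums (l * l + l * 1)"
    using sums_add[OF sums_mult[OF 2, of l] sums_mult[OF 1, of l]] by simp
  then show "(\<lambda>k. (real k)\<^sup>2 * P k) sums (l\<^sup>2 + l)"
    using sums_Suc[of "\<lambda>k. (real k)\<^sup>2 * P k" "l * l + l"] by (simp add: power2_eq_square)
qed

text \<open>The law is prescribed at the natural numbers only, whereas \<open>K\<close> could take
  any value in \<open>ennreal\<close>. The Poisson weights add up to one, so no probability is left
  for other values, and integrals of functions of \<open>K\<close> become series.\<close>

lemma (in prob_space) poisson_moments:
  fixes K :: "'a \<Rightarrow> ennreal" and l :: real
  assumes K [measurable]: "K \<in> borel_measurable M" and l: "0 \<le> l"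
    and law: "\<And>k::nat. measure M {\<omega> \<in> space M. K \<omega> = of_nat k} = l ^ k / fact k * exp (- l)"
  shows "(\<integral>\<^sup>+\<omega>. K \<omega> \<partial>M) = ennreal l" "(\<integral>\<^sup>+\<omega>. K \<omega> * K \<omega> \<partial>M) = ennreal (l\<^sup>2 + l)"
proof -
  define P where "P k = l ^ k / fact k * exp (- l)" for k
  have P0: "0 \<le> P k" for k using l by (simp add: P_def)
  define S where "S k = {\<omega> \<in> space M. K \<omega> = of_nat k}" for k :: nat
  have S [measurable]: "S k \<in> sets M" for k unfolding S_def by measurable
  have disj: "disjoint_family S" by (auto simp: disjoint_family_on_def S_def)
  have mS: "measure M (S k) = P k" for k using law by (simp add: S_def P_def)
  have "(\<lambda>k. measure M (S k)) sums measure M (\<Union>k. S k)"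
    by (rule finite_measure_UNION[OF _ disj]) auto
  then have "P sums measure M (\<Union>k. S k)" by (simp add: mS)
  then have "measure M (\<Union>k. S k) = 1"
    by (rule sums_unique2) (unfold P_def[abs_def], rule poisson_sums)
  then have ae: "AE \<omega> in M. \<omega> \<in> (\<Union>k. S k)"
    using prob_eq_1[of "\<Union>k. S k"] by (simp add: sets.countable_UN)
  have main: "(\<integral>\<^sup>+\<omega>. G (K \<omega>) \<partial>M) = (\<Sum>k. ennreal (g k) * ennreal (P k))"
    if G: "\<And>k::nat. G (of_nat k) = ennreal (g k)" and [measurable]: "(\<lambda>\<omega>. G (K \<omega>)) \<in> borel_measurable M"
    for G :: "ennreal \<Rightarrow> ennreal" and g :: "nat \<Rightarrow> real"
  proof -
    have "AE \<omega> in M. G (K \<omega>) = (\<Sum>k. ennreal (g k) * indicator (S k) \<omega>)"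
      using ae
    proof eventually_elim
      case (elim \<omega>)
      then obtain k where k: "\<omega> \<in> S k" by auto
      have "indicator (S j) \<omega> = (if j = k then 1 else 0 :: ennreal)" for j
        using k disj by (auto simp: disjoint_family_on_def indicator_def)
      then have "(\<Sum>j. ennreal (g j) * indicator (S j) \<omega>) = (\<Sum>j. if j = k then ennreal (g k) else 0)"
        by (intro suminf_cong) auto
      also have "\<dots> = ennreal (g k)" by (subst suminf_finite[of "{k}"]) auto
      finally show ?case using k G by (simp add: S_def)
    qed
    then have "(\<integral>\<^sup>+\<omega>. G (K \<omega>) \<partial>M) = (\<integral>\<^sup>+\<omega>. (\<Sum>k. ennreal (g k) * indicator (S k) \<omega>) \<partial>M)"
      by (rule nn_integral_cong_AE)
    also have "\<dots> = (\<Sum>k. \<integral>\<^sup>+\<omega>. ennreal (g k) * indicator (S k) \<omega> \<partial>M)"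
      by (rule nn_integral_suminf) measurable
    also have "\<dots> = (\<Sum>k. ennreal (g k) * ennreal (P k))"
      by (simp add: nn_integral_cmult_indicator emeasure_eq_measure mS)
    finally show ?thesis .
  qed
  have "(\<integral>\<^sup>+\<omega>. K \<omega> \<partial>M) = (\<Sum>k. ennreal (real k) * ennreal (P k))"
    by (rule main[of "\<lambda>x. x"]) (auto simp: ennreal_of_nat_eq_real_of_nat)
  also have "\<dots> = (\<Sum>k. ennreal (real k * P k))" using P0 by (simp add: ennreal_mult)
  also have "\<dots> = ennreal l"
    using P0 poisson_sums(2)[of l] unfolding P_def[symmetric] by (intro suminf_ennreal_eq) auto
  finally show "(\<integral>\<^sup>+\<omega>. K \<omega> \<partial>M) = ennreal l" .
  have "(\<integral>\<^sup>+\<omega>. K \<omega> * K \<omega> \<partial>M) = (\<Sum>k. ennreal ((real k)\<^sup>2) * ennreal (P k))"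
    by (rule main[of "\<lambda>x. x * x"]) (auto simp: ennreal_of_nat_eq_real_of_nat ennreal_mult[symmetric] power2_eq_square)
  also have "\<dots> = (\<Sum>k. ennreal ((real k)\<^sup>2 * P k))" using P0 by (simp add: ennreal_mult)
  also have "\<dots> = ennreal (l\<^sup>2 + l)"
    using P0 poisson_sums(3)[of l] unfolding P_def[symmetric] by (intro suminf_ennreal_eq) auto
  finally show "(\<integral>\<^sup>+\<omega>. K \<omega> * K \<omega> \<partial>M) = ennreal (l\<^sup>2 + l)" .
qed

text \<open>A monotone class argument in the integrand, starting from the masses of fixed
  sets.\<close>

lemma nn_integral_random_measure_measurable:
  assumes sets: "\<And>\<omega>. \<omega> \<in> space S \<Longrightarrow> sets (N \<omega>) = sets \<mu>"
    and meas: "\<And>A. A \<in> sets \<mu> \<Longrightarrow> (\<lambda>\<omega>. emeasure (N \<omega>) A) \<in> borel_measurable S"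
    and f: "f \<in> borel_measurable \<mu>"
  shows "(\<lambda>\<omega>. \<integral>\<^sup>+u. f u \<partial>N \<omega>) \<in> borel_measurable S"
proof -
  have eqm: "borel_measurable (N \<omega>) = borel_measurable \<mu>" if "\<omega> \<in> space S" for \<omega>
    by (rule measurable_cong_sets[OF sets[OF that] refl])
  have sp: "space (N \<omega>) = space \<mu>" if "\<omega> \<in> space S" for \<omega> using sets[OF that] by (rule sets_eq_imp_space_eq)
  show ?thesis using f
  proof (induction f rule: borel_measurable_induct)
    case (cong f g)
    have "(\<integral>\<^sup>+u. f u \<partial>N \<omega>) = (\<integral>\<^sup>+u. g u \<partial>N \<omega>)" if "\<omega> \<in> space S" for \<omega>
      by (rule nn_integral_cong) (simp add: sp[OF that] cong(3))
    then show ?case using cong(4) by (subst measurable_cong)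
  next
    case (set A)
    then show ?case using measurable_cong[of S "\<lambda>\<omega>. \<integral>\<^sup>+u. indicator A u \<partial>N \<omega>" "\<lambda>\<omega>. emeasure (N \<omega>) A"] meas sets
      by simp
  next
    case (mult u c)
    then show ?case using measurable_cong[of S "\<lambda>\<omega>. \<integral>\<^sup>+x. c * u x \<partial>N \<omega>" "\<lambda>\<omega>. c * (\<integral>\<^sup>+x. u x \<partial>N \<omega>)"]
      by (simp add: nn_integral_cmult eqm)
  next
    case (add u v)
    then show ?case using measurable_cong[of S "\<lambda>\<omega>. \<integral>\<^sup>+x. v x + u x \<partial>N \<omega>" "\<lambda>\<omega>. (\<integral>\<^sup>+x. v x \<partial>N \<omega>) + (\<integral>\<^sup>+x. u x \<partial>N \<omega>)"]
      by (simp add: nn_integral_add eqm)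
  next
    case (seq U)
    have "(\<integral>\<^sup>+x. (SUP i. U i) x \<partial>N \<omega>) = (SUP i. \<integral>\<^sup>+x. U i x \<partial>N \<omega>)" if "\<omega> \<in> space S" for \<omega>
    proof -
      have "(\<integral>\<^sup>+x. (SUP i. U i) x \<partial>N \<omega>) = (\<integral>\<^sup>+x. (SUP i. U i x) \<partial>N \<omega>)" by (simp add: image_comp)
      also have "\<dots> = (SUP i. \<integral>\<^sup>+x. U i x \<partial>N \<omega>)"
        by (rule nn_integral_monotone_convergence_SUP[OF seq(3)]) (simp only: eqm[OF that] seq(1))
      finally show ?thesis .
    qed
    then show ?case using measurable_cong[of S "\<lambda>\<omega>. \<integral>\<^sup>+x. (SUP i. U i) x \<partial>N \<omega>" "\<lambda>\<omega>. SUP i. \<integral>\<^sup>+x. U i x \<partial>N \<omega>"] seq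
      by simp
  qed
qed

text \<open>The Bochner integral is zero for a non-integrable function. Measurability in
  \<open>\<omega>\<close> is therefore that of a difference of two nonnegative integrals on the set
  where both are finite, and of zero elsewhere.\<close>

lemma integral_random_measure_measurable:
  fixes f :: "'z \<Rightarrow> real"
  assumes sets: "\<And>\<omega>. \<omega> \<in> space S \<Longrightarrow> sets (N \<omega>) = sets \<mu>"
    and meas: "\<And>A. A \<in> sets \<mu> \<Longrightarrow> (\<lambda>\<omega>. emeasure (N \<omega>) A) \<in> borel_measurable S"
    and f: "f \<in> borel_measurable \<mu>"
  shows "(\<lambda>\<omega>. \<integral>u. f u \<partial>N \<omega>) \<in> borel_measurable S"
proof -
  note nn = nn_integral_random_measure_measurable[OF sets meas]
  have [measurable]: "(\<lambda>\<omega>. \<integral>\<^sup>+u. ennreal (f u) \<partial>N \<omega>) \<in> borel_measurable S"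
    "(\<lambda>\<omega>. \<integral>\<^sup>+u. ennreal (- f u) \<partial>N \<omega>) \<in> borel_measurable S"
    using f by (auto intro!: nn)
  have eqm: "borel_measurable (N \<omega>) = borel_measurable \<mu>" if "\<omega> \<in> space S" for \<omega>
    by (rule measurable_cong_sets[OF sets[OF that] refl])
  have "(\<integral>u. f u \<partial>N \<omega>) = (if (\<integral>\<^sup>+u. ennreal (f u) \<partial>N \<omega>) < \<infinity> \<and> (\<integral>\<^sup>+u. ennreal (- f u) \<partial>N \<omega>) < \<infinity>
      then enn2real (\<integral>\<^sup>+u. ennreal (f u) \<partial>N \<omega>) - enn2real (\<integral>\<^sup>+u. ennreal (- f u) \<partial>N \<omega>) else 0)" if "\<omega> \<in> space S" for \<omega>
    using real_integrable_def[of "N \<omega>" f] real_lebesgue_integral_def[of "N \<omega>" f] not_integrable_integral_eq[of "N \<omega>" f] eqm[OF that] f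
    by (auto simp: less_top)
  then show ?thesis
    by (subst measurable_cong[of S _ "\<lambda>\<omega>. if (\<integral>\<^sup>+u. ennreal (f u) \<partial>N \<omega>) < \<infinity> \<and> (\<integral>\<^sup>+u. ennreal (- f u) \<partial>N \<omega>) < \<infinity>
      then enn2real (\<integral>\<^sup>+u. ennreal (f u) \<partial>N \<omega>) - enn2real (\<integral>\<^sup>+u. ennreal (- f u) \<partial>N \<omega>) else 0"]) auto
qed

text \<open>Models a random measure restricted to a region of finite intensity. Its masses are
  measurable for \<open>\<Sigma>'\<close>, which is independent of the past \<open>\<Sigma>\<close>.
  Of the independence over disjoint sets only the factorisation of mixed moments is kept, since
  second moments are the goal.\<close>

locale finite_prm = sub_prob M \<Sigma> for M :: "'w measure" and \<Sigma> +
  fixes N :: "'w \<Rightarrow> 'z measure" and \<mu> :: "'z measure" and \<Sigma>' :: "'w measure"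
  assumes N_sets: "\<And>\<omega>. \<omega> \<in> space M \<Longrightarrow> sets (N \<omega>) = sets \<mu>"
    and fin: "emeasure \<mu> (space \<mu>) < \<infinity>"
    and sub': "subalgebra M \<Sigma>'"
    and ind: "indep_set (sets \<Sigma>) (sets \<Sigma>')"
    and N_meas': "\<And>A. A \<in> sets \<mu> \<Longrightarrow> (\<lambda>\<omega>. emeasure (N \<omega>) A) \<in> borel_measurable \<Sigma>'"
    and law: "\<And>A k. A \<in> sets \<mu> \<Longrightarrow> measure M {\<omega> \<in> space M. emeasure (N \<omega>) A = of_nat k} = measure \<mu> A ^ k / fact k * exp (- measure \<mu> A)"
    and disj_indep: "\<And>A B. A \<in> sets \<mu> \<Longrightarrow> B \<in> sets \<mu> \<Longrightarrow> A \<inter> B = {} \<Longrightarrow>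
       (\<integral>\<^sup>+\<omega>. emeasure (N \<omega>) A * emeasure (N \<omega>) B \<partial>M) = (\<integral>\<^sup>+\<omega>. emeasure (N \<omega>) A \<partial>M) * (\<integral>\<^sup>+\<omega>. emeasure (N \<omega>) B \<partial>M)"
begin

sublocale \<mu>: finite_measure \<mu>
  by (rule finite_measureI) (use fin in simp)

lemma N_meas [measurable]: "A \<in> sets \<mu> \<Longrightarrow> (\<lambda>\<omega>. emeasure (N \<omega>) A) \<in> borel_measurable M"
  by (rule measurable_from_subalg[OF sub' N_meas'])

lemma eqm: "\<omega> \<in> space M \<Longrightarrow> borel_measurable (N \<omega>) = borel_measurable \<mu>"
  by (rule measurable_cong_sets[OF N_sets refl])

lemma N_space: "\<omega> \<in> space M \<Longrightarrow> space (N \<omega>) = space \<mu>"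
  using sets_eq_imp_space_eq[OF N_sets] .

lemma moments:
  assumes "A \<in> sets \<mu>"
  shows "(\<integral>\<^sup>+\<omega>. emeasure (N \<omega>) A \<partial>M) = emeasure \<mu> A"
    "(\<integral>\<^sup>+\<omega>. emeasure (N \<omega>) A * emeasure (N \<omega>) A \<partial>M) = emeasure \<mu> A * emeasure \<mu> A + emeasure \<mu> A"
  using poisson_moments[OF N_meas[OF assms] measure_nonneg law[OF assms]]
  by (auto simp: \<mu>.emeasure_eq_measure power2_eq_square ennreal_mult)

text \<open>Both sets are cut along their intersection. Each of the four products is then over
  disjoint sets, except the square of the common part, which contributes the extra
  \<open>emeasure \<mu> (A \<inter> B)\<close>.\<close>

lemma mixed_moments:
  assumes A: "A \<in> sets \<mu>" and B: "B \<in> sets \<mu>"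
  shows "(\<integral>\<^sup>+\<omega>. emeasure (N \<omega>) A * emeasure (N \<omega>) B \<partial>M) = emeasure \<mu> A * emeasure \<mu> B + emeasure \<mu> (A \<inter> B)"
proof -
  let ?D = "A \<inter> B" and ?A = "A - B" and ?B = "B - A"
  note m [measurable] = A B
  have split: "emeasure L A = emeasure L ?D + emeasure L ?A" "emeasure L B = emeasure L ?D + emeasure L ?B"
    if L: "sets L = sets \<mu>" for L
  proof -
    have 1: "?D \<union> ?A = A" "?D \<union> ?B = B" "?D \<inter> ?A = {}" "?D \<inter> ?B = {}" by blast+
    have 2: "?D \<in> sets L" "?A \<in> sets L" "?B \<in> sets L" using A B L by auto
    show "emeasure L A = emeasure L ?D + emeasure L ?A" using plus_emeasure[OF 2(1,2) 1(3)] 1(1) by simp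
    show "emeasure L B = emeasure L ?D + emeasure L ?B" using plus_emeasure[OF 2(1,3) 1(4)] 1(2) by simp
  qed
  note splitN = split[OF N_sets] and split\<mu> = split[OF refl]
  define d a b where "d \<omega> = emeasure (N \<omega>) ?D" and "a \<omega> = emeasure (N \<omega>) ?A" and "b \<omega> = emeasure (N \<omega>) ?B" for \<omega>
  have s: "?D \<in> sets \<mu>" "?A \<in> sets \<mu>" "?B \<in> sets \<mu>" using A B by auto
  have [measurable]: "d \<in> borel_measurable M" "a \<in> borel_measurable M" "b \<in> borel_measurable M"
    unfolding d_def[abs_def] a_def[abs_def] b_def[abs_def] by (rule N_meas, rule s)+
  have E: "(\<integral>\<^sup>+\<omega>. d \<omega> * d \<omega> \<partial>M) = emeasure \<mu> ?D * emeasure \<mu> ?D + emeasure \<mu> ?D"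
    "(\<integral>\<^sup>+\<omega>. d \<omega> * b \<omega> \<partial>M) = emeasure \<mu> ?D * emeasure \<mu> ?B"
    "(\<integral>\<^sup>+\<omega>. a \<omega> * d \<omega> \<partial>M) = emeasure \<mu> ?A * emeasure \<mu> ?D"
    "(\<integral>\<^sup>+\<omega>. a \<omega> * b \<omega> \<partial>M) = emeasure \<mu> ?A * emeasure \<mu> ?B"
    unfolding d_def a_def b_def
       apply (rule moments(2)[OF s(1)])
      apply (subst disj_indep[OF s(1) s(3)], blast, simp only: moments(1)[OF s(1)] moments(1)[OF s(3)])
     apply (subst disj_indep[OF s(2) s(1)], blast, simp only: moments(1)[OF s(2)] moments(1)[OF s(1)])
    apply (subst disj_indep[OF s(2) s(3)], blast, simp only: moments(1)[OF s(2)] moments(1)[OF s(3)])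
    done
  have "(\<integral>\<^sup>+\<omega>. emeasure (N \<omega>) A * emeasure (N \<omega>) B \<partial>M) = (\<integral>\<^sup>+\<omega>. (d \<omega> * d \<omega> + d \<omega> * b \<omega>) + (a \<omega> * d \<omega> + a \<omega> * b \<omega>) \<partial>M)"
  proof (rule nn_integral_cong)
    fix \<omega> assume w: "\<omega> \<in> space M"
    show "emeasure (N \<omega>) A * emeasure (N \<omega>) B = (d \<omega> * d \<omega> + d \<omega> * b \<omega>) + (a \<omega> * d \<omega> + a \<omega> * b \<omega>)"
      unfolding splitN[OF w] d_def[symmetric] a_def[symmetric] b_def[symmetric] by (simp only: distrib_left distrib_right ac_simps)
  qed
  also have "\<dots> = ((\<integral>\<^sup>+\<omega>. d \<omega> * d \<omega> \<partial>M) + (\<integral>\<^sup>+\<omega>. d \<omega> * b \<omega> \<partial>M)) + ((\<integral>\<^sup>+\<omega>. a \<omega> * d \<omega> \<partial>M) + (\<integral>\<^sup>+\<omega>. a \<omega> * b \<omega> \<partial>M))"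
    by (simp add: nn_integral_add)
  also have "\<dots> = emeasure \<mu> A * emeasure \<mu> B + emeasure \<mu> ?D"
    unfolding E split\<mu> by (simp only: distrib_left distrib_right ac_simps)
  finally show ?thesis .
qed

definition \<Phi> :: "('z \<Rightarrow> ennreal) \<Rightarrow> 'w \<Rightarrow> ennreal" where "\<Phi> f \<omega> = (\<integral>\<^sup>+u. f u \<partial>N \<omega>)"

lemma \<Phi>_meas': "f \<in> borel_measurable \<mu> \<Longrightarrow> \<Phi> f \<in> borel_measurable \<Sigma>'"
  unfolding \<Phi>_def[abs_def] using sub' N_sets N_meas'
  by (intro nn_integral_random_measure_measurable[where \<mu>=\<mu>]) (auto simp: subalgebra_def)

lemma \<Phi>_meas [measurable]: "f \<in> borel_measurable \<mu> \<Longrightarrow> \<Phi> f \<in> borel_measurable M"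
  using measurable_from_subalg[OF sub' \<Phi>_meas'] by blast

lemma \<Phi>_simps:
  assumes "\<omega> \<in> space M"
  shows "A \<in> sets \<mu> \<Longrightarrow> \<Phi> (indicator A) \<omega> = emeasure (N \<omega>) A"
    "f \<in> borel_measurable \<mu> \<Longrightarrow> \<Phi> (\<lambda>u. c * f u) \<omega> = c * \<Phi> f \<omega>"
    "f \<in> borel_measurable \<mu> \<Longrightarrow> g \<in> borel_measurable \<mu> \<Longrightarrow> \<Phi> (\<lambda>u. f u + g u) \<omega> = \<Phi> f \<omega> + \<Phi> g \<omega>"
    "(\<And>i. U i \<in> borel_measurable \<mu>) \<Longrightarrow> incseq U \<Longrightarrow> \<Phi> (SUP i::nat. U i) \<omega> = (SUP i. \<Phi> (U i) \<omega>)"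
    "(\<And>x. x \<in> space \<mu> \<Longrightarrow> f x = g x) \<Longrightarrow> \<Phi> f \<omega> = \<Phi> g \<omega>"
proof -
  show "\<Phi> (SUP i::nat. U i) \<omega> = (SUP i. \<Phi> (U i) \<omega>)" if "\<And>i. U i \<in> borel_measurable \<mu>" "incseq U"
  proof -
    have "\<Phi> (SUP i::nat. U i) \<omega> = (\<integral>\<^sup>+x. (SUP i. U i x) \<partial>N \<omega>)" by (simp add: image_comp \<Phi>_def)
    also have "\<dots> = (SUP i. \<integral>\<^sup>+x. U i x \<partial>N \<omega>)"
      by (rule nn_integral_monotone_convergence_SUP[OF that(2)]) (simp only: eqm[OF assms] that(1))
    finally show ?thesis by (simp add: \<Phi>_def)
  qed
  show "\<Phi> (indicator A) \<omega> = emeasure (N \<omega>) A" if "A \<in> sets \<mu>"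
    unfolding \<Phi>_def by (rule nn_integral_indicator) (simp only: N_sets[OF assms] that)
  show "\<Phi> (\<lambda>u. c * f u) \<omega> = c * \<Phi> f \<omega>" if "f \<in> borel_measurable \<mu>"
    unfolding \<Phi>_def by (rule nn_integral_cmult) (simp only: eqm[OF assms] that)
  show "\<Phi> (\<lambda>u. f u + g u) \<omega> = \<Phi> f \<omega> + \<Phi> g \<omega>" if "f \<in> borel_measurable \<mu>" "g \<in> borel_measurable \<mu>"
    unfolding \<Phi>_def by (rule nn_integral_add) (simp_all only: eqm[OF assms] that)
  show "\<Phi> f \<omega> = \<Phi> g \<omega>" if "\<And>x. x \<in> space \<mu> \<Longrightarrow> f x = g x"
    unfolding \<Phi>_def by (rule nn_integral_cong) (simp only: N_space[OF assms] that)
qed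

lemma \<Phi>_incseq: "incseq U \<Longrightarrow> incseq (\<lambda>i. \<Phi> (U i) \<omega>)"
  unfolding \<Phi>_def incseq_def le_fun_def by (auto intro!: nn_integral_mono)

lemma \<Phi>_first:
  assumes "f \<in> borel_measurable \<mu>"
  shows "(\<integral>\<^sup>+\<omega>. \<Phi> f \<omega> \<partial>M) = (\<integral>\<^sup>+u. f u \<partial>\<mu>)"
  using assms
proof (induction f rule: borel_measurable_induct)
  case (cong f g)
  have "(\<integral>\<^sup>+\<omega>. \<Phi> f \<omega> \<partial>M) = (\<integral>\<^sup>+\<omega>. \<Phi> g \<omega> \<partial>M)" by (intro nn_integral_cong \<Phi>_simps(5) cong(3))
  moreover have "(\<integral>\<^sup>+u. f u \<partial>\<mu>) = (\<integral>\<^sup>+u. g u \<partial>\<mu>)" by (intro nn_integral_cong cong(3))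
  ultimately show ?case using cong(4) by simp
next
  case (set A)
  have "(\<integral>\<^sup>+\<omega>. \<Phi> (indicator A) \<omega> \<partial>M) = (\<integral>\<^sup>+\<omega>. emeasure (N \<omega>) A \<partial>M)" by (intro nn_integral_cong \<Phi>_simps(1) set)
  then show ?case using set by (simp add: moments)
next
  case (mult u c)
  have "(\<integral>\<^sup>+\<omega>. \<Phi> (\<lambda>x. c * u x) \<omega> \<partial>M) = (\<integral>\<^sup>+\<omega>. c * \<Phi> u \<omega> \<partial>M)" by (intro nn_integral_cong \<Phi>_simps(2) mult)
  then show ?case using mult by (simp add: nn_integral_cmult)
next
  case (add u v)
  have "(\<integral>\<^sup>+\<omega>. \<Phi> (\<lambda>x. v x + u x) \<omega> \<partial>M) = (\<integral>\<^sup>+\<omega>. \<Phi> v \<omega> + \<Phi> u \<omega> \<partial>M)" by (intro nn_integral_cong \<Phi>_simps(3) add)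
  then show ?case using add by (simp add: nn_integral_add)
next
  case (seq U)
  have "(\<integral>\<^sup>+\<omega>. \<Phi> (SUP i. U i) \<omega> \<partial>M) = (\<integral>\<^sup>+\<omega>. (SUP i. \<Phi> (U i) \<omega>) \<partial>M)"
    by (intro nn_integral_cong \<Phi>_simps(4) seq)
  also have "\<dots> = (SUP i. \<integral>\<^sup>+\<omega>. \<Phi> (U i) \<omega> \<partial>M)"
    using \<Phi>_incseq[OF seq(3)] by (intro nn_integral_monotone_convergence_SUP \<Phi>_meas seq) (auto simp: incseq_def le_fun_def)
  also have "\<dots> = (SUP i. \<integral>\<^sup>+u. U i u \<partial>\<mu>)" using seq by simp
  also have "\<dots> = (\<integral>\<^sup>+u. (SUP i. U i u) \<partial>\<mu>)"
    by (rule nn_integral_monotone_convergence_SUP[OF seq(3,1), symmetric])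
  also have "(\<lambda>u. SUP i. U i u) = (SUP i. U i)" by (rule ext) (simp add: image_comp)
  finally show ?case .
qed

text \<open>The Campbell formula is bilinear, so two monotone class arguments reduce it to counts of
  two sets.\<close>

lemma \<Phi>_second_step:
  assumes g: "g \<in> borel_measurable \<mu>" and f: "f \<in> borel_measurable \<mu>"
    and base: "\<And>A. A \<in> sets \<mu> \<Longrightarrow> (\<integral>\<^sup>+\<omega>. emeasure (N \<omega>) A * \<Phi> g \<omega> \<partial>M) = emeasure \<mu> A * (\<integral>\<^sup>+u. g u \<partial>\<mu>) + (\<integral>\<^sup>+u. indicator A u * g u \<partial>\<mu>)"
  shows "(\<integral>\<^sup>+\<omega>. \<Phi> f \<omega> * \<Phi> g \<omega> \<partial>M) = (\<integral>\<^sup>+u. f u \<partial>\<mu>) * (\<integral>\<^sup>+u. g u \<partial>\<mu>) + (\<integral>\<^sup>+u. f u * g u \<partial>\<mu>)"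
  using f
proof (induction f rule: borel_measurable_induct)
  case (cong f f')
  have "(\<integral>\<^sup>+\<omega>. \<Phi> f \<omega> * \<Phi> g \<omega> \<partial>M) = (\<integral>\<^sup>+\<omega>. \<Phi> f' \<omega> * \<Phi> g \<omega> \<partial>M)"
    by (intro nn_integral_cong arg_cong2[where f="(*)"] \<Phi>_simps(5) cong(3) refl)
  moreover have "(\<integral>\<^sup>+u. f u \<partial>\<mu>) = (\<integral>\<^sup>+u. f' u \<partial>\<mu>)" by (intro nn_integral_cong cong(3))
  moreover have "(\<integral>\<^sup>+u. f u * g u \<partial>\<mu>) = (\<integral>\<^sup>+u. f' u * g u \<partial>\<mu>)"
    by (intro nn_integral_cong arg_cong2[where f="(*)"] cong(3) refl)
  ultimately show ?case using cong(4) by simp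
next
  case (set A)
  have "(\<integral>\<^sup>+\<omega>. \<Phi> (indicator A) \<omega> * \<Phi> g \<omega> \<partial>M) = (\<integral>\<^sup>+\<omega>. emeasure (N \<omega>) A * \<Phi> g \<omega> \<partial>M)"
    by (intro nn_integral_cong arg_cong2[where f="(*)"] \<Phi>_simps(1) set refl)
  then show ?case using base[OF set] set by simp
next
  case (mult u c)
  note [measurable] = \<Phi>_meas[OF mult(2)] \<Phi>_meas[OF g] g mult(2)
  have "(\<integral>\<^sup>+\<omega>. \<Phi> (\<lambda>x. c * u x) \<omega> * \<Phi> g \<omega> \<partial>M) = (\<integral>\<^sup>+\<omega>. c * (\<Phi> u \<omega> * \<Phi> g \<omega>) \<partial>M)"
    by (intro nn_integral_cong) (simp only: \<Phi>_simps(2)[OF _ mult(2)] mult.assoc)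
  also have "\<dots> = c * (\<integral>\<^sup>+\<omega>. \<Phi> u \<omega> * \<Phi> g \<omega> \<partial>M)" by (rule nn_integral_cmult) measurable
  finally have 1: "(\<integral>\<^sup>+\<omega>. \<Phi> (\<lambda>x. c * u x) \<omega> * \<Phi> g \<omega> \<partial>M) = c * (\<integral>\<^sup>+\<omega>. \<Phi> u \<omega> * \<Phi> g \<omega> \<partial>M)" .
  have 2: "(\<integral>\<^sup>+x. c * u x * g x \<partial>\<mu>) = c * (\<integral>\<^sup>+x. u x * g x \<partial>\<mu>)"
    unfolding mult.assoc by (rule nn_integral_cmult) measurable
  have 3: "(\<integral>\<^sup>+x. c * u x \<partial>\<mu>) = c * (\<integral>\<^sup>+x. u x \<partial>\<mu>)" by (rule nn_integral_cmult) measurable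
  show ?case unfolding 1 2 3 mult(4) by (simp only: mult.assoc distrib_left)
next
  case (add u v)
  note [measurable] = \<Phi>_meas[OF add(1)] \<Phi>_meas[OF add(3)] \<Phi>_meas[OF g] g add(1,3)
  have "(\<integral>\<^sup>+\<omega>. \<Phi> (\<lambda>x. v x + u x) \<omega> * \<Phi> g \<omega> \<partial>M) = (\<integral>\<^sup>+\<omega>. \<Phi> v \<omega> * \<Phi> g \<omega> + \<Phi> u \<omega> * \<Phi> g \<omega> \<partial>M)"
    by (intro nn_integral_cong) (simp only: \<Phi>_simps(3)[OF _ add(3) add(1)] distrib_right)
  also have "\<dots> = (\<integral>\<^sup>+\<omega>. \<Phi> v \<omega> * \<Phi> g \<omega> \<partial>M) + (\<integral>\<^sup>+\<omega>. \<Phi> u \<omega> * \<Phi> g \<omega> \<partial>M)" by (rule nn_integral_add) measurable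
  finally have 1: "(\<integral>\<^sup>+\<omega>. \<Phi> (\<lambda>x. v x + u x) \<omega> * \<Phi> g \<omega> \<partial>M) = (\<integral>\<^sup>+\<omega>. \<Phi> v \<omega> * \<Phi> g \<omega> \<partial>M) + (\<integral>\<^sup>+\<omega>. \<Phi> u \<omega> * \<Phi> g \<omega> \<partial>M)" .
  have 2: "(\<integral>\<^sup>+x. (v x + u x) * g x \<partial>\<mu>) = (\<integral>\<^sup>+x. v x * g x \<partial>\<mu>) + (\<integral>\<^sup>+x. u x * g x \<partial>\<mu>)"
    unfolding distrib_right by (rule nn_integral_add) measurable
  have 3: "(\<integral>\<^sup>+x. v x + u x \<partial>\<mu>) = (\<integral>\<^sup>+x. v x \<partial>\<mu>) + (\<integral>\<^sup>+x. u x \<partial>\<mu>)" by (rule nn_integral_add) measurable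
  show ?case unfolding 1 2 3 add(6,7) by (simp only: distrib_right distrib_left ac_simps)
next
  case (seq U)
  note [measurable] = \<Phi>_meas[OF seq(1)] \<Phi>_meas[OF g] g seq(1)
  have incM: "incseq (\<lambda>i \<omega>. \<Phi> (U i) \<omega> * \<Phi> g \<omega>)" "incseq (\<lambda>i u. U i u * g u)"
    using \<Phi>_incseq[OF seq(3)] seq(3) by (auto simp: incseq_def le_fun_def intro!: mult_right_mono)
  have a: "(SUP i. \<integral>\<^sup>+u. U i u \<partial>\<mu>) = (\<integral>\<^sup>+u. (SUP i. U i u) \<partial>\<mu>)"
    by (rule nn_integral_monotone_convergence_SUP[OF seq(3,1), symmetric])
  have b: "(SUP i. \<integral>\<^sup>+u. U i u * g u \<partial>\<mu>) = (\<integral>\<^sup>+u. (SUP i. U i u) * g u \<partial>\<mu>)"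
    unfolding SUP_mult_right_ennreal by (rule nn_integral_monotone_convergence_SUP[OF incM(2), symmetric]) measurable
  have "(\<integral>\<^sup>+\<omega>. \<Phi> (SUP i. U i) \<omega> * \<Phi> g \<omega> \<partial>M) = (\<integral>\<^sup>+\<omega>. (SUP i. \<Phi> (U i) \<omega> * \<Phi> g \<omega>) \<partial>M)"
    by (intro nn_integral_cong) (simp only: \<Phi>_simps(4)[OF _ seq(1,3)] SUP_mult_right_ennreal)
  also have "\<dots> = (SUP i. \<integral>\<^sup>+\<omega>. \<Phi> (U i) \<omega> * \<Phi> g \<omega> \<partial>M)"
    by (rule nn_integral_monotone_convergence_SUP[OF incM(1)]) measurable
  also have "\<dots> = (SUP i. (\<integral>\<^sup>+u. U i u \<partial>\<mu>) * (\<integral>\<^sup>+u. g u \<partial>\<mu>) + (\<integral>\<^sup>+u. U i u * g u \<partial>\<mu>))"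
    by (simp only: seq(5))
  also have "\<dots> = (SUP i. (\<integral>\<^sup>+u. U i u \<partial>\<mu>) * (\<integral>\<^sup>+u. g u \<partial>\<mu>)) + (SUP i. (\<integral>\<^sup>+u. U i u * g u \<partial>\<mu>))"
    using seq(3) incM(2) by (intro ennreal_SUP_add) (auto simp: incseq_def le_fun_def intro!: mult_right_mono nn_integral_mono)
  also have "\<dots> = (\<integral>\<^sup>+u. (SUP i. U i u) \<partial>\<mu>) * (\<integral>\<^sup>+u. g u \<partial>\<mu>) + (\<integral>\<^sup>+u. (SUP i. U i u) * g u \<partial>\<mu>)"
    unfolding a[symmetric] b[symmetric] by (simp only: SUP_mult_right_ennreal)
  also have "(\<lambda>u. SUP i. U i u) = (SUP i. U i)" by (rule ext) (simp add: image_comp)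
  finally show ?case .
qed

lemma \<Phi>_second:
  assumes f: "f \<in> borel_measurable \<mu>" and g: "g \<in> borel_measurable \<mu>"
  shows "(\<integral>\<^sup>+\<omega>. \<Phi> f \<omega> * \<Phi> g \<omega> \<partial>M) = (\<integral>\<^sup>+u. f u \<partial>\<mu>) * (\<integral>\<^sup>+u. g u \<partial>\<mu>) + (\<integral>\<^sup>+u. f u * g u \<partial>\<mu>)"
proof (rule \<Phi>_second_step[OF g f])
  fix A assume A: "A \<in> sets \<mu>"
  have "(\<integral>\<^sup>+\<omega>. \<Phi> g \<omega> * \<Phi> (indicator A) \<omega> \<partial>M) = (\<integral>\<^sup>+u. g u \<partial>\<mu>) * (\<integral>\<^sup>+u. indicator A u \<partial>\<mu>) + (\<integral>\<^sup>+u. g u * indicator A u \<partial>\<mu>)"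
  proof (rule \<Phi>_second_step[OF _ g])
    fix B assume B: "B \<in> sets \<mu>"
    have "(\<integral>\<^sup>+\<omega>. emeasure (N \<omega>) B * \<Phi> (indicator A) \<omega> \<partial>M) = (\<integral>\<^sup>+\<omega>. emeasure (N \<omega>) B * emeasure (N \<omega>) A \<partial>M)"
      by (intro nn_integral_cong arg_cong2[where f="(*)"] \<Phi>_simps(1) A refl)
    also have "\<dots> = emeasure \<mu> B * emeasure \<mu> A + emeasure \<mu> (B \<inter> A)" by (rule mixed_moments[OF B A])
    finally show "(\<integral>\<^sup>+\<omega>. emeasure (N \<omega>) B * \<Phi> (indicator A) \<omega> \<partial>M) =
        emeasure \<mu> B * (\<integral>\<^sup>+u. indicator A u \<partial>\<mu>) + (\<integral>\<^sup>+u. indicator B u * indicator A u \<partial>\<mu>)"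
      using A B by (simp add: indicator_inter_arith[symmetric])
  qed (use A in measurable)
  moreover have "(\<integral>\<^sup>+\<omega>. emeasure (N \<omega>) A * \<Phi> g \<omega> \<partial>M) = (\<integral>\<^sup>+\<omega>. \<Phi> g \<omega> * \<Phi> (indicator A) \<omega> \<partial>M)"
    by (intro nn_integral_cong) (simp add: \<Phi>_simps(1)[OF _ A] mult.commute)
  ultimately show "(\<integral>\<^sup>+\<omega>. emeasure (N \<omega>) A * \<Phi> g \<omega> \<partial>M) = emeasure \<mu> A * (\<integral>\<^sup>+u. g u \<partial>\<mu>) + (\<integral>\<^sup>+u. indicator A u * g u \<partial>\<mu>)"
    using A by (simp add: mult.commute)
qed

text \<open>The second Campbell formula on the diagonal gives the second moment
  \<open>m * m + s\<close>, so centring leaves the variance \<open>s\<close>. Independence lets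
  every weight factor out, which makes this computation conditional on \<open>\<Sigma>\<close>. The
  identities are proved in \<open>ennreal\<close> and carried over once the random integral is known
  to be finite almost surely.\<close>

lemma centred_nonneg:
  fixes g :: "'z \<Rightarrow> real"
  assumes g [measurable]: "g \<in> borel_measurable \<mu>" and g0: "\<And>u. u \<in> space \<mu> \<Longrightarrow> 0 \<le> g u" and gK: "\<And>u. u \<in> space \<mu> \<Longrightarrow> g u \<le> K"
  shows "centred_incr M \<Sigma> (\<integral>u. (g u)\<^sup>2 \<partial>\<mu>) (\<lambda>\<omega>. enn2real (\<Phi> (\<lambda>u. ennreal (g u)) \<omega>) - (\<integral>u. g u \<partial>\<mu>))"
  unfolding centred_incr_def
proof (intro conjI ballI allI impI)
  let ?P = "\<Phi> (\<lambda>u. ennreal (g u))"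
  define p where "p \<omega> = enn2real (?P \<omega>)" for \<omega>
  define m where "m = (\<integral>u. g u \<partial>\<mu>)"
  define s where "s = (\<integral>u. (g u)\<^sup>2 \<partial>\<mu>)"
  have P_meas [measurable]: "?P \<in> borel_measurable M" by (rule \<Phi>_meas) measurable
  have p_meas [measurable]: "p \<in> borel_measurable M" unfolding p_def by measurable
  have p0: "0 \<le> p \<omega>" for \<omega> by (simp add: p_def)
  have gI: "integrable \<mu> g" "integrable \<mu> (\<lambda>u. (g u)\<^sup>2)"
  proof -
    show "integrable \<mu> g" by (rule \<mu>.integrable_const_bound[where B=K]) (use g0 gK in \<open>auto intro!: AE_I2\<close>)
    show "integrable \<mu> (\<lambda>u. (g u)\<^sup>2)"
      by (rule \<mu>.integrable_const_bound[where B="K\<^sup>2"]) (use g0 gK in \<open>auto intro!: AE_I2 power_mono\<close>)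
  qed
  have m_nn: "(\<integral>\<^sup>+u. ennreal (g u) \<partial>\<mu>) = ennreal m"
    unfolding m_def using g0 by (intro nn_integral_eq_integral gI AE_I2)
  have "(\<integral>\<^sup>+u. ennreal (g u) * ennreal (g u) \<partial>\<mu>) = (\<integral>\<^sup>+u. ennreal ((g u)\<^sup>2) \<partial>\<mu>)"
    using g0 by (intro nn_integral_cong) (simp add: ennreal_mult power2_eq_square)
  also have "\<dots> = ennreal s" unfolding s_def by (intro nn_integral_eq_integral gI AE_I2) simp
  finally have s_nn: "(\<integral>\<^sup>+u. ennreal (g u) * ennreal (g u) \<partial>\<mu>) = ennreal s" .
  have m0: "0 \<le> m" unfolding m_def using g0 by (intro integral_nonneg_AE AE_I2)
  have s0: "0 \<le> s" unfolding s_def by simp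
  have E1: "(\<integral>\<^sup>+\<omega>. ?P \<omega> \<partial>M) = ennreal m" unfolding m_nn[symmetric] by (rule \<Phi>_first) measurable
  have E2: "(\<integral>\<^sup>+\<omega>. ?P \<omega> * ?P \<omega> \<partial>M) = ennreal (m * m + s)"
    by (subst \<Phi>_second) (simp_all add: m_nn s_nn m0 s0 ennreal_mult ennreal_plus)
  have fin: "AE \<omega> in M. ?P \<omega> = ennreal (p \<omega>)"
  proof -
    have "AE \<omega> in M. ?P \<omega> \<noteq> \<infinity>" by (rule nn_integral_PInf_AE[OF P_meas]) (simp add: E1)
    then show ?thesis by (rule AE_mp) (auto simp: p_def less_top)
  qed
  have xiP: "(\<integral>\<^sup>+\<omega>. ennreal (\<xi> \<omega>) * ennreal (p \<omega>) \<partial>M) = (\<integral>\<^sup>+\<omega>. ennreal (\<xi> \<omega>) \<partial>M) * ennreal m"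
    "(\<integral>\<^sup>+\<omega>. ennreal (\<xi> \<omega>) * ennreal ((p \<omega>)\<^sup>2) \<partial>M) = (\<integral>\<^sup>+\<omega>. ennreal (\<xi> \<omega>) \<partial>M) * ennreal (m * m + s)"
    if [measurable]: "\<xi> \<in> borel_measurable \<Sigma>" for \<xi> :: "'w \<Rightarrow> real"
  proof -
    have P': "?P \<in> borel_measurable \<Sigma>'" by (rule \<Phi>_meas') measurable
    have "(\<integral>\<^sup>+\<omega>. ennreal (\<xi> \<omega>) * ennreal (p \<omega>) \<partial>M) = (\<integral>\<^sup>+\<omega>. ennreal (\<xi> \<omega>) * ?P \<omega> \<partial>M)"
      by (rule nn_integral_cong_AE, rule AE_mp[OF fin]) (auto intro!: AE_I2)
    also have "\<dots> = (\<integral>\<^sup>+\<omega>. ennreal (\<xi> \<omega>) \<partial>M) * (\<integral>\<^sup>+\<omega>. ?P \<omega> \<partial>M)"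
      by (rule nn_indep_mult[OF ind sub' _ P']) measurable
    finally show "(\<integral>\<^sup>+\<omega>. ennreal (\<xi> \<omega>) * ennreal (p \<omega>) \<partial>M) = (\<integral>\<^sup>+\<omega>. ennreal (\<xi> \<omega>) \<partial>M) * ennreal m" unfolding E1 .
    have "(\<integral>\<^sup>+\<omega>. ennreal (\<xi> \<omega>) * ennreal ((p \<omega>)\<^sup>2) \<partial>M) = (\<integral>\<^sup>+\<omega>. ennreal (\<xi> \<omega>) * (?P \<omega> * ?P \<omega>) \<partial>M)"
      by (rule nn_integral_cong_AE, rule AE_mp[OF fin]) (auto intro!: AE_I2 simp: power2_eq_square ennreal_mult p0)
    also have "\<dots> = (\<integral>\<^sup>+\<omega>. ennreal (\<xi> \<omega>) \<partial>M) * (\<integral>\<^sup>+\<omega>. ?P \<omega> * ?P \<omega> \<partial>M)"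
      by (rule nn_indep_mult[OF ind sub' _ borel_measurable_times_ennreal[OF P' P']]) measurable
    finally show "(\<integral>\<^sup>+\<omega>. ennreal (\<xi> \<omega>) * ennreal ((p \<omega>)\<^sup>2) \<partial>M) = (\<integral>\<^sup>+\<omega>. ennreal (\<xi> \<omega>) \<partial>M) * ennreal (m * m + s)" unfolding E2 .
  qed
  have p2_int: "integrable M (\<lambda>\<omega>. (p \<omega>)\<^sup>2)"
  proof (rule integrableI_nonneg)
    have "(\<integral>\<^sup>+\<omega>. ennreal ((p \<omega>)\<^sup>2) \<partial>M) = ennreal (m * m + s)"
      using xiP(2)[of "\<lambda>_. 1"] by (simp add: emeasure_space_1)
    then show "(\<integral>\<^sup>+\<omega>. ennreal ((p \<omega>)\<^sup>2) \<partial>M) < \<infinity>" by simp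
  qed (auto intro!: AE_I2)
  show "(\<lambda>\<omega>. enn2real (?P \<omega>) - (\<integral>u. g u \<partial>\<mu>)) \<in> borel_measurable M" by measurable
  have pm_int: "integrable M (\<lambda>\<omega>. (p \<omega> + - m)\<^sup>2)" by (rule int_sq_add[OF p_meas p2_int]) auto
  then show "integrable M (\<lambda>\<omega>. (enn2real (?P \<omega>) - (\<integral>u. g u \<partial>\<mu>))\<^sup>2)" by (simp add: p_def m_def)
  fix \<xi> :: "'w \<Rightarrow> real" and c :: real assume xi: "\<xi> \<in> borel_measurable \<Sigma>" and c: "\<forall>\<omega>\<in>space M. 0 \<le> \<xi> \<omega> \<and> \<xi> \<omega> \<le> c"
  have b: "\<forall>\<omega>\<in>space M. \<bar>\<xi> \<omega>\<bar> \<le> c" using c by auto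
  note [measurable] = sub_M[OF xi]
  note i = int_xi_sq[OF sub_M[OF xi] b p_meas p2_int]
  define x where "x = (\<integral>\<omega>. \<xi> \<omega> \<partial>M)"
  have x_nn: "(\<integral>\<^sup>+\<omega>. ennreal (\<xi> \<omega>) \<partial>M) = ennreal x"
    unfolding x_def using c by (intro nn_integral_eq_integral i AE_I2) auto
  have x0: "0 \<le> x" unfolding x_def using c by (intro integral_nonneg_AE AE_I2) auto
  have I1: "(\<integral>\<omega>. \<xi> \<omega> * p \<omega> \<partial>M) = x * m"
  proof -
    have "ennreal (\<integral>\<omega>. \<xi> \<omega> * p \<omega> \<partial>M) = (\<integral>\<^sup>+\<omega>. ennreal (\<xi> \<omega> * p \<omega>) \<partial>M)"
      using c p0 by (intro nn_integral_eq_integral[symmetric] i AE_I2) auto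
    also have "\<dots> = (\<integral>\<^sup>+\<omega>. ennreal (\<xi> \<omega>) * ennreal (p \<omega>) \<partial>M)"
      using c p0 by (intro nn_integral_cong) (auto simp: ennreal_mult)
    also have "\<dots> = ennreal (x * m)" unfolding xiP(1)[OF xi] x_nn using x0 m0 by (simp add: ennreal_mult)
    finally show ?thesis using x0 m0 c p0 by (subst (asm) ennreal_inj) (auto intro!: integral_nonneg_AE AE_I2)
  qed
  have I2: "(\<integral>\<omega>. \<xi> \<omega> * (p \<omega>)\<^sup>2 \<partial>M) = x * (m * m + s)"
  proof -
    have "ennreal (\<integral>\<omega>. \<xi> \<omega> * (p \<omega>)\<^sup>2 \<partial>M) = (\<integral>\<^sup>+\<omega>. ennreal (\<xi> \<omega> * (p \<omega>)\<^sup>2) \<partial>M)"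
      using c by (intro nn_integral_eq_integral[symmetric] i AE_I2) auto
    also have "\<dots> = (\<integral>\<^sup>+\<omega>. ennreal (\<xi> \<omega>) * ennreal ((p \<omega>)\<^sup>2) \<partial>M)"
      using c by (intro nn_integral_cong) (auto simp: ennreal_mult)
    also have "\<dots> = ennreal (x * (m * m + s))" unfolding xiP(2)[OF xi] x_nn using x0 m0 s0 by (simp add: ennreal_mult)
    finally show ?thesis using x0 m0 s0 c by (subst (asm) ennreal_inj) (auto intro!: integral_nonneg_AE AE_I2)
  qed
  have "(\<integral>\<omega>. \<xi> \<omega> * (p \<omega> - m) \<partial>M) = (\<integral>\<omega>. \<xi> \<omega> * p \<omega> - m * \<xi> \<omega> \<partial>M)" by (simp add: algebra_simps)
  also have "\<dots> = 0" using i I1 by (simp add: x_def)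
  finally show "(\<integral>\<omega>. \<xi> \<omega> * (enn2real (?P \<omega>) - (\<integral>u. g u \<partial>\<mu>)) \<partial>M) = 0" by (simp add: p_def m_def)
  have "(\<integral>\<omega>. \<xi> \<omega> * (p \<omega> - m)\<^sup>2 \<partial>M) = (\<integral>\<omega>. \<xi> \<omega> * (p \<omega>)\<^sup>2 - 2 * m * (\<xi> \<omega> * p \<omega>) + m * m * \<xi> \<omega> \<partial>M)"
    by (simp add: power2_eq_square algebra_simps)
  also have "\<dots> = x * (m * m + s) - 2 * m * (x * m) + m * m * x"
    using i I1 I2 by (simp add: x_def)
  also have "\<dots> = s * x" by (simp add: algebra_simps)
  finally show "(\<integral>\<omega>. \<xi> \<omega> * (enn2real (?P \<omega>) - (\<integral>u. g u \<partial>\<mu>))\<^sup>2 \<partial>M) \<le> (\<integral>u. (g u)\<^sup>2 \<partial>\<mu>) * (\<integral>\<omega>. \<xi> \<omega> \<partial>M)"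
    by (simp add: p_def m_def s_def x_def)
qed

lemma AE_finite: "AE \<omega> in M. emeasure (N \<omega>) (space \<mu>) < \<infinity>"
proof -
  have "AE \<omega> in M. emeasure (N \<omega>) (space \<mu>) \<noteq> \<infinity>"
    by (rule nn_integral_PInf_AE) (use fin moments(1)[of "space \<mu>"] in auto)
  then show ?thesis by (rule AE_mp) (auto simp: less_top)
qed

text \<open>The Campbell formulas need nonnegative integrands, hence the two parts of
  \<open>f\<close>. Their squares add up to \<open>f\<^sup>2\<close>, so the factor 2 is just that
  of \<open>centred_incr_add\<close>.\<close>

lemma centred_integral:
  fixes f :: "'z \<Rightarrow> real"
  assumes f [measurable]: "f \<in> borel_measurable \<mu>" and fK: "\<And>u. u \<in> space \<mu> \<Longrightarrow> \<bar>f u\<bar> \<le> K"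
  shows "centred_incr M \<Sigma> (2 * (\<integral>u. (f u)\<^sup>2 \<partial>\<mu>)) (\<lambda>\<omega>. (\<integral>u. f u \<partial>N \<omega>) - (\<integral>u. f u \<partial>\<mu>))"
proof -
  let ?p = "\<lambda>u. max 0 (f u)" and ?n = "\<lambda>u. max 0 (- f u)"
  let ?P = "\<lambda>\<omega>. enn2real (\<Phi> (\<lambda>u. ennreal (?p u)) \<omega>) - (\<integral>u. ?p u \<partial>\<mu>)"
  let ?Q = "\<lambda>\<omega>. enn2real (\<Phi> (\<lambda>u. ennreal (?n u)) \<omega>) - (\<integral>u. ?n u \<partial>\<mu>)"
  have I: "integrable \<mu> ?p" "integrable \<mu> ?n" "integrable \<mu> (\<lambda>u. (?p u)\<^sup>2)" "integrable \<mu> (\<lambda>u. (?n u)\<^sup>2)" "integrable \<mu> f"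
  proof -
    have *: "integrable \<mu> h" if "h \<in> borel_measurable \<mu>" "\<And>u. u \<in> space \<mu> \<Longrightarrow> \<bar>h u\<bar> \<le> k" for h :: "'z \<Rightarrow> real" and k
      by (rule \<mu>.integrable_const_bound[where B=k]) (use that in \<open>auto intro!: AE_I2\<close>)
    have 1: "\<bar>?p u\<bar> \<le> K" "\<bar>?n u\<bar> \<le> K" if "u \<in> space \<mu>" for u using fK[OF that] by auto
    have 2: "\<bar>(?p u)\<^sup>2\<bar> \<le> K\<^sup>2" "\<bar>(?n u)\<^sup>2\<bar> \<le> K\<^sup>2" if "u \<in> space \<mu>" for u
      using 1[OF that] unfolding abs_power2 by (auto intro!: power_mono)
    show "integrable \<mu> ?p" by (rule *[OF _ 1(1)]) measurable
    show "integrable \<mu> ?n" by (rule *[OF _ 1(2)]) measurable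
    show "integrable \<mu> (\<lambda>u. (?p u)\<^sup>2)" by (rule *[OF _ 2(1)]) measurable
    show "integrable \<mu> (\<lambda>u. (?n u)\<^sup>2)" by (rule *[OF _ 2(2)]) measurable
    show "integrable \<mu> f" by (rule *[OF f fK])
  qed
  have "centred_incr M \<Sigma> (\<integral>u. (?p u)\<^sup>2 \<partial>\<mu>) ?P"
  proof (rule centred_nonneg[where K=K])
    show "?p u \<le> K" if "u \<in> space \<mu>" for u using fK[OF that] by auto
  qed auto
  moreover have "centred_incr M \<Sigma> (\<integral>u. (?n u)\<^sup>2 \<partial>\<mu>) ?Q"
  proof (rule centred_nonneg[where K=K])
    show "?n u \<le> K" if "u \<in> space \<mu>" for u using fK[OF that] by auto
  qed auto
  then have "centred_incr M \<Sigma> ((-1)\<^sup>2 * (\<integral>u. (?n u)\<^sup>2 \<partial>\<mu>)) (\<lambda>\<omega>. (-1) * ?Q \<omega>)" by (rule centred_incr_scale)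
  ultimately have "centred_incr M \<Sigma> (2 * (\<integral>u. (?p u)\<^sup>2 \<partial>\<mu>) + 2 * ((-1)\<^sup>2 * (\<integral>u. (?n u)\<^sup>2 \<partial>\<mu>))) (\<lambda>\<omega>. ?P \<omega> + (-1) * ?Q \<omega>)"
    by (rule centred_incr_add)
  moreover have "2 * (\<integral>u. (?p u)\<^sup>2 \<partial>\<mu>) + 2 * ((-1)\<^sup>2 * (\<integral>u. (?n u)\<^sup>2 \<partial>\<mu>)) = 2 * (\<integral>u. (f u)\<^sup>2 \<partial>\<mu>)"
  proof -
    have "(\<integral>u. (?p u)\<^sup>2 \<partial>\<mu>) + (\<integral>u. (?n u)\<^sup>2 \<partial>\<mu>) = (\<integral>u. (?p u)\<^sup>2 + (?n u)\<^sup>2 \<partial>\<mu>)" using I by simp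
    also have "\<dots> = (\<integral>u. (f u)\<^sup>2 \<partial>\<mu>)" by (intro Bochner_Integration.integral_cong) (auto simp: max_def)
    finally show ?thesis by simp
  qed
  ultimately have main: "centred_incr M \<Sigma> (2 * (\<integral>u. (f u)\<^sup>2 \<partial>\<mu>)) (\<lambda>\<omega>. ?P \<omega> + (-1) * ?Q \<omega>)" by simp
  show ?thesis
  proof (rule centred_incr_cong[OF main])
    show "(\<lambda>\<omega>. (\<integral>u. f u \<partial>N \<omega>) - (\<integral>u. f u \<partial>\<mu>)) \<in> borel_measurable M"
      by (intro borel_measurable_diff borel_measurable_const integral_random_measure_measurable[where \<mu>=\<mu>] N_sets N_meas f)
    have \<mu>f: "(\<integral>u. f u \<partial>\<mu>) = (\<integral>u. ?p u \<partial>\<mu>) - (\<integral>u. ?n u \<partial>\<mu>)"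
    proof -
      have "(\<integral>u. ?p u \<partial>\<mu>) - (\<integral>u. ?n u \<partial>\<mu>) = (\<integral>u. ?p u - ?n u \<partial>\<mu>)" using I by simp
      also have "\<dots> = (\<integral>u. f u \<partial>\<mu>)" by (intro Bochner_Integration.integral_cong) (auto simp: max_def)
      finally show ?thesis by simp
    qed
    \<comment> \<open>Only almost surely: the integral is split into the two parts where the total
      mass of \<open>N \<omega>\<close> is finite, so that the bounded \<open>f\<close> is
      integrable.\<close>
    show "AE \<omega> in M. ?P \<omega> + (-1) * ?Q \<omega> = (\<integral>u. f u \<partial>N \<omega>) - (\<integral>u. f u \<partial>\<mu>)"
    proof (rule AE_mp[OF AE_finite], rule AE_I2, rule impI)
      fix \<omega> assume w: "\<omega> \<in> space M" and fin: "emeasure (N \<omega>) (space \<mu>) < \<infinity>"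
      interpret N: finite_measure "N \<omega>" by (rule finite_measureI) (use fin in \<open>simp add: N_space[OF w]\<close>)
      have fm: "f \<in> borel_measurable (N \<omega>)" by (simp only: eqm[OF w] f)
      have int: "integrable (N \<omega>) f"
        by (rule N.integrable_const_bound[where B=K]) (use fm fK in \<open>auto intro!: AE_I2 simp: N_space[OF w]\<close>)
      have "(\<integral>u. f u \<partial>N \<omega>) = enn2real (\<integral>\<^sup>+u. ennreal (f u) \<partial>N \<omega>) - enn2real (\<integral>\<^sup>+u. ennreal (- f u) \<partial>N \<omega>)"
        by (rule real_lebesgue_integral_def[OF int])
      moreover have "ennreal (max 0 r) = ennreal r" for r by (simp add: max_def ennreal_neg)
      ultimately show "?P \<omega> + (-1) * ?Q \<omega> = (\<integral>u. f u \<partial>N \<omega>) - (\<integral>u. f u \<partial>\<mu>)"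
        unfolding \<mu>f \<Phi>_def by simp
    qed
  qed
qed

end

section \<open>Independent and Gaussian increments\<close>

lemma (in sub_prob) indep_var_subalgebras:
  fixes \<xi> Y :: "'w \<Rightarrow> real"
  assumes ind: "indep_set (sets \<Sigma>) \<Y>" and ev: "\<Y> \<subseteq> events"
    and xi: "\<xi> \<in> borel_measurable \<Sigma>" and Y: "Y \<in> borel_measurable M"
    and YY: "sigma_sets (space M) {Y -` A \<inter> space M | A. A \<in> sets borel} \<subseteq> \<Y>"
  shows "indep_var borel \<xi> borel Y"
  unfolding indep_var_eq
proof (intro conjI Y sub_M[OF xi] indep_setI)
  have sp: "space \<Sigma> = space M" using subalg by (simp add: subalgebra_def)
  have 1: "sigma_sets (space M) {\<xi> -` A \<inter> space M | A. A \<in> sets borel} \<subseteq> sets \<Sigma>"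
    unfolding sp[symmetric] by (rule sets.sigma_sets_subset) (auto intro: measurable_sets[OF xi])
  show "sigma_sets (space M) {\<xi> -` A \<inter> space M | A. A \<in> sets borel} \<subseteq> events"
    using 1 subalg by (auto simp: subalgebra_def)
  show "sigma_sets (space M) {Y -` A \<inter> space M | A. A \<in> sets borel} \<subseteq> events" using YY ev by blast
  fix a b assume "a \<in> sigma_sets (space M) {\<xi> -` A \<inter> space M | A. A \<in> sets borel}"
    and "b \<in> sigma_sets (space M) {Y -` A \<inter> space M | A. A \<in> sets borel}"
  then have "a \<in> sets \<Sigma>" "b \<in> \<Y>" using 1 YY by blast+
  then show "prob (a \<inter> b) = prob a * prob b" by (rule indep_setD[OF ind])
qed

lemma (in sub_prob) centred_incr_indep:
  fixes Y :: "'w \<Rightarrow> real"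
  assumes iv: "\<And>\<xi> g. \<xi> \<in> borel_measurable \<Sigma> \<Longrightarrow> g \<in> borel_measurable borel \<Longrightarrow> indep_var borel \<xi> borel (\<lambda>\<omega>. g (Y \<omega>) :: real)"
    and Y: "Y \<in> borel_measurable M" "integrable M (\<lambda>\<omega>. (Y \<omega>)\<^sup>2)"
    and E: "(\<integral>\<omega>. Y \<omega> \<partial>M) = 0" "(\<integral>\<omega>. (Y \<omega>)\<^sup>2 \<partial>M) \<le> v"
  shows "centred_incr M \<Sigma> v Y"
  unfolding centred_incr_def
proof (intro conjI ballI allI impI Y)
  fix \<xi> :: "'w \<Rightarrow> real" and c :: real assume xi: "\<xi> \<in> borel_measurable \<Sigma>" and c: "\<forall>\<omega>\<in>space M. 0 \<le> \<xi> \<omega> \<and> \<xi> \<omega> \<le> c"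
  have b: "\<forall>\<omega>\<in>space M. \<bar>\<xi> \<omega>\<bar> \<le> c" using c by auto
  note i = int_xi_sq[OF sub_M[OF xi] b Y]
  have x0: "0 \<le> (\<integral>\<omega>. \<xi> \<omega> \<partial>M)" using c by (intro integral_nonneg_AE AE_I2) auto
  show "(\<integral>\<omega>. \<xi> \<omega> * Y \<omega> \<partial>M) = 0"
    using indep_var_lebesgue_integral[OF iv[OF xi, of "\<lambda>x. x"] i(3,4)] E(1) by simp
  have "(\<integral>\<omega>. \<xi> \<omega> * (Y \<omega>)\<^sup>2 \<partial>M) = (\<integral>\<omega>. \<xi> \<omega> \<partial>M) * (\<integral>\<omega>. (Y \<omega>)\<^sup>2 \<partial>M)"
    using indep_var_lebesgue_integral[OF iv[OF xi, of "\<lambda>x. x\<^sup>2"] i(3) Y(2)] by simp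
  then show "(\<integral>\<omega>. \<xi> \<omega> * (Y \<omega>)\<^sup>2 \<partial>M) \<le> v * (\<integral>\<omega>. \<xi> \<omega> \<partial>M)"
    using mult_right_mono[OF E(2) x0] by (simp add: mult.commute)
qed

text \<open>Tonelli for a product density: \<open>\<phi>\<close> is absorbed into coordinate
  \<open>i\<close>, and every other coordinate integrates to one. Coordinates are indexed through
  \<open>Basis\<close>, along which Lebesgue measure factorises.\<close>

lemma nn_integral_lborel_vec_marginal:
  fixes \<phi> :: "real \<Rightarrow> ennreal" and f :: "real \<Rightarrow> real" and i :: "'r::finite"
  assumes [measurable]: "\<phi> \<in> borel_measurable borel" "f \<in> borel_measurable borel"
    and f0: "\<And>x. 0 \<le> f x" and f1: "(\<integral>\<^sup>+x. ennreal (f x) \<partial>lborel) = 1"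
  shows "(\<integral>\<^sup>+x. ennreal (\<Prod>j\<in>UNIV. f (x $ j)) * \<phi> (x $ i) \<partial>(lborel :: (real ^ 'r) measure)) = (\<integral>\<^sup>+y. ennreal (f y) * \<phi> y \<partial>lborel)"
proof -
  let ?e = "\<lambda>j. axis j 1 :: real ^ 'r"
  have B: "(Basis :: (real ^ 'r) set) = range ?e" by (auto simp: Basis_vec_def)
  have inj: "inj ?e" by (auto simp: inj_on_def axis_eq_axis)
  define h where "h b y = ennreal (f y) * (if b = ?e i then \<phi> y else 1)" for b y
  have [measurable]: "h b \<in> borel_measurable borel" for b unfolding h_def by measurable
  have "(\<Prod>b\<in>Basis. h b (x \<bullet> b)) = ennreal (\<Prod>j\<in>UNIV. f (x $ j)) * \<phi> (x $ i)" for x :: "real ^ 'r"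
  proof -
    have "(\<Prod>b\<in>Basis. h b (x \<bullet> b)) = (\<Prod>j\<in>UNIV. ennreal (f (x $ j)) * (if j = i then \<phi> (x $ j) else 1))"
      unfolding B by (subst prod.reindex[OF inj]) (auto simp: h_def inner_axis axis_eq_axis intro!: prod.cong)
    also have "\<dots> = (\<Prod>j\<in>UNIV. ennreal (f (x $ j))) * (\<Prod>j\<in>UNIV. if j = i then \<phi> (x $ j) else 1)" by (rule prod.distrib)
    also have "(\<Prod>j\<in>UNIV. if j = i then \<phi> (x $ j) else 1) = \<phi> (x $ i)" by simp
    also have "(\<Prod>j\<in>UNIV. ennreal (f (x $ j))) = ennreal (\<Prod>j\<in>UNIV. f (x $ j))" by (rule prod_ennreal) (rule f0)
    finally show ?thesis .
  qed
  then have "(\<integral>\<^sup>+x. ennreal (\<Prod>j\<in>UNIV. f (x $ j)) * \<phi> (x $ i) \<partial>(lborel :: (real ^ 'r) measure)) = (\<integral>\<^sup>+x. (\<Prod>b\<in>Basis. h b (x \<bullet> b)) \<partial>lborel)"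
    by simp
  also have "\<dots> = (\<Prod>b\<in>Basis. \<integral>\<^sup>+y. h b y \<partial>lborel)" by (rule nn_integral_lborel_prod) auto
  also have "\<dots> = (\<Prod>j\<in>UNIV. if j = i then \<integral>\<^sup>+y. ennreal (f y) * \<phi> y \<partial>lborel else 1)"
  proof -
    have "(\<integral>\<^sup>+y. h (?e j) y \<partial>lborel) = (if j = i then \<integral>\<^sup>+y. ennreal (f y) * \<phi> y \<partial>lborel else 1)" for j
      by (simp add: h_def axis_eq_axis f1)
    then show ?thesis unfolding B by (subst prod.reindex[OF inj]) (simp only: o_def)
  qed
  also have "\<dots> = (\<integral>\<^sup>+y. ennreal (f y) * \<phi> y \<partial>lborel)" by simp
  finally show ?thesis .
qed

lemma brownian_centred:
  fixes B :: "real \<Rightarrow> 'w \<Rightarrow> real ^ 'r"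
  assumes fs: "filtered_space M F" and bm: "brownian_motion M F B" and st: "0 \<le> s" "s < t"
  shows "centred_incr M (F s) (t - s) (\<lambda>\<omega>. (B t \<omega> - B s \<omega>) $ i)"
proof -
  interpret sub_prob M "F s"
    using fs st by (auto simp: filtered_space_def sub_prob_def sub_prob_axioms_def)
  let ?D = "\<lambda>\<omega>. B t \<omega> - B s \<omega>" and ?Y = "\<lambda>\<omega>. (B t \<omega> - B s \<omega>) $ i"
  define \<sigma> where "\<sigma> = sqrt (t - s)"
  have \<sigma>: "0 < \<sigma>" "\<sigma>\<^sup>2 = t - s" using st by (auto simp: \<sigma>_def)
  define Y where "Y = gen_events M borel {()} (\<lambda>_ \<omega>. B t \<omega> - B s \<omega>)"
  have dist: "distributed M lborel ?D (\<lambda>x. ennreal (\<Prod>j\<in>UNIV. normal_density 0 \<sigma> (x $ j)))"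
    and ind: "indep_set (sets (F s)) Y"
    using bm st unfolding brownian_motion_def \<sigma>_def Y_def by blast+
  have D [measurable]: "?D \<in> borel_measurable M" using distributed_measurable[OF dist] by simp
  have Ym: "?Y \<in> borel_measurable M" by (rule borel_measurable_nth[OF D])
  have Yev: "Y \<subseteq> events" using indep_setD_ev2[OF ind] .
  have f1: "(\<integral>\<^sup>+x. ennreal (normal_density 0 \<sigma> x) \<partial>lborel) = 1"
    using prob_space.emeasure_space_1[OF prob_space_normal_density[OF \<sigma>(1), of 0]] by (simp add: emeasure_density)
  have push: "(\<integral>\<^sup>+\<omega>. \<phi> (?Y \<omega>) \<partial>M) = (\<integral>\<^sup>+y. ennreal (normal_density 0 \<sigma> y) * \<phi> y \<partial>lborel)"
    if [measurable]: "\<phi> \<in> borel_measurable borel" for \<phi>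
  proof -
    have "(\<integral>\<^sup>+\<omega>. \<phi> (?Y \<omega>) \<partial>M) = (\<integral>\<^sup>+x. ennreal (\<Prod>j\<in>UNIV. normal_density 0 \<sigma> (x $ j)) * \<phi> (x $ i) \<partial>lborel)"
      by (rule distributed_nn_integral[OF dist, symmetric, of "\<lambda>x. \<phi> (x $ i)"]) measurable
    also have "\<dots> = (\<integral>\<^sup>+y. ennreal (normal_density 0 \<sigma> y) * \<phi> y \<partial>lborel)"
      by (rule nn_integral_lborel_vec_marginal) (auto simp: f1)
    finally show ?thesis .
  qed
  have push': "(\<integral>\<^sup>+\<omega>. ennreal (g (?Y \<omega>)) \<partial>M) = (\<integral>\<^sup>+y. ennreal (normal_density 0 \<sigma> y * g y) \<partial>lborel)"
    if [measurable]: "g \<in> borel_measurable borel" for g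
    by (subst push) (auto simp: ennreal_mult' intro!: nn_integral_cong)
  have sq: "(\<integral>\<^sup>+\<omega>. ennreal ((?Y \<omega>)\<^sup>2) \<partial>M) = ennreal (\<sigma>\<^sup>2)"
  proof -
    have h: "has_bochner_integral lborel (\<lambda>x. normal_density 0 \<sigma> x * (x - 0) ^ (2 * 1)) (fact (2 * 1) / ((2 / \<sigma>\<^sup>2)^1 * fact 1))"
      by (rule normal_moment_even[OF \<sigma>(1)])
    have "(\<integral>\<^sup>+\<omega>. ennreal ((?Y \<omega>)\<^sup>2) \<partial>M) = (\<integral>\<^sup>+y. ennreal (normal_density 0 \<sigma> y * y\<^sup>2) \<partial>lborel)" by (rule push') measurable
    also have "\<dots> = ennreal (\<sigma>\<^sup>2)"
    proof -
      have "integrable lborel (\<lambda>y. normal_density 0 \<sigma> y * y\<^sup>2)" "(\<integral>y. normal_density 0 \<sigma> y * y\<^sup>2 \<partial>lborel) = \<sigma>\<^sup>2"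
        using h by (simp_all add: has_bochner_integral_iff)
      then show ?thesis by (subst nn_integral_eq_integral) auto
    qed
    finally show ?thesis .
  qed
  have sq_int: "integrable M (\<lambda>\<omega>. (?Y \<omega>)\<^sup>2)"
  proof (rule integrableI_nonneg)
    show "(\<integral>\<^sup>+\<omega>. ennreal ((?Y \<omega>)\<^sup>2) \<partial>M) < \<infinity>" unfolding sq by simp
    show "AE \<omega> in M. 0 \<le> (?Y \<omega>)\<^sup>2" by simp
    show "(\<lambda>\<omega>. (?Y \<omega>)\<^sup>2) \<in> borel_measurable M" by (rule borel_measurable_power[OF Ym])
  qed
  have one: "\<forall>\<omega>\<in>space M. \<bar>1::real\<bar> \<le> 1" by simp
  have Y_int: "integrable M ?Y" using int_xi_sq(4)[OF borel_measurable_const one Ym sq_int] .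
  have nI: "integrable lborel (\<lambda>y. normal_density 0 \<sigma> y * y)" "(\<integral>y. normal_density 0 \<sigma> y * y \<partial>lborel) = 0"
    using \<sigma>(1) normal_moment_nz_1[of \<sigma> 0] by (auto simp: has_bochner_integral_iff)
  show ?thesis
  proof (rule centred_incr_indep)
    show "integrable M (\<lambda>\<omega>. (?Y \<omega>)\<^sup>2)" by (rule sq_int)
    show "?Y \<in> borel_measurable M" by (rule Ym)
    have "ennreal (\<integral>\<omega>. (?Y \<omega>)\<^sup>2 \<partial>M) = ennreal (\<sigma>\<^sup>2)"
      unfolding sq[symmetric] by (rule nn_integral_eq_integral[symmetric, OF sq_int]) simp
    moreover have "0 \<le> (\<integral>\<omega>. (?Y \<omega>)\<^sup>2 \<partial>M)" by (rule Bochner_Integration.integral_nonneg) simp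
    ultimately have "(\<integral>\<omega>. (?Y \<omega>)\<^sup>2 \<partial>M) = \<sigma>\<^sup>2" by (subst (asm) ennreal_inj) auto
    then show "(\<integral>\<omega>. (?Y \<omega>)\<^sup>2 \<partial>M) \<le> t - s" using \<sigma>(2) by linarith
    \<comment> \<open>The transfer formula \<open>push'\<close> concerns nonnegative integrals, so
      the mean is computed as the difference of those of the positive and negative parts.\<close>
    have "(\<integral>\<omega>. ?Y \<omega> \<partial>M) = enn2real (\<integral>\<^sup>+\<omega>. ennreal (?Y \<omega>) \<partial>M) - enn2real (\<integral>\<^sup>+\<omega>. ennreal (- ?Y \<omega>) \<partial>M)"
      by (rule real_lebesgue_integral_def[OF Y_int])
    also have "\<dots> = enn2real (\<integral>\<^sup>+y. ennreal (normal_density 0 \<sigma> y * y) \<partial>lborel) - enn2real (\<integral>\<^sup>+y. ennreal (- (normal_density 0 \<sigma> y * y)) \<partial>lborel)"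
      by (subst push'[of "\<lambda>x. x"], measurable, subst push'[of "\<lambda>x. - x"], measurable)
    also have "\<dots> = 0" using real_lebesgue_integral_def[OF nI(1)] nI(2) by simp
    finally show "(\<integral>\<omega>. ?Y \<omega> \<partial>M) = 0" .
    fix \<xi> :: "'w \<Rightarrow> real" and g :: "real \<Rightarrow> real"
    assume xi: "\<xi> \<in> borel_measurable (F s)" and g [measurable]: "g \<in> borel_measurable borel"
    show "indep_var borel \<xi> borel (\<lambda>\<omega>. g (?Y \<omega>))"
    proof (rule indep_var_subalgebras[OF ind Yev xi])
      show "(\<lambda>\<omega>. g (?Y \<omega>)) \<in> borel_measurable M" by (rule measurable_compose[OF Ym g])
      \<comment> \<open>A function of one coordinate is a function of the vector increment, so its
        events belong to the family assumed independent of the past.\<close>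
      have "{(\<lambda>\<omega>. g (?Y \<omega>)) -` A \<inter> space M | A. A \<in> sets borel} \<subseteq> {?D -` A \<inter> space M | i A. i \<in> {()} \<and> A \<in> sets borel}"
      proof safe
        fix A :: "real set" assume A: "A \<in> sets borel"
        have m: "(\<lambda>x::real^'r. g (x $ i)) \<in> borel_measurable borel" by measurable
        have "(\<lambda>x. g (x $ i)) -` A \<in> sets borel" using measurable_sets[OF m A] by simp
        then show "\<exists>ia Aa. (\<lambda>\<omega>. g (?Y \<omega>)) -` A \<inter> space M = ?D -` Aa \<inter> space M \<and> ia \<in> {()} \<and> Aa \<in> sets borel"
          by (intro exI[of _ "()"] exI[of _ "(\<lambda>x. g (x $ i)) -` A"]) auto
      qed
      then show "sigma_sets (space M) {(\<lambda>\<omega>. g (?Y \<omega>)) -` A \<inter> space M | A. A \<in> sets borel} \<subseteq> Y"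
        unfolding Y_def gen_events_def by (rule sigma_sets_mono')
    qed
  qed
qed

section \<open>Compensated jumps\<close>

text \<open>The origin is removed from the space, so the sets \<open>1 / (k + 1) < norm z\<close>
  exhaust it, and each has finite mass by Chebyshev's inequality. This gives access to product
  measure and Fubini for \<open>jump_intensity\<close>.\<close>

lemma levy_sigma_finite:
  assumes "levy_measure (\<nu> :: (real ^ 'd) measure)"
  shows "sigma_finite_measure \<nu>"
proof -
  have sp: "space \<nu> = - {0}" and st: "sets \<nu> = sets (restrict_space borel (- {0}))"
    and fin: "(\<integral>\<^sup>+ z. ennreal (min ((norm z)\<^sup>2) 1) \<partial>\<nu>) < \<infinity>" using assms by (auto simp: levy_measure_def)
  have m: "{z. c < norm z} \<in> sets \<nu>" if "0 < c" for c
  proof -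
    have "{z :: real^'d. c < norm z} \<in> sets borel" by measurable
    then show ?thesis unfolding st using that by (subst sets_restrict_space_iff) auto
  qed
  have f: "emeasure \<nu> {z. c < norm z} < \<infinity>" if c: "0 < c" "c \<le> 1" for c
  proof -
    have "ennreal (c\<^sup>2) * emeasure \<nu> {z. c < norm z} = (\<integral>\<^sup>+z. ennreal (c\<^sup>2) * indicator {z. c < norm z} z \<partial>\<nu>)"
      using m[OF c(1)] by (simp add: nn_integral_cmult_indicator)
    also have "\<dots> \<le> (\<integral>\<^sup>+ z. ennreal (min ((norm z)\<^sup>2) 1) \<partial>\<nu>)"
    proof (rule nn_integral_mono)
      fix z
      have "c\<^sup>2 \<le> min ((norm z)\<^sup>2) 1" if "c < norm z"
        using c that power_mono[of c "norm z" 2] power_mono[of c 1 2] by auto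
      then show "ennreal (c\<^sup>2) * indicator {z. c < norm z} z \<le> ennreal (min ((norm z)\<^sup>2) 1)"
        by (auto simp: indicator_def intro!: ennreal_leI)
    qed
    finally have "ennreal (c\<^sup>2) * emeasure \<nu> {z. c < norm z} < \<infinity>" using fin by simp
    then show ?thesis using c by (auto simp: ennreal_mult_less_top)
  qed
  show ?thesis
  proof
    let ?A = "range (\<lambda>k::nat. {z::real^'d. 1 / real (Suc k) < norm z})"
    have "\<Union>?A = space \<nu>"
    proof -
      have "\<exists>k. 1 / real (Suc k) < norm z" if "z \<noteq> 0" for z :: "real^'d"
        using reals_Archimedean[of "norm z"] that by (auto simp: inverse_eq_divide)
      then show ?thesis unfolding sp by auto
    qed
    moreover have "\<forall>a\<in>?A. emeasure \<nu> a \<noteq> \<infinity>" using f by (auto simp: less_top[symmetric])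
    moreover have "?A \<subseteq> sets \<nu>" using m by auto
    ultimately show "\<exists>A. countable A \<and> A \<subseteq> sets \<nu> \<and> \<Union>A = space \<nu> \<and> (\<forall>a\<in>A. emeasure \<nu> a \<noteq> \<infinity>)"
      by (intro exI[of _ ?A]) auto
  qed
qed

text \<open>The coordinate integrals alone do not determine the vector integral: it is zero as soon
  as the norm has infinite integral, even if some coordinate is integrable. Hence the case
  distinction on the norm before passing to coordinates.\<close>

lemma integral_random_measure_measurable_vec:
  fixes f :: "'z \<Rightarrow> real ^ 'd"
  assumes sets: "\<And>\<omega>. \<omega> \<in> space S \<Longrightarrow> sets (N \<omega>) = sets \<mu>"
    and meas: "\<And>A. A \<in> sets \<mu> \<Longrightarrow> (\<lambda>\<omega>. emeasure (N \<omega>) A) \<in> borel_measurable S"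
    and f: "f \<in> borel_measurable \<mu>"
  shows "(\<lambda>\<omega>. \<integral>u. f u \<partial>N \<omega>) \<in> borel_measurable S"
proof -
  note [measurable] = f
  have [measurable]: "(\<lambda>\<omega>. \<integral>\<^sup>+u. ennreal (norm (f u)) \<partial>N \<omega>) \<in> borel_measurable S"
    by (rule nn_integral_random_measure_measurable[OF sets meas measurable_compose[OF measurable_compose[OF f borel_measurable_norm] measurable_ennreal]])
  have [measurable]: "(\<lambda>\<omega>. \<integral>u. f u $ i \<partial>N \<omega>) \<in> borel_measurable S" for i
    by (rule integral_random_measure_measurable[OF sets meas borel_measurable_nth[OF f]])
  have eq: "(\<integral>u. f u \<partial>N \<omega>) = (\<Sum>i\<in>UNIV. (if (\<integral>\<^sup>+u. ennreal (norm (f u)) \<partial>N \<omega>) < \<infinity> then \<integral>u. f u $ i \<partial>N \<omega> else 0) *\<^sub>R axis i 1)"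
    if w: "\<omega> \<in> space S" for \<omega>
  proof -
    have fN: "f \<in> borel_measurable (N \<omega>)" using f measurable_cong_sets[OF sets[OF w] refl] by blast
    show ?thesis
    proof (cases "(\<integral>\<^sup>+u. ennreal (norm (f u)) \<partial>N \<omega>) < \<infinity>")
      case True
      then have int: "integrable (N \<omega>) f" using fN by (intro integrableI_bounded)
      have "(\<integral>u. f u \<partial>N \<omega>) $ i = (\<integral>u. f u $ i \<partial>N \<omega>)" for i
        by (rule integral_bounded_linear[OF bounded_linear_vec_nth int, symmetric])
      then show ?thesis using True by (simp add: vec_eq_iff axis_def if_distrib[of "\<lambda>x. _ * x"] cong: if_cong)
    next
      case False
      then have "\<not> integrable (N \<omega>) f" by (auto simp: integrable_iff_bounded)
      then show ?thesis using False by (simp add: not_integrable_integral_eq)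
    qed
  qed
  show ?thesis by (subst measurable_cong[OF eq]) measurable
qed

locale jump_noise =
  fixes M :: "'w measure" and F and N :: "'w \<Rightarrow> (real \<times> (real ^ 'd)) measure" and \<nu> :: "(real ^ 'd) measure"
  assumes filt: "filtered_space M F" and lm: "levy_measure \<nu>"
    and prm: "poisson_random_measure M F N (jump_intensity \<nu>)"
begin

sublocale prob_space M using filt by (simp add: filtered_space_def)

sublocale \<nu>: sigma_finite_measure \<nu> by (rule levy_sigma_finite[OF lm])

lemma sub_F: "0 \<le> t \<Longrightarrow> sub_prob M (F t)"
  using filt by (auto simp: filtered_space_def sub_prob_def sub_prob_axioms_def)

lemma space_F: "0 \<le> t \<Longrightarrow> space (F t) = space M"
  using filt by (auto simp: filtered_space_def subalgebra_def)

abbreviation "\<mu> \<equiv> jump_intensity \<nu>"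

lemma \<nu>_sets: "A \<in> sets \<nu> \<longleftrightarrow> A \<in> sets borel \<and> A \<subseteq> - {0}"
  using lm unfolding levy_measure_def by (auto simp: sets_restrict_space_iff)

lemma \<nu>_space: "space \<nu> = - {0}"
  using lm unfolding levy_measure_def by auto

lemma rect_sets: "0 \<le> s \<Longrightarrow> Z \<in> sets \<nu> \<Longrightarrow> {s<..t} \<times> Z \<in> sets \<mu>"
  unfolding jump_intensity_def by (intro pair_measureI) (auto simp: sets_restrict_space_iff)

lemma rect_emeasure:
  assumes "0 \<le> s" "s \<le> t" "Z \<in> sets \<nu>"
  shows "emeasure \<mu> ({s<..t} \<times> Z) = ennreal (t - s) * emeasure \<nu> Z"
proof -
  have "{s<..t} \<in> sets (restrict_space lborel {0..})" using assms by (auto simp: sets_restrict_space_iff)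
  moreover have "emeasure (restrict_space lborel {0..}) {s<..t} = ennreal (t - s)"
    using assms by (subst emeasure_restrict_space) auto
  ultimately show ?thesis unfolding jump_intensity_def using assms by (subst \<nu>.emeasure_pair_measure_Times) auto
qed

lemma N_sets: "\<omega> \<in> space M \<Longrightarrow> sets (N \<omega>) = sets \<mu>"
  and N_meas: "A \<in> sets \<mu> \<Longrightarrow> (\<lambda>\<omega>. emeasure (N \<omega>) A) \<in> borel_measurable M"
  and N_law: "A \<in> sets \<mu> \<Longrightarrow> emeasure \<mu> A < \<infinity> \<Longrightarrow> measure M {\<omega> \<in> space M. emeasure (N \<omega>) A = of_nat k} = measure \<mu> A ^ k / fact k * exp (- measure \<mu> A)"
  and N_adapt: "0 \<le> t \<Longrightarrow> A \<in> sets \<mu> \<Longrightarrow> A \<subseteq> {..t} \<times> UNIV \<Longrightarrow> (\<lambda>\<omega>. emeasure (N \<omega>) A) \<in> borel_measurable (F t)"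
  and N_future: "0 \<le> t \<Longrightarrow> indep_set (sets (F t)) (gen_events M borel {A \<in> sets \<mu>. A \<subseteq> {t<..} \<times> UNIV} (\<lambda>A \<omega>. emeasure (N \<omega>) A))"
proof -
  note P = prm[unfolded poisson_random_measure_def]
  note P2 = conjunct2[OF P] note P3 = conjunct2[OF P2] note P4 = conjunct2[OF P3] note P5 = conjunct2[OF P4] note P6 = conjunct2[OF P5]
  show "\<omega> \<in> space M \<Longrightarrow> sets (N \<omega>) = sets \<mu>" using conjunct1[OF P] by simp
  show "A \<in> sets \<mu> \<Longrightarrow> (\<lambda>\<omega>. emeasure (N \<omega>) A) \<in> borel_measurable M" using conjunct1[OF P2] by simp
  show "A \<in> sets \<mu> \<Longrightarrow> emeasure \<mu> A < \<infinity> \<Longrightarrow> measure M {\<omega> \<in> space M. emeasure (N \<omega>) A = of_nat k} = measure \<mu> A ^ k / fact k * exp (- measure \<mu> A)"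
    using conjunct1[OF P3] by simp
  show "0 \<le> t \<Longrightarrow> A \<in> sets \<mu> \<Longrightarrow> A \<subseteq> {..t} \<times> UNIV \<Longrightarrow> (\<lambda>\<omega>. emeasure (N \<omega>) A) \<in> borel_measurable (F t)"
    using conjunct1[OF P6] by simp
  show "0 \<le> t \<Longrightarrow> indep_set (sets (F t)) (gen_events M borel {A \<in> sets \<mu>. A \<subseteq> {t<..} \<times> UNIV} (\<lambda>A \<omega>. emeasure (N \<omega>) A))"
    using conjunct2[OF P6] by simp
qed

lemma N_disj:
  assumes A: "A \<in> sets \<mu>" and B: "B \<in> sets \<mu>" and AB: "A \<inter> B = {}"
  shows "(\<integral>\<^sup>+\<omega>. emeasure (N \<omega>) A * emeasure (N \<omega>) B \<partial>M) = (\<integral>\<^sup>+\<omega>. emeasure (N \<omega>) A \<partial>M) * (\<integral>\<^sup>+\<omega>. emeasure (N \<omega>) B \<partial>M)"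
proof -
  define C where "C i = (if i = 0 then A else B)" for i :: nat
  have "\<forall>i<2. C i \<in> sets \<mu>" "disjoint_family_on C {..<2}"
    using A B AB by (auto simp: C_def disjoint_family_on_def less_2_cases_iff)
  then have "indep_vars (\<lambda>_. borel) (\<lambda>i \<omega>. emeasure (N \<omega>) (C i)) {..<2::nat}"
    using prm[unfolded poisson_random_measure_def, THEN conjunct2, THEN conjunct2, THEN conjunct2, THEN conjunct2, THEN conjunct1]
    by simp
  from indep_vars_nn_integral[OF _ this] show ?thesis by (simp add: C_def numeral_2_eq_2)
qed

definition \<kappa> :: real where "\<kappa> = enn2real (\<integral>\<^sup>+ z. ennreal (min ((norm z)\<^sup>2) 1) \<partial>\<nu>)"

lemma \<kappa>: "(\<integral>\<^sup>+ z. ennreal (min ((norm z)\<^sup>2) 1) \<partial>\<nu>) = ennreal \<kappa>" "0 \<le> \<kappa>"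
  using lm unfolding levy_measure_def \<kappa>_def by (auto simp: less_top)

lemma borel_\<nu>: "f \<in> borel_measurable borel \<Longrightarrow> f \<in> borel_measurable \<nu>"
proof -
  assume f: "f \<in> borel_measurable borel"
  have "sets \<nu> = sets (restrict_space borel (- {0}))" using lm by (simp add: levy_measure_def)
  then show ?thesis using measurable_restrict_space1[OF f, of "- {0}"] measurable_cong_sets by blast
qed

lemma snd_meas: "snd \<in> borel_measurable \<mu>"
proof -
  have "(\<lambda>z. z) \<in> borel_measurable \<nu>" by (rule borel_\<nu>) simp
  then show ?thesis unfolding jump_intensity_def using measurable_compose[OF measurable_snd] by fastforce
qed

text \<open>For \<open>norm z \<le> R\<close> and \<open>1 \<le> R\<close> one has
  \<open>(norm z)\<^sup>2 \<le> R\<^sup>2 * min ((norm z)\<^sup>2) 1\<close>, so the integrability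
  built into a Levy measure already controls the second moment of truncated jumps.\<close>

lemma second_moment:
  assumes Z: "Z \<in> sets \<nu>" and R: "\<And>z. z \<in> Z \<Longrightarrow> norm z \<le> R" and R1: "1 \<le> R" and st: "0 \<le> s" "s < t"
  shows "(\<integral>\<^sup>+u. ennreal ((snd u $ i)\<^sup>2) * indicator ({s<..t} \<times> Z) u \<partial>\<mu>) \<le> ennreal ((t - s) * (R\<^sup>2 * \<kappa>))"
proof -
  let ?g = "\<lambda>x z. indicator {s<..t} x * ennreal (R\<^sup>2 * min ((norm z)\<^sup>2) 1)"
  have [measurable]: "(\<lambda>z. ennreal (R\<^sup>2 * min ((norm z)\<^sup>2) 1)) \<in> borel_measurable \<nu>" "(\<lambda>z. ennreal (min ((norm z)\<^sup>2) 1)) \<in> borel_measurable \<nu>"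
    "(\<lambda>z. min ((norm z)\<^sup>2) 1) \<in> borel_measurable \<nu>"
    by (rule borel_\<nu>, measurable)+
  have ind [measurable]: "indicator {s<..t} \<in> borel_measurable (restrict_space lborel {0..})"
    by (rule measurable_restrict_space1) measurable
  have "(\<integral>\<^sup>+u. ennreal ((snd u $ i)\<^sup>2) * indicator ({s<..t} \<times> Z) u \<partial>\<mu>) \<le> (\<integral>\<^sup>+u. ?g (fst u) (snd u) \<partial>\<mu>)"
  proof (rule nn_integral_mono)
    fix u :: "real \<times> (real ^ 'd)"
    have "(snd u $ i)\<^sup>2 \<le> R\<^sup>2 * min ((norm (snd u))\<^sup>2) 1" if z: "snd u \<in> Z"
    proof -
      have 1: "(snd u $ i)\<^sup>2 \<le> (norm (snd u))\<^sup>2"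
        using power_mono[OF component_le_norm_cart[of "snd u" i] abs_ge_zero, of 2] by simp
      have 2: "(norm (snd u))\<^sup>2 \<le> R\<^sup>2" using R[OF z] by (intro power_mono) auto
      have "1 \<le> R\<^sup>2" using R1 by simp
      then have "1 * (norm (snd u))\<^sup>2 \<le> R\<^sup>2 * (norm (snd u))\<^sup>2" by (rule mult_right_mono) simp
      then show ?thesis using 1 2 by (auto simp: min_def)
    qed
    then show "ennreal ((snd u $ i)\<^sup>2) * indicator ({s<..t} \<times> Z) u \<le> ?g (fst u) (snd u)"
      by (cases u) (auto simp: indicator_def intro!: ennreal_leI)
  qed
  also have "\<dots> = (\<integral>\<^sup>+x. \<integral>\<^sup>+z. ?g x z \<partial>\<nu> \<partial>restrict_space lborel {0..})"
    unfolding jump_intensity_def by (subst \<nu>.nn_integral_fst[symmetric]) simp_all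
  also have "\<dots> = (\<integral>\<^sup>+x. indicator {s<..t} x * ennreal (R\<^sup>2 * \<kappa>) \<partial>restrict_space lborel {0..})"
  proof (rule nn_integral_cong)
    fix x
    have "(\<integral>\<^sup>+z. ennreal (R\<^sup>2 * min ((norm z)\<^sup>2) 1) \<partial>\<nu>) = (\<integral>\<^sup>+z. ennreal (R\<^sup>2) * ennreal (min ((norm z)\<^sup>2) 1) \<partial>\<nu>)"
      by (simp add: ennreal_mult)
    also have "\<dots> = ennreal (R\<^sup>2 * \<kappa>)" using \<kappa> by (subst nn_integral_cmult) (auto simp: ennreal_mult)
    finally show "(\<integral>\<^sup>+z. ?g x z \<partial>\<nu>) = indicator {s<..t} x * ennreal (R\<^sup>2 * \<kappa>)" by (subst nn_integral_cmult) auto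
  qed
  also have "\<dots> = ennreal (R\<^sup>2 * \<kappa>) * emeasure (restrict_space lborel {0..}) {s<..t}"
  proof -
    have "{s<..t} \<in> sets (restrict_space lborel {0..})" using st by (auto simp: sets_restrict_space_iff)
    then show ?thesis by (subst nn_integral_multc) (auto simp: mult.commute)
  qed
  also have "emeasure (restrict_space lborel {0..}) {s<..t} = ennreal (t - s)"
    using st by (subst emeasure_restrict_space) auto
  also have "ennreal (R\<^sup>2 * \<kappa>) * ennreal (t - s) = ennreal ((t - s) * (R\<^sup>2 * \<kappa>))"
    using st \<kappa>(2) by (simp add: ennreal_mult mult.commute)
  finally show ?thesis .
qed

text \<open>Restricting the random measure and its intensity to the rectangle gives an instance of
  \<open>finite_prm\<close>. There \<open>\<Sigma>'\<close> is generated by all masses after time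
  \<open>s\<close>, which are independent of \<open>F s\<close>.\<close>

lemma jump_centred:
  assumes Z: "Z \<in> sets \<nu>" "emeasure \<nu> Z < \<infinity>" and R: "\<And>z. z \<in> Z \<Longrightarrow> norm z \<le> R" and R1: "1 \<le> R" and st: "0 \<le> s" "s < t"
  shows "centred_incr M (F s) (2 * ((t - s) * (R\<^sup>2 * \<kappa>)))
     (\<lambda>\<omega>. (LINT u:{s<..t} \<times> Z|N \<omega>. snd u $ i) - (LINT u:{s<..t} \<times> Z|\<mu>. snd u $ i))"
proof -
  let ?A = "{s<..t} \<times> Z"
  have A: "?A \<in> sets \<mu>" using rect_sets st Z by simp
  have A_in: "?A \<inter> space \<mu> \<in> sets \<mu>" using A by simp
  have A_in': "?A \<inter> space (N \<omega>) \<in> sets (N \<omega>)" if "\<omega> \<in> space M" for \<omega> using A N_sets[OF that] by simp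
  have fin: "emeasure \<mu> ?A < \<infinity>" using Z st by (subst rect_emeasure) (auto simp: ennreal_mult_less_top)
  define S where "S = {A \<in> sets \<mu>. A \<subseteq> {s<..} \<times> UNIV}"
  define GG where "GG = {(\<lambda>\<omega>. emeasure (N \<omega>) A) -` X \<inter> space M | A X. A \<in> S \<and> X \<in> sets borel}"
  define \<Sigma>' where "\<Sigma>' = sigma (space M) GG"
  have GGP: "GG \<subseteq> Pow (space M)" by (auto simp: GG_def)
  have sets\<Sigma>': "sets \<Sigma>' = gen_events M borel S (\<lambda>A \<omega>. emeasure (N \<omega>) A)"
    unfolding \<Sigma>'_def using GGP by (simp add: GG_def gen_events_def)
  have sp\<Sigma>': "space \<Sigma>' = space M" unfolding \<Sigma>'_def using GGP by (rule space_measure_of)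
  interpret sub_prob M "F s" by (rule sub_F) fact
  have ind: "indep_set (sets (F s)) (sets \<Sigma>')" unfolding sets\<Sigma>' S_def by (rule N_future) fact
  interpret P: finite_prm M "F s" "\<lambda>\<omega>. restrict_space (N \<omega>) ?A" "restrict_space \<mu> ?A" \<Sigma>'
  proof
    show "sets (restrict_space (N \<omega>) ?A) = sets (restrict_space \<mu> ?A)" if "\<omega> \<in> space M" for \<omega>
      by (rule sets_restrict_space_cong[OF N_sets[OF that]])
    show "emeasure (restrict_space \<mu> ?A) (space (restrict_space \<mu> ?A)) < \<infinity>"
      using fin A by (subst emeasure_restrict_space) (auto simp: space_restrict_space sets.sets_into_space Int_absorb2)
    show "subalgebra M \<Sigma>'" unfolding subalgebra_def using indep_setD_ev2[OF ind] sp\<Sigma>' by simp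
    show "indep_set (sets (F s)) (sets \<Sigma>')" by fact
  next
    fix A' assume "A' \<in> sets (restrict_space \<mu> ?A)"
    then have A': "A' \<subseteq> ?A" "A' \<in> sets \<mu>" using A by (auto simp: sets_restrict_space_iff)
    then have S: "A' \<in> S" by (auto simp: S_def)
    have eqN: "emeasure (restrict_space (N \<omega>) ?A) A' = emeasure (N \<omega>) A'" if "\<omega> \<in> space M" for \<omega>
      using A'(1) A_in'[OF that] by (rule emeasure_restrict_space[rotated])
    have eq\<mu>: "measure (restrict_space \<mu> ?A) A' = measure \<mu> A'" using A'(1) A_in by (rule measure_restrict_space[rotated])
    have "(\<lambda>\<omega>. emeasure (N \<omega>) A') \<in> borel_measurable \<Sigma>'"
    proof (rule measurableI)
      fix X :: "ennreal set" assume "X \<in> sets borel"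
      then have "(\<lambda>\<omega>. emeasure (N \<omega>) A') -` X \<inter> space M \<in> GG" using S by (auto simp: GG_def)
      then show "(\<lambda>\<omega>. emeasure (N \<omega>) A') -` X \<inter> space \<Sigma>' \<in> sets \<Sigma>'" unfolding \<Sigma>'_def using GGP by auto
    qed simp
    then show "(\<lambda>\<omega>. emeasure (restrict_space (N \<omega>) ?A) A') \<in> borel_measurable \<Sigma>'"
      by (subst measurable_cong[of \<Sigma>' _ "\<lambda>\<omega>. emeasure (N \<omega>) A'"]) (auto simp: eqN sp\<Sigma>')
    fix k
    have "emeasure \<mu> A' < \<infinity>" using emeasure_mono[OF A'(1) A] fin by auto
    from N_law[OF A'(2) this, of k]
    show "measure M {\<omega> \<in> space M. emeasure (restrict_space (N \<omega>) ?A) A' = of_nat k} = measure (restrict_space \<mu> ?A) A' ^ k / fact k * exp (- measure (restrict_space \<mu> ?A) A')"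
      unfolding eq\<mu> by (simp add: eqN cong: conj_cong)
    fix B' assume "B' \<in> sets (restrict_space \<mu> ?A)" and dis: "A' \<inter> B' = {}"
    then have B': "B' \<subseteq> ?A" "B' \<in> sets \<mu>" using A by (auto simp: sets_restrict_space_iff)
    have eqB: "emeasure (restrict_space (N \<omega>) ?A) B' = emeasure (N \<omega>) B'" if "\<omega> \<in> space M" for \<omega>
      using B'(1) A_in'[OF that] by (rule emeasure_restrict_space[rotated])
    show "(\<integral>\<^sup>+\<omega>. emeasure (restrict_space (N \<omega>) ?A) A' * emeasure (restrict_space (N \<omega>) ?A) B' \<partial>M) =
      (\<integral>\<^sup>+\<omega>. emeasure (restrict_space (N \<omega>) ?A) A' \<partial>M) * (\<integral>\<^sup>+\<omega>. emeasure (restrict_space (N \<omega>) ?A) B' \<partial>M)"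
      using N_disj[OF A'(2) B'(2) dis] by (simp add: eqN eqB cong: nn_integral_cong)
  qed
  have fm: "(\<lambda>u. snd u $ i) \<in> borel_measurable \<mu>" using snd_meas by measurable
  have bd: "\<bar>snd u $ i\<bar> \<le> R" if "u \<in> space (restrict_space \<mu> ?A)" for u
    using that R[of "snd u"] component_le_norm_cart[of "snd u" i] by (auto simp: space_restrict_space)
  have "centred_incr M (F s) (2 * (\<integral>u. (snd u $ i)\<^sup>2 \<partial>restrict_space \<mu> ?A))
     (\<lambda>\<omega>. (\<integral>u. snd u $ i \<partial>restrict_space (N \<omega>) ?A) - (\<integral>u. snd u $ i \<partial>restrict_space \<mu> ?A))"
    by (rule P.centred_integral[OF measurable_restrict_space1[OF fm] bd])
  moreover have "2 * (\<integral>u. (snd u $ i)\<^sup>2 \<partial>restrict_space \<mu> ?A) \<le> 2 * ((t - s) * (R\<^sup>2 * \<kappa>))"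
  proof (rule mult_left_mono[OF integral_real_bounded])
    show "(\<integral>\<^sup>+u. ennreal ((snd u $ i)\<^sup>2) \<partial>restrict_space \<mu> ?A) \<le> ennreal ((t - s) * (R\<^sup>2 * \<kappa>))"
      using second_moment[OF Z(1) R R1 st] by (subst nn_integral_restrict_space[OF A_in])
    show "0 \<le> (t - s) * (R\<^sup>2 * \<kappa>)" using st \<kappa>(2) by simp
  qed simp
  ultimately have main: "centred_incr M (F s) (2 * ((t - s) * (R\<^sup>2 * \<kappa>)))
     (\<lambda>\<omega>. (\<integral>u. snd u $ i \<partial>restrict_space (N \<omega>) ?A) - (\<integral>u. snd u $ i \<partial>restrict_space \<mu> ?A))"
    by (rule centred_incr_mono)
  have e: "(\<integral>u. snd u $ i \<partial>restrict_space (N \<omega>) ?A) - (\<integral>u. snd u $ i \<partial>restrict_space \<mu> ?A) =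
     (LINT u:?A|N \<omega>. snd u $ i) - (LINT u:?A|\<mu>. snd u $ i)" if "\<omega> \<in> space M" for \<omega>
    unfolding set_lebesgue_integral_def by (subst integral_restrict_space[OF A_in'[OF that]], subst integral_restrict_space[OF A_in]) simp
  show ?thesis
  proof (rule centred_incr_cong[OF main])
    show "AE \<omega> in M. (\<integral>u. snd u $ i \<partial>restrict_space (N \<omega>) ?A) - (\<integral>u. snd u $ i \<partial>restrict_space \<mu> ?A) =
     (LINT u:?A|N \<omega>. snd u $ i) - (LINT u:?A|\<mu>. snd u $ i)" using e by (intro AE_I2)
    show "(\<lambda>\<omega>. (LINT u:?A|N \<omega>. snd u $ i) - (LINT u:?A|\<mu>. snd u $ i)) \<in> borel_measurable M"
      unfolding set_lebesgue_integral_def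
    proof (intro borel_measurable_diff borel_measurable_const integral_random_measure_measurable[where \<mu>=\<mu>] N_sets N_meas)
      show "(\<lambda>u. indicator ?A u *\<^sub>R snd u $ i) \<in> borel_measurable \<mu>" using fm A by measurable
    qed
  qed
qed

lemma rect_meas_vec: "A \<in> sets \<mu> \<Longrightarrow> (\<lambda>u. indicator A u *\<^sub>R snd u) \<in> borel_measurable \<mu>"
  by (intro borel_measurable_scaleR borel_measurable_indicator snd_meas)

lemma lint_meas: "A \<in> sets \<mu> \<Longrightarrow> (\<lambda>\<omega>. LINT u:A|N \<omega>. snd u) \<in> borel_measurable M"
  unfolding set_lebesgue_integral_def
  by (rule integral_random_measure_measurable_vec[OF N_sets N_meas rect_meas_vec])

text \<open>Adaptedness is given for the masses of sets up to time \<open>t\<close>. Restricting the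
  random measure to \<open>A\<close> leaves only sets of this kind.\<close>

lemma lint_adapted:
  assumes t: "0 \<le> t" and A: "A \<in> sets \<mu>" "A \<subseteq> {..t} \<times> UNIV"
  shows "(\<lambda>\<omega>. LINT u:A|N \<omega>. snd u) \<in> borel_measurable (F t)"
proof -
  have A_in: "A \<inter> space (N \<omega>) \<in> sets (N \<omega>)" if "\<omega> \<in> space M" for \<omega> using A N_sets[OF that] by simp
  have eq: "(LINT u:A|N \<omega>. snd u) = (\<integral>u. snd u \<partial>restrict_space (N \<omega>) A)" if "\<omega> \<in> space (F t)" for \<omega>
    using A_in[of \<omega>] that space_F[OF t] unfolding set_lebesgue_integral_def by (subst integral_restrict_space) auto
  have "(\<lambda>\<omega>. \<integral>u. snd u \<partial>restrict_space (N \<omega>) A) \<in> borel_measurable (F t)"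
  proof (rule integral_random_measure_measurable_vec[where \<mu>="restrict_space \<mu> A"])
    show "sets (restrict_space (N \<omega>) A) = sets (restrict_space \<mu> A)" if "\<omega> \<in> space (F t)" for \<omega>
      using that space_F[OF t] by (intro sets_restrict_space_cong N_sets) simp
    show "snd \<in> borel_measurable (restrict_space \<mu> A)" by (rule measurable_restrict_space1[OF snd_meas])
    fix A' assume "A' \<in> sets (restrict_space \<mu> A)"
    then have A': "A' \<subseteq> A" "A' \<in> sets \<mu>" using A by (auto simp: sets_restrict_space_iff)
    have eqN: "emeasure (restrict_space (N \<omega>) A) A' = emeasure (N \<omega>) A'" if "\<omega> \<in> space (F t)" for \<omega>
      using A'(1) A_in[of \<omega>] that space_F[OF t] by (intro emeasure_restrict_space) auto
    show "(\<lambda>\<omega>. emeasure (restrict_space (N \<omega>) A) A') \<in> borel_measurable (F t)"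
      using A' A(2) by (subst measurable_cong[OF eqN]) (auto intro!: N_adapt[OF t])
  qed
  then show ?thesis by (subst measurable_cong[OF eq])
qed

lemma AE_rect_finite:
  assumes "0 \<le> t" "Z \<in> sets \<nu>" "emeasure \<nu> Z < \<infinity>"
  shows "AE \<omega> in M. emeasure (N \<omega>) ({0<..t} \<times> Z) < \<infinity>"
proof -
  let ?A = "{0<..t} \<times> Z"
  have A: "?A \<in> sets \<mu>" using rect_sets assms by simp
  have fin: "emeasure \<mu> ?A < \<infinity>" using assms by (subst rect_emeasure) (auto simp: ennreal_mult_less_top)
  have "(\<integral>\<^sup>+\<omega>. emeasure (N \<omega>) ?A \<partial>M) = ennreal (measure \<mu> ?A)"
    by (rule poisson_moments(1)[OF N_meas[OF A] measure_nonneg N_law[OF A fin]])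
  then have "AE \<omega> in M. emeasure (N \<omega>) ?A \<noteq> \<infinity>" by (intro nn_integral_PInf_AE N_meas A) simp
  then show ?thesis by (rule AE_mp) (auto simp: less_top)
qed

definition comp :: "(real ^ 'd) set \<Rightarrow> real \<Rightarrow> 'w \<Rightarrow> real ^ 'd" where
  "comp Z t \<omega> = (LINT u:{0<..t} \<times> Z|N \<omega>. snd u) - (LINT u:{0<..t} \<times> Z|\<mu>. snd u)"

lemma comp_meas: "Z \<in> sets \<nu> \<Longrightarrow> comp Z t \<in> borel_measurable M"
  unfolding comp_def by (intro borel_measurable_diff lint_meas borel_measurable_const rect_sets) auto

text \<open>Formulated for an arbitrary measure \<open>K\<close>, because it is applied to
  \<open>N \<omega>\<close> and to the intensity alike. Finite mass and bounded jumps supply the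
  integrability behind additivity.\<close>

lemma lint_split:
  assumes K: "sets K = sets \<mu>" and Z: "Z \<in> sets \<nu>" and fin: "emeasure K ({0<..t} \<times> Z) < \<infinity>"
    and R: "\<And>z. z \<in> Z \<Longrightarrow> norm z \<le> R" and st: "0 \<le> s" "s \<le> t"
  shows "((LINT u:{0<..t} \<times> Z|K. snd u) - (LINT u:{0<..s} \<times> Z|K. snd u)) $ i = (LINT u:{s<..t} \<times> Z|K. snd u $ i)"
proof -
  have sets: "{0<..t} \<times> Z \<in> sets K" "{0<..s} \<times> Z \<in> sets K" "{s<..t} \<times> Z \<in> sets K"
    using rect_sets Z st K by auto
  have sK: "snd \<in> borel_measurable K" using snd_meas measurable_cong_sets[OF K refl] by blast
  have si: "set_integrable K A snd" if A: "A \<in> sets K" "A \<subseteq> {0<..t} \<times> Z" for A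
    unfolding set_integrable_def
  proof (rule integrableI_bounded_set[where A=A and B=R])
    show "emeasure K A < \<infinity>" using emeasure_mono[OF A(2) sets(1)] fin by auto
    show "AE x in K. x \<in> A \<longrightarrow> norm (indicator A x *\<^sub>R snd x) \<le> R" using A(2) R by (intro AE_I2) auto
  qed (use A sK in auto)
  have i1: "set_integrable K ({0<..s} \<times> Z) snd" "set_integrable K ({s<..t} \<times> Z) snd"
    using sets st by (auto intro!: si)
  have "{0<..t} \<times> Z = ({0<..s} \<times> Z) \<union> ({s<..t} \<times> Z)" using st by auto
  then have "(LINT u:{0<..t} \<times> Z|K. snd u) = (LINT u:{0<..s} \<times> Z|K. snd u) + (LINT u:{s<..t} \<times> Z|K. snd u)"
    using i1 by (simp only:) (rule set_integral_Un, auto)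
  moreover have "(LINT u:{s<..t} \<times> Z|K. snd u) $ i = (LINT u:{s<..t} \<times> Z|K. snd u $ i)"
    using integral_bounded_linear[OF bounded_linear_vec_nth i1(2)[unfolded set_integrable_def], of i]
    unfolding set_lebesgue_integral_def by simp
  ultimately show ?thesis by simp
qed

lemma comp_centred:
  assumes Z: "Z \<in> sets \<nu>" "emeasure \<nu> Z < \<infinity>" and R: "\<And>z. z \<in> Z \<Longrightarrow> norm z \<le> R" and R1: "1 \<le> R" and st: "0 \<le> s" "s < t"
  shows "centred_incr M (F s) (2 * ((t - s) * (R\<^sup>2 * \<kappa>))) (\<lambda>\<omega>. (comp Z t \<omega> - comp Z s \<omega>) $ i)"
proof -
  interpret sub_prob M "F s" by (rule sub_F) fact
  have fin: "emeasure \<mu> ({0<..t} \<times> Z) < \<infinity>" using assms by (subst rect_emeasure) (auto simp: ennreal_mult_less_top)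
  show ?thesis
  proof (rule centred_incr_cong[OF jump_centred[OF assms]])
    have [measurable]: "comp Z t \<in> borel_measurable M" "comp Z s \<in> borel_measurable M" using comp_meas Z by auto
    show "(\<lambda>\<omega>. (comp Z t \<omega> - comp Z s \<omega>) $ i) \<in> borel_measurable M" by measurable
    \<comment> \<open>Increments of the integral from 0 are integrals over \<open>{s<..t}\<close>
      where the mass up to \<open>t\<close> is finite, that is, almost surely.\<close>
    show "AE \<omega> in M. (LINT u:{s<..t} \<times> Z|N \<omega>. snd u $ i) - (LINT u:{s<..t} \<times> Z|\<mu>. snd u $ i) = (comp Z t \<omega> - comp Z s \<omega>) $ i"
    proof (rule AE_mp[OF AE_rect_finite[of t Z]], use st Z in simp_all, rule AE_I2, rule impI)
      fix \<omega> assume w: "\<omega> \<in> space M" and f: "emeasure (N \<omega>) ({0<..t} \<times> Z) < \<top>"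
      have "((LINT u:{0<..t} \<times> Z|N \<omega>. snd u) - (LINT u:{0<..s} \<times> Z|N \<omega>. snd u)) $ i = (LINT u:{s<..t} \<times> Z|N \<omega>. snd u $ i)"
        using st f by (intro lint_split[OF N_sets[OF w] Z(1) _ R]) auto
      moreover have "((LINT u:{0<..t} \<times> Z|\<mu>. snd u) - (LINT u:{0<..s} \<times> Z|\<mu>. snd u)) $ i = (LINT u:{s<..t} \<times> Z|\<mu>. snd u $ i)"
        using st fin by (intro lint_split[OF refl Z(1) _ R]) auto
      ultimately show "(LINT u:{s<..t} \<times> Z|N \<omega>. snd u $ i) - (LINT u:{s<..t} \<times> Z|\<mu>. snd u $ i) = comp Z t \<omega> $ i - comp Z s \<omega> $ i"
        by (simp add: comp_def)
    qed
  qed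
qed

lemma annulus:
  assumes "0 < c"
  shows "{z. c < norm z \<and> norm z \<le> R} \<in> sets \<nu>" "{z. c < norm z} \<in> sets \<nu>"
    "emeasure \<nu> {z. c < norm z} < \<infinity>" "emeasure \<nu> {z. c < norm z \<and> norm z \<le> R} < \<infinity>"
proof -
  have "{z :: real^'d. c < norm z \<and> norm z \<le> R} \<in> sets borel" "{z :: real^'d. c < norm z} \<in> sets borel" by measurable
  then show m: "{z. c < norm z \<and> norm z \<le> R} \<in> sets \<nu>" "{z. c < norm z} \<in> sets \<nu>" using assms by (auto simp: \<nu>_sets)
  define k where "k = min (c\<^sup>2) 1"
  have k: "0 < k" using assms by (simp add: k_def)
  have "ennreal k * emeasure \<nu> {z. c < norm z} = (\<integral>\<^sup>+z. ennreal k * indicator {z. c < norm z} z \<partial>\<nu>)"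
    using m by (simp add: nn_integral_cmult_indicator)
  also have "\<dots> \<le> (\<integral>\<^sup>+ z. ennreal (min ((norm z)\<^sup>2) 1) \<partial>\<nu>)"
  proof (rule nn_integral_mono)
    fix z :: "real^'d"
    have "k \<le> min ((norm z)\<^sup>2) 1" if "c < norm z"
    proof -
      have "c\<^sup>2 \<le> (norm z)\<^sup>2" using assms that by (intro power_mono) auto
      then show ?thesis unfolding k_def by (auto simp: min_def)
    qed
    then show "ennreal k * indicator {z. c < norm z} z \<le> ennreal (min ((norm z)\<^sup>2) 1)"
      by (auto simp: indicator_def intro!: ennreal_leI)
  qed
  finally have "ennreal k * emeasure \<nu> {z. c < norm z} < \<infinity>" by (simp add: \<kappa> le_less_trans)
  then show f: "emeasure \<nu> {z. c < norm z} < \<infinity>" using k by (auto simp: ennreal_mult_less_top)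
  have "emeasure \<nu> {z. c < norm z \<and> norm z \<le> R} \<le> emeasure \<nu> {z. c < norm z}" by (rule emeasure_mono) (use m in auto)
  then show "emeasure \<nu> {z. c < norm z \<and> norm z \<le> R} < \<infinity>" using f by (rule le_less_trans)
qed

text \<open>The compensated integrals over \<open>\<delta> < norm z \<le> 1\<close> satisfy a
  variance bound by \<open>\<kappa>\<close> that is uniform in \<open>\<delta>\<close>; it survives
  the mean-square limit up to the factor 2 of \<open>centred_incr_limit\<close>.\<close>

lemma small_jumps_centred:
  assumes J: "small_jumps M N \<nu> J" and st: "0 \<le> s" "s < t"
  shows "centred_incr M (F s) (2 * (2 * ((t - s) * \<kappa>))) (\<lambda>\<omega>. (J t \<omega> - J s \<omega>) $ i)"
proof -
  interpret sub_prob M "F s" by (rule sub_F) fact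
  have Jm: "J r \<in> borel_measurable M" if "0 \<le> r" for r using J that by (simp add: small_jumps_def)
  have [measurable]: "J s \<in> borel_measurable M" "J t \<in> borel_measurable M" using Jm st by auto
  define Zd where "Zd \<delta> = {z :: real^'d. \<delta> < norm z \<and> norm z \<le> 1}" for \<delta>
  have lim: "((\<lambda>\<delta>. \<integral>\<^sup>+ \<omega>. ennreal ((norm (J r \<omega> - comp (Zd \<delta>) r \<omega>))\<^sup>2) \<partial>M) \<longlongrightarrow> 0) (at_right 0)" if "0 \<le> r" for r
    using J that unfolding small_jumps_def comp_def Zd_def by blast
  show ?thesis
  proof (rule centred_incr_limit)
    show "(\<lambda>\<omega>. (J t \<omega> - J s \<omega>) $ i) \<in> borel_measurable M" by measurable
    fix e :: real assume e: "0 < e"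
    \<comment> \<open>A quarter of the tolerance at each of the two times: the square of a
      difference doubles each error, and \<open>2 * (e / 4) + 2 * (e / 4) = e\<close>.\<close>
    have "\<forall>\<^sub>F \<delta> in at_right 0. (\<integral>\<^sup>+ \<omega>. ennreal ((norm (J s \<omega> - comp (Zd \<delta>) s \<omega>))\<^sup>2) \<partial>M) < ennreal (e / 4)"
      "\<forall>\<^sub>F \<delta> in at_right 0. (\<integral>\<^sup>+ \<omega>. ennreal ((norm (J t \<omega> - comp (Zd \<delta>) t \<omega>))\<^sup>2) \<partial>M) < ennreal (e / 4)"
      "\<forall>\<^sub>F \<delta> in at_right (0::real). 0 < \<delta>"
      using lim[of s] lim[of t] st e by (auto intro: order_tendstoD(2) simp: eventually_at_right_less)
    then have "\<forall>\<^sub>F \<delta> in at_right 0. (\<integral>\<^sup>+ \<omega>. ennreal ((norm (J s \<omega> - comp (Zd \<delta>) s \<omega>))\<^sup>2) \<partial>M) < ennreal (e / 4) \<and>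
      (\<integral>\<^sup>+ \<omega>. ennreal ((norm (J t \<omega> - comp (Zd \<delta>) t \<omega>))\<^sup>2) \<partial>M) < ennreal (e / 4) \<and> 0 < \<delta>"
      by (intro eventually_conj)
    then obtain \<delta> where \<delta>: "(\<integral>\<^sup>+ \<omega>. ennreal ((norm (J s \<omega> - comp (Zd \<delta>) s \<omega>))\<^sup>2) \<partial>M) < ennreal (e / 4)"
      "(\<integral>\<^sup>+ \<omega>. ennreal ((norm (J t \<omega> - comp (Zd \<delta>) t \<omega>))\<^sup>2) \<partial>M) < ennreal (e / 4)" "0 < \<delta>"
      using eventually_happens'[OF trivial_limit_at_right_real] by blast
    have Z: "Zd \<delta> \<in> sets \<nu>" "emeasure \<nu> (Zd \<delta>) < \<infinity>" unfolding Zd_def using annulus[OF \<delta>(3)] by auto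
    have [measurable]: "comp (Zd \<delta>) s \<in> borel_measurable M" "comp (Zd \<delta>) t \<in> borel_measurable M" using comp_meas[OF Z(1)] by auto
    let ?Y = "\<lambda>\<omega>. (comp (Zd \<delta>) t \<omega> - comp (Zd \<delta>) s \<omega>) $ i"
    have c: "centred_incr M (F s) (2 * ((t - s) * (1\<^sup>2 * \<kappa>))) ?Y"
      by (rule comp_centred[OF Z _ _ st]) (auto simp: Zd_def)
    have nn: "(\<integral>\<^sup>+\<omega>. ennreal (((J t \<omega> - J s \<omega>) $ i - ?Y \<omega>)\<^sup>2) \<partial>M) \<le> ennreal e"
    proof -
      have "(\<integral>\<^sup>+\<omega>. ennreal (((J t \<omega> - J s \<omega>) $ i - ?Y \<omega>)\<^sup>2) \<partial>M) \<le>
        (\<integral>\<^sup>+\<omega>. 2 * ennreal ((norm (J t \<omega> - comp (Zd \<delta>) t \<omega>))\<^sup>2) + 2 * ennreal ((norm (J s \<omega> - comp (Zd \<delta>) s \<omega>))\<^sup>2) \<partial>M)"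
      proof (rule nn_integral_mono)
        fix \<omega>
        let ?a = "J t \<omega> - comp (Zd \<delta>) t \<omega>" and ?b = "J s \<omega> - comp (Zd \<delta>) s \<omega>"
        have "((J t \<omega> - J s \<omega>) $ i - ?Y \<omega>)\<^sup>2 = ((?a - ?b) $ i)\<^sup>2" by (simp add: algebra_simps)
        also have "\<dots> \<le> (norm (?a - ?b))\<^sup>2"
          using power_mono[OF component_le_norm_cart[of "?a - ?b" i] abs_ge_zero, of 2] by (simp only: power2_abs)
        also have "\<dots> \<le> (norm ?a + norm ?b)\<^sup>2" by (intro power_mono norm_triangle_ineq4) simp
        also have "\<dots> \<le> 2 * (norm ?a)\<^sup>2 + 2 * (norm ?b)\<^sup>2" by (rule sq_sum_le)
        finally have "ennreal (((J t \<omega> - J s \<omega>) $ i - ?Y \<omega>)\<^sup>2) \<le> ennreal (2 * (norm ?a)\<^sup>2 + 2 * (norm ?b)\<^sup>2)" by (rule ennreal_leI)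
        also have "\<dots> = 2 * ennreal ((norm ?a)\<^sup>2) + 2 * ennreal ((norm ?b)\<^sup>2)" by (simp add: ennreal_mult)
        finally show "ennreal (((J t \<omega> - J s \<omega>) $ i - ?Y \<omega>)\<^sup>2) \<le> 2 * ennreal ((norm ?a)\<^sup>2) + 2 * ennreal ((norm ?b)\<^sup>2)" .
      qed
      also have "\<dots> = 2 * (\<integral>\<^sup>+\<omega>. ennreal ((norm (J t \<omega> - comp (Zd \<delta>) t \<omega>))\<^sup>2) \<partial>M) + 2 * (\<integral>\<^sup>+\<omega>. ennreal ((norm (J s \<omega> - comp (Zd \<delta>) s \<omega>))\<^sup>2) \<partial>M)"
        by (subst nn_integral_add) (simp_all add: nn_integral_cmult)
      also have "\<dots> \<le> 2 * ennreal (e / 4) + 2 * ennreal (e / 4)" using \<delta> by (intro add_mono mult_left_mono) auto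
      also have "\<dots> = ennreal (2 * (e / 4) + 2 * (e / 4))" using e by (simp add: ennreal_mult[symmetric] ennreal_plus[symmetric] ennreal_numeral[symmetric] del: ennreal_plus ennreal_numeral)
      finally show ?thesis by simp
    qed
    show "\<exists>Z. centred_incr M (F s) (2 * ((t - s) * \<kappa>)) Z \<and> integrable M (\<lambda>\<omega>. ((J t \<omega> - J s \<omega>) $ i - Z \<omega>)\<^sup>2) \<and>
        (\<integral>\<omega>. ((J t \<omega> - J s \<omega>) $ i - Z \<omega>)\<^sup>2 \<partial>M) \<le> e"
    proof (intro exI[of _ ?Y] conjI)
      show "centred_incr M (F s) (2 * ((t - s) * \<kappa>)) ?Y" using c by simp
      show "integrable M (\<lambda>\<omega>. ((J t \<omega> - J s \<omega>) $ i - ?Y \<omega>)\<^sup>2)"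
        by (rule integrableI_nonneg) (use nn in \<open>auto intro: le_less_trans\<close>)
      show "(\<integral>\<omega>. ((J t \<omega> - J s \<omega>) $ i - ?Y \<omega>)\<^sup>2 \<partial>M) \<le> e" by (rule integral_real_bounded[OF _ nn]) (use e in simp)
    qed
  qed
qed

end

section \<open>Drift and centred part of the truncated process\<close>

text \<open>Continuity of the measure from above, for sets of finite mass that decrease to the empty
  set.\<close>

lemma (in jump_noise) large_jump_tail:
  assumes \<delta>: "0 < \<delta>"
  shows "\<exists>R\<ge>1. measure \<nu> {z. R < norm z} \<le> \<delta>"
proof -
  define S where "S k = {z :: real^'d. real k + 1 < norm z}" for k :: nat
  have S: "S k \<in> sets \<nu>" "emeasure \<nu> (S k) < \<infinity>" for k unfolding S_def using annulus[of "real k + 1"] by auto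
  have "(\<lambda>k. emeasure \<nu> (S k)) \<longlonglongrightarrow> emeasure \<nu> (\<Inter>k. S k)"
  proof (rule Lim_emeasure_decseq)
    show "range S \<subseteq> sets \<nu>" using S by auto
    show "decseq S" by (auto simp: decseq_def S_def)
    show "emeasure \<nu> (S k) \<noteq> \<infinity>" for k using S(2)[of k] by simp
  qed
  moreover have "(\<Inter>k. S k) = {}"
  proof -
    have "\<exists>k. \<not> real k + 1 < norm z" for z :: "real^'d"
    proof -
      obtain k where "norm z < real k" using reals_Archimedean2 by blast
      then show ?thesis by (intro exI[of _ k]) auto
    qed
    then show ?thesis by (auto simp: S_def)
  qed
  ultimately have "(\<lambda>k. emeasure \<nu> (S k)) \<longlonglongrightarrow> 0" by simp
  then have "\<forall>\<^sub>F k in sequentially. emeasure \<nu> (S k) < ennreal \<delta>" using \<delta> by (intro order_tendstoD) auto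
  then obtain k where "emeasure \<nu> (S k) < ennreal \<delta>" using eventually_happens'[OF sequentially_bot] by blast
  then have "measure \<nu> (S k) \<le> \<delta>" using \<delta> unfolding measure_def by (intro enn2real_leI) auto
  then show ?thesis unfolding S_def by (intro exI[of _ "real k + 1"]) auto
qed

text \<open>Jumps with \<open>1 < norm z \<le> R\<close> are compensated, and their compensator
  joins the linear drift in \<open>A\<close>. The number of jumps beyond \<open>R\<close> in
  \<open>(0,1]\<close> is Poisson with mean at most \<open>\<delta>\<close>, so there are none with
  probability at least \<open>exp (- \<delta>) \<ge> 1 - \<delta>\<close>.\<close>

theorem levy_truncation:
  fixes a :: "real ^ 'd" and \<sigma> :: "real ^ 'r ^ 'd" and L :: "real \<Rightarrow> 'w \<Rightarrow> real ^ 'd"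
  assumes fs: "filtered_space M F" and noise: "levy_process M F a \<sigma> B N \<nu> L" and \<delta>: "0 < \<delta>"
  shows "\<exists>A c C W G. 0 \<le> c \<and> 0 \<le> C \<and> G \<in> sets M \<and> 1 - \<delta> \<le> measure M G \<and>
     (\<forall>s t. 0 \<le> s \<longrightarrow> s \<le> t \<longrightarrow> norm (A t - A s) \<le> c * (t - s)) \<and>
     (\<forall>\<omega>\<in>G. \<forall>t\<in>{0..1}. L t \<omega> = A t + W t \<omega>) \<and> (\<forall>t\<ge>0. W t \<in> borel_measurable (F t)) \<and>
     (\<forall>s t i. 0 \<le> s \<and> s < t \<longrightarrow> centred_incr M (F s) (C * (t - s)) (\<lambda>\<omega>. (W t \<omega> - W s \<omega> :: real ^ 'd) $ i))"
proof -
  note nz = noise[unfolded levy_process_def]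
  have bm: "brownian_motion M F B" and L_meas: "\<And>t. 0 \<le> t \<Longrightarrow> L t \<in> borel_measurable (F t)"
    and lm: "levy_measure \<nu>" and prm: "poisson_random_measure M F N (jump_intensity \<nu>)"
    using nz by auto
  obtain J where J: "small_jumps M N \<nu> J" and Leq: "AE \<omega> in M. \<forall>t\<ge>0. L t \<omega> = t *\<^sub>R a + \<sigma> *v B t \<omega> + J t \<omega> +
           (LINT u : {0<..t} \<times> {z. norm z > 1} | N \<omega>. snd u)" using nz by auto
  interpret jump_noise M F N \<nu> using fs lm prm by unfold_locales
  obtain R where R1: "1 \<le> R" and R\<delta>: "measure \<nu> {z. R < norm z} \<le> \<delta>" using large_jump_tail[OF \<delta>] by auto
  define Z where "Z = {z :: real^'d. 1 < norm z \<and> norm z \<le> R}"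
  define U where "U = {z :: real^'d. 1 < norm z}"
  have Z: "Z \<in> sets \<nu>" "emeasure \<nu> Z < \<infinity>" "\<And>z. z \<in> Z \<Longrightarrow> norm z \<le> R" and U: "U \<in> sets \<nu>"
    unfolding Z_def U_def using annulus(1)[of 1 R] annulus(2)[of 1] annulus(4)[of 1 R] by auto
  define A where "A t = t *\<^sub>R a + (LINT u:{0<..t} \<times> Z|\<mu>. snd u)" for t
  \<comment> \<open>\<open>W\<close> is obtained by correcting \<open>L\<close> instead of adding up
    its parts: \<open>small_jumps\<close> makes \<open>J\<close> measurable for \<open>M\<close>
    only, whereas \<open>L\<close> is adapted. The representation by \<open>B\<close>,
    \<open>J\<close> and \<open>comp Z\<close> holds almost surely and serves for the
    moments.\<close>
  define W where "W t \<omega> = L t \<omega> - A t - (LINT u:{0<..t} \<times> U|N \<omega>. snd u) + (LINT u:{0<..t} \<times> Z|N \<omega>. snd u)" for t \<omega>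
  define T where "T = {0<..1::real} \<times> {z :: real^'d. R < norm z}"
  have T: "T \<in> sets \<mu>" unfolding T_def using annulus(2)[of R] R1 by (intro rect_sets) auto
  \<comment> \<open>No jump beyond \<open>R\<close> up to time 1; on this event the integrals over
    \<open>U\<close> and over \<open>Z\<close> coincide.\<close>
  define G where "G = {\<omega> \<in> space M. emeasure (N \<omega>) T = 0}"
  have G: "G \<in> sets M" unfolding G_def using N_meas[OF T] by measurable
  have Tm: "emeasure \<mu> T = emeasure \<nu> {z. R < norm z}"
    unfolding T_def using annulus(2)[of R] R1 by (subst rect_emeasure) auto
  have Tfin: "emeasure \<mu> T < \<infinity>" unfolding Tm using annulus(3)[of R] R1 by auto
  have PG: "1 - \<delta> \<le> measure M G"
  proof -
    have "measure M G = exp (- measure \<mu> T)" using N_law[OF T Tfin, of 0] unfolding G_def by simp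
    moreover have "measure \<mu> T \<le> \<delta>" using R\<delta> Tm by (simp add: measure_def)
    ultimately show ?thesis using exp_ge_add_one_self[of "- measure \<mu> T"] by simp
  qed
  define c where "c = norm a + real CARD('d) * (R * measure \<nu> Z)"
  have A_lip: "norm (A t - A s) \<le> c * (t - s)" if st: "0 \<le> s" "s \<le> t" for s t
  proof -
    let ?D = "(LINT u:{0<..t} \<times> Z|\<mu>. snd u) - (LINT u:{0<..s} \<times> Z|\<mu>. snd u)"
    have fin: "emeasure \<mu> ({s<..t} \<times> Z) < \<infinity>" "emeasure \<mu> ({0<..t} \<times> Z) < \<infinity>"
      using st Z(1,2) by (auto simp: rect_emeasure ennreal_mult_less_top)
    have sets: "{s<..t} \<times> Z \<in> sets \<mu>" using rect_sets st Z by simp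
    have m: "measure \<mu> ({s<..t} \<times> Z) = (t - s) * measure \<nu> Z"
      unfolding measure_def using st Z by (subst rect_emeasure) (auto simp: enn2real_mult)
    have comp: "\<bar>?D $ i\<bar> \<le> R * measure \<nu> Z * (t - s)" for i
    proof -
      have "?D $ i = (\<integral>u. indicator ({s<..t} \<times> Z) u * (snd u $ i) \<partial>\<mu>)"
        using lint_split[OF refl Z(1) fin(2) Z(3) st] unfolding set_lebesgue_integral_def by simp
      also have "\<bar>\<dots>\<bar> \<le> (\<integral>u. \<bar>indicator ({s<..t} \<times> Z) u * (snd u $ i)\<bar> \<partial>\<mu>)" by (rule integral_abs_bound)
      also have "\<dots> \<le> (\<integral>u. R * indicator ({s<..t} \<times> Z) u \<partial>\<mu>)"
      proof (rule integral_mono')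
        show "integrable \<mu> (\<lambda>u. R * indicator ({s<..t} \<times> Z) u)" using sets fin by (intro integrable_mult_right integrable_real_indicator)
        fix u :: "real \<times> (real ^ 'd)"
        have "\<bar>snd u $ i\<bar> \<le> R" if "snd u \<in> Z" using component_le_norm_cart[of "snd u" i] Z(3)[OF that] by linarith
        then show "\<bar>indicator ({s<..t} \<times> Z) u * (snd u $ i)\<bar> \<le> R * indicator ({s<..t} \<times> Z) u"
          by (cases u) (auto simp: indicator_def)
        show "0 \<le> R * indicator ({s<..t} \<times> Z) u" using R1 by simp
      qed
      also have "\<dots> = R * measure \<nu> Z * (t - s)" using sets fin m by simp
      finally show ?thesis .
    qed
    have "norm ?D \<le> (\<Sum>i\<in>UNIV. \<bar>?D $ i\<bar>)" by (rule norm_le_l1_cart)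
    also have "\<dots> \<le> (\<Sum>i\<in>(UNIV::'d set). R * measure \<nu> Z * (t - s))" by (rule sum_mono) (rule comp)
    finally have D: "norm ?D \<le> real CARD('d) * (R * measure \<nu> Z) * (t - s)" by simp
    have "A t - A s = (t - s) *\<^sub>R a + ?D" by (simp add: A_def algebra_simps)
    then have "norm (A t - A s) \<le> (t - s) * norm a + norm ?D" using norm_triangle_ineq[of "(t - s) *\<^sub>R a" ?D] st by simp
    then show ?thesis using D by (simp add: c_def algebra_simps)
  qed
  have W_ad: "W t \<in> borel_measurable (F t)" if t: "0 \<le> t" for t
    unfolding W_def
  proof (intro borel_measurable_add borel_measurable_diff L_meas borel_measurable_const lint_adapted t rect_sets U Z order_refl)
    show "{0<..t} \<times> U \<subseteq> {..t} \<times> UNIV" "{0<..t} \<times> Z \<subseteq> {..t} \<times> UNIV" by auto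
  qed
  have LG: "L t \<omega> = A t + W t \<omega>" if w: "\<omega> \<in> G" and t: "t \<in> {0..1}" for \<omega> t
  proof -
    have wM: "\<omega> \<in> space M" and NT: "T \<in> null_sets (N \<omega>)" using w T N_sets[of \<omega>] by (auto simp: G_def null_sets_def)
    have "{0<..t} \<times> U \<in> sets \<mu>" "{0<..t} \<times> Z \<in> sets \<mu>" using rect_sets U Z by auto
    note m = rect_meas_vec[OF this(1)] rect_meas_vec[OF this(2)]
    have eqm: "borel_measurable (N \<omega>) = (borel_measurable \<mu> :: (real \<times> (real^'d) \<Rightarrow> real^'d) set)"
      by (rule measurable_cong_sets[OF N_sets[OF wM] refl])
    have "(LINT u:{0<..t} \<times> U|N \<omega>. snd u) = (LINT u:{0<..t} \<times> Z|N \<omega>. snd u)"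
      unfolding set_lebesgue_integral_def
    proof (rule integral_cong_AE)
      show "AE u in N \<omega>. indicator ({0<..t} \<times> U) u *\<^sub>R snd u = indicator ({0<..t} \<times> Z) u *\<^sub>R snd u"
        using AE_not_in[OF NT] by (rule AE_mp) (use t in \<open>auto simp: T_def U_def Z_def indicator_def intro!: AE_I2\<close>)
    qed (simp_all only: eqm m)
    then show ?thesis by (simp add: W_def)
  qed
  \<comment> \<open>The nested factors 2 come from two uses of \<open>centred_incr_add\<close> and
    from the moment bounds of the jumps, the power of two from the sum over the Brownian
    coordinates. Summing over \<open>i\<close> in \<open>C\<close> gives one constant for all
    coordinates.\<close>
  define V where "V i = 2 * (2 * (2 ^ CARD('r) * (\<Sum>j\<in>UNIV. (\<sigma> $ i $ j)\<^sup>2)) + 2 * (2 * (2 * \<kappa>))) + 2 * (2 * (R\<^sup>2 * \<kappa>))" for i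
  have V0: "0 \<le> V i" for i unfolding V_def using \<kappa>(2) by (intro add_nonneg_nonneg mult_nonneg_nonneg sum_nonneg) auto
  define C where "C = (\<Sum>i\<in>UNIV. V i)"
  have VC: "V i \<le> C" for i unfolding C_def by (rule member_le_sum) (auto simp: V0)
  have cent: "centred_incr M (F s) (C * (t - s)) (\<lambda>\<omega>. (W t \<omega> - W s \<omega>) $ i)" if st: "0 \<le> s \<and> s < t" for s t i
  proof -
    have st: "0 \<le> s" "s < t" using st by auto
    interpret sub_prob M "F s" by (rule sub_F) fact
    have "centred_incr M (F s) ((\<sigma> $ i $ j)\<^sup>2 * (t - s)) (\<lambda>\<omega>. \<sigma> $ i $ j * (B t \<omega> - B s \<omega>) $ j)" for j
      by (rule centred_incr_scale[OF brownian_centred[OF fs bm st]])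
    then have b: "centred_incr M (F s) (2 ^ CARD('r) * (\<Sum>j\<in>UNIV. (\<sigma> $ i $ j)\<^sup>2 * (t - s))) (\<lambda>\<omega>. \<Sum>j\<in>UNIV. \<sigma> $ i $ j * (B t \<omega> - B s \<omega>) $ j)"
      by (intro centred_incr_sum) (use st in auto)
    have j: "centred_incr M (F s) (2 * (2 * ((t - s) * \<kappa>))) (\<lambda>\<omega>. (J t \<omega> - J s \<omega>) $ i)" by (rule small_jumps_centred[OF J st])
    have k: "centred_incr M (F s) (2 * ((t - s) * (R\<^sup>2 * \<kappa>))) (\<lambda>\<omega>. (comp Z t \<omega> - comp Z s \<omega>) $ i)"
      by (rule comp_centred[OF Z R1 st])
    note main = centred_incr_add[OF centred_incr_add[OF b j] k]
    have veq: "2 * (2 * (2 ^ CARD('r) * (\<Sum>j\<in>UNIV. (\<sigma> $ i $ j)\<^sup>2 * (t - s))) + 2 * (2 * (2 * ((t - s) * \<kappa>)))) + 2 * (2 * ((t - s) * (R\<^sup>2 * \<kappa>))) = V i * (t - s)"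
      unfolding V_def sum_distrib_right[symmetric] by (simp add: algebra_simps)
    have "centred_incr M (F s) (V i * (t - s)) (\<lambda>\<omega>. (W t \<omega> - W s \<omega>) $ i)"
    proof (rule centred_incr_cong[OF main[unfolded veq]])
      have [measurable]: "W t \<in> borel_measurable M" "W s \<in> borel_measurable M"
        using measurable_from_subalg W_ad st fs unfolding filtered_space_def by (meson less_imp_le order_trans)+
      show "(\<lambda>\<omega>. (W t \<omega> - W s \<omega>) $ i) \<in> borel_measurable M" by measurable
      show "AE \<omega> in M. (\<Sum>j\<in>UNIV. \<sigma> $ i $ j * (B t \<omega> - B s \<omega>) $ j) + (J t \<omega> - J s \<omega>) $ i + (comp Z t \<omega> - comp Z s \<omega>) $ i = (W t \<omega> - W s \<omega>) $ i"
        using Leq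
      proof (rule AE_mp, intro AE_I2 impI)
        fix \<omega> assume L: "\<forall>t\<ge>0. L t \<omega> = t *\<^sub>R a + \<sigma> *v B t \<omega> + J t \<omega> + (LINT u : {0<..t} \<times> {z. norm z > 1} | N \<omega>. snd u)"
        have Wr: "W r \<omega> = \<sigma> *v B r \<omega> + J r \<omega> + comp Z r \<omega>" if "0 \<le> r" for r
          using L that by (simp add: W_def A_def comp_def U_def)
        have "W t \<omega> - W s \<omega> = \<sigma> *v (B t \<omega> - B s \<omega>) + (J t \<omega> - J s \<omega>) + (comp Z t \<omega> - comp Z s \<omega>)"
          using Wr[of t] Wr[of s] st by (simp add: matrix_vector_mult_diff_distrib)
        then show "(\<Sum>j\<in>UNIV. \<sigma> $ i $ j * (B t \<omega> - B s \<omega>) $ j) + (J t \<omega> - J s \<omega>) $ i + (comp Z t \<omega> - comp Z s \<omega>) $ i = (W t \<omega> - W s \<omega>) $ i"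
          by (simp add: matrix_vector_mult_def)
      qed
    qed
    then show ?thesis by (rule centred_incr_mono) (use VC st in \<open>auto intro!: mult_right_mono\<close>)
  qed
  have "0 \<le> c" unfolding c_def using R1 by simp
  moreover have "0 \<le> C" unfolding C_def by (rule sum_nonneg) (rule V0)
  ultimately show ?thesis
    using G PG A_lip LG W_ad cent by (intro exI[of _ A] exI[of _ c] exI[of _ C] exI[of _ W] exI[of _ G]) simp
qed

section \<open>Cadlag paths and their oscillation\<close>

lemma cadlag_on_subset:
  assumes "cadlag_on I f" "J \<subseteq> I"
  shows "cadlag_on J f"
  unfolding cadlag_on_def
proof (intro ballI conjI)
  fix t assume "t \<in> J"
  then have "t \<in> I" using assms by auto
  then have r: "(f \<longlongrightarrow> f t) (at t within I \<inter> {t<..})" and l: "\<exists>l. (f \<longlongrightarrow> l) (at t within I \<inter> {..<t})"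
    using assms(1) by (auto simp: cadlag_on_def)
  show "(f \<longlongrightarrow> f t) (at t within J \<inter> {t<..})" by (rule tendsto_within_subset[OF r]) (use assms in auto)
  obtain l' where "(f \<longlongrightarrow> l') (at t within I \<inter> {..<t})" using l by auto
  then have "(f \<longlongrightarrow> l') (at t within J \<inter> {..<t})" by (rule tendsto_within_subset) (use assms in auto)
  then show "\<exists>l. (f \<longlongrightarrow> l) (at t within J \<inter> {..<t})" by auto
qed

lemma cadlag_on_diff:
  fixes f g :: "real \<Rightarrow> 'a::real_normed_vector"
  assumes f: "cadlag_on I f" and g: "continuous_on I g"
  shows "cadlag_on I (\<lambda>t. f t - g t)"
  unfolding cadlag_on_def
proof (intro ballI conjI)
  fix t assume t: "t \<in> I"
  have gt: "(g \<longlongrightarrow> g t) (at t within I)" using g t by (simp add: continuous_on_def)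
  show "((\<lambda>t. f t - g t) \<longlongrightarrow> f t - g t) (at t within I \<inter> {t<..})"
    using f t by (intro tendsto_diff tendsto_within_subset[OF gt]) (auto simp: cadlag_on_def)
  obtain l where "(f \<longlongrightarrow> l) (at t within I \<inter> {..<t})" using f t by (auto simp: cadlag_on_def)
  then have "((\<lambda>t. f t - g t) \<longlongrightarrow> l - g t) (at t within I \<inter> {..<t})"
    by (intro tendsto_diff tendsto_within_subset[OF gt]) auto
  then show "\<exists>l. ((\<lambda>t. f t - g t) \<longlongrightarrow> l) (at t within I \<inter> {..<t})" by auto
qed

text \<open>One-sided limits bound the path near every point, and by compactness finitely many such
  neighbourhoods suffice. The sum of their bounds is a common one.\<close>

lemma cadlag_bounded:
  fixes f :: "real \<Rightarrow> 'a::real_normed_vector"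
  assumes f: "cadlag_on {0..1} f"
  shows "\<exists>B. \<forall>t\<in>{0..1}. norm (f t) \<le> B"
proof -
  have loc: "\<exists>d B. 0 < d \<and> (\<forall>x\<in>{0..1} \<inter> ball t d. norm (f x) \<le> B)" if t: "t \<in> {0..1}" for t
  proof -
    have r: "(f \<longlongrightarrow> f t) (at t within {0..1} \<inter> {t<..})" using f t by (simp add: cadlag_on_def)
    obtain l where l: "(f \<longlongrightarrow> l) (at t within {0..1} \<inter> {..<t})" using f t unfolding cadlag_on_def by blast
    obtain d1 where d1: "0 < d1" "\<And>x. x \<in> {0..1} \<inter> {t<..} \<Longrightarrow> x \<noteq> t \<Longrightarrow> dist x t < d1 \<Longrightarrow> dist (f x) (f t) < 1"
      using tendstoD[OF r, of 1] unfolding eventually_at by auto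
    obtain d2 where d2: "0 < d2" "\<And>x. x \<in> {0..1} \<inter> {..<t} \<Longrightarrow> x \<noteq> t \<Longrightarrow> dist x t < d2 \<Longrightarrow> dist (f x) l < 1"
      using tendstoD[OF l, of 1] unfolding eventually_at by auto
    have "norm (f x) \<le> norm (f t) + norm l + 1" if x: "x \<in> {0..1} \<inter> ball t (min d1 d2)" for x
    proof -
      consider "x = t" | "t < x" | "x < t" by linarith
      then show ?thesis
      proof cases
        case 2
        then have "dist (f x) (f t) < 1" using x by (intro d1) (auto simp: dist_commute)
        then show ?thesis using norm_triangle_sub[of "f x" "f t"] norm_ge_zero[of l] unfolding dist_norm by linarith
      next
        case 3
        then have "dist (f x) l < 1" using x by (intro d2) (auto simp: dist_commute)
        then show ?thesis using norm_triangle_sub[of "f x" l] norm_ge_zero[of "f t"] unfolding dist_norm by linarith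
      qed simp
    qed
    then show ?thesis using d1(1) d2(1) by (intro exI[of _ "min d1 d2"] exI[of _ "norm (f t) + norm l + 1"]) auto
  qed
  then obtain d B where dB: "\<And>t. t \<in> {0..1} \<Longrightarrow> 0 < d t" "\<And>t x. t \<in> {0..1} \<Longrightarrow> x \<in> {0..1} \<inter> ball t (d t) \<Longrightarrow> norm (f x) \<le> B t"
    by metis
  obtain T where T: "T \<subseteq> {0..1}" "finite T" "{0..1::real} \<subseteq> (\<Union>t\<in>T. ball t (d t))"
    by (rule compactE_image[of "{0..1::real}" "{0..1}" "\<lambda>t. ball t (d t)"]) (use dB in auto)
  have "norm (f x) \<le> (\<Sum>t\<in>T. \<bar>B t\<bar>)" if x: "x \<in> {0..1}" for x
  proof -
    obtain t where t: "t \<in> T" "x \<in> ball t (d t)" using T(3) x by auto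
    then have "norm (f x) \<le> B t" using dB(2) T(1) x by blast
    also have "\<dots> \<le> \<bar>B t\<bar>" by simp
    also have "\<dots> \<le> (\<Sum>t\<in>T. \<bar>B t\<bar>)" using t T by (intro member_le_sum) auto
    finally show ?thesis .
  qed
  then show ?thesis by blast
qed

section \<open>Grid approximation of paths\<close>

text \<open>Time is rounded up, so that right continuity gives convergence along refined grids. The
  map takes countably many values, which makes compositions with it measurable.\<close>

definition grid_up :: "nat \<Rightarrow> real \<Rightarrow> real" where
  "grid_up m s = real (nat \<lceil>real m * s\<rceil>) / real m"

lemma grid_up:
  assumes m: "0 < m" and s: "0 \<le> s"
  shows "s \<le> grid_up m s" "grid_up m s \<le> s + 1 / real m" "s \<le> 1 \<Longrightarrow> grid_up m s \<le> 1"
proof -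
  have n: "real (nat \<lceil>real m * s\<rceil>) = of_int \<lceil>real m * s\<rceil>" using m s by simp
  show "s \<le> grid_up m s" unfolding grid_up_def n using m le_of_int_ceiling[of "real m * s"] by (simp add: field_simps)
  show "grid_up m s \<le> s + 1 / real m" unfolding grid_up_def n using m of_int_ceiling_le_add_one[of "real m * s"] by (simp add: field_simps)
  show "grid_up m s \<le> 1" if "s \<le> 1"
  proof -
    have "\<lceil>real m * s\<rceil> \<le> int m" using m s that mult_left_mono[of s 1 "real m"] by (intro ceiling_le) simp
    then have "real_of_int \<lceil>real m * s\<rceil> \<le> real m" by (metis of_int_le_iff of_int_of_nat_eq)
    then show ?thesis unfolding grid_up_def n using m by simp
  qed
qed

lemma grid_up_tendsto: "0 \<le> s \<Longrightarrow> (\<lambda>m. grid_up (Suc m) s) \<longlonglongrightarrow> s"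
proof (rule tendsto_sandwich)
  assume s: "0 \<le> s"
  show "\<forall>\<^sub>F m in sequentially. s \<le> grid_up (Suc m) s" "\<forall>\<^sub>F m in sequentially. grid_up (Suc m) s \<le> s + inverse (real (Suc m))"
    using grid_up[OF zero_less_Suc s] by (auto simp: inverse_eq_divide)
  show "(\<lambda>m. s + inverse (real (Suc m))) \<longlonglongrightarrow> s" using tendsto_add[OF tendsto_const LIMSEQ_inverse_real_of_nat] by simp
qed simp

lemma cadlag_grid_limit:
  fixes f :: "real \<Rightarrow> 'a::metric_space"
  assumes f: "cadlag_on {0..1} f" and s: "s \<in> {0..1}"
  shows "(\<lambda>m. f (grid_up (Suc m) s)) \<longlonglongrightarrow> f s"
proof (rule metric_LIMSEQ_I)
  fix e :: real assume e: "0 < e"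
  have r: "(f \<longlongrightarrow> f s) (at s within {0..1} \<inter> {s<..})" using f s by (simp add: cadlag_on_def)
  obtain d where d: "0 < d" "\<And>x. x \<in> {0..1} \<inter> {s<..} \<Longrightarrow> x \<noteq> s \<Longrightarrow> dist x s < d \<Longrightarrow> dist (f x) (f s) < e"
    using tendstoD[OF r e] unfolding eventually_at by auto
  obtain N where N: "\<And>m. N \<le> m \<Longrightarrow> dist (grid_up (Suc m) s) s < d"
    using metric_LIMSEQ_D[OF grid_up_tendsto d(1), of s] s by auto
  have "dist (f (grid_up (Suc m) s)) (f s) < e" if "N \<le> m" for m
  proof (cases "grid_up (Suc m) s = s")
    case False
    then have "grid_up (Suc m) s \<in> {0..1} \<inter> {s<..}" using grid_up[of "Suc m" s] s by auto
    then show ?thesis using d(2) False N[OF that] by blast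
  qed (use e in simp)
  then show "\<exists>N. \<forall>m\<ge>N. dist (f (grid_up (Suc m) s)) (f s) < e" by blast
qed

lemma cadlag_measurable:
  fixes f :: "real \<Rightarrow> 'a::euclidean_space"
  assumes f: "cadlag_on {0..1} f"
  shows "(\<lambda>s. indicator {0..1} s *\<^sub>R f s) \<in> borel_measurable borel"
proof (rule borel_measurable_LIMSEQ_metric)
  show "(\<lambda>s. indicator {0..1} s *\<^sub>R f (grid_up (Suc m) s)) \<in> borel_measurable borel" for m
  proof -
    have "(\<lambda>s. (\<lambda>k s. f (real k / real (Suc m))) (nat \<lceil>real (Suc m) * s\<rceil>) s) \<in> borel_measurable borel"
      by (rule measurable_compose_countable) measurable
    then have [measurable]: "(\<lambda>s. f (grid_up (Suc m) s)) \<in> borel_measurable borel" by (simp add: grid_up_def)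
    show ?thesis by measurable
  qed
  show "(\<lambda>m. indicator {0..1} s *\<^sub>R f (grid_up (Suc m) s)) \<longlonglongrightarrow> indicator {0..1} s *\<^sub>R f s" for s
    using cadlag_grid_limit[OF f, of s] by (auto simp: indicator_def)
qed

text \<open>Connects the Henstock-Kurzweil integral, in which the equation is written, with the
  nonnegative Lebesgue integral, for which Fatou and Tonelli are available.\<close>

lemma cadlag_norm_integral:
  fixes f :: "real \<Rightarrow> 'a::euclidean_space"
  assumes f: "cadlag_on {0..1} f" and ab: "{a..b} \<subseteq> {0..1}"
  shows "(\<lambda>s. norm (f s - w)) integrable_on {a..b}"
    "ennreal (integral {a..b} (\<lambda>s. norm (f s - w))) = (\<integral>\<^sup>+s. indicator {a..b} s * ennreal (norm (f s - w)) \<partial>lborel)"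
proof -
  let ?g = "\<lambda>s. indicator {a..b} s * norm (f s - w)"
  obtain B where B: "\<And>t. t \<in> {0..1} \<Longrightarrow> norm (f t) \<le> B" using cadlag_bounded[OF f] by blast
  have [measurable]: "(\<lambda>s. indicator {0..1} s *\<^sub>R f s) \<in> borel_measurable borel" by (rule cadlag_measurable[OF f])
  have "?g = (\<lambda>s. indicator {a..b} s * norm (indicator {0..1} s *\<^sub>R f s - w))" using ab by (auto simp: indicator_def fun_eq_iff)
  then have gm [measurable]: "?g \<in> borel_measurable borel" by simp
  have gi: "integrable lborel ?g"
  proof (rule integrableI_bounded_set[where A="{a..b}" and B="B + norm w"])
    have "norm (f s - w) \<le> B + norm w" if "s \<in> {a..b}" for s
      using norm_triangle_ineq4[of "f s" w] B[of s] that ab by auto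
    then show "AE x in lborel. x \<in> {a..b} \<longrightarrow> norm (indicator {a..b} x * norm (f x - w)) \<le> B + norm w" by (intro AE_I2) auto
    show "emeasure lborel {a..b} < \<infinity>" by (cases "a \<le> b") auto
  qed (auto simp: gm)
  have hi: "(?g has_integral (\<integral>s. ?g s \<partial>lborel)) UNIV" by (rule has_integral_integral_lborel[OF gi])
  have "((\<lambda>s. norm (f s - w)) has_integral (\<integral>s. ?g s \<partial>lborel)) {a..b}"
    by (subst has_integral_restrict_UNIV[symmetric]) (rule has_integral_eq[OF _ hi], simp add: indicator_def)
  then show "(\<lambda>s. norm (f s - w)) integrable_on {a..b}" "ennreal (integral {a..b} (\<lambda>s. norm (f s - w))) = (\<integral>\<^sup>+s. indicator {a..b} s * ennreal (norm (f s - w)) \<partial>lborel)"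
  proof -
    assume h: "((\<lambda>s. norm (f s - w)) has_integral (\<integral>s. ?g s \<partial>lborel)) {a..b}"
    show "(\<lambda>s. norm (f s - w)) integrable_on {a..b}" using h by blast
    have "ennreal (integral {a..b} (\<lambda>s. norm (f s - w))) = ennreal (\<integral>s. ?g s \<partial>lborel)" using integral_unique[OF h] by simp
    also have "\<dots> = (\<integral>\<^sup>+s. ennreal (?g s) \<partial>lborel)" by (rule nn_integral_eq_integral[symmetric, OF gi]) simp
    also have "\<dots> = (\<integral>\<^sup>+s. indicator {a..b} s * ennreal (norm (f s - w)) \<partial>lborel)"
      by (intro nn_integral_cong) (simp add: indicator_def)
    finally show "ennreal (integral {a..b} (\<lambda>s. norm (f s - w))) = (\<integral>\<^sup>+s. indicator {a..b} s * ennreal (norm (f s - w)) \<partial>lborel)" .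
  qed
qed

section \<open>Square-integrable centred noise\<close>

locale noise_process =
  fixes M :: "'w measure" and F and W :: "real \<Rightarrow> 'w \<Rightarrow> real ^ 'd" and C :: real
  assumes filt: "filtered_space M F" and C0: "0 \<le> C"
    and W_ad: "0 \<le> t \<Longrightarrow> W t \<in> borel_measurable (F t)"
    and cent: "0 \<le> s \<Longrightarrow> s < t \<Longrightarrow> centred_incr M (F s) (C * (t - s)) (\<lambda>\<omega>. (W t \<omega> - W s \<omega>) $ i)"
begin

sublocale prob_space M using filt by (simp add: filtered_space_def)

lemma sub_F: "0 \<le> t \<Longrightarrow> sub_prob M (F t)"
  using filt by (auto simp: filtered_space_def sub_prob_def sub_prob_axioms_def)

lemma W_M [measurable]: "0 \<le> t \<Longrightarrow> W t \<in> borel_measurable M"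
  using sub_prob.sub_M[OF sub_F W_ad] by blast

text \<open>The variance constant \<open>C\<close> is per coordinate; the squared norm collects one
  for each.\<close>

definition D where "D = real CARD('d) * C"

lemma D0: "0 \<le> D" using C0 by (simp add: D_def)

lemma norm_sq: "(norm x)\<^sup>2 = (\<Sum>i\<in>UNIV. (x $ i)\<^sup>2)" for x :: "real ^ 'd"
  by (simp add: norm_vec_def L2_set_def sum_nonneg)

lemma norm_incr:
  assumes st: "0 \<le> s" "s < t" and xi: "\<xi> \<in> borel_measurable (F s)" and c: "\<forall>\<omega>\<in>space M. 0 \<le> \<xi> \<omega> \<and> \<xi> \<omega> \<le> c"
  shows "integrable M (\<lambda>\<omega>. \<xi> \<omega> * (norm (W t \<omega> - W s \<omega>))\<^sup>2)"
    "(\<integral>\<omega>. \<xi> \<omega> * (norm (W t \<omega> - W s \<omega>))\<^sup>2 \<partial>M) \<le> D * (t - s) * (\<integral>\<omega>. \<xi> \<omega> \<partial>M)"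
proof -
  interpret S: sub_prob M "F s" by (rule sub_F) fact
  have b: "\<forall>\<omega>\<in>space M. \<bar>\<xi> \<omega>\<bar> \<le> c" using c by auto
  have ci: "centred_incr M (F s) (C * (t - s)) (\<lambda>\<omega>. (W t \<omega> - W s \<omega>) $ i)" for i by (rule cent[OF st])
  have 1: "integrable M (\<lambda>\<omega>. \<xi> \<omega> * ((W t \<omega> - W s \<omega>) $ i)\<^sup>2)" for i
    using ci[of i] by (intro S.int_xi_sq(1)[OF S.sub_M[OF xi] b]) (simp_all only: centred_incr_def)
  have 2: "(\<integral>\<omega>. \<xi> \<omega> * ((W t \<omega> - W s \<omega>) $ i)\<^sup>2 \<partial>M) \<le> C * (t - s) * (\<integral>\<omega>. \<xi> \<omega> \<partial>M)" for i
    using ci[of i] xi c unfolding centred_incr_def by blast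
  show "integrable M (\<lambda>\<omega>. \<xi> \<omega> * (norm (W t \<omega> - W s \<omega>))\<^sup>2)"
    unfolding norm_sq sum_distrib_left by (rule Bochner_Integration.integrable_sum) (rule 1)
  have "(\<integral>\<omega>. \<xi> \<omega> * (norm (W t \<omega> - W s \<omega>))\<^sup>2 \<partial>M) = (\<Sum>i\<in>UNIV. \<integral>\<omega>. \<xi> \<omega> * ((W t \<omega> - W s \<omega>) $ i)\<^sup>2 \<partial>M)"
    unfolding norm_sq sum_distrib_left by (rule Bochner_Integration.integral_sum) (rule 1)
  also have "\<dots> \<le> (\<Sum>i\<in>(UNIV::'d set). C * (t - s) * (\<integral>\<omega>. \<xi> \<omega> \<partial>M))" by (rule sum_mono) (rule 2)
  finally show "(\<integral>\<omega>. \<xi> \<omega> * (norm (W t \<omega> - W s \<omega>))\<^sup>2 \<partial>M) \<le> D * (t - s) * (\<integral>\<omega>. \<xi> \<omega> \<partial>M)" by (simp add: D_def)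
qed

text \<open>The tests in \<open>centred_incr\<close> are nonnegative, so a signed weight is written
  as \<open>(\<xi> + c) - c\<close>.\<close>

lemma mean_incr:
  assumes st: "0 \<le> s" "s < t" and xi: "\<xi> \<in> borel_measurable (F s)" and c: "\<And>\<omega>. \<omega> \<in> space M \<Longrightarrow> \<bar>\<xi> \<omega>\<bar> \<le> c"
  shows "(\<integral>\<omega>. \<xi> \<omega> * ((W t \<omega> - W s \<omega>) $ i) \<partial>M) = 0"
proof -
  interpret S: sub_prob M "F s" by (rule sub_F) fact
  have ci: "centred_incr M (F s) (C * (t - s)) (\<lambda>\<omega>. (W t \<omega> - W s \<omega>) $ i)" by (rule cent[OF st])
  let ?Y = "\<lambda>\<omega>. (W t \<omega> - W s \<omega>) $ i"
  have Y: "?Y \<in> borel_measurable M" "integrable M (\<lambda>\<omega>. (?Y \<omega>)\<^sup>2)" using ci unfolding centred_incr_def by blast+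
  have z: "(\<integral>\<omega>. \<zeta> \<omega> * ?Y \<omega> \<partial>M) = 0" if "\<zeta> \<in> borel_measurable (F s)" "\<forall>\<omega>\<in>space M. 0 \<le> \<zeta> \<omega> \<and> \<zeta> \<omega> \<le> k" for \<zeta> k
    using ci that unfolding centred_incr_def by blast
  have xc: "(\<lambda>\<omega>. \<xi> \<omega> + c) \<in> borel_measurable (F s)" using xi by measurable
  have b: "0 \<le> \<xi> \<omega> + c \<and> \<xi> \<omega> + c \<le> 2 * c" "\<bar>\<xi> \<omega> + c\<bar> \<le> 2 * c" "0 \<le> c" if "\<omega> \<in> space M" for \<omega> using c[OF that] by auto
  have i: "integrable M (\<lambda>\<omega>. (\<xi> \<omega> + c) * ?Y \<omega>)" "integrable M (\<lambda>\<omega>. c * ?Y \<omega>)"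
  proof -
    show "integrable M (\<lambda>\<omega>. (\<xi> \<omega> + c) * ?Y \<omega>)"
      by (rule S.int_xi_sq(2)[OF S.sub_M[OF xc] _ Y, of "2 * c"]) (use b in blast)
    show "integrable M (\<lambda>\<omega>. c * ?Y \<omega>)"
      by (rule integrable_mult_right, rule S.int_xi_sq(4)[OF S.sub_M[OF xc] _ Y, of "2 * c"]) (use b in blast)
  qed
  have "(\<integral>\<omega>. \<xi> \<omega> * ?Y \<omega> \<partial>M) = (\<integral>\<omega>. (\<xi> \<omega> + c) * ?Y \<omega> - c * ?Y \<omega> \<partial>M)" by (simp add: algebra_simps)
  also have "\<dots> = (\<integral>\<omega>. (\<xi> \<omega> + c) * ?Y \<omega> \<partial>M) - (\<integral>\<omega>. c * ?Y \<omega> \<partial>M)" by (rule Bochner_Integration.integral_diff[OF i])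
  also have "\<dots> = 0" using z[OF xc, of "2*c"] z[of "\<lambda>_. c" c] b by simp
  finally show ?thesis .
qed

text \<open>The order \<open>sqrt h\<close> comes from
  \<open>norm x \<le> sqrt h + (norm x)\<^sup>2 / sqrt h\<close>, used in place of the
  Cauchy-Schwarz inequality.\<close>

lemma incr_L1:
  assumes st: "0 \<le> s" "s \<le> t" "t - s \<le> h" "0 < h"
  shows "(\<integral>\<^sup>+\<omega>. ennreal (norm (W t \<omega> - W s \<omega>)) \<partial>M) \<le> ennreal ((1 + D) * sqrt h)"
proof (cases "s = t")
  case True
  then show ?thesis using D0 st by simp
next
  case False
  then have st': "0 \<le> s" "s < t" using st by auto
  note N = norm_incr[OF st' borel_measurable_const, of 1 1, simplified]
  have sh: "0 < sqrt h" using st by simp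
  have le: "norm x \<le> sqrt h + (norm x)\<^sup>2 / sqrt h" for x :: "real ^ 'd"
  proof -
    have "sqrt h + (norm x)\<^sup>2 / sqrt h - 2 * norm x = (sqrt h - norm x)\<^sup>2 / sqrt h"
      using sh by (simp add: power2_eq_square field_simps)
    also have "\<dots> \<ge> 0" using sh by simp
    finally have "2 * norm x \<le> sqrt h + (norm x)\<^sup>2 / sqrt h" by simp
    then show ?thesis using norm_ge_zero[of x] by linarith
  qed
  have "(\<integral>\<^sup>+\<omega>. ennreal (norm (W t \<omega> - W s \<omega>)) \<partial>M) \<le> (\<integral>\<^sup>+\<omega>. ennreal (sqrt h + (norm (W t \<omega> - W s \<omega>))\<^sup>2 / sqrt h) \<partial>M)"
    using le by (intro nn_integral_mono ennreal_leI)
  also have "\<dots> = ennreal (\<integral>\<omega>. sqrt h + (norm (W t \<omega> - W s \<omega>))\<^sup>2 / sqrt h \<partial>M)"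
    using N(1) sh by (intro nn_integral_eq_integral) auto
  also have "\<dots> \<le> ennreal ((1 + D) * sqrt h)"
  proof (rule ennreal_leI)
    have "(\<integral>\<omega>. sqrt h + (norm (W t \<omega> - W s \<omega>))\<^sup>2 / sqrt h \<partial>M) = sqrt h + (\<integral>\<omega>. (norm (W t \<omega> - W s \<omega>))\<^sup>2 \<partial>M) / sqrt h"
      using N(1) by (simp add: prob_space)
    also have "\<dots> \<le> sqrt h + D * h / sqrt h"
      using N(2) mult_left_mono[OF st(3) D0] sh by (intro add_left_mono divide_right_mono) (auto simp: prob_space)
    also have "\<dots> = (1 + D) * sqrt h" using st(4) by (simp add: real_div_sqrt distrib_right flip: times_divide_eq_right)
    finally show "(\<integral>\<omega>. sqrt h + (norm (W t \<omega> - W s \<omega>))\<^sup>2 / sqrt h \<partial>M) \<le> (1 + D) * sqrt h" .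
  qed
  finally show ?thesis .
qed

text \<open>By Fatou's lemma along the grid approximations of the time variable; this avoids a jointly
  measurable version of \<open>W\<close>.\<close>

lemma oscillation_bound:
  assumes n: "0 < n"
  shows "\<exists>\<Delta>. \<Delta> \<in> borel_measurable M \<and> (\<integral>\<^sup>+\<omega>. \<Delta> \<omega> \<partial>M) \<le> ennreal ((1 + D) * sqrt (2 / real n)) \<and>
    (\<forall>\<omega>\<in>space M. cadlag_on {0..1} (\<lambda>t. W t \<omega>) \<longrightarrow>
      (\<Sum>k<n. \<integral>\<^sup>+s. indicator {real k / real n..real (Suc k) / real n} s * ennreal (norm (W s \<omega> - W (real k / real n) \<omega>)) \<partial>lborel) \<le> \<Delta> \<omega>)"
proof -
  let ?I = "\<lambda>k. {real k / real n..real (Suc k) / real n}"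
  \<comment> \<open>The grids are finer than \<open>1 / n\<close>, so rounding up moves
    \<open>s\<close> by at most \<open>1 / n\<close>, and the two times differ by at most
    \<open>2 / n\<close>. This explains the argument of the square root.\<close>
  define g where "g k m \<omega> s = (indicator (?I k) s :: ennreal) * ennreal (norm (W (grid_up (Suc (m + n)) s) \<omega> - W (real k / real n) \<omega>))" for k m \<omega> s
  have gm [measurable]: "(\<lambda>(\<omega>, s). g k m \<omega> s) \<in> borel_measurable (M \<Otimes>\<^sub>M lborel)" for k m
  proof -
    have 1: "(\<lambda>x. (\<lambda>j x. W (real j / real (Suc (m + n))) (fst x)) (nat \<lceil>real (Suc (m + n)) * snd x\<rceil>) x) \<in> borel_measurable (M \<Otimes>\<^sub>M lborel)"
    proof (rule measurable_compose_countable[where f="\<lambda>j x. W (real j / real (Suc (m + n))) (fst x)"])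
      show "(\<lambda>x. W (real j / real (Suc (m + n))) (fst x)) \<in> borel_measurable (M \<Otimes>\<^sub>M lborel)" for j
        by (rule measurable_compose[OF measurable_fst W_M]) simp
    qed measurable
    have 2: "(\<lambda>x. W (real k / real n) (fst x)) \<in> borel_measurable (M \<Otimes>\<^sub>M lborel)"
      by (rule measurable_compose[OF measurable_fst W_M]) simp
    have 3: "(\<lambda>x. indicator (?I k) (snd x) :: ennreal) \<in> borel_measurable (M \<Otimes>\<^sub>M lborel)" by measurable
    have "(\<lambda>x. indicator (?I k) (snd x) * ennreal (norm (W (grid_up (Suc (m + n)) (snd x)) (fst x) - W (real k / real n) (fst x)))) \<in> borel_measurable (M \<Otimes>\<^sub>M lborel)"
      using 1 2 3 unfolding grid_up_def by measurable
    then show ?thesis by (simp add: g_def case_prod_beta')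
  qed
  \<comment> \<open>The lower limit is measurable without any assumption on the path; for cadlag
    paths it equals the true integrand.\<close>
  define \<Delta> where "\<Delta> \<omega> = (\<Sum>k<n. \<integral>\<^sup>+s. liminf (\<lambda>m. g k m \<omega> s) \<partial>lborel)" for \<omega>
  have lm [measurable]: "(\<lambda>(\<omega>, s). liminf (\<lambda>m. g k m \<omega> s)) \<in> borel_measurable (M \<Otimes>\<^sub>M lborel)" for k
    using gm[of k] unfolding case_prod_beta' by measurable
  have term_m [measurable]: "(\<lambda>\<omega>. \<integral>\<^sup>+s. liminf (\<lambda>m. g k m \<omega> s) \<partial>lborel) \<in> borel_measurable M" for k
    by (rule lborel.borel_measurable_nn_integral) (rule lm)
  have \<Delta>_meas: "\<Delta> \<in> borel_measurable M" unfolding \<Delta>_def by measurable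
  interpret P: pair_sigma_finite M lborel ..
  have each: "(\<integral>\<^sup>+\<omega>. \<integral>\<^sup>+s. liminf (\<lambda>m. g k m \<omega> s) \<partial>lborel \<partial>M) \<le> ennreal (1 / real n * ((1 + D) * sqrt (2 / real n)))" if k: "k < n" for k
  proof -
    have "(\<integral>\<^sup>+\<omega>. \<integral>\<^sup>+s. liminf (\<lambda>m. g k m \<omega> s) \<partial>lborel \<partial>M) = (\<integral>\<^sup>+x. liminf (\<lambda>m. g k m (fst x) (snd x)) \<partial>(M \<Otimes>\<^sub>M lborel))"
      using lborel.nn_integral_fst[OF lm[of k]] by (simp add: case_prod_beta')
    also have "\<dots> \<le> liminf (\<lambda>m. \<integral>\<^sup>+x. g k m (fst x) (snd x) \<partial>(M \<Otimes>\<^sub>M lborel))"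
      using gm[of k] by (intro nn_integral_liminf) (simp add: case_prod_beta')
    also have "\<dots> \<le> liminf (\<lambda>m::nat. ennreal (1 / real n * ((1 + D) * sqrt (2 / real n))))"
    proof (rule Liminf_mono, rule always_eventually, rule allI)
      fix m
      have "(\<integral>\<^sup>+x. g k m (fst x) (snd x) \<partial>(M \<Otimes>\<^sub>M lborel)) = (\<integral>\<^sup>+s. \<integral>\<^sup>+\<omega>. g k m \<omega> s \<partial>M \<partial>lborel)"
        using P.nn_integral_snd[OF gm[of k m]] by (simp add: case_prod_beta')
      also have "\<dots> \<le> (\<integral>\<^sup>+s. ennreal ((1 + D) * sqrt (2 / real n)) * indicator (?I k) s \<partial>lborel)"
      proof (rule nn_integral_mono)
        fix s
        show "(\<integral>\<^sup>+\<omega>. g k m \<omega> s \<partial>M) \<le> ennreal ((1 + D) * sqrt (2 / real n)) * indicator (?I k) s"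
        proof (cases "s \<in> ?I k")
          case True
          have k0: "0 \<le> real k / real n" by simp
          then have s0: "0 \<le> s" using True by (meson atLeastAtMost_iff order_trans)
          note gu = grid_up[OF zero_less_Suc s0, of "m + n"]
          have "1 / real (Suc (m + n)) \<le> 1 / real n" using n by (intro divide_left_mono) auto
          then have "grid_up (Suc (m + n)) s \<le> s + 1 / real n" using gu(2) by linarith
          moreover have "s \<le> real k / real n + 1 / real n" using True by (simp add: add_divide_distrib)
          moreover have "1 / real n + 1 / real n = 2 / real n" by simp
          ultimately have d: "grid_up (Suc (m + n)) s - real k / real n \<le> 2 / real n" by linarith
          have "(\<integral>\<^sup>+\<omega>. ennreal (norm (W (grid_up (Suc (m + n)) s) \<omega> - W (real k / real n) \<omega>)) \<partial>M) \<le> ennreal ((1 + D) * sqrt (2 / real n))"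
            by (rule incr_L1) (use True gu d n in auto)
          then show ?thesis using True by (simp add: g_def)
        qed (simp add: g_def)
      qed
      also have "\<dots> = ennreal ((1 + D) * sqrt (2 / real n)) * emeasure lborel (?I k)" by (rule nn_integral_cmult_indicator) simp
      also have "emeasure lborel (?I k) = ennreal (1 / real n)" using n by (simp add: divide_right_mono diff_divide_distrib[symmetric])
      also have "ennreal ((1 + D) * sqrt (2 / real n)) * ennreal (1 / real n) = ennreal (1 / real n * ((1 + D) * sqrt (2 / real n)))"
        using D0 by (simp add: ennreal_mult[symmetric] mult.commute)
      finally show "(\<integral>\<^sup>+x. g k m (fst x) (snd x) \<partial>(M \<Otimes>\<^sub>M lborel)) \<le> ennreal (1 / real n * ((1 + D) * sqrt (2 / real n)))" .
    qed
    also have "\<dots> = ennreal (1 / real n * ((1 + D) * sqrt (2 / real n)))" by (rule Liminf_const) simp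
    finally show ?thesis .
  qed
  have "(\<integral>\<^sup>+\<omega>. \<Delta> \<omega> \<partial>M) = (\<Sum>k<n. \<integral>\<^sup>+\<omega>. \<integral>\<^sup>+s. liminf (\<lambda>m. g k m \<omega> s) \<partial>lborel \<partial>M)"
    unfolding \<Delta>_def by (rule nn_integral_sum) (rule term_m)
  also have "\<dots> \<le> (\<Sum>k<n. ennreal (1 / real n * ((1 + D) * sqrt (2 / real n))))" using each by (intro sum_mono) auto
  also have "\<dots> = ennreal ((1 + D) * sqrt (2 / real n))"
    using n D0 by (subst sum_ennreal) auto
  finally have E: "(\<integral>\<^sup>+\<omega>. \<Delta> \<omega> \<partial>M) \<le> ennreal ((1 + D) * sqrt (2 / real n))" .
  have path: "(\<Sum>k<n. \<integral>\<^sup>+s. indicator (?I k) s * ennreal (norm (W s \<omega> - W (real k / real n) \<omega>)) \<partial>lborel) \<le> \<Delta> \<omega>"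
    if cd: "cadlag_on {0..1} (\<lambda>t. W t \<omega>)" for \<omega>
    unfolding \<Delta>_def
  proof (intro sum_mono nn_integral_mono)
    fix k s assume k: "k \<in> {..<n}"
    show "indicator (?I k) s * ennreal (norm (W s \<omega> - W (real k / real n) \<omega>)) \<le> liminf (\<lambda>m. g k m \<omega> s)"
    proof (cases "s \<in> ?I k")
      case True
      have "0 \<le> real k / real n" "real (Suc k) / real n \<le> 1" using k n by auto
      then have s: "s \<in> {0..1}" using True by (meson atLeastAtMost_iff order_trans)
      have "(\<lambda>m. W (grid_up (Suc m) s) \<omega>) \<longlonglongrightarrow> W s \<omega>" by (rule cadlag_grid_limit[OF cd s])
      then have "(\<lambda>m. W (grid_up (Suc (m + n)) s) \<omega>) \<longlonglongrightarrow> W s \<omega>" by (rule LIMSEQ_ignore_initial_segment)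
      then have "(\<lambda>m. ennreal (norm (W (grid_up (Suc (m + n)) s) \<omega> - W (real k / real n) \<omega>))) \<longlonglongrightarrow> ennreal (norm (W s \<omega> - W (real k / real n) \<omega>))"
        by (intro tendsto_intros)
      then have "(\<lambda>m. g k m \<omega> s) \<longlonglongrightarrow> ennreal (norm (W s \<omega> - W (real k / real n) \<omega>))" using True by (simp add: g_def)
      then have "liminf (\<lambda>m. g k m \<omega> s) = ennreal (norm (W s \<omega> - W (real k / real n) \<omega>))" by (rule lim_imp_Liminf[OF sequentially_bot])
      then show ?thesis using True by simp
    qed simp
  qed
  show ?thesis using \<Delta>_meas E path by blast
qed

end

section \<open>Regularity of the drift\<close>

lemma norm_l1_le: "(\<Sum>i\<in>UNIV. \<bar>x $ i\<bar>) \<le> real CARD('m) * norm (x :: real ^ 'm)"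
proof -
  have "(\<Sum>i\<in>UNIV. \<bar>x $ i\<bar>) \<le> (\<Sum>i\<in>(UNIV::'m set). norm x)" by (intro sum_mono component_le_norm_cart)
  then show ?thesis by simp
qed

text \<open>Coordinates are switched from \<open>x\<close> to \<open>y\<close> one at a time;
  intermediate points stay in the ball, since componentwise they are no farther from
  \<open>x\<close> than \<open>y\<close> is. The numbers \<open>c i\<close> are free: zero yields a
  Lipschitz bound, the partial derivatives at \<open>x\<close> a first-order Taylor bound.\<close>

lemma partials_increment:
  fixes f :: "real ^ 'm \<Rightarrow> real"
  assumes d: "\<And>i z. z \<in> cball x r \<Longrightarrow> ((\<lambda>h. f (z + h *\<^sub>R axis i 1)) has_real_derivative df i z) (at 0)"
    and e: "\<And>i z. z \<in> cball x r \<Longrightarrow> \<bar>df i z - c i\<bar> \<le> e"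
    and y: "y \<in> cball x r"
  shows "\<bar>f y - f x - (\<Sum>i\<in>UNIV. c i * (y $ i - x $ i))\<bar> \<le> e * (\<Sum>i\<in>UNIV. \<bar>y $ i - x $ i\<bar>)"
proof -
  define p where "p S = (\<chi> i. if i \<in> S then y $ i else x $ i)" for S
  have "\<bar>f (p S) - f x - (\<Sum>i\<in>S. c i * (y $ i - x $ i))\<bar> \<le> e * (\<Sum>i\<in>S. \<bar>y $ i - x $ i\<bar>)" if "finite S" for S
    using that
  proof (induction S)
    case empty
    have "p {} = x" by (simp add: p_def vec_eq_iff)
    then show ?case by simp
  next
    case (insert j S)
    let ?T = "y $ j - x $ j"
    have in_ball: "p S + t *\<^sub>R axis j 1 \<in> cball x r" if t: "t \<in> closed_segment 0 ?T" for t
    proof -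
      have "\<bar>t\<bar> \<le> \<bar>?T\<bar>" using t by (auto simp: closed_segment_eq_real_ivl split: if_splits)
      then have "norm (p S + t *\<^sub>R axis j 1 - x) \<le> norm (y - x)"
        using insert.hyps by (intro norm_le_componentwise_cart) (auto simp: p_def axis_def)
      then show ?thesis using y by (simp add: dist_norm norm_minus_commute)
    qed
    define \<psi> where "\<psi> t = f (p S + t *\<^sub>R axis j 1) - c j * t" for t
    have "(\<psi> has_real_derivative (df j (p S + t *\<^sub>R axis j 1) - c j)) (at t within closed_segment 0 ?T)" if t: "t \<in> closed_segment 0 ?T" for t
    proof -
      have "((\<lambda>h. f ((p S + t *\<^sub>R axis j 1) + h *\<^sub>R axis j 1)) has_real_derivative df j (p S + t *\<^sub>R axis j 1)) (at 0)"
        by (rule d[OF in_ball[OF t]])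
      then have "((\<lambda>s. f (p S + s *\<^sub>R axis j 1)) has_real_derivative df j (p S + t *\<^sub>R axis j 1)) (at (t + 0))"
        by (subst DERIV_at_within_shift[where S=UNIV, simplified]) (simp add: algebra_simps)
      then have "((\<lambda>s. f (p S + s *\<^sub>R axis j 1)) has_real_derivative df j (p S + t *\<^sub>R axis j 1)) (at t within closed_segment 0 ?T)"
        by (simp add: has_field_derivative_at_within)
      then show ?thesis unfolding \<psi>_def by (auto intro!: derivative_eq_intros)
    qed
    from field_differentiable_bound[OF convex_closed_segment this, of e ?T 0] e[OF in_ball]
    have "\<bar>\<psi> ?T - \<psi> 0\<bar> \<le> e * \<bar>?T\<bar>" by simp
    moreover have "p S + ?T *\<^sub>R axis j 1 = p (insert j S)"
      using insert.hyps by (auto simp: p_def vec_eq_iff axis_def)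
    ultimately have "\<bar>f (p (insert j S)) - f (p S) - c j * ?T\<bar> \<le> e * \<bar>?T\<bar>" by (simp add: \<psi>_def algebra_simps)
    then show ?case using insert by (simp add: distrib_left)
  qed
  from this[of UNIV] show ?thesis by (simp add: p_def)
qed

text \<open>\<open>\<Gamma> \<beta>\<close> plays the derivative with multi-index
  \<open>\<beta>\<close>. Bounds are asked up to radius \<open>3 * R\<close> because the points
  visited between \<open>x\<close> and \<open>y\<close> fill the ball about \<open>x\<close> of
  radius \<open>norm (y - x) \<le> 2 * R\<close>, which may leave \<open>cball 0 R\<close>. Each
  passage between coordinates and norms costs a factor equal to the dimension, hence its
  square.\<close>

lemma C2_onI:
  fixes \<Gamma> :: "('d \<Rightarrow> nat) \<Rightarrow> real ^ 'd \<Rightarrow> real"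
  assumes d: "\<And>\<beta> i x. sum \<beta> UNIV < 2 \<Longrightarrow> ((\<lambda>h. \<Gamma> \<beta> (x + h *\<^sub>R axis i 1)) has_real_derivative \<Gamma> (\<beta>(i := Suc (\<beta> i))) x) (at 0)"
    and bd: "\<And>\<beta> x. sum \<beta> UNIV \<le> 2 \<Longrightarrow> norm x \<le> 3 * R \<Longrightarrow> \<bar>\<Gamma> \<beta> x\<bar> \<le> K"
  shows "C2_on R ((real CARD('d))\<^sup>2 * K) (\<Gamma> (\<lambda>_. 0)) (\<lambda>x. \<chi> i. \<Gamma> ((\<lambda>_. 0)(i := Suc 0)) x)"
proof (cases "R < 0")
  case True
  then show ?thesis by (auto simp: C2_on_def dest: order_trans[OF norm_ge_zero])
next
  case False
  let ?d = "real CARD('d)" and ?z = "(\<lambda>_. 0) :: 'd \<Rightarrow> nat"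
  have K0: "0 \<le> K" using bd[of ?z 0] False by (auto intro: order_trans[OF abs_ge_zero])
  have d1: "1 \<le> ?d" by simp
  have dd: "K \<le> ?d * K" "?d * K \<le> ?d\<^sup>2 * K" using mult_right_mono[OF d1 K0] mult_left_mono[of K "?d * K" ?d]
    by (auto simp: power2_eq_square)
  have s1: "sum (?z(i := Suc 0)) UNIV = 1" for i by (simp add: sum.delta[of UNIV i "\<lambda>_. Suc 0", simplified] fun_upd_def)
  have s2: "sum ((?z(i := Suc 0))(j := Suc ((?z(i := Suc 0)) j))) UNIV = 2" for i j
  proof -
    have "sum ((?z(i := Suc 0))(j := Suc ((?z(i := Suc 0)) j))) UNIV = (\<Sum>k\<in>UNIV. (?z(i := Suc 0)) k + (if k = j then 1 else 0))"
      by (intro sum.cong) auto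
    then show ?thesis unfolding sum.distrib s1 by simp
  qed
  have ball: "norm z \<le> 3 * R" if "norm x \<le> R" "norm y \<le> R" "z \<in> cball x (norm (y - x))" for x y z :: "real ^ 'd"
  proof -
    have "norm z \<le> norm x + norm (z - x)" using norm_triangle_sub[of z x] by simp
    moreover have "norm (z - x) \<le> norm (y - x)" using that(3) by (simp add: dist_norm norm_minus_commute)
    moreover have "norm (y - x) \<le> 2 * R" using norm_triangle_ineq4[of y x] that by linarith
    ultimately show ?thesis using that by linarith
  qed
  have lip: "\<bar>\<Gamma> (?z(i := Suc 0)) y - \<Gamma> (?z(i := Suc 0)) x\<bar> \<le> ?d * K * norm (y - x)"
    if xy: "norm x \<le> R" "norm y \<le> R" for x y i
  proof -
    have "\<bar>\<Gamma> (?z(i := Suc 0)) y - \<Gamma> (?z(i := Suc 0)) x - (\<Sum>j\<in>UNIV. 0 * (y $ j - x $ j))\<bar> \<le> K * (\<Sum>j\<in>UNIV. \<bar>y $ j - x $ j\<bar>)"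
      by (rule partials_increment[where r="norm (y - x)" and df="\<lambda>j. \<Gamma> ((?z(i := Suc 0))(j := Suc ((?z(i := Suc 0)) j)))"])
        (use s1 s2 ball[OF xy] in \<open>auto intro!: d bd simp: dist_norm norm_minus_commute simp del: fun_upd_apply\<close>)
    also have "\<dots> \<le> K * (?d * norm (y - x))" using norm_l1_le[of "y - x"] K0 by (intro mult_left_mono) auto
    finally show ?thesis by (simp add: ac_simps)
  qed
  have taylor: "\<bar>\<Gamma> ?z y - \<Gamma> ?z x - (\<chi> i. \<Gamma> (?z(i := Suc 0)) x) \<bullet> (y - x)\<bar> \<le> ?d\<^sup>2 * K * (norm (y - x))\<^sup>2"
    if xy: "norm x \<le> R" "norm y \<le> R" for x y
  proof -
    have lip': "\<bar>\<Gamma> (?z(i := Suc 0)) z - \<Gamma> (?z(i := Suc 0)) x\<bar> \<le> ?d * K * norm (y - x)" if z: "z \<in> cball x (norm (y - x))" for z i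
    proof -
      have "\<bar>\<Gamma> (?z(i := Suc 0)) z - \<Gamma> (?z(i := Suc 0)) x - (\<Sum>j\<in>UNIV. 0 * (z $ j - x $ j))\<bar> \<le> K * (\<Sum>j\<in>UNIV. \<bar>z $ j - x $ j\<bar>)"
        by (rule partials_increment[where r="norm (y - x)" and df="\<lambda>j. \<Gamma> ((?z(i := Suc 0))(j := Suc ((?z(i := Suc 0)) j)))"])
          (use s1 s2 ball[OF xy] z in \<open>auto intro!: d bd simp del: fun_upd_apply\<close>)
      also have "\<dots> \<le> K * (?d * norm (z - x))" using norm_l1_le[of "z - x"] K0 by (intro mult_left_mono) auto
      also have "\<dots> \<le> K * (?d * norm (y - x))" using z K0 by (intro mult_left_mono) (auto simp: dist_norm norm_minus_commute)
      finally show ?thesis by (simp add: ac_simps)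
    qed
    have dz: "((\<lambda>h. \<Gamma> ?z (w + h *\<^sub>R axis i 1)) has_real_derivative \<Gamma> (?z(i := Suc 0)) w) (at 0)" for w i
      using d[of ?z w i] by simp
    have "\<bar>\<Gamma> ?z y - \<Gamma> ?z x - (\<Sum>i\<in>UNIV. \<Gamma> (?z(i := Suc 0)) x * (y $ i - x $ i))\<bar> \<le> ?d * K * norm (y - x) * (\<Sum>i\<in>UNIV. \<bar>y $ i - x $ i\<bar>)"
      by (rule partials_increment[where r="norm (y - x)" and df="\<lambda>i. \<Gamma> (?z(i := Suc 0))", OF dz lip'])
        (simp_all add: dist_norm norm_minus_commute)
    also have "\<dots> \<le> ?d * K * norm (y - x) * (?d * norm (y - x))" using norm_l1_le[of "y - x"] K0 by (intro mult_left_mono) auto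
    finally show ?thesis by (simp add: inner_vec_def power2_eq_square ac_simps)
  qed
  show ?thesis
    unfolding C2_on_def
  proof (intro ballI conjI)
    fix x :: "real ^ 'd" assume "x \<in> cball 0 R"
    then have x: "norm x \<le> R" by simp
    then have x3: "norm x \<le> 3 * R" using False by simp
    show "\<bar>\<Gamma> ?z x\<bar> \<le> ?d\<^sup>2 * K" using bd[of ?z x, OF _ x3] dd by simp
    have "norm (\<chi> i. \<Gamma> (?z(i := Suc 0)) x) \<le> (\<Sum>i\<in>UNIV. \<bar>(\<chi> i. \<Gamma> (?z(i := Suc 0)) x) $ i\<bar>)" by (rule norm_le_l1_cart)
    also have "\<dots> \<le> (\<Sum>i\<in>(UNIV::'d set). K)"
    proof (rule sum_mono)
      fix i :: 'd
      show "\<bar>(\<chi> i. \<Gamma> (?z(i := Suc 0)) x) $ i\<bar> \<le> K" using bd[of "?z(i := Suc 0)" x, OF _ x3] s1[of i] by simp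
    qed
    also have "\<dots> \<le> ?d\<^sup>2 * K" using dd by simp
    finally show "norm (\<chi> i. \<Gamma> (?z(i := Suc 0)) x) \<le> ?d\<^sup>2 * K" .
    fix y :: "real ^ 'd" assume "y \<in> cball 0 R"
    then have y: "norm y \<le> R" by simp
    show "\<bar>\<Gamma> ?z y - \<Gamma> ?z x - (\<chi> i. \<Gamma> (?z(i := Suc 0)) x) \<bullet> (y - x)\<bar> \<le> ?d\<^sup>2 * K * (norm (y - x))\<^sup>2" by (rule taylor[OF x y])
    have "norm ((\<chi> i. \<Gamma> (?z(i := Suc 0)) y) - (\<chi> i. \<Gamma> (?z(i := Suc 0)) x)) \<le> (\<Sum>i\<in>UNIV. \<bar>((\<chi> i. \<Gamma> (?z(i := Suc 0)) y) - (\<chi> i. \<Gamma> (?z(i := Suc 0)) x)) $ i\<bar>)"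
      by (rule norm_le_l1_cart)
    also have "\<dots> \<le> (\<Sum>i\<in>(UNIV::'d set). ?d * K * norm (y - x))"
    proof (rule sum_mono)
      fix i :: 'd
      show "\<bar>((\<chi> i. \<Gamma> (?z(i := Suc 0)) y) - (\<chi> i. \<Gamma> (?z(i := Suc 0)) x)) $ i\<bar> \<le> ?d * K * norm (y - x)"
        using lip[OF x y, of i] by simp
    qed
    also have "\<dots> = ?d\<^sup>2 * K * norm (y - x)" by (simp add: power2_eq_square)
    finally show "norm ((\<chi> i. \<Gamma> (?z(i := Suc 0)) y) - (\<chi> i. \<Gamma> (?z(i := Suc 0)) x)) \<le> ?d\<^sup>2 * K * norm (y - x)" .
  qed
qed

section \<open>Expansion of the drift in the parameter\<close>

text \<open>Derivatives in the parameter are given at interior points, while \<open>\<theta>\<close>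
  may be a boundary point. By convexity the open segment from the interior point
  \<open>\<theta>\<^sub>0\<close> stays in the interior, and continuity on \<open>\<Theta>\<close>
  covers the endpoint, so the one-dimensional mean value theorem applies.\<close>

lemma theta_mean_value:
  fixes D :: "('p \<Rightarrow> nat) \<Rightarrow> ('d \<Rightarrow> nat) \<Rightarrow> real ^ 'd \<Rightarrow> real ^ 'p \<Rightarrow> real"
  assumes df: "derivative_family k l \<Theta> f D" and conv: "convex \<Theta>"
    and t0: "\<theta>\<^sub>0 \<in> interior \<Theta>" and t: "\<theta> \<in> \<Theta>" and ord: "sum \<alpha> UNIV < l" "sum \<beta> UNIV \<le> k"
  shows "\<exists>s. 0 < s \<and> s < 1 \<and> \<theta>\<^sub>0 + s *\<^sub>R (\<theta> - \<theta>\<^sub>0) \<in> \<Theta> \<and>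
     D \<alpha> \<beta> x \<theta> - D \<alpha> \<beta> x \<theta>\<^sub>0 = (\<Sum>j\<in>UNIV. D (\<alpha>(j := Suc (\<alpha> j))) \<beta> x (\<theta>\<^sub>0 + s *\<^sub>R (\<theta> - \<theta>\<^sub>0)) * (\<theta> - \<theta>\<^sub>0) $ j)"
proof -
  let ?F = "\<lambda>\<theta>. D \<alpha> \<beta> x \<theta>" and ?F' = "\<lambda>j \<theta>. D (\<alpha>(j := Suc (\<alpha> j))) \<beta> x \<theta>" and ?v = "\<theta> - \<theta>\<^sub>0"
  have ord': "sum (\<alpha>(j := Suc (\<alpha> j))) UNIV \<le> l" for j
  proof -
    have "sum (\<alpha>(j := Suc (\<alpha> j))) UNIV = (\<Sum>k\<in>UNIV. \<alpha> k + (if k = j then 1 else 0))" by (intro sum.cong) auto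
    then show ?thesis using ord by (simp add: sum.distrib)
  qed
  have cont: "continuous_on \<Theta> (\<lambda>\<theta>. D \<alpha>' \<beta> x \<theta>)" if "sum \<alpha>' UNIV \<le> l" for \<alpha>'
  proof -
    have c: "continuous_on (UNIV \<times> \<Theta>) (\<lambda>(x, \<theta>). D \<alpha>' \<beta> x \<theta>)" using df that ord(2) unfolding derivative_family_def by blast
    have "continuous_on \<Theta> ((\<lambda>(x, \<theta>). D \<alpha>' \<beta> x \<theta>) \<circ> (\<lambda>\<theta>. (x, \<theta>)))"
      by (rule continuous_on_compose) (auto intro!: continuous_intros continuous_on_subset[OF c])
    then show ?thesis by (simp add: o_def)
  qed
  have part: "((\<lambda>h. ?F (z + h *\<^sub>R axis j 1)) has_real_derivative ?F' j z) (at 0)" if "z \<in> interior \<Theta>" for z j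
    using df that ord unfolding derivative_family_def by blast
  \<comment> \<open>Partial derivatives alone do not differentiate along a slanted segment; their
    continuity gives the total derivative.\<close>
  have deriv: "(?F has_derivative (\<lambda>h. \<Sum>j\<in>UNIV. ?F' j z * h $ j)) (at z)" if z: "z \<in> interior \<Theta>" for z
    unfolding has_derivative_at_alt
  proof (intro conjI allI impI)
    show "bounded_linear (\<lambda>h. \<Sum>j\<in>UNIV. ?F' j z * h $ j)"
      by (intro bounded_linear_sum bounded_linear_const_mult bounded_linear_vec_nth)
    fix e :: real assume e: "0 < e"
    define e' where "e' = e / real CARD('p)"
    have e': "0 < e'" using e by (simp add: e'_def)
    obtain r0 where r0: "0 < r0" "cball z r0 \<subseteq> interior \<Theta>" using z open_contains_cball[of "interior \<Theta>"] by auto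
    have "\<exists>r>0. \<forall>w. dist w z < r \<longrightarrow> w \<in> \<Theta> \<longrightarrow> \<bar>?F' j w - ?F' j z\<bar> \<le> e'" for j
    proof -
      have "z \<in> \<Theta>" using z interior_subset by blast
      then obtain r where "0 < r" "\<forall>w\<in>\<Theta>. dist w z < r \<longrightarrow> dist (?F' j w) (?F' j z) < e'"
        using cont[OF ord'[of j]] e' unfolding continuous_on_iff by metis
      then show ?thesis by (intro exI[of _ r]) (auto simp: dist_real_def less_imp_le)
    qed
    then obtain r where r: "\<And>j. 0 < r j" "\<And>j w. dist w z < r j \<Longrightarrow> w \<in> \<Theta> \<Longrightarrow> \<bar>?F' j w - ?F' j z\<bar> \<le> e'" by metis
    define m where "m = min r0 (Min (range r))"
    have m0: "0 < m" using r0 r by (simp add: m_def)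
    have mr: "m \<le> r j" "m \<le> r0" for j by (auto simp: m_def intro: min.coboundedI2)
    show "\<exists>d>0. \<forall>y. norm (y - z) < d \<longrightarrow> norm (?F y - ?F z - (\<Sum>j\<in>UNIV. ?F' j z * (y - z) $ j)) \<le> e * norm (y - z)"
    proof (intro exI[of _ m] conjI m0 allI impI)
      fix y assume y: "norm (y - z) < m"
      have sub: "w \<in> interior \<Theta>" "dist w z < r j" if "w \<in> cball z (norm (y - z))" for w j
      proof -
        have "dist w z < m" using that y by (simp add: dist_commute)
        then show "dist w z < r j" "w \<in> interior \<Theta>" using mr(1)[of j] mr(2) r0(2) by (auto simp: dist_commute)
      qed
      have "\<bar>?F y - ?F z - (\<Sum>j\<in>UNIV. ?F' j z * (y $ j - z $ j))\<bar> \<le> e' * (\<Sum>j\<in>UNIV. \<bar>y $ j - z $ j\<bar>)"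
      proof (rule partials_increment[where r="norm (y - z)" and df="?F'"])
        show "\<bar>?F' i w - ?F' i z\<bar> \<le> e'" if "w \<in> cball z (norm (y - z))" for i w
          using r(2)[OF sub(2)[OF that]] sub(1)[OF that] interior_subset by blast
      qed (auto intro!: part sub(1) simp: dist_norm norm_minus_commute)
      also have "\<dots> \<le> e' * (real CARD('p) * norm (y - z))" using norm_l1_le[of "y - z"] e' by (intro mult_left_mono) auto
      also have "\<dots> = e * norm (y - z)" by (simp add: e'_def)
      finally show "norm (?F y - ?F z - (\<Sum>j\<in>UNIV. ?F' j z * (y - z) $ j)) \<le> e * norm (y - z)" by simp
    qed
  qed
  have seg: "\<theta>\<^sub>0 + s *\<^sub>R ?v \<in> \<Theta>" if "0 \<le> s" "s \<le> 1" for s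
  proof -
    have "(1 - s) *\<^sub>R \<theta>\<^sub>0 + s *\<^sub>R \<theta> \<in> \<Theta>" using conv t t0 interior_subset that by (intro convexD) auto
    then show ?thesis by (simp add: algebra_simps)
  qed
  have seg_int: "\<theta>\<^sub>0 + s *\<^sub>R ?v \<in> interior \<Theta>" if "0 < s" "s < 1" for s
  proof (cases "\<theta> = \<theta>\<^sub>0")
    case False
    have "open_segment \<theta>\<^sub>0 \<theta> \<subseteq> interior \<Theta>"
      using in_interior_closure_convex_segment[OF conv t0] t closure_subset by blast
    moreover have "\<theta>\<^sub>0 + s *\<^sub>R ?v \<in> open_segment \<theta>\<^sub>0 \<theta>"
      unfolding in_segment using that False by (auto simp: algebra_simps intro!: exI[of _ s])
    ultimately show ?thesis by blast
  qed (use t0 in simp)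
  have "\<exists>\<xi>>0. \<xi> < 1 \<and> ?F (\<theta>\<^sub>0 + 1 *\<^sub>R ?v) - ?F (\<theta>\<^sub>0 + 0 *\<^sub>R ?v) = (\<Sum>j\<in>UNIV. ?F' j (\<theta>\<^sub>0 + \<xi> *\<^sub>R ?v) * ((1 - 0) *\<^sub>R ?v) $ j)"
  proof (rule mvt[of 0 1 "\<lambda>s. ?F (\<theta>\<^sub>0 + s *\<^sub>R ?v)" "\<lambda>\<xi> h. \<Sum>j\<in>UNIV. ?F' j (\<theta>\<^sub>0 + \<xi> *\<^sub>R ?v) * (h *\<^sub>R ?v) $ j"])
    show "continuous_on {0..1} (\<lambda>s. ?F (\<theta>\<^sub>0 + s *\<^sub>R ?v))"
      using ord(1) seg by (intro continuous_on_compose2[OF cont[of \<alpha>]] continuous_intros) auto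
    fix s :: real assume s: "0 < s" "s < 1"
    have g: "((\<lambda>s. \<theta>\<^sub>0 + s *\<^sub>R ?v) has_derivative (\<lambda>h. h *\<^sub>R ?v)) (at s)" by (auto intro!: derivative_eq_intros)
    show "((\<lambda>s. ?F (\<theta>\<^sub>0 + s *\<^sub>R ?v)) has_derivative (\<lambda>h. \<Sum>j\<in>UNIV. ?F' j (\<theta>\<^sub>0 + s *\<^sub>R ?v) * (h *\<^sub>R ?v) $ j)) (at s)"
      by (rule has_derivative_compose[OF g deriv[OF seg_int[OF s]]])
  qed auto
  then obtain s where "0 < s" "s < 1" "?F \<theta> - ?F \<theta>\<^sub>0 = (\<Sum>j\<in>UNIV. ?F' j (\<theta>\<^sub>0 + s *\<^sub>R ?v) * ?v $ j)" by auto
  then show ?thesis using seg[of s] by (intro exI[of _ s]) auto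
qed

lemma sum_upd_Suc: "sum (\<alpha>(j := Suc (\<alpha> j))) UNIV = Suc (sum \<alpha> (UNIV :: 'a::finite set))"
proof -
  have "sum (\<alpha>(j := Suc (\<alpha> j))) UNIV = (\<Sum>k\<in>UNIV. \<alpha> k + (if k = j then 1 else 0))" by (intro sum.cong) auto
  then show ?thesis by (simp add: sum.distrib)
qed

lemma C2_on_mono:
  fixes g :: "'a::real_inner \<Rightarrow> real"
  assumes "C2_on R k g Dg" "k \<le> k'"
  shows "C2_on R k' g Dg"
  unfolding C2_on_def
proof (intro ballI conjI)
  fix x :: 'a assume x: "x \<in> cball 0 R"
  show "\<bar>g x\<bar> \<le> k'" "norm (Dg x) \<le> k'" using assms x unfolding C2_on_def by force+
  fix y :: 'a assume y: "y \<in> cball 0 R"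
  have "\<bar>g y - g x - Dg x \<bullet> (y - x)\<bar> \<le> k * (norm (y - x))\<^sup>2" "norm (Dg y - Dg x) \<le> k * norm (y - x)"
    using assms(1) x y unfolding C2_on_def by blast+
  moreover have "k * (norm (y - x))\<^sup>2 \<le> k' * (norm (y - x))\<^sup>2" "k * norm (y - x) \<le> k' * norm (y - x)"
    using assms(2) by (auto intro!: mult_right_mono)
  ultimately show "\<bar>g y - g x - Dg x \<bullet> (y - x)\<bar> \<le> k' * (norm (y - x))\<^sup>2" "norm (Dg y - Dg x) \<le> k' * norm (y - x)"
    by linarith+
qed

text \<open>Differences in the parameter commute with derivatives in \<open>x\<close>, so all
  \<open>x\<close>-derivatives up to order two obey the same mean value bounds. One application
  gives a factor \<open>norm (\<theta> - \<theta>\<^sub>0)\<close>, a second one, to the first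
  parameter derivatives, gives its square; \<open>C2_onI\<close> then collects the three
  orders.\<close>

lemma drift_regularity_component:
  fixes f :: "real ^ 'd \<Rightarrow> real ^ 'p \<Rightarrow> real"
  assumes f: "f \<in> C_up 2 3 \<Theta>" and conv: "convex \<Theta>" and t0: "\<theta>\<^sub>0 \<in> interior \<Theta>" and R: "0 \<le> R"
  shows "\<exists>f' K. 0 \<le> K \<and> continuous_on (UNIV \<times> \<Theta>) (\<lambda>(x, \<theta>). f x \<theta>) \<and>
     (\<forall>x j. ((\<lambda>h. f x (\<theta>\<^sub>0 + h *\<^sub>R axis j 1)) has_real_derivative f' j x) (at 0)) \<and>
     (\<forall>j. \<exists>Df. C2_on R K (f' j) Df) \<and>
     (\<forall>\<theta>\<in>\<Theta>. (\<exists>Dg. C2_on R (K * norm (\<theta> - \<theta>\<^sub>0)) (\<lambda>x. f x \<theta> - f x \<theta>\<^sub>0) Dg) \<and>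
        (\<exists>Dh. C2_on R (K * (norm (\<theta> - \<theta>\<^sub>0))\<^sup>2) (\<lambda>x. f x \<theta> - f x \<theta>\<^sub>0 - (\<Sum>j\<in>UNIV. (\<theta> - \<theta>\<^sub>0) $ j * f' j x)) Dh))"
proof -
  obtain D C q where df: "derivative_family 2 3 \<Theta> f D" and C: "0 < C" and q: "0 < q"
    and growth: "\<And>\<alpha> \<beta> x \<theta>. sum \<alpha> UNIV \<le> 3 \<Longrightarrow> sum \<beta> UNIV \<le> 2 \<Longrightarrow> \<theta> \<in> \<Theta> \<Longrightarrow> \<bar>D \<alpha> \<beta> x \<theta>\<bar> \<le> C * (1 + norm x) powr q"
    using f unfolding C_up_def by auto
  let ?z = "(\<lambda>_. 0) :: 'd \<Rightarrow> nat" and ?a = "(\<lambda>_. 0) :: 'p \<Rightarrow> nat"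
  let ?e = "\<lambda>j. ?a(j := Suc (?a j))"
  let ?p = "real CARD('p)" and ?d = "real CARD('d)"
  have t0': "\<theta>\<^sub>0 \<in> \<Theta>" using t0 interior_subset by blast
  \<comment> \<open>The growth condition evaluated at the radius \<open>3 * R\<close> that
    \<open>C2_onI\<close> asks for.\<close>
  define K where "K = C * (1 + 3 * R) powr q"
  have K0: "0 \<le> K" using C by (simp add: K_def)
  have bd: "\<bar>D \<alpha> \<beta> x \<theta>\<bar> \<le> K" if "sum \<alpha> UNIV \<le> 3" "sum \<beta> UNIV \<le> 2" "\<theta> \<in> \<Theta>" "norm x \<le> 3 * R" for \<alpha> \<beta> x \<theta>
  proof -
    have "(1 + norm x) powr q \<le> (1 + 3 * R) powr q" using that q by (intro powr_mono2) auto
    then show ?thesis unfolding K_def by (rule order_trans[OF growth[OF that(1-3)] mult_left_mono[OF _ less_imp_le[OF C]]])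
  qed
  have D0: "D ?a ?z x \<theta> = f x \<theta>" if "\<theta> \<in> \<Theta>" for x \<theta> using df that unfolding derivative_family_def by blast
  have dx: "((\<lambda>h. D \<alpha> \<beta> (x + h *\<^sub>R axis i 1) \<theta>) has_real_derivative D \<alpha> (\<beta>(i := Suc (\<beta> i))) x \<theta>) (at 0)"
    if "sum \<alpha> UNIV \<le> 3" "sum \<beta> UNIV < 2" "\<theta> \<in> \<Theta>" for \<alpha> \<beta> x \<theta> i
    using df that unfolding derivative_family_def by blast
  have dth: "((\<lambda>h. D \<alpha> \<beta> x (\<theta> + h *\<^sub>R axis j 1)) has_real_derivative D (\<alpha>(j := Suc (\<alpha> j))) \<beta> x \<theta>) (at 0)"
    if "sum \<alpha> UNIV < 3" "sum \<beta> UNIV \<le> 2" "\<theta> \<in> interior \<Theta>" for \<alpha> \<beta> \<theta> x j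
    using df that unfolding derivative_family_def by blast
  have cont: "continuous_on (UNIV \<times> \<Theta>) (\<lambda>(x, \<theta>). f x \<theta>)"
  proof -
    have "continuous_on (UNIV \<times> \<Theta>) (\<lambda>(x, \<theta>). D ?a ?z x \<theta>)"
      using df[unfolded derivative_family_def, THEN conjunct2, THEN conjunct1, rule_format, of ?a ?z] by simp
    then show ?thesis by (rule continuous_on_eq) (auto simp: D0)
  qed
  have ord_e: "sum (?e j) UNIV \<le> 3" "sum (?e j) UNIV < 3" for j using sum_upd_Suc[of ?a j] by simp_all
  have ord_ee: "sum ((?e j)(i := Suc ((?e j) i))) UNIV \<le> 3" for i j
    unfolding sum_upd_Suc[of "?e j" i] sum_upd_Suc[of ?a j] by simp
  define f' where "f' j x = D (?e j) ?z x \<theta>\<^sub>0" for j x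
  have der: "((\<lambda>h. f x (\<theta>\<^sub>0 + h *\<^sub>R axis j 1)) has_real_derivative f' j x) (at 0)" for x j
  proof -
    have 1: "((\<lambda>h. D ?a ?z x (\<theta>\<^sub>0 + h *\<^sub>R axis j 1)) has_real_derivative f' j x) (at 0)"
      using dth[of ?a ?z \<theta>\<^sub>0 x j] t0 by (simp add: f'_def)
    \<comment> \<open>The family \<open>D\<close> agrees with \<open>f\<close> on
      \<open>\<Theta>\<close>; as \<open>\<theta>\<^sub>0\<close> is interior, the two agree near it
      and so share the derivative.\<close>
    have "((\<lambda>h. \<theta>\<^sub>0 + h *\<^sub>R axis j 1) \<longlongrightarrow> \<theta>\<^sub>0 + 0 *\<^sub>R axis j 1) (nhds 0)" by (intro tendsto_intros filterlim_ident)
    then have "\<forall>\<^sub>F h in nhds 0. \<theta>\<^sub>0 + h *\<^sub>R axis j 1 \<in> interior \<Theta>"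
      using t0 by (intro topological_tendstoD) auto
    then have ev: "\<forall>\<^sub>F h in nhds 0. D ?a ?z x (\<theta>\<^sub>0 + h *\<^sub>R axis j 1) = f x (\<theta>\<^sub>0 + h *\<^sub>R axis j 1)"
      by eventually_elim (use D0 interior_subset in blast)
    show ?thesis by (rule DERIV_cong_ev[OF refl ev refl, THEN iffD1, OF 1])
  qed
  have T3: "\<exists>Df. C2_on R (?d\<^sup>2 * K) (f' j) Df" for j
  proof -
    have "C2_on R (?d\<^sup>2 * K) ((\<lambda>\<beta> x. D (?e j) \<beta> x \<theta>\<^sub>0) ?z) (\<lambda>x. \<chi> i. (\<lambda>\<beta> x. D (?e j) \<beta> x \<theta>\<^sub>0) (?z(i := Suc 0)) x)"
      by (rule C2_onI) (use ord_e t0' in \<open>auto intro!: dx bd simp del: fun_upd_apply\<close>)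
    then show ?thesis unfolding f'_def by blast
  qed
  have mv1: "\<bar>D \<alpha> \<beta> x \<theta> - D \<alpha> \<beta> x \<theta>\<^sub>0\<bar> \<le> K * ?p * norm (\<theta> - \<theta>\<^sub>0)"
    if hy: "sum \<alpha> UNIV < 3" "sum \<beta> UNIV \<le> 2" "\<theta> \<in> \<Theta>" "norm x \<le> 3 * R" for \<alpha> \<beta> x \<theta>
  proof -
    obtain s where s: "\<theta>\<^sub>0 + s *\<^sub>R (\<theta> - \<theta>\<^sub>0) \<in> \<Theta>"
      "D \<alpha> \<beta> x \<theta> - D \<alpha> \<beta> x \<theta>\<^sub>0 = (\<Sum>j\<in>UNIV. D (\<alpha>(j := Suc (\<alpha> j))) \<beta> x (\<theta>\<^sub>0 + s *\<^sub>R (\<theta> - \<theta>\<^sub>0)) * (\<theta> - \<theta>\<^sub>0) $ j)"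
      using theta_mean_value[OF df conv t0 hy(3) hy(1,2), of x] by blast
    have "\<bar>D \<alpha> \<beta> x \<theta> - D \<alpha> \<beta> x \<theta>\<^sub>0\<bar> \<le> (\<Sum>j\<in>UNIV. K * \<bar>(\<theta> - \<theta>\<^sub>0) $ j\<bar>)"
      unfolding s(2)
    proof (rule order_trans[OF sum_abs], rule sum_mono)
      fix j
      have "sum (\<alpha>(j := Suc (\<alpha> j))) UNIV \<le> 3" using sum_upd_Suc[of \<alpha> j] hy(1) by simp
      from bd[OF this hy(2) s(1) hy(4)]
      show "\<bar>D (\<alpha>(j := Suc (\<alpha> j))) \<beta> x (\<theta>\<^sub>0 + s *\<^sub>R (\<theta> - \<theta>\<^sub>0)) * (\<theta> - \<theta>\<^sub>0) $ j\<bar> \<le> K * \<bar>(\<theta> - \<theta>\<^sub>0) $ j\<bar>"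
        unfolding abs_mult by (rule mult_right_mono) simp
    qed
    also have "\<dots> = K * (\<Sum>j\<in>UNIV. \<bar>(\<theta> - \<theta>\<^sub>0) $ j\<bar>)" by (simp add: sum_distrib_left)
    also have "\<dots> \<le> K * (?p * norm (\<theta> - \<theta>\<^sub>0))" using norm_l1_le K0 by (intro mult_left_mono)
    finally show ?thesis by (simp add: ac_simps)
  qed
  have mv2: "\<bar>D ?a \<beta> x \<theta> - D ?a \<beta> x \<theta>\<^sub>0 - (\<Sum>j\<in>UNIV. (\<theta> - \<theta>\<^sub>0) $ j * D (?e j) \<beta> x \<theta>\<^sub>0)\<bar> \<le> K * ?p\<^sup>2 * (norm (\<theta> - \<theta>\<^sub>0))\<^sup>2"
    if hy: "sum \<beta> UNIV \<le> 2" "\<theta> \<in> \<Theta>" "norm x \<le> 3 * R" for \<beta> x \<theta>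
  proof -
    let ?v = "\<theta> - \<theta>\<^sub>0"
    obtain s where s: "0 < s" "s < 1" "\<theta>\<^sub>0 + s *\<^sub>R ?v \<in> \<Theta>"
      "D ?a \<beta> x \<theta> - D ?a \<beta> x \<theta>\<^sub>0 = (\<Sum>j\<in>UNIV. D (?e j) \<beta> x (\<theta>\<^sub>0 + s *\<^sub>R ?v) * ?v $ j)"
      using theta_mean_value[OF df conv t0 hy(2), of ?a \<beta> x] hy(1) by auto
    have "D ?a \<beta> x \<theta> - D ?a \<beta> x \<theta>\<^sub>0 - (\<Sum>j\<in>UNIV. ?v $ j * D (?e j) \<beta> x \<theta>\<^sub>0) =
      (\<Sum>j\<in>UNIV. (D (?e j) \<beta> x (\<theta>\<^sub>0 + s *\<^sub>R ?v) - D (?e j) \<beta> x \<theta>\<^sub>0) * ?v $ j)"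
      unfolding s(4) sum_subtractf[symmetric] by (intro sum.cong refl) (simp only: left_diff_distrib right_diff_distrib mult.commute)
    also have "\<bar>\<dots>\<bar> \<le> (\<Sum>j\<in>UNIV. K * ?p * norm ?v * \<bar>?v $ j\<bar>)"
    proof (rule order_trans[OF sum_abs], rule sum_mono)
      fix j
      have "\<bar>D (?e j) \<beta> x (\<theta>\<^sub>0 + s *\<^sub>R ?v) - D (?e j) \<beta> x \<theta>\<^sub>0\<bar> \<le> K * ?p * norm (\<theta>\<^sub>0 + s *\<^sub>R ?v - \<theta>\<^sub>0)"
        by (rule mv1[OF ord_e(2) hy(1) s(3) hy(3)])
      also have "\<dots> \<le> K * ?p * norm ?v" using s K0 by (intro mult_left_mono) (auto simp: mult_left_le_one_le)
      finally show "\<bar>(D (?e j) \<beta> x (\<theta>\<^sub>0 + s *\<^sub>R ?v) - D (?e j) \<beta> x \<theta>\<^sub>0) * ?v $ j\<bar> \<le> K * ?p * norm ?v * \<bar>?v $ j\<bar>"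
        unfolding abs_mult by (rule mult_right_mono) simp
    qed
    also have "\<dots> = K * ?p * norm ?v * (\<Sum>j\<in>UNIV. \<bar>?v $ j\<bar>)" by (simp add: sum_distrib_left)
    also have "\<dots> \<le> K * ?p * norm ?v * (?p * norm ?v)" using K0 by (intro mult_left_mono[OF norm_l1_le]) simp
    finally show ?thesis by (simp add: power2_eq_square ac_simps)
  qed
  define K' where "K' = ?d\<^sup>2 * (K * ?p\<^sup>2)"
  have p1: "1 \<le> ?p" by simp
  have pp: "1 \<le> ?p\<^sup>2" "?p \<le> ?p\<^sup>2" using one_le_power[OF p1, of 2] self_le_power[OF p1, of 2] by simp_all
  have KK': "?d\<^sup>2 * K \<le> K'" "?d\<^sup>2 * (K * ?p) \<le> K'"
    unfolding K'_def using pp K0 by (auto intro!: mult_left_mono mult_right_mono simp: mult_le_cancel_left1)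
  have T1: "\<exists>Dg. C2_on R (K' * norm (\<theta> - \<theta>\<^sub>0)) (\<lambda>x. f x \<theta> - f x \<theta>\<^sub>0) Dg" if t: "\<theta> \<in> \<Theta>" for \<theta>
  proof -
    have a3: "sum ?a UNIV \<le> 3" "sum ?a UNIV < 3" by auto
    have "C2_on R (?d\<^sup>2 * (K * ?p * norm (\<theta> - \<theta>\<^sub>0))) ((\<lambda>\<beta> x. D ?a \<beta> x \<theta> - D ?a \<beta> x \<theta>\<^sub>0) ?z) (\<lambda>x. \<chi> i. (\<lambda>\<beta> x. D ?a \<beta> x \<theta> - D ?a \<beta> x \<theta>\<^sub>0) (?z(i := Suc 0)) x)"
    proof (rule C2_onI)
      fix \<beta> :: "'d \<Rightarrow> nat" and i and x :: "real ^ 'd" assume b: "sum \<beta> UNIV < 2"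
      show "((\<lambda>h. D ?a \<beta> (x + h *\<^sub>R axis i 1) \<theta> - D ?a \<beta> (x + h *\<^sub>R axis i 1) \<theta>\<^sub>0) has_real_derivative
         D ?a (\<beta>(i := Suc (\<beta> i))) x \<theta> - D ?a (\<beta>(i := Suc (\<beta> i))) x \<theta>\<^sub>0) (at 0)"
        by (rule DERIV_diff[OF dx[OF a3(1) b t] dx[OF a3(1) b t0']])
    next
      fix \<beta> :: "'d \<Rightarrow> nat" and x :: "real ^ 'd" assume "sum \<beta> UNIV \<le> 2" "norm x \<le> 3 * R"
      then show "\<bar>D ?a \<beta> x \<theta> - D ?a \<beta> x \<theta>\<^sub>0\<bar> \<le> K * ?p * norm (\<theta> - \<theta>\<^sub>0)" by (intro mv1 a3 t)
    qed
    then have "C2_on R (?d\<^sup>2 * (K * ?p * norm (\<theta> - \<theta>\<^sub>0))) (\<lambda>x. f x \<theta> - f x \<theta>\<^sub>0) (\<lambda>x. \<chi> i. (\<lambda>\<beta> x. D ?a \<beta> x \<theta> - D ?a \<beta> x \<theta>\<^sub>0) (?z(i := Suc 0)) x)"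
      by (simp add: D0 t t0')
    moreover have "?d\<^sup>2 * (K * ?p * norm (\<theta> - \<theta>\<^sub>0)) \<le> K' * norm (\<theta> - \<theta>\<^sub>0)"
      using mult_right_mono[OF KK'(2) norm_ge_zero[of "\<theta> - \<theta>\<^sub>0"]] by (simp add: ac_simps)
    ultimately show ?thesis by (intro exI) (rule C2_on_mono)
  qed
  have T2: "\<exists>Dh. C2_on R (K' * (norm (\<theta> - \<theta>\<^sub>0))\<^sup>2) (\<lambda>x. f x \<theta> - f x \<theta>\<^sub>0 - (\<Sum>j\<in>UNIV. (\<theta> - \<theta>\<^sub>0) $ j * f' j x)) Dh" if t: "\<theta> \<in> \<Theta>" for \<theta>
  proof -
    have a3: "sum ?a UNIV \<le> 3" by auto
    let ?G = "\<lambda>\<beta> x. D ?a \<beta> x \<theta> - D ?a \<beta> x \<theta>\<^sub>0 - (\<Sum>j\<in>UNIV. (\<theta> - \<theta>\<^sub>0) $ j * D (?e j) \<beta> x \<theta>\<^sub>0)"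
    have "C2_on R (?d\<^sup>2 * (K * ?p\<^sup>2 * (norm (\<theta> - \<theta>\<^sub>0))\<^sup>2)) (?G ?z) (\<lambda>x. \<chi> i. ?G (?z(i := Suc 0)) x)"
    proof (rule C2_onI)
      fix \<beta> :: "'d \<Rightarrow> nat" and i and x :: "real ^ 'd" assume b: "sum \<beta> UNIV < 2"
      show "((\<lambda>h. ?G \<beta> (x + h *\<^sub>R axis i 1)) has_real_derivative ?G (\<beta>(i := Suc (\<beta> i))) x) (at 0)"
        by (intro DERIV_diff DERIV_sum DERIV_cmult dx a3 b t t0' ord_e(1))
    next
      fix \<beta> :: "'d \<Rightarrow> nat" and x :: "real ^ 'd" assume "sum \<beta> UNIV \<le> 2" "norm x \<le> 3 * R"
      then show "\<bar>?G \<beta> x\<bar> \<le> K * ?p\<^sup>2 * (norm (\<theta> - \<theta>\<^sub>0))\<^sup>2" by (intro mv2 t)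
    qed
    moreover have "?G ?z = (\<lambda>x. f x \<theta> - f x \<theta>\<^sub>0 - (\<Sum>j\<in>UNIV. (\<theta> - \<theta>\<^sub>0) $ j * f' j x))"
      by (rule ext) (simp add: D0 t t0' f'_def)
    ultimately have "C2_on R (?d\<^sup>2 * (K * ?p\<^sup>2 * (norm (\<theta> - \<theta>\<^sub>0))\<^sup>2)) (\<lambda>x. f x \<theta> - f x \<theta>\<^sub>0 - (\<Sum>j\<in>UNIV. (\<theta> - \<theta>\<^sub>0) $ j * f' j x)) (\<lambda>x. \<chi> i. ?G (?z(i := Suc 0)) x)"
      by (simp only:)
    moreover have "?d\<^sup>2 * (K * ?p\<^sup>2 * (norm (\<theta> - \<theta>\<^sub>0))\<^sup>2) \<le> K' * (norm (\<theta> - \<theta>\<^sub>0))\<^sup>2" by (simp add: K'_def mult.assoc)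
    ultimately show ?thesis by (intro exI) (rule C2_on_mono)
  qed
  have T3': "\<exists>Df. C2_on R K' (f' j) Df" for j using T3[of j] C2_on_mono[OF _ KK'(1)] by blast
  have K'0: "0 \<le> K'" unfolding K'_def using K0 by simp
  show ?thesis
  proof (intro exI[of _ f'] exI[of _ K'] conjI allI ballI)
  qed (rule K'0 cont der T3' T1 T2, assumption?)+
qed

theorem drift_regularity:
  fixes b :: "real ^ 'd \<Rightarrow> real ^ 'p \<Rightarrow> real ^ 'd"
  assumes b: "\<And>i. (\<lambda>x \<theta>. b x \<theta> $ i) \<in> C_up 2 3 \<Theta>" and conv: "convex \<Theta>" and t0: "\<theta>\<^sub>0 \<in> interior \<Theta>" and R: "0 \<le> R"
  shows "continuous_on (UNIV \<times> \<Theta>) (\<lambda>(x, \<theta>). b x \<theta>)"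
    "\<exists>K\<ge>0. \<forall>i. (\<forall>j. \<exists>Df. C2_on R K (\<lambda>x. partial_theta b j x \<theta>\<^sub>0 $ i) Df) \<and>
     (\<forall>\<theta>\<in>\<Theta>. (\<exists>Dg. C2_on R (K * norm (\<theta> - \<theta>\<^sub>0)) (\<lambda>x. b x \<theta> $ i - b x \<theta>\<^sub>0 $ i) Dg) \<and>
        (\<exists>Dh. C2_on R (K * (norm (\<theta> - \<theta>\<^sub>0))\<^sup>2) (\<lambda>x. b x \<theta> $ i - b x \<theta>\<^sub>0 $ i - (\<Sum>j\<in>UNIV. (\<theta> - \<theta>\<^sub>0) $ j * partial_theta b j x \<theta>\<^sub>0 $ i)) Dh))"
proof -
  have "\<forall>i. \<exists>f' K. 0 \<le> K \<and> continuous_on (UNIV \<times> \<Theta>) (\<lambda>(x, \<theta>). b x \<theta> $ i) \<and>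
     (\<forall>x j. ((\<lambda>h. b x (\<theta>\<^sub>0 + h *\<^sub>R axis j 1) $ i) has_real_derivative f' j x) (at 0)) \<and>
     (\<forall>j. \<exists>Df. C2_on R K (f' j) Df) \<and>
     (\<forall>\<theta>\<in>\<Theta>. (\<exists>Dg. C2_on R (K * norm (\<theta> - \<theta>\<^sub>0)) (\<lambda>x. b x \<theta> $ i - b x \<theta>\<^sub>0 $ i) Dg) \<and>
        (\<exists>Dh. C2_on R (K * (norm (\<theta> - \<theta>\<^sub>0))\<^sup>2) (\<lambda>x. b x \<theta> $ i - b x \<theta>\<^sub>0 $ i - (\<Sum>j\<in>UNIV. (\<theta> - \<theta>\<^sub>0) $ j * f' j x)) Dh))"
    using drift_regularity_component[OF b conv t0 R] by blast
  then obtain f' K where F: "\<And>i. 0 \<le> K i" "\<And>i. continuous_on (UNIV \<times> \<Theta>) (\<lambda>(x, \<theta>). b x \<theta> $ i)"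
     "\<And>i x j. ((\<lambda>h. b x (\<theta>\<^sub>0 + h *\<^sub>R axis j 1) $ i) has_real_derivative f' i j x) (at 0)"
     "\<And>i j. \<exists>Df. C2_on R (K i) (f' i j) Df"
     "\<And>i \<theta>. \<theta> \<in> \<Theta> \<Longrightarrow> \<exists>Dg. C2_on R (K i * norm (\<theta> - \<theta>\<^sub>0)) (\<lambda>x. b x \<theta> $ i - b x \<theta>\<^sub>0 $ i) Dg"
     "\<And>i \<theta>. \<theta> \<in> \<Theta> \<Longrightarrow> \<exists>Dh. C2_on R (K i * (norm (\<theta> - \<theta>\<^sub>0))\<^sup>2) (\<lambda>x. b x \<theta> $ i - b x \<theta>\<^sub>0 $ i - (\<Sum>j\<in>UNIV. (\<theta> - \<theta>\<^sub>0) $ j * f' i j x)) Dh"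
    unfolding choice_iff by blast
  show "continuous_on (UNIV \<times> \<Theta>) (\<lambda>(x, \<theta>). b x \<theta>)"
  proof (rule continuous_on_componentwise[THEN iffD2], rule ballI)
    fix e :: "real ^ 'd" assume "e \<in> Basis"
    then obtain i where e: "e = axis i 1" by (auto simp: Basis_vec_def)
    show "continuous_on (UNIV \<times> \<Theta>) (\<lambda>x. (case x of (x, \<theta>) \<Rightarrow> b x \<theta>) \<bullet> e)"
      using F(2)[of i] unfolding e by (simp add: case_prod_beta' inner_axis)
  qed
  \<comment> \<open>\<open>partial_theta\<close> selects a derivative by choice; uniqueness
    identifies it with the coordinatewise derivatives.\<close>
  have pt: "partial_theta b j x \<theta>\<^sub>0 $ i = f' i j x" for i j x
  proof -
    have "((\<lambda>h. b x (\<theta>\<^sub>0 + h *\<^sub>R axis j 1)) has_vector_derivative (\<chi> i. f' i j x)) (at 0)"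
      unfolding has_vector_derivative_def
    proof (rule has_derivative_componentwise_within[THEN iffD2], rule ballI)
      fix e :: "real ^ 'd" assume "e \<in> Basis"
      then obtain i where e: "e = axis i 1" by (auto simp: Basis_vec_def)
      show "((\<lambda>h. b x (\<theta>\<^sub>0 + h *\<^sub>R axis j 1) \<bullet> e) has_derivative (\<lambda>h. (h *\<^sub>R (\<chi> i. f' i j x)) \<bullet> e)) (at 0)"
        using F(3)[of x j i] unfolding e has_field_derivative_def by (simp add: inner_axis mult.commute[of _ "f' i j x"])
    qed
    then have "partial_theta b j x \<theta>\<^sub>0 = (\<chi> i. f' i j x)" unfolding partial_theta_def by (rule vector_derivative_at)
    then show ?thesis by simp
  qed
  define k where "k = (\<Sum>i\<in>UNIV. K i)"
  have kK: "K i \<le> k" for i unfolding k_def by (rule member_le_sum) (auto simp: F)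
  have "\<exists>Df. C2_on R k (f' i j) Df" for i j using F(4)[of i j] C2_on_mono[OF _ kK] by blast
  moreover have "\<exists>Dg. C2_on R (k * norm (\<theta> - \<theta>\<^sub>0)) (\<lambda>x. b x \<theta> $ i - b x \<theta>\<^sub>0 $ i) Dg" if "\<theta> \<in> \<Theta>" for i \<theta>
    using F(5)[OF that, of i] C2_on_mono[OF _ mult_right_mono[OF kK[of i] norm_ge_zero]] by blast
  moreover have "\<exists>Dh. C2_on R (k * (norm (\<theta> - \<theta>\<^sub>0))\<^sup>2) (\<lambda>x. b x \<theta> $ i - b x \<theta>\<^sub>0 $ i - (\<Sum>j\<in>UNIV. (\<theta> - \<theta>\<^sub>0) $ j * f' i j x)) Dh" if "\<theta> \<in> \<Theta>" for i \<theta>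
    using F(6)[OF that, of i] C2_on_mono[OF _ mult_right_mono[OF kK[of i] zero_le_power2]] by blast
  moreover have "0 \<le> k" unfolding k_def using F(1) by (rule sum_nonneg)
  ultimately show "\<exists>K\<ge>0. \<forall>i. (\<forall>j. \<exists>Df. C2_on R K (\<lambda>x. partial_theta b j x \<theta>\<^sub>0 $ i) Df) \<and>
     (\<forall>\<theta>\<in>\<Theta>. (\<exists>Dg. C2_on R (K * norm (\<theta> - \<theta>\<^sub>0)) (\<lambda>x. b x \<theta> $ i - b x \<theta>\<^sub>0 $ i) Dg) \<and>
        (\<exists>Dh. C2_on R (K * (norm (\<theta> - \<theta>\<^sub>0))\<^sup>2) (\<lambda>x. b x \<theta> $ i - b x \<theta>\<^sub>0 $ i - (\<Sum>j\<in>UNIV. (\<theta> - \<theta>\<^sub>0) $ j * partial_theta b j x \<theta>\<^sub>0 $ i)) Dh))"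
    unfolding pt by blast
qed

text \<open>Two points of the ball are at distance at most \<open>2 * R\<close>, so the quadratic
  Taylor remainder is absorbed into a linear bound.\<close>

lemma C2_on_lipschitz:
  fixes f :: "'a::real_inner \<Rightarrow> real"
  assumes f: "C2_on R K f Df" and xy: "norm x \<le> R" "norm y \<le> R"
  shows "\<bar>f y - f x\<bar> \<le> K * (1 + 2 * R) * norm (y - x)"
proof -
  have 1: "\<bar>f y - f x - Df x \<bullet> (y - x)\<bar> \<le> K * (norm (y - x))\<^sup>2" and 2: "norm (Df x) \<le> K"
    using f xy unfolding C2_on_def by (meson mem_cball_0)+
  have K: "0 \<le> K" by (rule order_trans[OF norm_ge_zero 2])
  have 3: "norm (y - x) \<le> 2 * R" using norm_triangle_ineq4[of y x] xy by linarith
  have "\<bar>Df x \<bullet> (y - x)\<bar> \<le> K * norm (y - x)"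
    by (rule order_trans[OF Cauchy_Schwarz_ineq2 mult_right_mono[OF 2 norm_ge_zero]])
  moreover have "K * (norm (y - x))\<^sup>2 \<le> K * (2 * R * norm (y - x))"
    unfolding power2_eq_square using 3 K by (intro mult_left_mono mult_right_mono) auto
  ultimately show ?thesis using 1 by (simp add: algebra_simps)
qed

lemma C2_on_bound: "C2_on R K f Df \<Longrightarrow> norm x \<le> R \<Longrightarrow> \<bar>f x\<bar> \<le> K"
  by (auto simp: C2_on_def)

section \<open>The contrast and its minimiser\<close>

text \<open>In the supremum norm weighted by \<open>exp (- 2 * K * t)\<close> the integral operator
  contracts by one half, which replaces Gronwall's lemma. The bound \<open>B0\<close> makes the
  supremum finite a priori. Only the integral equation is used, as \<open>x\<close> may
  jump.\<close>

lemma gronwall_stability: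
  fixes x y L :: "real \<Rightarrow> 'a::euclidean_space"
  assumes lip: "\<And>u w. norm (\<beta> u - \<beta> w) \<le> K * norm (u - w)" and K: "0 < K"
    and x: "\<And>t. t \<in> {0..1} \<Longrightarrow> ((\<lambda>s. \<beta> (x s)) has_integral (x t - x0 - \<epsilon> *\<^sub>R L t)) {0..t}"
    and y: "\<And>t. t \<in> {0..1} \<Longrightarrow> ((\<lambda>s. \<beta> (y s)) has_integral (y t - x0)) {0..t}"
    and bd: "\<And>t. t \<in> {0..1} \<Longrightarrow> norm (x t - y t) \<le> B0"
    and L: "\<And>t. t \<in> {0..1} \<Longrightarrow> norm (L t) \<le> B" and \<epsilon>: "0 \<le> \<epsilon>" and t: "t \<in> {0..1}"
  shows "norm (x t - y t) \<le> 2 * exp (2 * K) * B * \<epsilon>"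
proof -
  define S where "S = (SUP t\<in>{0..1}. exp (- 2 * K * t) * norm (x t - y t))"
  have bdd: "bdd_above ((\<lambda>t. exp (- 2 * K * t) * norm (x t - y t)) ` {0..1})"
  proof (rule bdd_aboveI2)
    fix t :: real assume t: "t \<in> {0..1}"
    have "exp (- 2 * K * t) * norm (x t - y t) \<le> 1 * norm (x t - y t)" using t K by (intro mult_right_mono) auto
    then show "exp (- 2 * K * t) * norm (x t - y t) \<le> B0" using bd[OF t] by simp
  qed
  have ee: "exp (- 2 * K * t) = inverse (exp (2 * K * t))" for t by (simp add: exp_minus)
  have upper: "norm (x t - y t) \<le> S * exp (2 * K * t)" if t: "t \<in> {0..1}" for t
  proof -
    have "exp (- 2 * K * t) * norm (x t - y t) \<le> S" unfolding S_def by (rule cSUP_upper[OF t bdd])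
    then show ?thesis unfolding ee by (simp add: field_simps)
  qed
  have S0: "0 \<le> S" using order_trans[OF norm_ge_zero upper[of 0]] by simp
  have step: "norm (x t - y t) \<le> \<epsilon> * B + S * exp (2 * K * t) / 2" if t: "t \<in> {0..1}" for t
  proof -
    have d: "((\<lambda>s. \<beta> (x s) - \<beta> (y s)) has_integral (x t - y t - \<epsilon> *\<^sub>R L t)) {0..t}"
      using has_integral_diff[OF x[OF t] y[OF t]] by (simp add: algebra_simps)
    have e: "((\<lambda>s. K * (S * exp (2 * K * s))) has_integral (S * exp (2 * K * t) / 2 - S * exp (2 * K * 0) / 2)) {0..t}"
    proof (rule fundamental_theorem_of_calculus)
      show "0 \<le> t" using t by simp
      fix s
      show "((\<lambda>s. S * exp (2 * K * s) / 2) has_vector_derivative K * (S * exp (2 * K * s))) (at s within {0..t})"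
        unfolding has_real_derivative_iff_has_vector_derivative[symmetric] by (auto intro!: derivative_eq_intros)
    qed
    have "norm (integral {0..t} (\<lambda>s. \<beta> (x s) - \<beta> (y s))) \<le> integral {0..t} (\<lambda>s. K * (S * exp (2 * K * s)))"
    proof (rule integral_norm_bound_integral)
      fix s assume "s \<in> {0..t}"
      then have "s \<in> {0..1}" using t by auto
      then show "norm (\<beta> (x s) - \<beta> (y s)) \<le> K * (S * exp (2 * K * s))"
        using order_trans[OF lip mult_left_mono[OF upper]] K by simp
    qed (use d e in auto)
    then have "norm (x t - y t - \<epsilon> *\<^sub>R L t) \<le> S * exp (2 * K * t) / 2 - S / 2"
      using integral_unique[OF d] integral_unique[OF e] by simp
    moreover have "norm (x t - y t) \<le> norm (x t - y t - \<epsilon> *\<^sub>R L t) + norm (\<epsilon> *\<^sub>R L t)"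
      using norm_triangle_sub[of "x t - y t" "\<epsilon> *\<^sub>R L t"] by linarith
    moreover have "norm (\<epsilon> *\<^sub>R L t) \<le> \<epsilon> * B" using L[OF t] \<epsilon> by (simp add: mult_left_mono)
    ultimately show ?thesis using S0 by linarith
  qed
  have "(SUP t\<in>{0..1}. exp (- 2 * K * t) * norm (x t - y t)) \<le> \<epsilon> * B + S / 2"
  proof (rule cSUP_least)
    fix t :: real assume t: "t \<in> {0..1}"
    have B: "0 \<le> B" by (rule order_trans[OF norm_ge_zero L[OF t]])
    have "exp (- 2 * K * t) * norm (x t - y t) \<le> exp (- 2 * K * t) * (\<epsilon> * B + S * exp (2 * K * t) / 2)"
      using step[OF t] by (intro mult_left_mono) auto
    also have "\<dots> = exp (- 2 * K * t) * (\<epsilon> * B) + S / 2" unfolding ee by (simp add: field_simps)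
    also have "\<dots> \<le> 1 * (\<epsilon> * B) + S / 2" using t K \<epsilon> B by (intro add_mono mult_right_mono) auto
    finally show "exp (- 2 * K * t) * norm (x t - y t) \<le> \<epsilon> * B + S / 2" by simp
  qed simp
  then have S2: "S \<le> 2 * (\<epsilon> * B)" unfolding S_def[symmetric] by linarith
  have "norm (x t - y t) \<le> S * exp (2 * K * t)" by (rule upper[OF t])
  also have "\<dots> \<le> 2 * (\<epsilon> * B) * exp (2 * K)" using S2 S0 t K by (intro mult_mono) auto
  finally show ?thesis by (simp add: ac_simps)
qed

lemma integral_increment:
  fixes f :: "real \<Rightarrow> 'a::euclidean_space"
  assumes F: "\<And>t. t \<in> {0..1} \<Longrightarrow> (f has_integral (F t)) {0..t}" and st: "0 \<le> s" "s \<le> t" "t \<le> 1"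
  shows "(f has_integral (F t - F s)) {s..t}"
proof -
  have i: "f integrable_on {0..t}" using F[of t] st by auto
  then have "f integrable_on {s..t}" by (rule integrable_on_subinterval) (use st in auto)
  moreover have "integral {0..s} f + integral {s..t} f = integral {0..t} f"
    by (rule Henstock_Kurzweil_Integration.integral_combine[OF st(1,2) i])
  moreover have "integral {0..s} f = F s" "integral {0..t} f = F t" using F[of s] F[of t] st by (auto intro: integral_unique)
  ultimately show ?thesis by (metis add_diff_cancel_left' integrable_integral)
qed

text \<open>Induction over cells with an error proportional to the length already covered, so no
  factor \<open>n\<close> accumulates.\<close>

lemma riemann_sum_error:
  fixes f :: "real \<Rightarrow> real"
  assumes n: "0 < n" and f: "f integrable_on {0..1}"
    and a: "\<And>k s. k < n \<Longrightarrow> s \<in> {real k / real n..real (Suc k) / real n} \<Longrightarrow> \<bar>a k - f s\<bar> \<le> e"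
  shows "\<bar>(\<Sum>k<n. a k) / real n - integral {0..1} f\<bar> \<le> e"
proof -
  have part: "\<bar>(\<Sum>k<m. a k) / real n - integral {0..real m / real n} f\<bar> \<le> e * (real m / real n)" if "m \<le> n" for m
    using that
  proof (induction m)
    case 0
    then show ?case by simp
  next
    case (Suc m)
    let ?s = "real m / real n" and ?t = "real (Suc m) / real n"
    have st: "0 \<le> ?s" "?s \<le> ?t" "?t \<le> 1" "?t - ?s = 1 / real n"
      using Suc.prems n by (simp_all add: divide_right_mono diff_divide_distrib[symmetric])
    have i: "f integrable_on {0..?t}" "f integrable_on {?s..?t}"
    proof -
      have "{0..?t} \<subseteq> {0..1}" "{?s..?t} \<subseteq> {0..1}"
        unfolding atLeastatMost_subset_iff using st(1-3) by blast+
      then show "f integrable_on {0..?t}" "f integrable_on {?s..?t}" using integrable_on_subinterval[OF f] by blast+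
    qed
    have split: "integral {0..?s} f + integral {?s..?t} f = integral {0..?t} f"
      by (rule Henstock_Kurzweil_Integration.integral_combine[OF st(1,2) i(1)])
    have "norm (integral {?s..?t} (\<lambda>s. a m - f s)) \<le> integral {?s..?t} (\<lambda>s. e)"
      by (rule integral_norm_bound_integral) (use i a[of m] Suc.prems in \<open>auto intro!: integrable_diff\<close>)
    moreover have "integral {?s..?t} (\<lambda>s. a m - f s) = a m / real n - integral {?s..?t} f"
      using i st by (subst integral_diff) auto
    moreover have "integral {?s..?t} (\<lambda>s. e) = e / real n" using st by simp
    ultimately have "\<bar>a m / real n - integral {?s..?t} f\<bar> \<le> e / real n" by simp
    moreover have "\<bar>(\<Sum>k<m. a k) / real n - integral {0..?s} f\<bar> \<le> e * ?s" using Suc by simp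
    ultimately show ?case using split by (simp add: add_divide_distrib distrib_left)
  qed
  from part[of n] show ?thesis using n by simp
qed

section \<open>Minimisers of perturbed quadratic functions\<close>

text \<open>The form attains a positive minimum on the unit sphere, and homogeneity extends it.
  Positivity also gives injectivity, so the choice in \<open>matrix_inv\<close> returns a genuine
  inverse.\<close>

lemma pos_definite_coercive:
  fixes A :: "real ^ 'p ^ 'p"
  assumes A: "pos_definite A"
  shows "\<exists>l>0. \<forall>v. l * (norm v)\<^sup>2 \<le> v \<bullet> (A *v v)" "A *v (matrix_inv A *v s) = s"
proof -
  have pos: "v \<noteq> 0 \<Longrightarrow> 0 < v \<bullet> (A *v v)" for v using A by (simp add: pos_definite_def)
  have c: "continuous_on (sphere 0 1) (\<lambda>v. v \<bullet> (A *v v))"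
    by (intro continuous_on_inner continuous_on_id linear_continuous_on matrix_vector_mul_bounded_linear)
  have ne: "sphere (0 :: real ^ 'p) 1 \<noteq> {}" by simp
  obtain w where w: "w \<in> sphere 0 1" "\<And>v. v \<in> sphere 0 1 \<Longrightarrow> w \<bullet> (A *v w) \<le> v \<bullet> (A *v v)"
    using continuous_attains_inf[OF compact_sphere ne c] by blast
  let ?l = "w \<bullet> (A *v w)"
  have l: "0 < ?l" using w(1) by (intro pos) auto
  have "?l * (norm v)\<^sup>2 \<le> v \<bullet> (A *v v)" for v
  proof (cases "v = 0")
    case False
    have "?l \<le> (v /\<^sub>R norm v) \<bullet> (A *v (v /\<^sub>R norm v))" using False by (intro w) auto
    also have "\<dots> = v \<bullet> (A *v v) / (norm v)\<^sup>2"
      by (simp add: matrix_vector_mult_scaleR power2_eq_square divide_inverse)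
    finally show ?thesis using False by (simp add: field_simps)
  qed simp
  then show "\<exists>l>0. \<forall>v. l * (norm v)\<^sup>2 \<le> v \<bullet> (A *v v)" using l by blast
  have "inj ((*v) A)"
  proof (rule linear_injective_0[THEN iffD2, OF matrix_vector_mul_linear], intro allI impI)
    fix v assume "A *v v = 0"
    then show "v = 0" using pos[of v] by force
  qed
  then have "invertible A" by (simp add: invertible_left_inverse matrix_left_invertible_injective)
  then have "\<exists>A'. A ** A' = mat 1 \<and> A' ** A = mat 1" by (simp add: invertible_def)
  then have "A ** matrix_inv A = mat 1" unfolding matrix_inv_def by (rule someI2_ex) blast
  then show "A *v (matrix_inv A *v s) = s" by (simp add: matrix_vector_mul_assoc)
qed

text \<open>Deterministic, so that one threshold \<open>g\<close>, fixed by the constants alone,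
  serves all paths and all small \<open>\<epsilon>\<close>. In the error hypothesis the linear term
  carries the small \<open>\<gamma>\<close>, whereas the coefficient \<open>Q\<close> of the square
  is just bounded: multiplied by \<open>\<epsilon>\<close>, it is absorbed by coercivity.\<close>

lemma quadratic_argmin:
  fixes A :: "real ^ 'p ^ 'p" and q :: "real ^ 'p \<Rightarrow> real"
  assumes A: "transpose A = A" and l: "0 < l" "\<And>v. l * (norm v)\<^sup>2 \<le> v \<bullet> (A *v v)" and inv: "\<And>s. A *v (matrix_inv A *v s) = s"
    and q: "\<And>\<theta>. \<theta> \<in> \<Theta> \<Longrightarrow> c * (norm (\<theta> - \<theta>\<^sub>0))\<^sup>2 \<le> q \<theta>" "0 < c"
      "\<And>\<theta>. \<theta> \<in> \<Theta> \<Longrightarrow> \<bar>q \<theta> - (\<theta> - \<theta>\<^sub>0) \<bullet> (A *v (\<theta> - \<theta>\<^sub>0))\<bar> \<le> C * norm (\<theta> - \<theta>\<^sub>0) ^ 3"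
    and r: "0 < r" "ball \<theta>\<^sub>0 r \<subseteq> \<Theta>" and R: "0 \<le> R" and Q: "0 \<le> Q" and C: "0 \<le> C" and \<eta>: "0 < \<eta>"
  shows "\<exists>g>0. \<forall>\<gamma> \<epsilon> s \<theta> \<Delta>. 0 \<le> \<gamma> \<longrightarrow> \<gamma> \<le> g \<longrightarrow> 0 < \<epsilon> \<longrightarrow> \<epsilon> \<le> g \<longrightarrow> norm s \<le> R \<longrightarrow> \<theta> \<in> \<Theta> \<longrightarrow>
     \<Delta> \<theta>\<^sub>0 = 0 \<longrightarrow> (\<forall>\<theta>'\<in>\<Theta>. \<Delta> \<theta> \<le> \<Delta> \<theta>') \<longrightarrow>
     (\<forall>\<theta>\<in>\<Theta>. \<bar>\<Delta> \<theta> - q \<theta> + 2 * \<epsilon> * (s \<bullet> (\<theta> - \<theta>\<^sub>0))\<bar> \<le> \<gamma> * (norm (\<theta> - \<theta>\<^sub>0))\<^sup>2 + 2 * \<epsilon> * (\<gamma> * norm (\<theta> - \<theta>\<^sub>0) + Q * (norm (\<theta> - \<theta>\<^sub>0))\<^sup>2)) \<longrightarrow>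
     norm ((1 / \<epsilon>) *\<^sub>R (\<theta> - \<theta>\<^sub>0) - matrix_inv A *v s) \<le> \<eta>"
proof -
  \<comment> \<open>The first summand bounds the rescaled minimiser, the second the target
    \<open>matrix_inv A *v s\<close>.\<close>
  define K where "K = 4 * (R + 1) / c + R / l"
  have K: "4 * (R + 1) / c \<le> K" "R / l \<le> K" "0 < K" using R q(2) l(1) by (auto simp: K_def add_pos_nonneg)
  \<comment> \<open>At \<open>\<theta>\<^sub>0 + \<epsilon> *\<^sub>R z\<close> with
    \<open>norm z \<le> K\<close> the total error is at most
    \<open>\<epsilon>\<^sup>2 * (g * P)\<close>. The four terms stem from the two parts with
    \<open>\<gamma>\<close>, the part with \<open>Q\<close> and the cubic remainder of
    \<open>q\<close>.\<close>
  define P where "P = K\<^sup>2 + 2 * K + 2 * Q * K\<^sup>2 + C * K ^ 3"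
  have P: "0 < P" unfolding P_def using K(3) Q C by (intro add_pos_nonneg) auto
  \<comment> \<open>The entries serve in turn to replace \<open>R + \<gamma>\<close> by
    \<open>R + 1\<close>, to let half of the coercivity absorb the quadratic errors, to keep
    \<open>\<theta>'\<close> in the ball of radius \<open>r\<close>, and to make the final gap at
    most \<open>l * \<eta>\<^sup>2\<close>.\<close>
  define g where "g = Min {1, c / (2 * (1 + 2 * Q)), r / (2 * K), l * \<eta>\<^sup>2 / (2 * P)}"
  have g: "g \<le> 1" "g \<le> c / (2 * (1 + 2 * Q))" "g \<le> r / (2 * K)" "g \<le> l * \<eta>\<^sup>2 / (2 * P)" unfolding g_def by auto
  have g0: "0 < g" unfolding g_def using q(2) Q r(1) K(3) l(1) \<eta> P by auto
  show ?thesis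
  proof (intro exI[of _ g] conjI g0 allI impI)
    fix \<gamma> \<epsilon> s \<theta> \<Delta>
    assume \<gamma>: "0 \<le> \<gamma>" "\<gamma> \<le> g" and \<epsilon>: "0 < \<epsilon>" "\<epsilon> \<le> g" and s: "norm s \<le> R" and \<theta>: "\<theta> \<in> \<Theta>"
      and \<Delta>0: "\<Delta> \<theta>\<^sub>0 = 0" and min: "\<forall>\<theta>'\<in>\<Theta>. \<Delta> \<theta> \<le> \<Delta> \<theta>'"
      and ap: "\<forall>\<theta>\<in>\<Theta>. \<bar>\<Delta> \<theta> - q \<theta> + 2 * \<epsilon> * (s \<bullet> (\<theta> - \<theta>\<^sub>0))\<bar> \<le> \<gamma> * (norm (\<theta> - \<theta>\<^sub>0))\<^sup>2 + 2 * \<epsilon> * (\<gamma> * norm (\<theta> - \<theta>\<^sub>0) + Q * (norm (\<theta> - \<theta>\<^sub>0))\<^sup>2)"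
    let ?v = "\<theta> - \<theta>\<^sub>0"
    have t0: "\<theta>\<^sub>0 \<in> \<Theta>" using r by auto
    have small: "\<gamma> + 2 * \<epsilon> * Q \<le> c / 2"
    proof -
      have "\<epsilon> * Q \<le> g * Q" using \<epsilon> Q by (intro mult_right_mono) auto
      then have "\<gamma> + 2 * \<epsilon> * Q \<le> g * (1 + 2 * Q)" using \<gamma> by (simp add: algebra_simps)
      also have "\<dots> \<le> c / (2 * (1 + 2 * Q)) * (1 + 2 * Q)" using g(2) Q by (intro mult_right_mono) auto
      also have "\<dots> = c / 2" using Q by (simp add: field_simps)
      finally show ?thesis .
    qed
    have rate: "norm ?v \<le> \<epsilon> * K"
    proof -
      have "\<Delta> \<theta> \<le> 0" using min t0 \<Delta>0 by force
      moreover have "c * (norm ?v)\<^sup>2 \<le> q \<theta>" by (rule q(1)[OF \<theta>])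
      moreover have "\<bar>\<Delta> \<theta> - q \<theta> + 2 * \<epsilon> * (s \<bullet> ?v)\<bar> \<le> \<gamma> * (norm ?v)\<^sup>2 + 2 * \<epsilon> * (\<gamma> * norm ?v + Q * (norm ?v)\<^sup>2)" using ap \<theta> by blast
      moreover have "s \<bullet> ?v \<le> R * norm ?v" by (rule order_trans[OF norm_cauchy_schwarz mult_right_mono[OF s norm_ge_zero]])
      then have "2 * \<epsilon> * (s \<bullet> ?v) \<le> 2 * \<epsilon> * (R * norm ?v)" using \<epsilon>(1) by (intro mult_left_mono) auto
      ultimately have "c * (norm ?v)\<^sup>2 \<le> 2 * \<epsilon> * (R * norm ?v) + \<gamma> * (norm ?v)\<^sup>2 + 2 * \<epsilon> * (\<gamma> * norm ?v + Q * (norm ?v)\<^sup>2)" by linarith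
      also have "\<dots> = 2 * \<epsilon> * ((R + \<gamma>) * norm ?v) + (\<gamma> + 2 * \<epsilon> * Q) * (norm ?v)\<^sup>2" by (simp add: algebra_simps)
      also have "\<dots> \<le> 2 * \<epsilon> * ((R + 1) * norm ?v) + c / 2 * (norm ?v)\<^sup>2"
        using small \<gamma> g(1) \<epsilon>(1) by (intro add_mono mult_left_mono mult_right_mono) auto
      finally have "c / 2 * (norm ?v)\<^sup>2 \<le> 2 * \<epsilon> * ((R + 1) * norm ?v)" by linarith
      then have "norm ?v * (c * norm ?v) \<le> norm ?v * (4 * \<epsilon> * (R + 1))" by (simp add: power2_eq_square algebra_simps)
      then have "norm ?v = 0 \<or> c * norm ?v \<le> 4 * \<epsilon> * (R + 1)" by (auto simp: mult_le_cancel_left)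
      then have "norm ?v \<le> \<epsilon> * (4 * (R + 1) / c)" using q(2) \<epsilon>(1) R by (auto simp: field_simps)
      also have "\<dots> \<le> \<epsilon> * K" using K(1) \<epsilon>(1) by (intro mult_left_mono) auto
      finally show ?thesis .
    qed
    define u where "u = (1 / \<epsilon>) *\<^sub>R ?v"
    define w where "w = matrix_inv A *v s"
    have Aw: "A *v w = s" unfolding w_def by (rule inv)
    have v: "?v = \<epsilon> *\<^sub>R u" using \<epsilon>(1) by (simp add: u_def)
    have uK: "norm u \<le> K" using rate \<epsilon>(1) unfolding v by (simp add: mult_le_cancel_left)
    have wK: "norm w \<le> K"
    proof -
      have "l * (norm w)\<^sup>2 \<le> w \<bullet> s" using l(2)[of w] by (simp add: Aw)
      also have "\<dots> \<le> norm w * R" by (rule order_trans[OF norm_cauchy_schwarz mult_left_mono[OF s norm_ge_zero]])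
      finally have "norm w * (l * norm w) \<le> norm w * R" by (simp add: power2_eq_square algebra_simps)
      then have "norm w = 0 \<or> l * norm w \<le> R" by (auto simp: mult_le_cancel_left)
      then have "norm w \<le> R / l" using l(1) R by (auto simp: field_simps)
      then show ?thesis using K(2) by linarith
    qed
    define \<theta>' where "\<theta>' = \<theta>\<^sub>0 + \<epsilon> *\<^sub>R w"
    have \<theta>': "\<theta>' \<in> \<Theta>"
    proof -
      have "\<epsilon> * norm w \<le> r / (2 * K) * K" using \<epsilon> g(3) wK K(3) by (intro mult_mono) auto
      also have "\<dots> < r" using K(3) r(1) by simp
      finally show ?thesis using r(2) \<epsilon>(1) unfolding \<theta>'_def by (auto simp: dist_norm intro!: subsetD[OF r(2)])
    qed
    define \<phi> where "\<phi> z = z \<bullet> (A *v z) - 2 * (s \<bullet> z)" for z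
    have est: "\<bar>\<Delta> (\<theta>\<^sub>0 + \<epsilon> *\<^sub>R z) - \<epsilon>\<^sup>2 * \<phi> z\<bar> \<le> \<epsilon>\<^sup>2 * (g * P)" if z: "norm z \<le> K" and zT: "\<theta>\<^sub>0 + \<epsilon> *\<^sub>R z \<in> \<Theta>" for z
    proof -
      let ?t = "\<theta>\<^sub>0 + \<epsilon> *\<^sub>R z"
      have 1: "\<bar>\<Delta> ?t - q ?t + 2 * \<epsilon> * (s \<bullet> (\<epsilon> *\<^sub>R z))\<bar> \<le> \<gamma> * (norm (\<epsilon> *\<^sub>R z))\<^sup>2 + 2 * \<epsilon> * (\<gamma> * norm (\<epsilon> *\<^sub>R z) + Q * (norm (\<epsilon> *\<^sub>R z))\<^sup>2)"
        using ap[rule_format, OF zT] by simp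
      have 2: "\<bar>q ?t - (\<epsilon> *\<^sub>R z) \<bullet> (A *v (\<epsilon> *\<^sub>R z))\<bar> \<le> C * norm (\<epsilon> *\<^sub>R z) ^ 3" using q(3)[OF zT] by simp
      have 3: "(\<epsilon> *\<^sub>R z) \<bullet> (A *v (\<epsilon> *\<^sub>R z)) = \<epsilon>\<^sup>2 * (z \<bullet> (A *v z))" by (simp add: matrix_vector_mult_scaleR power2_eq_square)
      have n: "norm (\<epsilon> *\<^sub>R z) = \<epsilon> * norm z" using \<epsilon>(1) by simp
      have sq: "(norm z)\<^sup>2 \<le> K\<^sup>2" "norm z ^ 3 \<le> K ^ 3" using z by (auto intro: power_mono)
      have a1: "\<gamma> * (norm z)\<^sup>2 \<le> g * K\<^sup>2" using \<gamma> sq by (intro mult_mono) auto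
      have a2: "\<gamma> * norm z \<le> g * K" using \<gamma> z by (intro mult_mono) auto
      have a3: "\<epsilon> * (Q * (norm z)\<^sup>2) \<le> g * (Q * K\<^sup>2)" using \<epsilon> Q sq by (intro mult_mono mult_left_mono) auto
      have a4: "\<epsilon> * (C * norm z ^ 3) \<le> g * (C * K ^ 3)" using \<epsilon> C sq by (intro mult_mono mult_left_mono) auto
      have "\<bar>\<Delta> ?t - \<epsilon>\<^sup>2 * \<phi> z\<bar> \<le> \<gamma> * (\<epsilon> * norm z)\<^sup>2 + 2 * \<epsilon> * (\<gamma> * (\<epsilon> * norm z) + Q * (\<epsilon> * norm z)\<^sup>2) + C * (\<epsilon> * norm z) ^ 3"
        using 1 2 unfolding 3 n \<phi>_def by (simp add: power2_eq_square algebra_simps)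
      also have "\<dots> = \<epsilon>\<^sup>2 * (\<gamma> * (norm z)\<^sup>2 + 2 * (\<gamma> * norm z) + 2 * (\<epsilon> * (Q * (norm z)\<^sup>2)) + \<epsilon> * (C * norm z ^ 3))"
        by (simp add: power2_eq_square power3_eq_cube algebra_simps)
      also have "\<dots> \<le> \<epsilon>\<^sup>2 * (g * P)"
        using a1 a2 a3 a4 by (intro mult_left_mono) (auto simp: P_def algebra_simps)
      finally show ?thesis .
    qed
    have tu: "\<theta>\<^sub>0 + \<epsilon> *\<^sub>R u = \<theta>" using v by (simp add: algebra_simps)
    have E1: "\<bar>\<Delta> \<theta> - \<epsilon>\<^sup>2 * \<phi> u\<bar> \<le> \<epsilon>\<^sup>2 * (g * P)" using est[OF uK] \<theta> unfolding tu by blast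
    have E2: "\<bar>\<Delta> \<theta>' - \<epsilon>\<^sup>2 * \<phi> w\<bar> \<le> \<epsilon>\<^sup>2 * (g * P)" using est[OF wK] \<theta>' unfolding \<theta>'_def by blast
    have "\<Delta> \<theta> \<le> \<Delta> \<theta>'" using min \<theta>' by blast
    then have "\<epsilon>\<^sup>2 * (\<phi> u - \<phi> w) \<le> \<epsilon>\<^sup>2 * (2 * (g * P))" using E1 E2 by (simp add: algebra_simps)
    then have le: "\<phi> u - \<phi> w \<le> 2 * (g * P)" using \<epsilon>(1) by (simp add: mult_le_cancel_left)
    have sym: "w \<bullet> (A *v u) = u \<bullet> s"
    proof -
      have "w \<bullet> (A *v u) = (w v* A) \<bullet> u" by (rule dot_lmul_matrix[symmetric])
      also have "w v* A = A *v w" using A by (metis transpose_matrix_vector)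
      finally show ?thesis by (simp add: Aw inner_commute)
    qed
    \<comment> \<open>Completing the square: since \<open>A *v w = s\<close>, the point
      \<open>w\<close> minimises \<open>\<phi>\<close>, and the excess at \<open>u\<close> is the
      form at \<open>u - w\<close>.\<close>
    have "\<phi> u - \<phi> w = (u - w) \<bullet> (A *v (u - w))"
      unfolding \<phi>_def by (simp add: matrix_vector_mult_diff_distrib inner_diff_left inner_diff_right Aw sym inner_commute)
    then have "l * (norm (u - w))\<^sup>2 \<le> 2 * (g * P)" using l(2)[of "u - w"] le by linarith
    also have "\<dots> \<le> 2 * (l * \<eta>\<^sup>2 / (2 * P) * P)" using g(4) P by (intro mult_left_mono mult_right_mono) auto
    also have "\<dots> = l * \<eta>\<^sup>2" using P by simp
    finally have "(norm (u - w))\<^sup>2 \<le> \<eta>\<^sup>2" using l(1) by (simp add: mult_le_cancel_left)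
    then have "norm (u - w) \<le> \<eta>" using \<eta> by (simp add: power2_le_iff_abs_le)
    then show "norm ((1 / \<epsilon>) *\<^sub>R (\<theta> - \<theta>\<^sub>0) - matrix_inv A *v s) \<le> \<eta>" by (simp add: u_def w_def)
  qed
qed

text \<open>Signed weights reach the variance bound through their absolute values; the constant
  \<open>D\<close> per unit time turns into \<open>D\<close> times the number of steps times
  \<open>1 / n\<close>.\<close>

lemma (in noise_process) discrete_noise_grid:
  assumes n: "0 < n"
  shows "discrete_noise M (\<lambda>k. F (real k / real n)) (\<lambda>k. W (real k / real n)) (1 / real n) D"
proof
  show "subalgebra M (F (real k / real n))" for k using filt by (auto simp: filtered_space_def)
  show "sets (F (real k / real n)) \<subseteq> sets (F (real l / real n))" if "k \<le> l" for k l
  proof -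
    have "\<And>s t. 0 \<le> s \<Longrightarrow> s \<le> t \<Longrightarrow> sets (F s) \<subseteq> sets (F t)" using filt unfolding filtered_space_def by blast
    then show ?thesis using that by (simp add: divide_right_mono)
  qed
  show "W (real k / real n) \<in> borel_measurable (F (real k / real n))" for k by (rule W_ad) simp
  show "0 < 1 / real n" using n by simp
  show "0 \<le> D" by (rule D0)
  fix k l :: nat assume "k < l"
  then have kl: "0 \<le> real k / real n" "real k / real n < real l / real n" using n by (auto simp: divide_strict_right_mono)
  have kl': "real l / real n - real k / real n = real (l - k) * (1 / real n)" using \<open>k < l\<close> by (simp add: of_nat_diff diff_divide_distrib)
  show "integrable M (\<lambda>\<omega>. (norm (W (real l / real n) \<omega> - W (real k / real n) \<omega>))\<^sup>2)"
    using norm_incr(1)[OF kl borel_measurable_const, of 1 1] by simp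
  fix \<xi> :: "'w \<Rightarrow> real" and c
  assume xi: "\<xi> \<in> borel_measurable (F (real k / real n))" and c: "\<And>\<omega>. \<omega> \<in> space M \<Longrightarrow> \<bar>\<xi> \<omega>\<bar> \<le> c"
  show "(\<integral>\<omega>. \<xi> \<omega> * (W (real l / real n) \<omega> - W (real k / real n) \<omega>) $ i \<partial>M) = 0" for i by (rule mean_incr[OF kl xi c])
  have xa: "(\<lambda>\<omega>. \<bar>\<xi> \<omega>\<bar>) \<in> borel_measurable (F (real k / real n))" using xi by measurable
  have ca: "\<forall>\<omega>\<in>space M. 0 \<le> \<bar>\<xi> \<omega>\<bar> \<and> \<bar>\<xi> \<omega>\<bar> \<le> c" using c by simp
  note N = norm_incr[OF kl xa ca]
  have xM: "\<xi> \<in> borel_measurable M" by (rule sub_prob.sub_M[OF sub_F[OF kl(1)] xi])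
  have [measurable]: "W (real l / real n) \<in> borel_measurable M" "W (real k / real n) \<in> borel_measurable M" by auto
  have "integrable M (\<lambda>\<omega>. \<xi> \<omega> * (norm (W (real l / real n) \<omega> - W (real k / real n) \<omega>))\<^sup>2)"
    by (rule Bochner_Integration.integrable_bound[OF N(1)]) (use xM in \<open>auto simp: abs_mult\<close>)
  then have "(\<integral>\<omega>. \<xi> \<omega> * (norm (W (real l / real n) \<omega> - W (real k / real n) \<omega>))\<^sup>2 \<partial>M) \<le>
      (\<integral>\<omega>. \<bar>\<xi> \<omega>\<bar> * (norm (W (real l / real n) \<omega> - W (real k / real n) \<omega>))\<^sup>2 \<partial>M)"
    by (rule integral_mono[OF _ N(1)]) (simp add: mult_right_mono)
  also have "\<dots> \<le> D * (real (l - k) * (1 / real n)) * (\<integral>\<omega>. \<bar>\<xi> \<omega>\<bar> \<partial>M)" using N(2) unfolding kl' .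
  finally show "(\<integral>\<omega>. \<xi> \<omega> * (norm (W (real l / real n) \<omega> - W (real k / real n) \<omega>))\<^sup>2 \<partial>M) \<le> D * (real (l - k) * (1 / real n)) * (\<integral>\<omega>. \<bar>\<xi> \<omega>\<bar> \<partial>M)" .
qed

section \<open>Algebra of the contrast\<close>

text \<open>The squared residuals at \<open>\<theta>\<^sub>0\<close> cancel, which removes the term
  quadratic in the noise. What is left is a square of the drift difference and one term linear in
  the residuals.\<close>

lemma lse_contrast_difference:
  assumes n: "0 < n" and \<epsilon>: "0 < \<epsilon>"
  shows "\<epsilon>\<^sup>2 * (lse_contrast b n \<epsilon> x \<theta> - lse_contrast b n \<epsilon> x \<theta>\<^sub>0) =
    (\<Sum>k<n. (norm (b (x (real k / real n)) \<theta> - b (x (real k / real n)) \<theta>\<^sub>0))\<^sup>2) / real n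
    - 2 * (\<Sum>k<n. (x (real (Suc k) / real n) - x (real k / real n) - (1 / real n) *\<^sub>R b (x (real k / real n)) \<theta>\<^sub>0)
        \<bullet> (b (x (real k / real n)) \<theta> - b (x (real k / real n)) \<theta>\<^sub>0))"
proof -
  define r where "r k = x (real (Suc k) / real n) - x (real k / real n) - (1 / real n) *\<^sub>R b (x (real k / real n)) \<theta>\<^sub>0" for k
  define g where "g k = b (x (real k / real n)) \<theta> - b (x (real k / real n)) \<theta>\<^sub>0" for k
  have lse: "\<epsilon>\<^sup>2 * lse_contrast b n \<epsilon> x \<theta>' = (\<Sum>k<n. real n * (norm (x (real (Suc k) / real n) - x (real k / real n) - (1 / real n) *\<^sub>R b (x (real k / real n)) \<theta>'))\<^sup>2)" for \<theta>'
  proof -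
    have "\<epsilon>\<^sup>2 * lse_contrast b n \<epsilon> x \<theta>' = (\<Sum>k=1..n. real n * (norm (x (real k / real n) - x (real (k - 1) / real n) - (1 / real n) *\<^sub>R b (x (real (k - 1) / real n)) \<theta>'))\<^sup>2)"
      unfolding lse_contrast_def sum_distrib_left using n \<epsilon> by (intro sum.cong) auto
    also have "\<dots> = (\<Sum>k<n. real n * (norm (x (real (Suc k) / real n) - x (real k / real n) - (1 / real n) *\<^sub>R b (x (real k / real n)) \<theta>'))\<^sup>2)"
      by (rule sum.reindex_bij_witness[of _ Suc "\<lambda>k. k - 1"]) auto
    finally show ?thesis .
  qed
  have th: "x (real (Suc k) / real n) - x (real k / real n) - (1 / real n) *\<^sub>R b (x (real k / real n)) \<theta> = r k - (1 / real n) *\<^sub>R g k" for k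
    by (simp add: r_def g_def algebra_simps)
  have "\<epsilon>\<^sup>2 * (lse_contrast b n \<epsilon> x \<theta> - lse_contrast b n \<epsilon> x \<theta>\<^sub>0) = (\<Sum>k<n. real n * ((norm (r k - (1 / real n) *\<^sub>R g k))\<^sup>2 - (norm (r k))\<^sup>2))"
    unfolding right_diff_distrib lse th r_def[symmetric] sum_subtractf ..
  also have "\<dots> = (\<Sum>k<n. (norm (g k))\<^sup>2 / real n - 2 * (r k \<bullet> g k))"
  proof (rule sum.cong[OF refl])
    fix k
    have "(norm (r k - (1 / real n) *\<^sub>R g k))\<^sup>2 = (norm (r k))\<^sup>2 - 2 * (r k \<bullet> g k) / real n + (norm (g k))\<^sup>2 / (real n)\<^sup>2"
      unfolding power2_norm_eq_inner by (simp add: inner_diff_left inner_diff_right inner_commute power2_eq_square)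
    then show "real n * ((norm (r k - (1 / real n) *\<^sub>R g k))\<^sup>2 - (norm (r k))\<^sup>2) = (norm (g k))\<^sup>2 / real n - 2 * (r k \<bullet> g k)"
      using n by (simp add: field_simps power2_eq_square)
  qed
  finally show ?thesis by (simp add: sum_subtractf sum_divide_distrib sum_distrib_left r_def g_def)
qed

lemma norm_vec_bound: "(\<And>i. \<bar>y $ i\<bar> \<le> B) \<Longrightarrow> norm (y :: real ^ 'd) \<le> real CARD('d) * B"
  using order_trans[OF norm_le_l1_cart sum_mono[of UNIV "\<lambda>i. \<bar>y $ i\<bar>" "\<lambda>_. B"]] by simp

text \<open>\<open>\<rho>\<close> is the Euler error and \<open>dL\<close> the noise in the
  residual. The drift difference is split into its linearisation by \<open>f\<close>, which produces
  \<open>s\<close> up to small errors, and a remainder of second order. The coefficients of the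
  parameter distance have to become small, those of its square merely bounded.\<close>

lemma contrast_expansion:
  fixes b :: "real ^ 'd \<Rightarrow> real ^ 'p \<Rightarrow> real ^ 'd" and f :: "'p \<Rightarrow> real ^ 'd \<Rightarrow> real ^ 'd"
  assumes \<epsilon>: "0 < \<epsilon>" and K: "0 \<le> K" and dL: "\<And>k. dL k = dA k + dW k"
    and xR: "\<And>k. k < n \<Longrightarrow> norm (x k) \<le> R"
    and g: "\<And>i. \<exists>Dg. C2_on R (K * norm (\<theta> - \<theta>\<^sub>0)) (\<lambda>y. b y \<theta> $ i - b y \<theta>\<^sub>0 $ i) Dg"
    and h: "\<And>i. \<exists>Dh. C2_on R (K * (norm (\<theta> - \<theta>\<^sub>0))\<^sup>2) (\<lambda>y. b y \<theta> $ i - b y \<theta>\<^sub>0 $ i - (\<Sum>j\<in>UNIV. (\<theta> - \<theta>\<^sub>0) $ j * f j y $ i)) Dh"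
    and \<rho>: "(\<Sum>k<n. norm (\<rho> k)) \<le> \<epsilon> * \<gamma>1" and A: "(\<Sum>k<n. norm (dA k)) \<le> c"
    and Q: "\<And>i K f Df. C2_on R K f Df \<Longrightarrow> \<bar>\<Sum>k<n. f (x k) * dW k $ i\<bar> \<le> K * Qb"
    and S: "\<And>j. \<bar>(\<Sum>k<n. f j (x k) \<bullet> dL k) - s $ j\<bar> \<le> \<gamma>2"
  shows "\<bar>(\<Sum>k<n. (\<rho> k + \<epsilon> *\<^sub>R dL k) \<bullet> (b (x k) \<theta> - b (x k) \<theta>\<^sub>0)) - \<epsilon> * (s \<bullet> (\<theta> - \<theta>\<^sub>0))\<bar> \<le>
    \<epsilon> * ((\<gamma>1 * (real CARD('d) * K) + real CARD('p) * \<gamma>2) * norm (\<theta> - \<theta>\<^sub>0) + (c * (real CARD('d) * K) + real CARD('d) * (K * Qb)) * (norm (\<theta> - \<theta>\<^sub>0))\<^sup>2)"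
proof -
  let ?v = "\<theta> - \<theta>\<^sub>0" and ?d = "real CARD('d)" and ?p = "real CARD('p)"
  define G where "G k = b (x k) \<theta> - b (x k) \<theta>\<^sub>0" for k
  define H where "H y = b y \<theta> - b y \<theta>\<^sub>0 - (\<Sum>j\<in>UNIV. ?v $ j *\<^sub>R f j y)" for y
  have Hi: "H y $ i = b y \<theta> $ i - b y \<theta>\<^sub>0 $ i - (\<Sum>j\<in>UNIV. ?v $ j * f j y $ i)" for y i by (simp add: H_def)
  have Gb: "norm (G k) \<le> ?d * (K * norm ?v)" if "k < n" for k
    by (rule norm_vec_bound) (use g C2_on_bound[OF _ xR[OF that]] in \<open>fastforce simp: G_def\<close>)
  have Hb: "norm (H (x k)) \<le> ?d * (K * (norm ?v)\<^sup>2)" if "k < n" for k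
  proof (rule norm_vec_bound)
    fix i
    obtain Dh where "C2_on R (K * (norm ?v)\<^sup>2) (\<lambda>y. H y $ i) Dh" using h[of i] unfolding Hi by blast
    from C2_on_bound[OF this xR[OF that]] show "\<bar>H (x k) $ i\<bar> \<le> K * (norm ?v)\<^sup>2" .
  qed
  have G_split: "G k = (\<Sum>j\<in>UNIV. ?v $ j *\<^sub>R f j (x k)) + H (x k)" for k by (simp add: G_def H_def)
  have T1: "\<bar>\<Sum>k<n. \<rho> k \<bullet> G k\<bar> \<le> \<epsilon> * (\<gamma>1 * (?d * K) * norm ?v)"
  proof -
    have "\<bar>\<Sum>k<n. \<rho> k \<bullet> G k\<bar> \<le> (\<Sum>k<n. norm (\<rho> k) * (?d * (K * norm ?v)))"
      by (rule order_trans[OF sum_abs], rule sum_mono, rule order_trans[OF Cauchy_Schwarz_ineq2], rule mult_left_mono[OF Gb]) auto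
    also have "\<dots> = (\<Sum>k<n. norm (\<rho> k)) * (?d * (K * norm ?v))" by (simp add: sum_distrib_right)
    also have "\<dots> \<le> \<epsilon> * \<gamma>1 * (?d * (K * norm ?v))" using K by (intro mult_right_mono[OF \<rho>]) simp
    finally show ?thesis by (simp add: ac_simps)
  qed
  have T2: "\<bar>(\<Sum>j\<in>UNIV. ?v $ j * (\<Sum>k<n. f j (x k) \<bullet> dL k)) - s \<bullet> ?v\<bar> \<le> ?p * \<gamma>2 * norm ?v"
  proof -
    have "(\<Sum>j\<in>UNIV. ?v $ j * (\<Sum>k<n. f j (x k) \<bullet> dL k)) - s \<bullet> ?v = (\<Sum>j\<in>UNIV. ?v $ j * ((\<Sum>k<n. f j (x k) \<bullet> dL k) - s $ j))"
      unfolding inner_vec_def sum_subtractf[symmetric] by (intro sum.cong refl) (simp add: algebra_simps)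
    also have "\<bar>\<dots>\<bar> \<le> (\<Sum>j\<in>(UNIV::'p set). norm ?v * \<gamma>2)"
      by (rule order_trans[OF sum_abs], rule sum_mono, unfold abs_mult, rule mult_mono[OF component_le_norm_cart S]) auto
    finally show ?thesis by (simp add: ac_simps)
  qed
  have T3: "\<bar>\<Sum>k<n. dA k \<bullet> H (x k)\<bar> \<le> c * (?d * K) * (norm ?v)\<^sup>2"
  proof -
    have "\<bar>\<Sum>k<n. dA k \<bullet> H (x k)\<bar> \<le> (\<Sum>k<n. norm (dA k) * (?d * (K * (norm ?v)\<^sup>2)))"
      by (rule order_trans[OF sum_abs], rule sum_mono, rule order_trans[OF Cauchy_Schwarz_ineq2], rule mult_left_mono[OF Hb]) auto
    also have "\<dots> = (\<Sum>k<n. norm (dA k)) * (?d * (K * (norm ?v)\<^sup>2))" by (simp add: sum_distrib_right)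
    also have "\<dots> \<le> c * (?d * (K * (norm ?v)\<^sup>2))" using K by (intro mult_right_mono[OF A]) simp
    finally show ?thesis by (simp add: ac_simps)
  qed
  \<comment> \<open>The integrand \<open>H\<close> depends on the parameter, for which the random
    minimiser is inserted later; a bound holding for all integrands at once permits this.\<close>
  have T4: "\<bar>\<Sum>k<n. dW k \<bullet> H (x k)\<bar> \<le> ?d * (K * Qb) * (norm ?v)\<^sup>2"
  proof -
    have "(\<Sum>k<n. dW k \<bullet> H (x k)) = (\<Sum>i\<in>UNIV. \<Sum>k<n. H (x k) $ i * dW k $ i)"
      unfolding inner_vec_def by (subst sum.swap) (simp add: mult.commute)
    also have "\<bar>\<dots>\<bar> \<le> (\<Sum>i\<in>(UNIV::'d set). K * (norm ?v)\<^sup>2 * Qb)"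
    proof (rule order_trans[OF sum_abs], rule sum_mono)
      fix i
      obtain Dh where "C2_on R (K * (norm ?v)\<^sup>2) (\<lambda>y. H y $ i) Dh" using h[of i] unfolding Hi by blast
      from Q[OF this] show "\<bar>\<Sum>k<n. H (x k) $ i * dW k $ i\<bar> \<le> K * (norm ?v)\<^sup>2 * Qb" .
    qed
    finally show ?thesis by (simp add: ac_simps)
  qed
  have "(\<Sum>k<n. dL k \<bullet> G k) = (\<Sum>k<n. (\<Sum>j\<in>UNIV. ?v $ j * (f j (x k) \<bullet> dL k)) + (dA k \<bullet> H (x k) + dW k \<bullet> H (x k)))"
    by (intro sum.cong refl) (simp add: G_split inner_add_right inner_sum_right inner_add_left dL inner_commute)
  also have "\<dots> = (\<Sum>j\<in>UNIV. ?v $ j * (\<Sum>k<n. f j (x k) \<bullet> dL k)) + ((\<Sum>k<n. dA k \<bullet> H (x k)) + (\<Sum>k<n. dW k \<bullet> H (x k)))"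
    unfolding sum.distrib sum_distrib_left by (subst sum.swap) simp
  finally have "\<bar>(\<Sum>k<n. dL k \<bullet> G k) - s \<bullet> ?v\<bar> \<le> ?p * \<gamma>2 * norm ?v + (c * (?d * K) * (norm ?v)\<^sup>2 + ?d * (K * Qb) * (norm ?v)\<^sup>2)"
    using T2 T3 T4 by linarith
  then have e: "\<epsilon> * \<bar>(\<Sum>k<n. dL k \<bullet> G k) - s \<bullet> ?v\<bar> \<le> \<epsilon> * (?p * \<gamma>2 * norm ?v + (c * (?d * K) * (norm ?v)\<^sup>2 + ?d * (K * Qb) * (norm ?v)\<^sup>2))"
    using \<epsilon> by (intro mult_left_mono) auto
  have "(\<Sum>k<n. (\<rho> k + \<epsilon> *\<^sub>R dL k) \<bullet> G k) - \<epsilon> * (s \<bullet> ?v) = (\<Sum>k<n. \<rho> k \<bullet> G k) + \<epsilon> * ((\<Sum>k<n. dL k \<bullet> G k) - s \<bullet> ?v)"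
    by (simp add: inner_add_left sum.distrib sum_distrib_left right_diff_distrib)
  also have "\<bar>\<dots>\<bar> \<le> \<bar>\<Sum>k<n. \<rho> k \<bullet> G k\<bar> + \<epsilon> * \<bar>(\<Sum>k<n. dL k \<bullet> G k) - s \<bullet> ?v\<bar>"
    by (rule order_trans[OF abs_triangle_ineq]) (use \<epsilon> in \<open>simp add: abs_mult\<close>)
  also have "\<dots> \<le> \<epsilon> * (\<gamma>1 * (?d * K) * norm ?v) + \<epsilon> * (?p * \<gamma>2 * norm ?v + (c * (?d * K) * (norm ?v)\<^sup>2 + ?d * (K * Qb) * (norm ?v)\<^sup>2))"
    by (rule add_mono[OF T1 e])
  finally show ?thesis unfolding G_def by (simp add: algebra_simps)
qed

text \<open>A deterministic continuous integrand is approximated uniformly by its left-endpoint step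
  functions, without any exceptional event, so the characterisation of the integral applies to the
  observation grid itself.\<close>

lemma stoch_integral_grid:
  fixes L :: "real \<Rightarrow> 'w \<Rightarrow> 'b::euclidean_space"
  assumes P: "prob_space M" and S: "has_stoch_integral M F (\<lambda>s \<omega>. H s) L 1 Y"
  shows "tendsto_in_prob M (\<lambda>n \<omega>. \<Sum>k<n. H (real k / real n) \<bullet> (L (real (Suc k) / real n) \<omega> - L (real k / real n) \<omega>)) Y sequentially"
proof -
  interpret prob_space M by fact
  obtain \<omega>0 where "\<omega>0 \<in> space M" using not_empty by blast
  then have Hc: "continuous_on {0..1} H" using S unfolding has_stoch_integral_def by blast
  \<comment> \<open>Grid number \<open>k\<close> has \<open>Suc k\<close> cells, as a partition of
    \<open>(0,1]\<close> has at least one; \<open>LIMSEQ_imp_Suc\<close> undoes the shift at the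
    end.\<close>
  define \<tau> where "\<tau> k i = real i / real (Suc k)" for k i :: nat
  define \<xi> where "\<xi> k i = (\<lambda>\<omega>::'w. H (\<tau> k i))" for k i
  have simple: "simple_integrand M F 1 (Suc k) (\<tau> k) (\<xi> k)" for k
    unfolding simple_integrand_def \<tau>_def \<xi>_def by (auto simp: divide_strict_right_mono intro: bounded_subset[of "{H (real _ / (1 + real k))}"] finite_imp_bounded)
  have unif: "(\<lambda>k. measure M {\<omega> \<in> space M. \<exists>s\<in>{0<..1}. dist (simple_process (Suc k) (\<tau> k) (\<xi> k) s \<omega>) (H s) > \<eta>}) \<longlonglongrightarrow> 0" if \<eta>: "0 < \<eta>" for \<eta>
  proof -
    have "uniformly_continuous_on {0..1} H" by (rule compact_uniformly_continuous[OF Hc]) simp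
    then obtain d where d: "0 < d" "\<And>s t. s \<in> {0..1} \<Longrightarrow> t \<in> {0..1} \<Longrightarrow> dist t s < d \<Longrightarrow> dist (H t) (H s) < \<eta>"
      unfolding uniformly_continuous_on_def using \<eta> by metis
    obtain k0 where k0: "1 / real (Suc k0) < d" using reals_Archimedean[OF d(1)] by (auto simp: inverse_eq_divide)
    have "{\<omega> \<in> space M. \<exists>s\<in>{0<..1}. dist (simple_process (Suc k) (\<tau> k) (\<xi> k) s \<omega>) (H s) > \<eta>} = {}" if k: "k0 \<le> k" for k
    proof -
      have "dist (simple_process (Suc k) (\<tau> k) (\<xi> k) s \<omega>) (H s) \<le> \<eta>" if s: "s \<in> {0<..1}" for s \<omega>
      proof -
        \<comment> \<open>Cells are open on the left and closed on the right, so \<open>s\<close>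
          lies in the cell numbered by the ceiling minus one.\<close>
        define j where "j = nat (\<lceil>real (Suc k) * s\<rceil> - 1)"
        have c: "0 < \<lceil>real (Suc k) * s\<rceil>" "\<lceil>real (Suc k) * s\<rceil> \<le> int (Suc k)"
        proof -
          show "0 < \<lceil>real (Suc k) * s\<rceil>" using s by simp
          have "real (Suc k) * s \<le> real (Suc k) * 1" using s by (intro mult_left_mono) auto
          then show "\<lceil>real (Suc k) * s\<rceil> \<le> int (Suc k)" by (intro ceiling_le) simp
        qed
        have jr: "real j = of_int \<lceil>real (Suc k) * s\<rceil> - 1" unfolding j_def using c by simp
        have jk: "j < Suc k" using c unfolding j_def by linarith
        have "real j < real (Suc k) * s" "real (Suc k) * s \<le> real j + 1"
          unfolding jr using ceiling_correct[of "real (Suc k) * s"] by auto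
        then have sj: "\<tau> k j < s" "s \<le> \<tau> k (Suc j)" unfolding \<tau>_def by (auto simp: field_simps)
        have mono: "\<tau> k i \<le> \<tau> k i'" if "i \<le> i'" for i i' using that unfolding \<tau>_def by (simp add: divide_right_mono)
        have "simple_process (Suc k) (\<tau> k) (\<xi> k) s \<omega> = (\<Sum>i<Suc k. if i = j then H (\<tau> k j) else 0)"
          unfolding simple_process_def
        proof (rule sum.cong[OF refl])
          fix i
          have "s \<in> {\<tau> k i<..\<tau> k (Suc i)} \<longleftrightarrow> i = j"
          proof
            assume si: "s \<in> {\<tau> k i<..\<tau> k (Suc i)}"
            show "i = j"
            proof (rule ccontr)
              assume "i \<noteq> j"
              then have "Suc i \<le> j \<or> Suc j \<le> i" by auto
              then show False using mono[of "Suc i" j] mono[of "Suc j" i] si sj by auto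
            qed
          qed (use sj in auto)
          then show "indicator {\<tau> k i<..\<tau> k (Suc i)} s *\<^sub>R \<xi> k i \<omega> = (if i = j then H (\<tau> k j) else 0)"
            by (auto simp: indicator_def \<xi>_def)
        qed
        also have "\<dots> = H (\<tau> k j)" using jk by simp
        finally have eq: "simple_process (Suc k) (\<tau> k) (\<xi> k) s \<omega> = H (\<tau> k j)" .
        have "1 / real (Suc k) \<le> 1 / real (Suc k0)" using k by (intro divide_left_mono) auto
        moreover have "\<tau> k (Suc j) = \<tau> k j + 1 / real (Suc k)" unfolding \<tau>_def by (simp add: add_divide_distrib)
        moreover have "0 \<le> \<tau> k j" unfolding \<tau>_def by simp
        ultimately have "dist (\<tau> k j) s < d" "\<tau> k j \<in> {0..1}" using sj k0 s by (auto simp: dist_real_def)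
        then show ?thesis unfolding eq using d(2)[of s "\<tau> k j"] s by auto
      qed
      then show ?thesis by (auto simp: not_less)
    qed
    note empty = this
    have "\<forall>\<^sub>F k in sequentially. measure M {\<omega> \<in> space M. \<exists>s\<in>{0<..1}. dist (simple_process (Suc k) (\<tau> k) (\<xi> k) s \<omega>) (H s) > \<eta>} = 0"
      unfolding eventually_sequentially
    proof (intro exI[of _ k0] allI impI)
      show "measure M {\<omega> \<in> space M. \<exists>s\<in>{0<..1}. dist (simple_process (Suc k) (\<tau> k) (\<xi> k) s \<omega>) (H s) > \<eta>} = 0" if "k0 \<le> k" for k
        by (simp only: empty[OF that] measure_empty)
    qed
    then show ?thesis by (rule tendsto_eventually)
  qed
  have t: "tendsto_in_prob M (\<lambda>k. simple_integral (Suc k) (\<tau> k) (\<xi> k) L) Y sequentially"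
    using S[unfolded has_stoch_integral_def, THEN conjunct2, THEN conjunct2, THEN conjunct2, rule_format, of Suc \<tau> \<xi>] simple unif by blast
  show ?thesis
    unfolding tendsto_in_prob_def
  proof (intro allI impI)
    fix \<eta> :: real assume "0 < \<eta>"
    then have "(\<lambda>k. measure M {\<omega> \<in> space M. dist (simple_integral (Suc k) (\<tau> k) (\<xi> k) L \<omega>) (Y \<omega>) > \<eta>}) \<longlonglongrightarrow> 0"
      using t unfolding tendsto_in_prob_def by blast
    then have "(\<lambda>k. measure M {\<omega> \<in> space M. dist (\<Sum>i<Suc k. H (real i / real (Suc k)) \<bullet> (L (real (Suc i) / real (Suc k)) \<omega> - L (real i / real (Suc k)) \<omega>)) (Y \<omega>) > \<eta>}) \<longlonglongrightarrow> 0"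
      unfolding simple_integral_def \<tau>_def \<xi>_def .
    then show "(\<lambda>n. measure M {\<omega> \<in> space M. dist (\<Sum>i<n. H (real i / real n) \<bullet> (L (real (Suc i) / real n) \<omega> - L (real i / real n) \<omega>)) (Y \<omega>) > \<eta>}) \<longlonglongrightarrow> 0"
      by (rule LIMSEQ_imp_Suc)
  qed
qed

text \<open>Near \<open>\<theta>\<^sub>0\<close> the form of the information matrix dominates the
  cubic error; away from it \<open>q\<close> is continuous and, by identifiability, positive on a
  compact set. The cubic error comes from factoring a difference of squared norms: one factor is of
  order two in the parameter distance, the other of order one.\<close>

lemma identification:
  fixes b :: "real ^ 'd \<Rightarrow> real ^ 'p \<Rightarrow> real ^ 'd" and f :: "'p \<Rightarrow> real ^ 'd \<Rightarrow> real ^ 'd" and X0 :: "real \<Rightarrow> real ^ 'd"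
  assumes cont: "continuous_on (UNIV \<times> \<Theta>) (\<lambda>(x, \<theta>). b x \<theta>)" and X0c: "continuous_on {0..1} X0"
    and X0R: "\<And>t. t \<in> {0..1} \<Longrightarrow> norm (X0 t) \<le> R" and \<Theta>: "compact \<Theta>" "\<theta>\<^sub>0 \<in> \<Theta>" and K: "0 \<le> K"
    and f: "\<And>i j. \<exists>Df. C2_on R K (\<lambda>x. f j x $ i) Df"
    and g: "\<And>\<theta> i. \<theta> \<in> \<Theta> \<Longrightarrow> \<exists>Dg. C2_on R (K * norm (\<theta> - \<theta>\<^sub>0)) (\<lambda>x. b x \<theta> $ i - b x \<theta>\<^sub>0 $ i) Dg"
    and h: "\<And>\<theta> i. \<theta> \<in> \<Theta> \<Longrightarrow> \<exists>Dh. C2_on R (K * (norm (\<theta> - \<theta>\<^sub>0))\<^sup>2) (\<lambda>x. b x \<theta> $ i - b x \<theta>\<^sub>0 $ i - (\<Sum>j\<in>UNIV. (\<theta> - \<theta>\<^sub>0) $ j * f j x $ i)) Dh"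
    and A3: "\<And>\<theta>. \<theta> \<in> \<Theta> \<Longrightarrow> \<theta> \<noteq> \<theta>\<^sub>0 \<Longrightarrow> \<exists>t\<in>{0..1}. b (X0 t) \<theta> \<noteq> b (X0 t) \<theta>\<^sub>0"
    and l: "0 < l" "\<And>v. l * (norm v)\<^sup>2 \<le> v \<bullet> ((\<chi> i j. integral {0..1} (\<lambda>s. f i (X0 s) \<bullet> f j (X0 s))) *v v)"
  defines "q \<equiv> \<lambda>\<theta>. integral {0..1} (\<lambda>s. (norm (b (X0 s) \<theta> - b (X0 s) \<theta>\<^sub>0))\<^sup>2)"
  shows "\<exists>c C. 0 < c \<and> 0 \<le> C \<and> (\<forall>\<theta>\<in>\<Theta>. c * (norm (\<theta> - \<theta>\<^sub>0))\<^sup>2 \<le> q \<theta> \<and>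
     \<bar>q \<theta> - (\<theta> - \<theta>\<^sub>0) \<bullet> ((\<chi> i j. integral {0..1} (\<lambda>s. f i (X0 s) \<bullet> f j (X0 s))) *v (\<theta> - \<theta>\<^sub>0))\<bar> \<le> C * norm (\<theta> - \<theta>\<^sub>0) ^ 3)"
proof -
  let ?d = "real CARD('d)" and ?p = "real CARD('p)"
  let ?A = "\<chi> i j. integral {0..1} (\<lambda>s. f i (X0 s) \<bullet> f j (X0 s)) :: real ^ 'p ^ 'p"
  have fc: "continuous_on {0..1} (\<lambda>s. f j (X0 s))" for j
  proof (rule continuous_on_componentwise[THEN iffD2], rule ballI)
    fix e :: "real ^ 'd" assume "e \<in> Basis"
    then obtain i where e: "e = axis i 1" by (auto simp: Basis_vec_def)
    obtain Df where Df: "C2_on R K (\<lambda>x. f j x $ i) Df" using f by blast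
    have "(K * (1 + 2 * R))-lipschitz_on (cball 0 R) (\<lambda>x. f j x $ i)" if "0 \<le> R"
    proof (rule lipschitz_onI)
      show "dist (f j x $ i) (f j y $ i) \<le> K * (1 + 2 * R) * dist x y" if "x \<in> cball 0 R" "y \<in> cball 0 R" for x y
        using C2_on_lipschitz[OF Df, of y x] that by (simp add: dist_norm)
      show "0 \<le> K * (1 + 2 * R)" using K that by simp
    qed
    then have "continuous_on (cball 0 R) (\<lambda>x. f j x $ i)"
      by (cases "0 \<le> R") (auto intro: lipschitz_on_continuous_on)
    then have "continuous_on {0..1} (\<lambda>s. f j (X0 s) $ i)"
      by (rule continuous_on_compose2[OF _ X0c]) (use X0R in auto)
    then show "continuous_on {0..1} (\<lambda>s. f j (X0 s) \<bullet> e)" by (simp add: e inner_axis)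
  qed
  have bc: "continuous_on (\<Theta> \<times> {0..1}) (\<lambda>(\<theta>, s). b (X0 s) \<theta>)"
  proof -
    have "continuous_on (\<Theta> \<times> {0..1}) (\<lambda>y. (\<lambda>(x, \<theta>). b x \<theta>) (X0 (snd y), fst y))"
      by (rule continuous_on_compose2[OF cont]) (auto intro!: continuous_intros continuous_on_compose2[OF X0c])
    then show ?thesis by (simp add: case_prod_beta')
  qed
  have bs: "continuous_on {0..1} (\<lambda>s. b (X0 s) \<theta>)" if "\<theta> \<in> \<Theta>" for \<theta>
  proof -
    have "continuous_on {0..1} (\<lambda>s. (\<lambda>(\<theta>, s). b (X0 s) \<theta>) (\<theta>, s))"
      by (rule continuous_on_compose2[OF bc]) (use that in \<open>auto intro!: continuous_intros\<close>)
    then show ?thesis by simp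
  qed
  have qs: "continuous_on {0..1} (\<lambda>s. (norm (b (X0 s) \<theta> - b (X0 s) \<theta>\<^sub>0))\<^sup>2)" if "\<theta> \<in> \<Theta>" for \<theta>
    by (intro continuous_intros bs that \<Theta>)
  have qc: "continuous_on \<Theta> q"
  proof -
    have b0: "continuous_on (\<Theta> \<times> {0..1}) (\<lambda>y. b (X0 (snd y)) \<theta>\<^sub>0)"
      by (rule continuous_on_compose2[OF bs[OF \<Theta>(2)]]) (auto intro!: continuous_intros)
    have "continuous_on (\<Theta> \<times> {0..1}) (\<lambda>y. (norm (b (X0 (snd y)) (fst y) - b (X0 (snd y)) \<theta>\<^sub>0))\<^sup>2)"
      using bc b0 by (intro continuous_intros) (auto simp: case_prod_beta')
    then have "continuous_on (\<Theta> \<times> cbox 0 1) (\<lambda>(\<theta>, s). (norm (b (X0 s) \<theta> - b (X0 s) \<theta>\<^sub>0))\<^sup>2)" by (simp add: case_prod_beta')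
    from integral_continuous_on_param[OF this] show ?thesis by (simp add: q_def)
  qed
  have quad: "v \<bullet> (?A *v v) = integral {0..1} (\<lambda>s. (norm (\<Sum>j\<in>UNIV. v $ j *\<^sub>R f j (X0 s)))\<^sup>2)" for v
  proof -
    have ii: "(\<lambda>s. f i (X0 s) \<bullet> f j (X0 s)) integrable_on {0..1}" for i j
      by (intro integrable_continuous_interval continuous_on_inner fc)
    have "v \<bullet> (?A *v v) = (\<Sum>i\<in>UNIV. \<Sum>j\<in>UNIV. v $ i * v $ j * integral {0..1} (\<lambda>s. f i (X0 s) \<bullet> f j (X0 s)))"
      unfolding inner_vec_def matrix_vector_mult_def by (simp add: sum_distrib_left ac_simps)
    also have "\<dots> = (\<Sum>i\<in>UNIV. \<Sum>j\<in>UNIV. integral {0..1} (\<lambda>s. v $ i * v $ j * (f i (X0 s) \<bullet> f j (X0 s))))" by simp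
    also have "\<dots> = integral {0..1} (\<lambda>s. \<Sum>i\<in>UNIV. \<Sum>j\<in>UNIV. v $ i * v $ j * (f i (X0 s) \<bullet> f j (X0 s)))"
      using ii by (subst integral_sum, simp, intro integrable_sum integrable_on_mult_right, simp, simp, subst integral_sum) (auto intro!: integrable_on_mult_right)
    also have "\<dots> = integral {0..1} (\<lambda>s. (norm (\<Sum>j\<in>UNIV. v $ j *\<^sub>R f j (X0 s)))\<^sup>2)"
      unfolding power2_norm_eq_inner inner_sum_left inner_sum_right by (simp add: ac_simps inner_commute)
    finally show ?thesis .
  qed
  define C where "C = ?d * K * (?d * K + ?p * (?d * K))"
  have C0: "0 \<le> C" unfolding C_def using K by simp
  have near: "\<bar>q \<theta> - (\<theta> - \<theta>\<^sub>0) \<bullet> (?A *v (\<theta> - \<theta>\<^sub>0))\<bar> \<le> C * norm (\<theta> - \<theta>\<^sub>0) ^ 3" if t: "\<theta> \<in> \<Theta>" for \<theta>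
  proof -
    let ?v = "\<theta> - \<theta>\<^sub>0"
    let ?G = "\<lambda>s. b (X0 s) \<theta> - b (X0 s) \<theta>\<^sub>0" and ?F = "\<lambda>s. \<Sum>j\<in>UNIV. ?v $ j *\<^sub>R f j (X0 s)"
    have pw: "\<bar>(norm (?G s))\<^sup>2 - (norm (?F s))\<^sup>2\<bar> \<le> C * norm ?v ^ 3" if s: "s \<in> {0..1}" for s
    proof -
      have G: "norm (?G s) \<le> ?d * (K * norm ?v)"
      proof (rule norm_vec_bound)
        fix i
        obtain Dg where "C2_on R (K * norm ?v) (\<lambda>x. b x \<theta> $ i - b x \<theta>\<^sub>0 $ i) Dg" using g[OF t] by blast
        from C2_on_bound[OF this X0R[OF s]] show "\<bar>?G s $ i\<bar> \<le> K * norm ?v" by simp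
      qed
      have H: "norm (?G s - ?F s) \<le> ?d * (K * (norm ?v)\<^sup>2)"
      proof (rule norm_vec_bound)
        fix i
        obtain Dh where "C2_on R (K * (norm ?v)\<^sup>2) (\<lambda>x. b x \<theta> $ i - b x \<theta>\<^sub>0 $ i - (\<Sum>j\<in>UNIV. ?v $ j * f j x $ i)) Dh" using h[OF t] by blast
        from C2_on_bound[OF this X0R[OF s]] show "\<bar>(?G s - ?F s) $ i\<bar> \<le> K * (norm ?v)\<^sup>2" by simp
      qed
      have F: "norm (?F s) \<le> ?p * (?d * K) * norm ?v"
      proof -
        have "norm (?F s) \<le> (\<Sum>j\<in>(UNIV::'p set). norm ?v * (?d * K))"
        proof (rule order_trans[OF norm_sum], rule sum_mono)
          fix j
          have "norm (f j (X0 s)) \<le> ?d * K"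
          proof (rule norm_vec_bound)
            fix i
            obtain Df where "C2_on R K (\<lambda>x. f j x $ i) Df" using f by blast
            from C2_on_bound[OF this X0R[OF s]] show "\<bar>f j (X0 s) $ i\<bar> \<le> K" .
          qed
          then show "norm (?v $ j *\<^sub>R f j (X0 s)) \<le> norm ?v * (?d * K)"
            unfolding norm_scaleR real_norm_def using component_le_norm_cart[of ?v j] by (intro mult_mono) auto
        qed
        then show ?thesis by (simp add: ac_simps)
      qed
      have "\<bar>(norm (?G s))\<^sup>2 - (norm (?F s))\<^sup>2\<bar> = \<bar>norm (?G s) - norm (?F s)\<bar> * (norm (?G s) + norm (?F s))"
        unfolding power2_eq_square square_diff_square_factored by (simp add: abs_mult mult.commute)
      also have "\<dots> \<le> norm (?G s - ?F s) * (norm (?G s) + norm (?F s))"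
        by (intro mult_right_mono norm_triangle_ineq3) simp
      also have "\<dots> \<le> ?d * (K * (norm ?v)\<^sup>2) * (?d * (K * norm ?v) + ?p * (?d * K) * norm ?v)"
        using G H F K by (intro mult_mono add_mono) auto
      also have "\<dots> = C * norm ?v ^ 3" by (simp add: C_def power2_eq_square power3_eq_cube algebra_simps)
      finally show ?thesis .
    qed
    have Fc: "continuous_on {0..1} (\<lambda>s. (norm (?F s))\<^sup>2)" by (intro continuous_intros fc)
    have "q \<theta> - ?v \<bullet> (?A *v ?v) = integral {0..1} (\<lambda>s. (norm (?G s))\<^sup>2 - (norm (?F s))\<^sup>2)"
      unfolding quad q_def by (rule integral_diff[symmetric]) (intro integrable_continuous_interval qs t Fc)+
    also have "\<bar>\<dots>\<bar> \<le> integral {0..1} (\<lambda>s::real. C * norm ?v ^ 3)"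
    proof -
      have "norm (integral {0..1} (\<lambda>s. (norm (?G s))\<^sup>2 - (norm (?F s))\<^sup>2)) \<le> integral {0..1} (\<lambda>s::real. C * norm ?v ^ 3)"
      proof (rule integral_norm_bound_integral)
        show "(\<lambda>s. (norm (?G s))\<^sup>2 - (norm (?F s))\<^sup>2) integrable_on {0..1}"
          by (intro integrable_continuous_interval continuous_on_diff qs t Fc)
        show "norm ((norm (?G s))\<^sup>2 - (norm (?F s))\<^sup>2) \<le> C * norm ?v ^ 3" if "s \<in> {0..1}" for s
          using pw[OF that] by simp
      qed (rule integrable_const_ivl)
      then show ?thesis by simp
    qed
    finally show ?thesis by simp
  qed
  \<comment> \<open>Chosen with \<open>C * r \<le> l / 2\<close>, so the cubic error consumes at
    most half of the form; the added 1 covers \<open>C = 0\<close>.\<close>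
  define r where "r = l / (2 * (C + 1))"
  have r: "0 < r" "C * r \<le> l / 2" using l(1) C0 by (auto simp: r_def field_simps)
  have close: "l / 2 * (norm (\<theta> - \<theta>\<^sub>0))\<^sup>2 \<le> q \<theta>" if t: "\<theta> \<in> \<Theta>" and v: "norm (\<theta> - \<theta>\<^sub>0) \<le> r" for \<theta>
  proof -
    have "C * norm (\<theta> - \<theta>\<^sub>0) ^ 3 = C * norm (\<theta> - \<theta>\<^sub>0) * (norm (\<theta> - \<theta>\<^sub>0))\<^sup>2" by (simp add: power2_eq_square power3_eq_cube)
    also have "\<dots> \<le> l / 2 * (norm (\<theta> - \<theta>\<^sub>0))\<^sup>2"
      using order_trans[OF mult_left_mono[OF v C0] r(2)] by (rule mult_right_mono) simp
    finally show ?thesis using near[OF t] l(2)[of "\<theta> - \<theta>\<^sub>0"] by linarith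
  qed
  have far: "\<exists>c>0. \<forall>\<theta>\<in>\<Theta>. r \<le> norm (\<theta> - \<theta>\<^sub>0) \<longrightarrow> c * (norm (\<theta> - \<theta>\<^sub>0))\<^sup>2 \<le> q \<theta>"
  proof (cases "\<Theta> \<inter> {\<theta>. r \<le> norm (\<theta> - \<theta>\<^sub>0)} = {}")
    case True
    then show ?thesis by (intro exI[of _ 1]) auto
  next
    case False
    let ?T = "\<Theta> \<inter> {\<theta>. r \<le> norm (\<theta> - \<theta>\<^sub>0)}"
    have T: "compact ?T" by (intro compact_Int_closed \<Theta> closed_Collect_le continuous_intros)
    \<comment> \<open>Minimising the quotient, and not \<open>q\<close> itself, gives the quadratic
      lower bound directly.\<close>
    have "continuous_on ?T (\<lambda>\<theta>. q \<theta> / (norm (\<theta> - \<theta>\<^sub>0))\<^sup>2)"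
      using r(1) by (intro continuous_intros continuous_on_subset[OF qc]) auto
    from continuous_attains_inf[OF T False this]
    obtain t where t: "t \<in> ?T" "\<And>\<theta>. \<theta> \<in> ?T \<Longrightarrow> q t / (norm (t - \<theta>\<^sub>0))\<^sup>2 \<le> q \<theta> / (norm (\<theta> - \<theta>\<^sub>0))\<^sup>2" by blast
    have tv: "0 < norm (t - \<theta>\<^sub>0)" using t(1) r(1) by auto
    have "0 < q t"
    proof -
      have "0 \<le> q t" unfolding q_def by (rule integral_nonneg) (use t qs in \<open>auto intro!: integrable_continuous_interval\<close>)
      \<comment> \<open>A continuous nonnegative integrand with integral zero vanishes identically,
        contrary to identifiability.\<close>
      moreover have "q t \<noteq> 0"
        unfolding q_def using A3[of t] t(1) tv by (subst integral_eq_0_iff) (auto intro: qs)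
      ultimately show ?thesis by simp
    qed
    then have c: "0 < q t / (norm (t - \<theta>\<^sub>0))\<^sup>2" using tv by simp
    have "q t / (norm (t - \<theta>\<^sub>0))\<^sup>2 * (norm (\<theta> - \<theta>\<^sub>0))\<^sup>2 \<le> q \<theta>" if "\<theta> \<in> \<Theta>" "r \<le> norm (\<theta> - \<theta>\<^sub>0)" for \<theta>
    proof -
      have "0 < norm (\<theta> - \<theta>\<^sub>0)" using that r(1) by linarith
      then have p: "0 < (norm (\<theta> - \<theta>\<^sub>0))\<^sup>2" by (rule zero_less_power)
      have "q t / (norm (t - \<theta>\<^sub>0))\<^sup>2 \<le> q \<theta> / (norm (\<theta> - \<theta>\<^sub>0))\<^sup>2" using that by (intro t) auto
      then show ?thesis unfolding pos_le_divide_eq[OF p] .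
    qed
    then show ?thesis using c by blast
  qed
  then obtain c1 where c1: "0 < c1" "\<And>\<theta>. \<theta> \<in> \<Theta> \<Longrightarrow> r \<le> norm (\<theta> - \<theta>\<^sub>0) \<Longrightarrow> c1 * (norm (\<theta> - \<theta>\<^sub>0))\<^sup>2 \<le> q \<theta>" by blast
  have low: "min c1 (l / 2) * (norm (\<theta> - \<theta>\<^sub>0))\<^sup>2 \<le> q \<theta>" if t: "\<theta> \<in> \<Theta>" for \<theta>
  proof (cases "norm (\<theta> - \<theta>\<^sub>0) \<le> r")
    case True
    have "min c1 (l / 2) * (norm (\<theta> - \<theta>\<^sub>0))\<^sup>2 \<le> l / 2 * (norm (\<theta> - \<theta>\<^sub>0))\<^sup>2" by (intro mult_right_mono) auto
    then show ?thesis using close[OF t True] by linarith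
  next
    case False
    have "min c1 (l / 2) * (norm (\<theta> - \<theta>\<^sub>0))\<^sup>2 \<le> c1 * (norm (\<theta> - \<theta>\<^sub>0))\<^sup>2" by (intro mult_right_mono) auto
    then show ?thesis using c1(2)[OF t] False by linarith
  qed
  have "0 < min c1 (l / 2)" using c1(1) l(1) by simp
  then show ?thesis using C0 low near by blast
qed

section \<open>Events of high probability\<close>

text \<open>Markov's inequality for the majorants of \<open>uniform_sum_bound\<close>, one per noise
  coordinate. It yields a numerical bound that depends neither on \<open>n\<close> nor on the
  path.\<close>

lemma (in noise_process) uniform_event:
  fixes X :: "nat \<Rightarrow> 'w \<Rightarrow> real ^ 'd" and G :: "nat \<Rightarrow> 'w set" and R c \<delta> :: real
  assumes n: "0 < n" and \<delta>: "0 < \<delta>"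
    and X_meas: "\<And>k. X k \<in> borel_measurable (F (real k / real n))"
    and G_sets: "\<And>k. G k \<in> sets (F (real k / real n))"
    and G_anti: "\<And>k l. k \<le> l \<Longrightarrow> G l \<subseteq> G k"
    and X_bdd: "\<And>j k \<omega>. j \<le> k \<Longrightarrow> \<omega> \<in> G k \<Longrightarrow> norm (X j \<omega>) \<le> R"
    and W_bdd: "\<And>j k \<omega>. j \<le> k \<Longrightarrow> \<omega> \<in> G k \<Longrightarrow> norm (W (real j / real n) \<omega>) \<le> R"
    and X_incr: "\<And>i j k \<omega>. i \<le> j \<Longrightarrow> j \<le> k \<Longrightarrow> \<omega> \<in> G k \<Longrightarrow>
       norm (X j \<omega> - X i \<omega>) \<le> c * (real (j - i) * (1 / real n)) + norm (W (real j / real n) \<omega> - W (real i / real n) \<omega>)"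
    and R0: "0 \<le> R" and c0: "0 \<le> c"
  defines "C1 \<equiv> 2 * c\<^sup>2 + 2 * D"
  defines "C2 \<equiv> real CARD('d) * (D * C1)"
  defines "C3 \<equiv> C1 * (1 + D) + C1 + C2"
  shows "\<exists>B\<in>sets M. measure M B \<le> \<delta> \<and> (\<forall>\<omega>\<in>G n - B. \<forall>i K f Df. C2_on R K f Df \<longrightarrow>
     \<bar>\<Sum>k<n. f (X k \<omega>) * (W (real (Suc k) / real n) \<omega> - W (real k / real n) \<omega>) $ i\<bar> \<le> K * (real CARD('d) * (2 + D + C2 + 6 * C3) / \<delta>))"
proof -
  interpret N: discrete_noise M "\<lambda>k. F (real k / real n)" "\<lambda>k. W (real k / real n)" "1 / real n" D
    by (rule discrete_noise_grid[OF n])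
  interpret X: discrete_diffusion M "\<lambda>k. F (real k / real n)" "\<lambda>k. W (real k / real n)" "1 / real n" D X G R c
    by unfold_locales (use assms in auto)
  have eqs: "X.C1 = C1" "X.C2 = C2" "X.C3 = C3"
    unfolding X.C3_def X.C2_def X.C1_def C1_def C2_def C3_def by simp_all
  have "\<forall>i::'d. \<exists>Q. integrable M Q \<and> (\<forall>\<omega>. 0 \<le> Q \<omega>) \<and> (\<integral>\<omega>. Q \<omega> \<partial>M) \<le> 2 + D + C2 + 6 * C3 \<and>
     (\<forall>\<omega>\<in>G n. \<forall>K f Df. C2_on R K f Df \<longrightarrow>
        \<bar>\<Sum>k<n. f (X k \<omega>) * (W (real (Suc k) / real n) \<omega> - W (real k / real n) \<omega>) $ i\<bar> \<le> K * Q \<omega>)"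
    using X.uniform_sum_bound[of n] n unfolding eqs by simp
  then obtain Q where Q: "\<And>i. integrable M (Q i)" "\<And>i \<omega>. 0 \<le> Q i \<omega>" "\<And>i. (\<integral>\<omega>. Q i \<omega> \<partial>M) \<le> 2 + D + C2 + 6 * C3"
     "\<And>i \<omega> K f Df. \<omega> \<in> G n \<Longrightarrow> C2_on R K f Df \<Longrightarrow>
        \<bar>\<Sum>k<n. f (X k \<omega>) * (W (real (Suc k) / real n) \<omega> - W (real k / real n) \<omega>) $ i\<bar> \<le> K * Q i \<omega>"
    unfolding choice_iff by blast
  define b where "b = 2 + D + C2 + 6 * C3"
  have b: "0 < b" unfolding b_def using D0 X.C2_nonneg X.C3_nonneg unfolding eqs by linarith
  \<comment> \<open>The factor \<open>real CARD('d)\<close> pays for the union over coordinates, so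
    that the exceptional set has measure at most \<open>\<delta>\<close>.\<close>
  define lam where "lam = real CARD('d) * b / \<delta>"
  have lam: "0 < lam" unfolding lam_def using b \<delta> by simp
  define B where "B = (\<Union>i\<in>UNIV. {\<omega> \<in> space M. lam \<le> Q i \<omega>})"
  have Qm [measurable]: "Q i \<in> borel_measurable M" for i using Q(1)[of i] by simp
  have Bs: "B \<in> sets M" unfolding B_def by measurable
  have "measure M B \<le> (\<Sum>i\<in>UNIV. measure M {\<omega> \<in> space M. lam \<le> Q i \<omega>})"
    unfolding B_def by (rule finite_measure_subadditive_finite) auto
  also have "\<dots> \<le> (\<Sum>i\<in>(UNIV::'d set). b / lam)"
  proof (rule sum_mono)
    fix i
    have "measure M {\<omega> \<in> space M. lam \<le> Q i \<omega>} \<le> (\<integral>\<omega>. Q i \<omega> \<partial>M) / lam"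
      by (rule integral_Markov_inequality_measure[OF Q(1) sets.empty_sets]) (use Q(2) lam in auto)
    also have "\<dots> \<le> b / lam" using Q(3)[of i] lam unfolding b_def by (intro divide_right_mono) auto
    finally show "measure M {\<omega> \<in> space M. lam \<le> Q i \<omega>} \<le> b / lam" .
  qed
  also have "\<dots> = \<delta>" using b \<delta> by (simp add: lam_def)
  finally have Bm: "measure M B \<le> \<delta>" .
  have "\<bar>\<Sum>k<n. f (X k \<omega>) * (W (real (Suc k) / real n) \<omega> - W (real k / real n) \<omega>) $ i\<bar> \<le> K * lam"
    if \<omega>: "\<omega> \<in> G n - B" and f: "C2_on R K f Df" for \<omega> i K f Df
  proof -
    have "\<omega> \<in> space M" using \<omega> sets.sets_into_space[OF N.sets_M[OF G_sets[of n]]] by blast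
    then have "Q i \<omega> \<le> lam" using \<omega> by (auto simp: B_def not_le intro: less_imp_le)
    moreover have "0 \<le> K"
    proof -
      have "\<bar>f 0\<bar> \<le> K" by (rule C2_on_bound[OF f]) (simp add: R0)
      then show ?thesis by linarith
    qed
    ultimately show ?thesis using Q(4)[OF _ f, of \<omega> i] \<omega> mult_left_mono[of "Q i \<omega>" lam K] by force
  qed
  then show ?thesis using Bs Bm unfolding lam_def b_def by blast
qed

text \<open>For given adapted weights of uniformly small size Chebyshev's inequality makes the sum
  small, not just bounded. It is applied to the difference of \<open>f j\<close> along
  \<open>X\<close> and along \<open>X0\<close>, which is of order \<open>\<epsilon>\<close>.\<close>

lemma (in noise_process) chebyshev_event:
  fixes \<eta> :: "nat \<Rightarrow> 'w \<Rightarrow> real"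
  assumes n: "0 < n" and \<gamma>: "0 < \<gamma>" and e: "0 \<le> e"
    and meas: "\<And>k. \<eta> k \<in> borel_measurable (F (real k / real n))"
    and bdd: "\<And>k \<omega>. \<omega> \<in> space M \<Longrightarrow> \<bar>\<eta> k \<omega>\<bar> \<le> e"
    and loc: "\<And>k j \<omega>. \<omega> \<in> space M \<Longrightarrow> j \<le> k \<Longrightarrow> \<eta> k \<omega> \<noteq> 0 \<Longrightarrow> norm (W (real j / real n) \<omega>) \<le> R"
  shows "\<exists>B\<in>sets M. measure M B \<le> D * e\<^sup>2 / \<gamma>\<^sup>2 \<and> (\<forall>\<omega>\<in>space M - B.
     \<bar>\<Sum>k<n. \<eta> k \<omega> * (W (real (Suc k) / real n) \<omega> - W (real k / real n) \<omega>) $ i\<bar> \<le> \<gamma>)"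
proof -
  interpret N: discrete_noise M "\<lambda>k. F (real k / real n)" "\<lambda>k. W (real k / real n)" "1 / real n" D
    by (rule discrete_noise_grid[OF n])
  define S where "S \<omega> = (\<Sum>k\<in>{0..<n}. \<eta> k \<omega> * (W (real (Suc k) / real n) \<omega> - W (real k / real n) \<omega>) $ i)" for \<omega>
  have etaM [measurable]: "\<eta> k \<in> borel_measurable M" for k using N.meas_M[OF meas] .
  have L2: "integrable M (\<lambda>\<omega>. (S \<omega>)\<^sup>2)" "(\<integral>\<omega>. (S \<omega>)\<^sup>2 \<partial>M) \<le> D * (1 / real n) * (\<Sum>k\<in>{0..<n}. \<integral>\<omega>. (\<eta> k \<omega>)\<^sup>2 \<partial>M)"
    using N.transform_L2[of \<eta> e R 0 n i, OF meas bdd loc] unfolding S_def by auto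
  have "(\<integral>\<omega>. (\<eta> k \<omega>)\<^sup>2 \<partial>M) \<le> e\<^sup>2" for k
  proof -
    have sq: "(\<eta> k \<omega>)\<^sup>2 \<le> e\<^sup>2" if "\<omega> \<in> space M" for \<omega>
      using power_mono[OF bdd[OF that] abs_ge_zero, of k 2] by simp
    have "(\<integral>\<omega>. (\<eta> k \<omega>)\<^sup>2 \<partial>M) \<le> (\<integral>\<omega>. e\<^sup>2 \<partial>M)"
    proof (rule integral_mono)
      show "integrable M (\<lambda>\<omega>. (\<eta> k \<omega>)\<^sup>2)" by (rule N.integrable_bdd[where c="e\<^sup>2"]) (use sq in auto)
    qed (use sq in auto)
    then show ?thesis by (simp add: prob_space)
  qed
  then have "(\<Sum>k\<in>{0..<n}. \<integral>\<omega>. (\<eta> k \<omega>)\<^sup>2 \<partial>M) \<le> (\<Sum>k\<in>{0..<n}. e\<^sup>2)" by (intro sum_mono)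
  then have "D * (1 / real n) * (\<Sum>k\<in>{0..<n}. \<integral>\<omega>. (\<eta> k \<omega>)\<^sup>2 \<partial>M) \<le> D * (1 / real n) * (real n * e\<^sup>2)"
    using D0 by (intro mult_left_mono) auto
  also have "\<dots> = D * e\<^sup>2" using n by simp
  finally have ES: "(\<integral>\<omega>. (S \<omega>)\<^sup>2 \<partial>M) \<le> D * e\<^sup>2" using L2(2) by linarith
  have Sm [measurable]: "S \<in> borel_measurable M"
    unfolding S_def by (intro borel_measurable_sum borel_measurable_times borel_measurable_nth borel_measurable_diff etaM W_M) simp_all
  define B where "B = {\<omega> \<in> space M. \<gamma>\<^sup>2 \<le> (S \<omega>)\<^sup>2}"
  have "B \<in> sets M" unfolding B_def by measurable
  moreover have "measure M B \<le> D * e\<^sup>2 / \<gamma>\<^sup>2"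
  proof -
    have "measure M B \<le> (\<integral>\<omega>. (S \<omega>)\<^sup>2 \<partial>M) / \<gamma>\<^sup>2"
      unfolding B_def by (rule integral_Markov_inequality_measure[OF L2(1) sets.empty_sets]) (use \<gamma> in auto)
    also have "\<dots> \<le> D * e\<^sup>2 / \<gamma>\<^sup>2" using ES by (intro divide_right_mono) auto
    finally show ?thesis .
  qed
  moreover have "\<bar>S \<omega>\<bar> \<le> \<gamma>" if "\<omega> \<in> space M - B" for \<omega>
  proof -
    have "(S \<omega>)\<^sup>2 \<le> \<gamma>\<^sup>2" using that by (auto simp: B_def)
    then show ?thesis using \<gamma> abs_le_square_iff[of "S \<omega>" \<gamma>] by simp
  qed
  ultimately show ?thesis unfolding S_def atLeast0LessThan by blast
qed

text \<open>The exceptional set is defined through the measurable majorant of the oscillation;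
  Markov's inequality bounds it in \<open>ennreal\<close>.\<close>

lemma (in noise_process) oscillation_event:
  assumes n: "0 < n" and \<tau>: "0 < \<tau>"
  shows "\<exists>B\<in>sets M. measure M B \<le> (1 + D) * sqrt (2 / real n) / \<tau> \<and>
    (\<forall>\<omega>\<in>space M - B. cadlag_on {0..1} (\<lambda>t. W t \<omega>) \<longrightarrow>
      (\<Sum>k<n. integral {real k / real n..real (Suc k) / real n} (\<lambda>s. norm (W s \<omega> - W (real k / real n) \<omega>))) \<le> \<tau>)"
proof -
  obtain \<Delta> where \<Delta> [measurable]: "\<Delta> \<in> borel_measurable M" and E: "(\<integral>\<^sup>+\<omega>. \<Delta> \<omega> \<partial>M) \<le> ennreal ((1 + D) * sqrt (2 / real n))"
    and path: "\<And>\<omega>. \<omega> \<in> space M \<Longrightarrow> cadlag_on {0..1} (\<lambda>t. W t \<omega>) \<Longrightarrow>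
      (\<Sum>k<n. \<integral>\<^sup>+s. indicator {real k / real n..real (Suc k) / real n} s * ennreal (norm (W s \<omega> - W (real k / real n) \<omega>)) \<partial>lborel) \<le> \<Delta> \<omega>"
    using oscillation_bound[OF n] by blast
  define B where "B = {\<omega> \<in> space M. ennreal \<tau> \<le> \<Delta> \<omega>}"
  have Bs: "B \<in> sets M" unfolding B_def by measurable
  have "ennreal \<tau> * emeasure M B = (\<integral>\<^sup>+\<omega>. ennreal \<tau> * indicator B \<omega> \<partial>M)" by (rule nn_integral_cmult_indicator[OF Bs, symmetric])
  also have "\<dots> \<le> (\<integral>\<^sup>+\<omega>. \<Delta> \<omega> \<partial>M)" by (rule nn_integral_mono) (auto simp: B_def indicator_def)
  also have "\<dots> \<le> ennreal ((1 + D) * sqrt (2 / real n))" by (rule E)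
  also have "ennreal \<tau> * emeasure M B = ennreal (\<tau> * measure M B)"
    using \<tau> by (simp add: emeasure_eq_measure ennreal_mult)
  finally have "ennreal (\<tau> * measure M B) \<le> ennreal ((1 + D) * sqrt (2 / real n))" .
  then have "\<tau> * measure M B \<le> (1 + D) * sqrt (2 / real n)" using D0 by (simp add: ennreal_le_iff)
  then have Bm: "measure M B \<le> (1 + D) * sqrt (2 / real n) / \<tau>" using \<tau> by (simp add: field_simps)
  have "(\<Sum>k<n. integral {real k / real n..real (Suc k) / real n} (\<lambda>s. norm (W s \<omega> - W (real k / real n) \<omega>))) \<le> \<tau>"
    if \<omega>: "\<omega> \<in> space M - B" and cd: "cadlag_on {0..1} (\<lambda>t. W t \<omega>)" for \<omega>
  proof -
    let ?a = "\<lambda>k. integral {real k / real n..real (Suc k) / real n} (\<lambda>s. norm (W s \<omega> - W (real k / real n) \<omega>))"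
    have sub: "{real k / real n..real (Suc k) / real n} \<subseteq> {0..1}" if "k < n" for k
      unfolding atLeastatMost_subset_iff using that n by simp
    have nn: "0 \<le> ?a k" if "k < n" for k by (rule integral_nonneg[OF cadlag_norm_integral(1)[OF cd sub[OF that]]]) simp
    have "ennreal (\<Sum>k<n. ?a k) = (\<Sum>k<n. ennreal (?a k))" using nn by (intro sum_ennreal[symmetric]) auto
    also have "\<dots> = (\<Sum>k<n. \<integral>\<^sup>+s. indicator {real k / real n..real (Suc k) / real n} s * ennreal (norm (W s \<omega> - W (real k / real n) \<omega>)) \<partial>lborel)"
      by (intro sum.cong refl cadlag_norm_integral(2)[OF cd sub]) simp
    also have "\<dots> \<le> \<Delta> \<omega>" using \<omega> cd by (intro path) auto
    also have "\<dots> \<le> ennreal \<tau>" using \<omega> by (auto simp: B_def not_le intro: less_imp_le)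
    finally show ?thesis using \<tau> by (simp add: ennreal_le_iff)
  qed
  then show ?thesis using Bs Bm by blast
qed

section \<open>Asymptotics of the estimator\<close>

text \<open>A supremum over uncountably many times need not be measurable, so the event is defined
  by rational times. Right continuity extends the bound to all times, since the approximating grid
  points are rational.\<close>

lemma cadlag_bounded_in_probability:
  fixes L :: "real \<Rightarrow> 'w \<Rightarrow> 'b::euclidean_space"
  assumes P: "prob_space M" and L: "\<And>t. t \<in> {0..1} \<Longrightarrow> L t \<in> borel_measurable M"
    and cd: "AE \<omega> in M. cadlag_on {0..1} (\<lambda>t. L t \<omega>)" and \<delta>: "0 < \<delta>"
  shows "\<exists>R\<ge>0. \<exists>E\<in>sets M. 1 - \<delta> \<le> measure M E \<and> (\<forall>\<omega>\<in>E. cadlag_on {0..1} (\<lambda>t. L t \<omega>) \<and> (\<forall>t\<in>{0..1}. norm (L t \<omega>) \<le> R))"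
proof -
  interpret prob_space M by fact
  obtain Z where Z: "{\<omega> \<in> space M. \<not> cadlag_on {0..1} (\<lambda>t. L t \<omega>)} \<subseteq> Z" "emeasure M Z = 0" "Z \<in> sets M"
    using AE_E[OF cd] by auto
  define H where "H k q = {\<omega> \<in> space M. norm (L q \<omega>) \<le> real k}" for k :: nat and q :: real
  define E where "E k = (space M - Z) \<inter> (\<Inter>q\<in>\<rat> \<inter> {0..1}. H k q)" for k
  have Hs: "H k q \<in> sets M" if "q \<in> {0..1}" for k q
  proof -
    note L[OF that, measurable]
    show ?thesis unfolding H_def by measurable
  qed
  have ne: "\<rat> \<inter> {0..1::real} \<noteq> {}" by (auto intro!: exI[of _ "0::real"])
  have cnt: "countable (\<rat> \<inter> {0..1::real})" by (intro countable_Int1 countable_rat)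
  have Es: "E k \<in> sets M" for k
    unfolding E_def using Z(3) Hs by (intro sets.Int sets.countable_INT'[OF cnt ne]) auto
  have "incseq E"
  proof (rule incseq_SucI)
    show "E k \<le> E (Suc k)" for k by (auto simp: E_def H_def intro: order_trans)
  qed
  moreover have U: "(\<Union>k. E k) = space M - Z"
  proof
    show "space M - Z \<subseteq> (\<Union>k. E k)"
    proof
      fix \<omega> assume w: "\<omega> \<in> space M - Z"
      then have "cadlag_on {0..1} (\<lambda>t. L t \<omega>)" using Z(1) by blast
      from cadlag_bounded[OF this] obtain B where B: "\<And>t. t \<in> {0..1} \<Longrightarrow> norm (L t \<omega>) \<le> B" by blast
      obtain k :: nat where "B \<le> real k" using real_arch_simple by blast
      then have "\<omega> \<in> E k" using w by (auto simp: E_def H_def intro!: order_trans[OF B])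
      then show "\<omega> \<in> (\<Union>k. E k)" by blast
    qed
  qed (auto simp: E_def)
  ultimately have "(\<lambda>k. measure M (E k)) \<longlonglongrightarrow> measure M (space M - Z)"
    using finite_Lim_measure_incseq[of E] Es by auto
  moreover have "measure M (space M - Z) = 1" using prob_compl[OF Z(3)] Z(2) by (simp add: measure_def)
  ultimately have "(\<lambda>k. measure M (E k)) \<longlonglongrightarrow> 1" by simp
  then have "\<forall>\<^sub>F k in sequentially. 1 - \<delta> < measure M (E k)" by (rule order_tendstoD) (use \<delta> in simp)
  then obtain k where k: "1 - \<delta> < measure M (E k)" using eventually_happens by force
  have "cadlag_on {0..1} (\<lambda>t. L t \<omega>) \<and> (\<forall>t\<in>{0..1}. norm (L t \<omega>) \<le> real k)" if w: "\<omega> \<in> E k" for \<omega>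
  proof -
    have c: "cadlag_on {0..1} (\<lambda>t. L t \<omega>)" using w Z(1) by (auto simp: E_def)
    have "norm (L t \<omega>) \<le> real k" if t: "t \<in> {0..1}" for t
    proof (rule LIMSEQ_le_const2[OF tendsto_norm[OF cadlag_grid_limit[OF c t]]], intro exI[of _ 0] allI impI)
      fix m
      have "grid_up (Suc m) t \<in> \<rat>" unfolding grid_up_def by (intro Rats_divide Rats_of_nat)
      then have "grid_up (Suc m) t \<in> \<rat> \<inter> {0..1}" using grid_up[of "Suc m" t] t by auto
      then show "norm (L (grid_up (Suc m) t) \<omega>) \<le> real k" using w by (auto simp: E_def H_def)
    qed
    then show ?thesis using c by blast
  qed
  then show ?thesis using k Es by (intro exI[of _ "real k"] conjI bexI[of _ "E k"]) auto
qed

text \<open>Membership in \<open>E\<close> may depend on the whole path, so \<open>E\<close> cannot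
  serve as a cut-off in adapted sums. The grid conditions up to index \<open>k\<close> define
  adapted decreasing events \<open>G k\<close>, and \<open>E\<close> is contained in
  \<open>G n\<close>.\<close>

lemma (in noise_process) good_event:
  fixes X :: "real \<Rightarrow> 'w \<Rightarrow> real ^ 'd" and X0 :: "real \<Rightarrow> real ^ 'd" and f :: "'p::finite \<Rightarrow> real ^ 'd \<Rightarrow> real ^ 'd" and R c1 K e \<delta> \<tau> \<gamma> :: real
  assumes n: "0 < n" and pos: "0 < \<delta>" "0 < \<tau>" "0 < \<gamma>" "0 \<le> R" "0 \<le> c1" "0 \<le> K" "0 \<le> e"
    and X_ad: "\<And>t. t \<in> {0..1} \<Longrightarrow> X t \<in> borel_measurable (F t)"
    and E: "E \<subseteq> space M"
    and bd: "\<And>\<omega> t. \<omega> \<in> E \<Longrightarrow> t \<in> {0..1} \<Longrightarrow> norm (X t \<omega>) \<le> R \<and> norm (W t \<omega>) \<le> R \<and> norm (X t \<omega> - X0 t) \<le> e"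
    and inc: "\<And>\<omega> s t. \<omega> \<in> E \<Longrightarrow> 0 \<le> s \<Longrightarrow> s \<le> t \<Longrightarrow> t \<le> 1 \<Longrightarrow> norm (X t \<omega> - X s \<omega>) \<le> c1 * (t - s) + norm (W t \<omega> - W s \<omega>)"
    and cd: "\<And>\<omega>. \<omega> \<in> E \<Longrightarrow> cadlag_on {0..1} (\<lambda>t. W t \<omega>)"
    and X0R: "\<And>t. t \<in> {0..1} \<Longrightarrow> norm (X0 t) \<le> R"
    and f: "\<And>i j. \<exists>Df. C2_on R K (\<lambda>x. f j x $ i) Df" and fm: "\<And>i j. (\<lambda>x. f j x $ i) \<in> borel_measurable borel"
  defines "C1 \<equiv> 2 * c1\<^sup>2 + 2 * D"
  defines "C2 \<equiv> real CARD('d) * (D * C1)"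
  defines "C3 \<equiv> C1 * (1 + D) + C1 + C2"
  shows "\<exists>B\<in>sets M. measure M B \<le> \<delta> + (1 + D) * sqrt (2 / real n) / \<tau> + real CARD('p) * (real CARD('d) * (D * (K * (1 + 2 * R) * e)\<^sup>2 / \<gamma>\<^sup>2)) \<and>
    (\<forall>\<omega>\<in>E - B.
      (\<forall>i K f Df. C2_on R K f Df \<longrightarrow> \<bar>\<Sum>k<n. f (X (real k / real n) \<omega>) * (W (real (Suc k) / real n) \<omega> - W (real k / real n) \<omega>) $ i\<bar>
         \<le> K * (real CARD('d) * (2 + D + C2 + 6 * C3) / \<delta>)) \<and>
      (\<Sum>k<n. integral {real k / real n..real (Suc k) / real n} (\<lambda>s. norm (W s \<omega> - W (real k / real n) \<omega>))) \<le> \<tau> \<and>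
      (\<forall>j i. \<bar>\<Sum>k<n. (f j (X (real k / real n) \<omega>) - f j (X0 (real k / real n))) $ i * (W (real (Suc k) / real n) \<omega> - W (real k / real n) \<omega>) $ i\<bar> \<le> \<gamma>))"
proof -
  \<comment> \<open>Adaptedness of \<open>X\<close> is given on \<open>[0,1]\<close>, whereas the
    discrete estimates take a sequence over all \<open>k\<close>; time is frozen at 1 after
    \<open>n\<close> steps.\<close>
  define u where "u k = real (min k n) / real n" for k
  have u: "u k \<in> {0..1}" "u k \<le> real k / real n" for k using n by (auto simp: u_def divide_right_mono)
  have u_n: "u k = real k / real n" if "k \<le> n" for k using that by (simp add: u_def)
  have Fmono: "Y \<in> borel_measurable (F t)" if "Y \<in> borel_measurable (F s)" "0 \<le> s" "s \<le> t" for Y :: "'w \<Rightarrow> real ^ 'd" and s t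
  proof -
    have sub: "\<And>t. 0 \<le> t \<Longrightarrow> subalgebra M (F t)" "\<And>s t. 0 \<le> s \<Longrightarrow> s \<le> t \<Longrightarrow> sets (F s) \<subseteq> sets (F t)"
      using filt unfolding filtered_space_def by blast+
    have "0 \<le> t" using that by linarith
    then have "subalgebra (F t) (F s)" using sub(1)[of t] sub(1)[OF that(2)] sub(2)[OF that(2,3)] by (simp add: subalgebra_def)
    from measurable_from_subalg[OF this that(1)] show ?thesis .
  qed
  have spF: "space (F (real k / real n)) = space M" for k
    using filt unfolding filtered_space_def by (simp add: subalgebra_def)
  have Xk: "X (u j) \<in> borel_measurable (F (real k / real n))" if "j \<le> k" for j k
  proof (rule Fmono[OF X_ad[OF u(1)]])
    show "0 \<le> u j" using u(1)[of j] by simp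
    have "real j / real n \<le> real k / real n" using that by (intro divide_right_mono) auto
    then show "u j \<le> real k / real n" using u(2)[of j] by linarith
  qed
  have Wk: "W (real j / real n) \<in> borel_measurable (F (real k / real n))" if "j \<le> k" for j k
    by (rule Fmono[OF W_ad]) (use that in \<open>auto simp: divide_right_mono\<close>)
  \<comment> \<open>For a pair of grid indices, what the discrete estimates require. There are
    finitely many such pairs up to \<open>k\<close>, all involving times up to \<open>k / n\<close>,
    so \<open>G k\<close> is measurable for the past.\<close>
  define P where "P = (\<lambda>(i, j) \<omega>. norm (X (u j) \<omega>) \<le> R \<and> norm (W (real j / real n) \<omega>) \<le> R \<and> norm (X (u j) \<omega> - X0 (u j)) \<le> e \<and>
     norm (X (u j) \<omega> - X (u i) \<omega>) \<le> c1 * (real (j - i) * (1 / real n)) + norm (W (real j / real n) \<omega> - W (real i / real n) \<omega>))"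
  define I where "I k = {(i, j). i \<le> j \<and> j \<le> k}" for k :: nat
  define G where "G k = {\<omega> \<in> space M. \<forall>p\<in>I k. P p \<omega>}" for k
  have fI: "finite (I k)" for k
  proof (rule finite_subset)
    show "I k \<subseteq> {..k} \<times> {..k}" by (auto simp: I_def)
  qed simp
  have Gs: "G k \<in> sets (F (real k / real n))" for k
    unfolding G_def spF[of k, symmetric]
  proof (rule sets.sets_Collect_finite_All[OF _ fI])
    fix p assume "p \<in> I k"
    then obtain i j where p: "p = (i, j)" "i \<le> j" "j \<le> k" unfolding I_def by blast
    note [measurable] = Xk[OF p(3)] Wk[OF p(3)] Xk[OF order_trans[OF p(2,3)]] Wk[OF order_trans[OF p(2,3)]]
    show "{\<omega> \<in> space (F (real k / real n)). P p \<omega>} \<in> sets (F (real k / real n))" unfolding P_def p(1) prod.case by measurable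
  qed
  have Ganti: "G l \<subseteq> G k" if "k \<le> l" for k l using that by (force simp: G_def I_def)
  have GD: "P (i, j) \<omega>" if "\<omega> \<in> G k" "i \<le> j" "j \<le> k" for i j k \<omega> using that by (auto simp: G_def I_def)
  have EG: "\<omega> \<in> G n" if w: "\<omega> \<in> E" for \<omega>
    unfolding G_def
  proof (intro CollectI conjI ballI)
    show "\<omega> \<in> space M" using w E by blast
    fix p assume "p \<in> I n"
    then obtain i j where p: "p = (i, j)" "i \<le> j" "j \<le> n" unfolding I_def by blast
    have ij: "i \<le> n" using p by simp
    have ji: "u j - u i = real (j - i) * (1 / real n)" using p ij by (simp add: u_n of_nat_diff diff_divide_distrib)
    have "u i \<le> u j" unfolding u_n[OF p(3)] u_n[OF ij] using p(2) by (intro divide_right_mono) auto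
    then have "norm (X (u j) \<omega> - X (u i) \<omega>) \<le> c1 * (u j - u i) + norm (W (u j) \<omega> - W (u i) \<omega>)"
      using inc[OF w, of "u i" "u j"] u(1)[of i] u(1)[of j] by simp
    then show "P p \<omega>" unfolding P_def p(1) prod.case ji[symmetric] u_n[OF p(3), symmetric] u_n[OF ij, symmetric]
      using bd[OF w u(1)[of j]] by blast
  qed
  obtain B1 where B1: "B1 \<in> sets M" "measure M B1 \<le> \<delta>" "\<And>\<omega> i K f Df. \<omega> \<in> G n - B1 \<Longrightarrow> C2_on R K f Df \<Longrightarrow>
     \<bar>\<Sum>k<n. f (X (u k) \<omega>) * (W (real (Suc k) / real n) \<omega> - W (real k / real n) \<omega>) $ i\<bar> \<le> K * (real CARD('d) * (2 + D + C2 + 6 * C3) / \<delta>)"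
  proof -
    have "\<exists>B\<in>sets M. measure M B \<le> \<delta> \<and> (\<forall>\<omega>\<in>G n - B. \<forall>i K f Df. C2_on R K f Df \<longrightarrow>
       \<bar>\<Sum>k<n. f (X (u k) \<omega>) * (W (real (Suc k) / real n) \<omega> - W (real k / real n) \<omega>) $ i\<bar> \<le> K * (real CARD('d) * (2 + D + C2 + 6 * C3) / \<delta>))"
      unfolding C3_def C2_def C1_def
    proof (rule uniform_event[OF n pos(1)])
      show "X (u k) \<in> borel_measurable (F (real k / real n))" for k by (rule Xk) simp
      show "G k \<in> sets (F (real k / real n))" for k by (rule Gs)
      show "G l \<subseteq> G k" if "k \<le> l" for k l by (rule Ganti[OF that])
      show "norm (X (u j) \<omega>) \<le> R" if "j \<le> k" "\<omega> \<in> G k" for j k \<omega> using GD[OF that(2) order_refl that(1)] by (simp add: P_def)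
      show "norm (W (real j / real n) \<omega>) \<le> R" if "j \<le> k" "\<omega> \<in> G k" for j k \<omega> using GD[OF that(2) order_refl that(1)] by (simp add: P_def)
      show "norm (X (u j) \<omega> - X (u i) \<omega>) \<le> c1 * (real (j - i) * (1 / real n)) + norm (W (real j / real n) \<omega> - W (real i / real n) \<omega>)"
        if "i \<le> j" "j \<le> k" "\<omega> \<in> G k" for i j k \<omega> using GD[OF that(3,1,2)] by (simp add: P_def)
    qed (use pos in auto)
    then show ?thesis using that by blast
  qed
  obtain B2 where B2: "B2 \<in> sets M" "measure M B2 \<le> (1 + D) * sqrt (2 / real n) / \<tau>"
    "\<And>\<omega>. \<omega> \<in> space M - B2 \<Longrightarrow> cadlag_on {0..1} (\<lambda>t. W t \<omega>) \<Longrightarrow>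
      (\<Sum>k<n. integral {real k / real n..real (Suc k) / real n} (\<lambda>s. norm (W s \<omega> - W (real k / real n) \<omega>))) \<le> \<tau>"
    using oscillation_event[OF n pos(2)] by blast
  \<comment> \<open>The indicator makes the weights adapted and bounded on the whole space; on
    \<open>E\<close> it equals one for all \<open>k < n\<close>.\<close>
  define h where "h j i k \<omega> = indicator (G k) \<omega> * (f j (X (u k) \<omega>) - f j (X0 (u k))) $ i" for j i k \<omega>
  have "\<exists>B\<in>sets M. measure M B \<le> D * (K * (1 + 2 * R) * e)\<^sup>2 / \<gamma>\<^sup>2 \<and> (\<forall>\<omega>\<in>space M - B.
     \<bar>\<Sum>k<n. h j i k \<omega> * (W (real (Suc k) / real n) \<omega> - W (real k / real n) \<omega>) $ i\<bar> \<le> \<gamma>)" for j i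
  proof (rule chebyshev_event[OF n pos(3)])
    show "0 \<le> K * (1 + 2 * R) * e" using pos by simp
    show "h j i k \<in> borel_measurable (F (real k / real n))" for k
    proof -
      have "(\<lambda>\<omega>. f j (X (u k) \<omega>) $ i) \<in> borel_measurable (F (real k / real n))"
        by (rule measurable_compose[OF Xk fm]) simp
      then show ?thesis unfolding h_def vector_minus_component
        by (intro borel_measurable_times borel_measurable_diff borel_measurable_indicator Gs) simp_all
    qed
    show "\<bar>h j i k \<omega>\<bar> \<le> K * (1 + 2 * R) * e" for k \<omega>
    proof (cases "\<omega> \<in> G k")
      case True
      then have Pk: "norm (X (u k) \<omega>) \<le> R" "norm (X (u k) \<omega> - X0 (u k)) \<le> e" using GD[OF True order_refl order_refl] by (auto simp: P_def)
      obtain Df where "C2_on R K (\<lambda>x. f j x $ i) Df" using f by blast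
      from C2_on_lipschitz[OF this X0R[OF u(1)] Pk(1)]
      have "\<bar>f j (X (u k) \<omega>) $ i - f j (X0 (u k)) $ i\<bar> \<le> K * (1 + 2 * R) * norm (X (u k) \<omega> - X0 (u k))" .
      also have "\<dots> \<le> K * (1 + 2 * R) * e" using Pk(2) pos by (intro mult_left_mono) auto
      finally show ?thesis using True by (simp add: h_def)
    qed (use pos in \<open>simp add: h_def\<close>)
    show "norm (W (real l / real n) \<omega>) \<le> R" if "l \<le> k" "h j i k \<omega> \<noteq> 0" for k l \<omega>
    proof -
      have "\<omega> \<in> G k" using that(2) by (auto simp: h_def indicator_def split: if_splits)
      from GD[OF this order_refl that(1)] show ?thesis by (simp add: P_def)
    qed
  qed
  then have "\<forall>j i. \<exists>B. B \<in> sets M \<and> measure M B \<le> D * (K * (1 + 2 * R) * e)\<^sup>2 / \<gamma>\<^sup>2 \<and> (\<forall>\<omega>\<in>space M - B.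
     \<bar>\<Sum>k<n. h j i k \<omega> * (W (real (Suc k) / real n) \<omega> - W (real k / real n) \<omega>) $ i\<bar> \<le> \<gamma>)" by (simp add: Bex_def)
  then obtain B3 where B3: "\<And>j i. B3 j i \<in> sets M" "\<And>j i. measure M (B3 j i) \<le> D * (K * (1 + 2 * R) * e)\<^sup>2 / \<gamma>\<^sup>2"
     "\<And>j i \<omega>. \<omega> \<in> space M - B3 j i \<Longrightarrow> \<bar>\<Sum>k<n. h j i k \<omega> * (W (real (Suc k) / real n) \<omega> - W (real k / real n) \<omega>) $ i\<bar> \<le> \<gamma>"
    unfolding choice_iff by blast
  define B where "B = B1 \<union> B2 \<union> (\<Union>j. \<Union>i. B3 j i)"
  have Bs: "B \<in> sets M" unfolding B_def using B1(1) B2(1) B3(1) by (intro sets.Un sets.finite_UN) auto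
  have m3: "measure M (\<Union>j. \<Union>i. B3 j i) \<le> real CARD('p) * (real CARD('d) * (D * (K * (1 + 2 * R) * e)\<^sup>2 / \<gamma>\<^sup>2))"
  proof -
    have "measure M (\<Union>j. \<Union>i. B3 j i) \<le> (\<Sum>j\<in>UNIV. measure M (\<Union>i. B3 j i))"
      using B3(1) by (intro finite_measure_subadditive_finite) auto
    also have "\<dots> \<le> (\<Sum>j\<in>(UNIV::'p set). \<Sum>i\<in>UNIV. measure M (B3 j i))"
      using B3(1) by (intro sum_mono finite_measure_subadditive_finite) auto
    also have "\<dots> \<le> (\<Sum>j\<in>(UNIV::'p set). \<Sum>i\<in>(UNIV::'d set). D * (K * (1 + 2 * R) * e)\<^sup>2 / \<gamma>\<^sup>2)"
      by (intro sum_mono B3(2))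
    finally show ?thesis by simp
  qed
  have s3: "(\<Union>j. \<Union>i. B3 j i) \<in> sets M" using B3(1) by (intro sets.finite_UN) auto
  have "measure M B \<le> measure M (B1 \<union> B2) + measure M (\<Union>j. \<Union>i. B3 j i)"
    unfolding B_def by (rule measure_Un_le[OF sets.Un[OF B1(1) B2(1)] s3])
  also have "measure M (B1 \<union> B2) \<le> measure M B1 + measure M B2" by (rule measure_Un_le[OF B1(1) B2(1)])
  finally have mB: "measure M B \<le> \<delta> + (1 + D) * sqrt (2 / real n) / \<tau> + real CARD('p) * (real CARD('d) * (D * (K * (1 + 2 * R) * e)\<^sup>2 / \<gamma>\<^sup>2))"
    using m3 B1(2) B2(2) by linarith
  show ?thesis
  proof (intro bexI[OF _ Bs] conjI mB ballI allI impI)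
    fix \<omega> assume w: "\<omega> \<in> E - B"
    have wG: "\<omega> \<in> G n" and wM: "\<omega> \<in> space M" and wE: "\<omega> \<in> E" using w EG E by blast+
    have uk: "u k = real k / real n" if "k \<in> {..<n}" for k using that by (simp add: u_def)
    show "\<bar>\<Sum>k<n. g (X (real k / real n) \<omega>) * (W (real (Suc k) / real n) \<omega> - W (real k / real n) \<omega>) $ i\<bar>
         \<le> K' * (real CARD('d) * (2 + D + C2 + 6 * C3) / \<delta>)" if g: "C2_on R K' g Dg" for i K' g Dg
    proof -
      have "\<omega> \<in> G n - B1" using wG w by (simp add: B_def)
      from B1(3)[OF this g, of i] show ?thesis by (simp add: uk cong: sum.cong_simp)
    qed
    show "(\<Sum>k<n. integral {real k / real n..real (Suc k) / real n} (\<lambda>s. norm (W s \<omega> - W (real k / real n) \<omega>))) \<le> \<tau>"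
      by (rule B2(3)[OF _ cd[OF wE]]) (use w wM in \<open>simp add: B_def\<close>)
    show "\<bar>\<Sum>k<n. (f j (X (real k / real n) \<omega>) - f j (X0 (real k / real n))) $ i * (W (real (Suc k) / real n) \<omega> - W (real k / real n) \<omega>) $ i\<bar> \<le> \<gamma>" for j i
    proof -
      have "\<omega> \<in> space M - B3 j i" using w wM by (simp add: B_def)
      from B3(3)[OF this] have "\<bar>\<Sum>k<n. h j i k \<omega> * (W (real (Suc k) / real n) \<omega> - W (real k / real n) \<omega>) $ i\<bar> \<le> \<gamma>" .
      also have "(\<Sum>k<n. h j i k \<omega> * (W (real (Suc k) / real n) \<omega> - W (real k / real n) \<omega>) $ i) =
        (\<Sum>k<n. (f j (X (real k / real n) \<omega>) - f j (X0 (real k / real n))) $ i * (W (real (Suc k) / real n) \<omega> - W (real k / real n) \<omega>) $ i)"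
      proof (rule sum.cong[OF refl])
        fix k assume k: "k \<in> {..<n}"
        have "\<omega> \<in> G k" using Ganti[of k n] k wG by auto
        then show "h j i k \<omega> * (W (real (Suc k) / real n) \<omega> - W (real k / real n) \<omega>) $ i =
          (f j (X (real k / real n) \<omega>) - f j (X0 (real k / real n))) $ i * (W (real (Suc k) / real n) \<omega> - W (real k / real n) \<omega>) $ i"
          unfolding h_def uk[OF k] by simp
      qed
      finally show ?thesis .
    qed
  qed
qed

section \<open>The contrast along a single path\<close>

text \<open>All probabilistic input arrives as the numerical bounds \<open>osc\<close>,
  \<open>Q\<close>, \<open>Sa\<close> and \<open>Sb\<close>. The Euler errors add up to order
  \<open>1 / n\<close> plus \<open>\<epsilon>\<close> times the oscillation of \<open>W\<close>;
  relative to \<open>\<epsilon>\<close> this leaves \<open>c1 / (real n * \<epsilon>)\<close> and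
  \<open>\<tau>\<close>.\<close>

lemma contrast_path_expansion:
  fixes b :: "real ^ 'd \<Rightarrow> real ^ 'p \<Rightarrow> real ^ 'd" and x X0 A W L :: "real \<Rightarrow> real ^ 'd" and f :: "'p \<Rightarrow> real ^ 'd \<Rightarrow> real ^ 'd"
  assumes n: "0 < n" and \<epsilon>: "0 < \<epsilon>" and K: "0 \<le> K" and R: "0 \<le> R" and K0: "0 \<le> K0" and c0: "0 \<le> c0" and CX: "0 \<le> CX" and c1: "0 \<le> c1"
    and cont: "continuous_on (UNIV \<times> \<Theta>) (\<lambda>(x, \<theta>). b x \<theta>)" and \<theta>: "\<theta> \<in> \<Theta>" "\<theta>\<^sub>0 \<in> \<Theta>"
    and lip: "\<And>u w. norm (b u \<theta>\<^sub>0 - b w \<theta>\<^sub>0) \<le> K0 * norm (u - w)"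
    and x_int: "\<And>t. t \<in> {0..1} \<Longrightarrow> ((\<lambda>s. b (x s) \<theta>\<^sub>0) has_integral (x t - x0 - \<epsilon> *\<^sub>R L t)) {0..t}"
    and L: "\<And>t. t \<in> {0..1} \<Longrightarrow> L t = A t + W t" and Wcd: "cadlag_on {0..1} W"
    and A: "\<And>s t. 0 \<le> s \<Longrightarrow> s \<le> t \<Longrightarrow> norm (A t - A s) \<le> c * (t - s)"
    and xR: "\<And>t. t \<in> {0..1} \<Longrightarrow> norm (x t) \<le> R" and xX: "\<And>t. t \<in> {0..1} \<Longrightarrow> norm (x t - X0 t) \<le> \<epsilon> * CX"
    and X0R: "\<And>t. t \<in> {0..1} \<Longrightarrow> norm (X0 t) \<le> R" and X0c: "continuous_on {0..1} X0"
    and X0i: "\<And>s t. 0 \<le> s \<Longrightarrow> s \<le> t \<Longrightarrow> t \<le> 1 \<Longrightarrow> norm (X0 t - X0 s) \<le> c0 * (t - s)"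
    and inc: "\<And>s t. 0 \<le> s \<Longrightarrow> s \<le> t \<Longrightarrow> t \<le> 1 \<Longrightarrow> norm (x t - x s) \<le> c1 * (t - s) + \<epsilon> * norm (W t - W s)"
    and osc: "(\<Sum>k<n. integral {real k / real n..real (Suc k) / real n} (\<lambda>s. norm (W s - W (real k / real n)))) \<le> \<tau>"
    and f: "\<And>i j. \<exists>Df. C2_on R K (\<lambda>x. f j x $ i) Df"
    and g: "\<And>i. \<exists>Dg. C2_on R (K * norm (\<theta> - \<theta>\<^sub>0)) (\<lambda>y. b y \<theta> $ i - b y \<theta>\<^sub>0 $ i) Dg"
    and h: "\<And>i. \<exists>Dh. C2_on R (K * (norm (\<theta> - \<theta>\<^sub>0))\<^sup>2) (\<lambda>y. b y \<theta> $ i - b y \<theta>\<^sub>0 $ i - (\<Sum>j\<in>UNIV. (\<theta> - \<theta>\<^sub>0) $ j * f j y $ i)) Dh"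
    and Q: "\<And>i K f Df. C2_on R K f Df \<Longrightarrow> \<bar>\<Sum>k<n. f (x (real k / real n)) * (W (real (Suc k) / real n) - W (real k / real n)) $ i\<bar> \<le> K * Qb"
    and Sa: "\<And>j. \<bar>(\<Sum>k<n. f j (X0 (real k / real n)) \<bullet> (L (real (Suc k) / real n) - L (real k / real n))) - s $ j\<bar> \<le> \<gamma>a"
    and Sb: "\<And>j i. \<bar>\<Sum>k<n. (f j (x (real k / real n)) - f j (X0 (real k / real n))) $ i * (W (real (Suc k) / real n) - W (real k / real n)) $ i\<bar> \<le> \<gamma>b"
  shows "\<bar>\<epsilon>\<^sup>2 * (lse_contrast b n \<epsilon> x \<theta> - lse_contrast b n \<epsilon> x \<theta>\<^sub>0) - integral {0..1} (\<lambda>s. (norm (b (X0 s) \<theta> - b (X0 s) \<theta>\<^sub>0))\<^sup>2)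
      + 2 * \<epsilon> * (s \<bullet> (\<theta> - \<theta>\<^sub>0))\<bar> \<le>
    2 * (real CARD('d) * K)\<^sup>2 * (1 + 2 * R) * (\<epsilon> * CX + c0 / real n) * (norm (\<theta> - \<theta>\<^sub>0))\<^sup>2 +
    2 * \<epsilon> * ((K0 * (c1 / (real n * \<epsilon>) + \<tau>) * (real CARD('d) * K) +
        real CARD('p) * (\<gamma>a + c * (real CARD('d) * (K * (1 + 2 * R) * (\<epsilon> * CX))) + real CARD('d) * \<gamma>b)) * norm (\<theta> - \<theta>\<^sub>0) +
      (c * (real CARD('d) * K) + real CARD('d) * (K * Qb)) * (norm (\<theta> - \<theta>\<^sub>0))\<^sup>2)"
proof -
  let ?d = "real CARD('d)" and ?p = "real CARD('p)" and ?v = "norm (\<theta> - \<theta>\<^sub>0)"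
  define t where "t k = real k / real n" for k
  have t: "t k \<in> {0..1}" "t (Suc k) \<in> {0..1}" "0 \<le> t k" "t k \<le> t (Suc k)" "t (Suc k) \<le> 1" "t (Suc k) - t k = 1 / real n" if "k < n" for k
    using that n unfolding t_def by (simp_all add: divide_right_mono diff_divide_distrib[symmetric])
  have sub: "{t k..t (Suc k)} \<subseteq> {0..1}" if "k < n" for k
    unfolding atLeastatMost_subset_iff using t[OF that] by simp
  define dW where "dW k = W (t (Suc k)) - W (t k)" for k
  define dL where "dL k = L (t (Suc k)) - L (t k)" for k
  \<comment> \<open>Defined as a difference, so that \<open>dL k = dA k + dW k\<close> holds for
    every index, while the decomposition of \<open>L\<close> is known on
    \<open>[0,1]\<close>.\<close>
  define dA where "dA k = dL k - dW k" for k
  have dA: "norm (dA k) \<le> c / real n" if "k < n" for k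
  proof -
    have "dA k = A (t (Suc k)) - A (t k)" unfolding dA_def dL_def dW_def L[OF t(1)[OF that]] L[OF t(2)[OF that]] by simp
    then show ?thesis using A[OF t(3,4)[OF that]] t(6)[OF that] by simp
  qed
  have sA: "(\<Sum>k<n. norm (dA k)) \<le> c"
  proof -
    have "(\<Sum>k<n. norm (dA k)) \<le> (\<Sum>k<n. c / real n)" using dA by (intro sum_mono) auto
    then show ?thesis using n by simp
  qed
  define \<rho> where "\<rho> k = x (t (Suc k)) - x (t k) - (1 / real n) *\<^sub>R b (x (t k)) \<theta>\<^sub>0 - \<epsilon> *\<^sub>R dL k" for k
  have rho: "norm (\<rho> k) \<le> K0 * (c1 / (real n)\<^sup>2 + \<epsilon> * integral {t k..t (Suc k)} (\<lambda>s. norm (W s - W (t k))))" if k: "k < n" for k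
  proof -
    have 1: "((\<lambda>s. b (x s) \<theta>\<^sub>0) has_integral ((x (t (Suc k)) - x0 - \<epsilon> *\<^sub>R L (t (Suc k))) - (x (t k) - x0 - \<epsilon> *\<^sub>R L (t k)))) {t k..t (Suc k)}"
      by (rule integral_increment[OF x_int t(3,4,5)[OF k]])
    have 2: "((\<lambda>s. b (x (t k)) \<theta>\<^sub>0) has_integral ((1 / real n) *\<^sub>R b (x (t k)) \<theta>\<^sub>0)) {t k..t (Suc k)}"
      using has_integral_const_real[of "b (x (t k)) \<theta>\<^sub>0" "t k" "t (Suc k)"] t(4,6)[OF k] by simp
    have 3: "((\<lambda>s. b (x s) \<theta>\<^sub>0 - b (x (t k)) \<theta>\<^sub>0) has_integral \<rho> k) {t k..t (Suc k)}"
      using has_integral_diff[OF 1 2] by (simp add: \<rho>_def dL_def algebra_simps)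
    note Wi = cadlag_norm_integral(1)[OF Wcd sub[OF k], of "W (t k)"]
    have 4: "((\<lambda>s. K0 * (c1 / real n + \<epsilon> * norm (W s - W (t k)))) has_integral
        (K0 * (c1 / real n * (1 / real n) + \<epsilon> * integral {t k..t (Suc k)} (\<lambda>s. norm (W s - W (t k)))))) {t k..t (Suc k)}"
      using has_integral_mult_right[OF has_integral_add[OF has_integral_const_real[of "c1 / real n" "t k" "t (Suc k)"] has_integral_mult_right[OF integrable_integral[OF Wi], of \<epsilon>]], of K0]
        t(4,6)[OF k] by (simp add: mult.commute)
    have "norm (integral {t k..t (Suc k)} (\<lambda>s. b (x s) \<theta>\<^sub>0 - b (x (t k)) \<theta>\<^sub>0)) \<le> integral {t k..t (Suc k)} (\<lambda>s. K0 * (c1 / real n + \<epsilon> * norm (W s - W (t k))))"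
    proof (rule integral_norm_bound_integral)
      fix s assume s: "s \<in> {t k..t (Suc k)}"
      have "norm (x s - x (t k)) \<le> c1 * (s - t k) + \<epsilon> * norm (W s - W (t k))"
        using s t(3,5)[OF k] by (intro inc) auto
      also have "c1 * (s - t k) \<le> c1 * (1 / real n)" using s t(6)[OF k] c1 by (intro mult_left_mono) auto
      finally have "norm (x s - x (t k)) \<le> c1 / real n + \<epsilon> * norm (W s - W (t k))" by simp
      then show "norm (b (x s) \<theta>\<^sub>0 - b (x (t k)) \<theta>\<^sub>0) \<le> K0 * (c1 / real n + \<epsilon> * norm (W s - W (t k)))"
        using order_trans[OF lip mult_left_mono[OF _ K0]] by blast
    qed (use 3 4 in auto)
    then show ?thesis unfolding integral_unique[OF 3] integral_unique[OF 4] by (simp add: power2_eq_square)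
  qed
  have srho: "(\<Sum>k<n. norm (\<rho> k)) \<le> \<epsilon> * (K0 * (c1 / (real n * \<epsilon>) + \<tau>))"
  proof -
    have "(\<Sum>k<n. norm (\<rho> k)) \<le> (\<Sum>k<n. K0 * (c1 / (real n)\<^sup>2 + \<epsilon> * integral {t k..t (Suc k)} (\<lambda>s. norm (W s - W (t k)))))"
      using rho by (intro sum_mono) auto
    also have "\<dots> = K0 * (real n * (c1 / (real n)\<^sup>2) + \<epsilon> * (\<Sum>k<n. integral {t k..t (Suc k)} (\<lambda>s. norm (W s - W (t k)))))"
      by (simp add: sum_distrib_left[symmetric] sum.distrib)
    also have "\<dots> \<le> K0 * (real n * (c1 / (real n)\<^sup>2) + \<epsilon> * \<tau>)"
      using osc K0 \<epsilon> unfolding t_def by (intro mult_left_mono add_left_mono) auto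
    also have "\<dots> = \<epsilon> * (K0 * (c1 / (real n * \<epsilon>) + \<tau>))" using n \<epsilon> by (simp add: field_simps power2_eq_square)
    finally show ?thesis .
  qed
  \<comment> \<open>The integrand is moved from the observed path to \<open>X0\<close>. Against the
    Lipschitz part of \<open>L\<close>, closeness of the two paths is enough; against
    \<open>W\<close>, smallness is the hypothesis \<open>Sb\<close>.\<close>
  have S: "\<bar>(\<Sum>k<n. f j (x (t k)) \<bullet> dL k) - s $ j\<bar> \<le> \<gamma>a + c * (?d * (K * (1 + 2 * R) * (\<epsilon> * CX))) + ?d * \<gamma>b" for j
  proof -
    define Df where "Df k = f j (x (t k)) - f j (X0 (t k))" for k
    have "\<bar>Df k $ i\<bar> \<le> K * (1 + 2 * R) * (\<epsilon> * CX)" if k: "k < n" for k i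
    proof -
      obtain Dg where "C2_on R K (\<lambda>x. f j x $ i) Dg" using f by blast
      from C2_on_lipschitz[OF this X0R[OF t(1)[OF k]] xR[OF t(1)[OF k]]]
      have "\<bar>Df k $ i\<bar> \<le> K * (1 + 2 * R) * norm (x (t k) - X0 (t k))" by (simp add: Df_def)
      also have "\<dots> \<le> K * (1 + 2 * R) * (\<epsilon> * CX)" using xX[OF t(1)[OF k]] K R by (intro mult_left_mono) auto
      finally show ?thesis .
    qed
    then have Dfn: "norm (Df k) \<le> ?d * (K * (1 + 2 * R) * (\<epsilon> * CX))" if "k < n" for k using that by (intro norm_vec_bound)
    have a1: "\<bar>\<Sum>k<n. Df k \<bullet> dA k\<bar> \<le> c * (?d * (K * (1 + 2 * R) * (\<epsilon> * CX)))"
    proof -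
      have "\<bar>\<Sum>k<n. Df k \<bullet> dA k\<bar> \<le> (\<Sum>k<n. norm (dA k) * (?d * (K * (1 + 2 * R) * (\<epsilon> * CX))))"
      proof (rule order_trans[OF sum_abs], rule sum_mono)
        fix k assume "k \<in> {..<n}"
        then show "\<bar>Df k \<bullet> dA k\<bar> \<le> norm (dA k) * (?d * (K * (1 + 2 * R) * (\<epsilon> * CX)))"
          unfolding inner_commute[of "Df k"] by (intro order_trans[OF Cauchy_Schwarz_ineq2 mult_left_mono] Dfn) auto
      qed
      also have "\<dots> \<le> c * (?d * (K * (1 + 2 * R) * (\<epsilon> * CX)))"
        unfolding sum_distrib_right[symmetric] using K R \<epsilon> CX by (intro mult_right_mono[OF sA]) auto
      finally show ?thesis .
    qed
    have a2: "\<bar>\<Sum>k<n. Df k \<bullet> dW k\<bar> \<le> ?d * \<gamma>b"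
    proof -
      have "(\<Sum>k<n. Df k \<bullet> dW k) = (\<Sum>i\<in>UNIV. \<Sum>k<n. Df k $ i * dW k $ i)" unfolding inner_vec_def by (subst sum.swap) simp
      also have "\<bar>\<dots>\<bar> \<le> (\<Sum>i\<in>(UNIV::'d set). \<gamma>b)"
        by (rule order_trans[OF sum_abs], rule sum_mono) (use Sb in \<open>simp add: Df_def dW_def t_def\<close>)
      finally show ?thesis by simp
    qed
    have "(\<Sum>k<n. f j (x (t k)) \<bullet> dL k) = (\<Sum>k<n. f j (X0 (t k)) \<bullet> dL k) + ((\<Sum>k<n. Df k \<bullet> dA k) + (\<Sum>k<n. Df k \<bullet> dW k))"
      unfolding sum.distrib[symmetric] by (intro sum.cong refl) (simp add: Df_def dA_def inner_diff_left inner_diff_right)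
    moreover have "\<bar>(\<Sum>k<n. f j (X0 (t k)) \<bullet> dL k) - s $ j\<bar> \<le> \<gamma>a" using Sa[of j] unfolding dL_def t_def .
    ultimately show ?thesis using a1 a2 by linarith
  qed
  have E: "\<bar>(\<Sum>k<n. (\<rho> k + \<epsilon> *\<^sub>R dL k) \<bullet> (b (x (t k)) \<theta> - b (x (t k)) \<theta>\<^sub>0)) - \<epsilon> * (s \<bullet> (\<theta> - \<theta>\<^sub>0))\<bar> \<le>
    \<epsilon> * ((K0 * (c1 / (real n * \<epsilon>) + \<tau>) * (?d * K) + ?p * (\<gamma>a + c * (?d * (K * (1 + 2 * R) * (\<epsilon> * CX))) + ?d * \<gamma>b)) * ?v
      + (c * (?d * K) + ?d * (K * Qb)) * ?v\<^sup>2)"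
  proof (rule contrast_expansion[OF \<epsilon> K _ _ g h srho sA _ S])
    show "dL k = dA k + dW k" for k by (simp add: dA_def)
    show "norm (x (t k)) \<le> R" if "k < n" for k by (rule xR[OF t(1)[OF that]])
    show "\<bar>\<Sum>k<n. fa (x (t k)) * dW k $ i\<bar> \<le> Ka * Qb" if "C2_on R Ka fa Df" for i Ka fa Df
      using Q[OF that, of i] unfolding t_def dW_def .
  qed
  define G where "G y = b y \<theta> - b y \<theta>\<^sub>0" for y
  have Gb: "norm (G y) \<le> ?d * (K * ?v)" if y: "norm y \<le> R" for y
  proof (rule norm_vec_bound)
    fix i
    obtain Dg where "C2_on R (K * ?v) (\<lambda>x. b x \<theta> $ i - b x \<theta>\<^sub>0 $ i) Dg" using g by blast
    from C2_on_bound[OF this y] show "\<bar>G y $ i\<bar> \<le> K * ?v" by (simp add: G_def)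
  qed
  have Gl: "norm (G y - G z) \<le> ?d * (K * ?v * (1 + 2 * R) * norm (y - z))" if y: "norm y \<le> R" "norm z \<le> R" for y z
  proof (rule norm_vec_bound)
    fix i
    obtain Dg where "C2_on R (K * ?v) (\<lambda>x. b x \<theta> $ i - b x \<theta>\<^sub>0 $ i) Dg" using g by blast
    from C2_on_lipschitz[OF this y(2,1)] show "\<bar>(G y - G z) $ i\<bar> \<le> K * ?v * (1 + 2 * R) * norm (y - z)" by (simp add: G_def)
  qed
  \<comment> \<open>A Riemann sum along \<open>x\<close> compared with the integral along
    \<open>X0\<close>. The drift difference and its Lipschitz constant each carry a factor
    \<open>norm (\<theta> - \<theta>\<^sub>0)\<close>, whence the square.\<close>
  have Rm: "\<bar>(\<Sum>k<n. (norm (G (x (t k))))\<^sup>2) / real n - integral {0..1} (\<lambda>s. (norm (G (X0 s)))\<^sup>2)\<bar> \<le>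
    2 * (?d * K)\<^sup>2 * (1 + 2 * R) * (\<epsilon> * CX + c0 / real n) * ?v\<^sup>2"
  proof (rule riemann_sum_error[OF n])
    have bs: "continuous_on {0..1} (\<lambda>s. b (X0 s) \<theta>')" if "\<theta>' \<in> \<Theta>" for \<theta>'
    proof -
      have "continuous_on {0..1} (\<lambda>s. (\<lambda>(x, \<theta>). b x \<theta>) (X0 s, \<theta>'))"
        by (rule continuous_on_compose2[OF cont]) (use that X0c in \<open>auto intro!: continuous_intros\<close>)
      then show ?thesis by simp
    qed
    show "(\<lambda>s. (norm (G (X0 s)))\<^sup>2) integrable_on {0..1}"
      unfolding G_def by (intro integrable_continuous_interval continuous_intros bs \<theta>)
    fix k s assume k: "k < n" and s: "s \<in> {real k / real n..real (Suc k) / real n}"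
    have s': "s \<in> {t k..t (Suc k)}" using s by (simp add: t_def)
    have s1: "s \<in> {0..1}" using s' sub[OF k] by blast
    let ?y = "x (t k)" and ?z = "X0 s"
    have yz: "norm ?y \<le> R" "norm ?z \<le> R" using xR[OF t(1)[OF k]] X0R[OF s1] by auto
    have dist: "norm (?y - ?z) \<le> \<epsilon> * CX + c0 / real n"
    proof -
      have "norm (?y - ?z) \<le> norm (x (t k) - X0 (t k)) + norm (X0 s - X0 (t k))"
        using norm_triangle_ineq4[of "x (t k) - X0 (t k)" "X0 s - X0 (t k)"] by simp
      also have "norm (X0 s - X0 (t k)) \<le> c0 * (s - t k)" using s' s1 t(3)[OF k] by (intro X0i) auto
      also have "\<dots> \<le> c0 * (1 / real n)" using s' t(6)[OF k] c0 by (intro mult_left_mono) auto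
      finally show ?thesis using xX[OF t(1)[OF k]] by simp
    qed
    have "\<bar>(norm (G ?y))\<^sup>2 - (norm (G ?z))\<^sup>2\<bar> = \<bar>norm (G ?y) - norm (G ?z)\<bar> * (norm (G ?y) + norm (G ?z))"
      unfolding power2_eq_square square_diff_square_factored by (simp add: abs_mult mult.commute)
    also have "\<dots> \<le> norm (G ?y - G ?z) * (norm (G ?y) + norm (G ?z))"
      by (intro mult_right_mono norm_triangle_ineq3) simp
    also have "\<dots> \<le> (?d * (K * ?v * (1 + 2 * R) * norm (?y - ?z))) * (?d * (K * ?v) + ?d * (K * ?v))"
      using Gl[OF yz] Gb[OF yz(1)] Gb[OF yz(2)] K R by (intro mult_mono add_mono) auto
    also have "\<dots> = 2 * (?d * K)\<^sup>2 * (1 + 2 * R) * norm (?y - ?z) * ?v\<^sup>2" by (simp add: power2_eq_square)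
    also have "\<dots> \<le> 2 * (?d * K)\<^sup>2 * (1 + 2 * R) * (\<epsilon> * CX + c0 / real n) * ?v\<^sup>2"
      using R by (intro mult_right_mono mult_left_mono dist) auto
    finally show "\<bar>(norm (G ?y))\<^sup>2 - (norm (G ?z))\<^sup>2\<bar> \<le> 2 * (?d * K)\<^sup>2 * (1 + 2 * R) * (\<epsilon> * CX + c0 / real n) * ?v\<^sup>2" .
  qed
  have dif: "\<epsilon>\<^sup>2 * (lse_contrast b n \<epsilon> x \<theta> - lse_contrast b n \<epsilon> x \<theta>\<^sub>0) =
     (\<Sum>k<n. (norm (G (x (t k))))\<^sup>2) / real n - 2 * (\<Sum>k<n. (\<rho> k + \<epsilon> *\<^sub>R dL k) \<bullet> (b (x (t k)) \<theta> - b (x (t k)) \<theta>\<^sub>0))"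
    unfolding lse_contrast_difference[OF n \<epsilon>] G_def \<rho>_def t_def by simp
  show ?thesis using E Rm unfolding dif G_def by linarith
qed

lemma cadlag_on_cong:
  assumes "cadlag_on I f" "\<And>t. t \<in> I \<Longrightarrow> f t = g t"
  shows "cadlag_on I g"
proof -
  have ev: "\<forall>\<^sub>F x in at t within I \<inter> S. f x = g x" for t S
    using assms(2) by (auto simp: eventually_at_filter)
  show ?thesis
    unfolding cadlag_on_def
  proof (intro ballI conjI)
    fix t assume t: "t \<in> I"
    show "(g \<longlongrightarrow> g t) (at t within I \<inter> {t<..})"
      using assms t unfolding cadlag_on_def tendsto_cong[OF ev] by force
    show "\<exists>l. (g \<longlongrightarrow> l) (at t within I \<inter> {..<t})"
      using assms(1) t unfolding cadlag_on_def tendsto_cong[OF ev] by blast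
  qed
qed

text \<open>Regularity is available as quantitative bounds on balls; local Lipschitz continuity is
  extracted from them.\<close>

lemma C2_on_borel_measurable:
  fixes f :: "real ^ 'd \<Rightarrow> real"
  assumes "\<And>R. 0 \<le> R \<Longrightarrow> \<exists>K Df. 0 \<le> K \<and> C2_on R K f Df"
  shows "f \<in> borel_measurable borel"
proof (rule borel_measurable_continuous_onI)
  have "isCont f x" for x
  proof -
    let ?R = "norm x + 1"
    obtain K Df where K: "0 \<le> K" "C2_on ?R K f Df" using assms[of ?R] by auto
    have "(K * (1 + 2 * ?R))-lipschitz_on (ball 0 ?R) f"
    proof (rule lipschitz_onI)
      show "dist (f y) (f z) \<le> K * (1 + 2 * ?R) * dist y z" if "y \<in> ball 0 ?R" "z \<in> ball 0 ?R" for y z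
        using C2_on_lipschitz[OF K(2), of z y] that by (simp add: dist_norm)
      show "0 \<le> K * (1 + 2 * ?R)" using K(1) by simp
    qed
    then have "continuous_on (ball 0 ?R) f" by (rule lipschitz_on_continuous_on)
    moreover have "x \<in> ball 0 ?R" by simp
    ultimately show ?thesis using continuous_on_eq_continuous_at[OF open_ball] by blast
  qed
  then show "continuous_on UNIV f" by (simp add: continuous_at_imp_continuous_on)
qed

text \<open>The restriction \<open>\<epsilon> \<le> 1\<close> makes radius and speed independent of
  \<open>\<epsilon>\<close>. The factor \<open>\<epsilon>\<close> of the noise increment is retained
  for the Euler error.\<close>

lemma solution_bounds:
  fixes x y A W L :: "real \<Rightarrow> 'a::euclidean_space"
  assumes lip: "\<And>u w. norm (\<beta> u - \<beta> w) \<le> K * norm (u - w)" and growth: "\<And>u. norm (\<beta> u) \<le> K * (1 + norm u)" and K: "0 < K"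
    and x: "\<And>t. t \<in> {0..1} \<Longrightarrow> ((\<lambda>s. \<beta> (x s)) has_integral (x t - x0 - \<epsilon> *\<^sub>R L t)) {0..t}"
    and y: "\<And>t. t \<in> {0..1} \<Longrightarrow> ((\<lambda>s. \<beta> (y s)) has_integral (y t - x0)) {0..t}"
    and xc: "cadlag_on {0..1} x" and yR: "\<And>t. t \<in> {0..1} \<Longrightarrow> norm (y t) \<le> R0"
    and L: "\<And>t. t \<in> {0..1} \<Longrightarrow> norm (L t) \<le> B" "\<And>t. t \<in> {0..1} \<Longrightarrow> L t = A t + W t"
    and A: "\<And>s t. 0 \<le> s \<Longrightarrow> s \<le> t \<Longrightarrow> norm (A t - A s) \<le> c * (t - s)" and c: "0 \<le> c"
    and \<epsilon>: "0 < \<epsilon>" "\<epsilon> \<le> 1" and R: "R0 + 2 * exp (2 * K) * B \<le> R"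
  shows "t \<in> {0..1} \<Longrightarrow> norm (x t - y t) \<le> \<epsilon> * (2 * exp (2 * K) * B)"
    and "t \<in> {0..1} \<Longrightarrow> norm (x t) \<le> R"
    and "0 \<le> s \<Longrightarrow> s \<le> t \<Longrightarrow> t \<le> 1 \<Longrightarrow> norm (x t - x s) \<le> (K * (1 + R) + c) * (t - s) + \<epsilon> * norm (W t - W s)"
proof -
  obtain Bx where Bx: "\<And>t. t \<in> {0..1} \<Longrightarrow> norm (x t) \<le> Bx" using cadlag_bounded[OF xc] by blast
  have bd: "norm (x t - y t) \<le> Bx + R0" if "t \<in> {0..1}" for t
    using norm_triangle_ineq4[of "x t" "y t"] Bx[OF that] yR[OF that] by linarith
  have 1: "norm (x t - y t) \<le> \<epsilon> * (2 * exp (2 * K) * B)" if t: "t \<in> {0..1}" for t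
    using gronwall_stability[OF lip K x y bd L(1) less_imp_le[OF \<epsilon>(1)] t] by (simp add: mult.commute)
  then show "t \<in> {0..1} \<Longrightarrow> norm (x t - y t) \<le> \<epsilon> * (2 * exp (2 * K) * B)" .
  have B0: "0 \<le> B" by (rule order_trans[OF norm_ge_zero L(1)[of 0]]) simp
  have xR: "norm (x t) \<le> R" if t: "t \<in> {0..1}" for t
  proof -
    have "\<epsilon> * (2 * exp (2 * K) * B) \<le> 1 * (2 * exp (2 * K) * B)" using \<epsilon> B0 by (intro mult_right_mono) auto
    moreover have "norm (x t) \<le> norm (y t) + norm (x t - y t)" using norm_triangle_sub[of "x t" "y t"] .
    ultimately show ?thesis using 1[OF t] yR[OF t] R by linarith
  qed
  then show "t \<in> {0..1} \<Longrightarrow> norm (x t) \<le> R" .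
  have R0: "0 \<le> R" by (rule order_trans[OF norm_ge_zero xR[of 0]]) simp
  show "norm (x t - x s) \<le> (K * (1 + R) + c) * (t - s) + \<epsilon> * norm (W t - W s)" if st: "0 \<le> s" "s \<le> t" "t \<le> 1"
  proof -
    have st': "s \<in> {0..1}" "t \<in> {0..1}" using st by auto
    define J where "J = (x t - x0 - \<epsilon> *\<^sub>R L t) - (x s - x0 - \<epsilon> *\<^sub>R L s)"
    have "((\<lambda>s. \<beta> (x s)) has_integral J) {s..t}" unfolding J_def by (rule integral_increment[OF x st])
    moreover have "norm (\<beta> (x u)) \<le> K * (1 + R)" if "u \<in> {s..t}" for u
    proof -
      have "u \<in> {0..1}" using that st by auto
      from xR[OF this] have "K * (1 + norm (x u)) \<le> K * (1 + R)" using K by (intro mult_left_mono) auto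
      then show ?thesis using growth[of "x u"] by linarith
    qed
    ultimately have "norm J \<le> K * (1 + R) * measure lborel {s..t}" using K R0 by (intro has_integral_bound_real[of "K * (1 + R)" "{}"]) auto
    then have J: "norm J \<le> K * (1 + R) * (t - s)" using st by simp
    have eq: "x t - x s = J + \<epsilon> *\<^sub>R (A t - A s) + \<epsilon> *\<^sub>R (W t - W s)"
      unfolding J_def L(2)[OF st'(1)] L(2)[OF st'(2)] by (simp add: algebra_simps)
    have "\<epsilon> * norm (A t - A s) \<le> 1 * (c * (t - s))" using \<epsilon> A[OF st(1,2)] by (intro mult_mono) auto
    then have "norm (\<epsilon> *\<^sub>R (A t - A s)) \<le> c * (t - s)" using \<epsilon> by simp
    moreover have "norm (\<epsilon> *\<^sub>R (W t - W s)) = \<epsilon> * norm (W t - W s)" using \<epsilon> by simp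
    moreover have "norm (x t - x s) \<le> norm J + norm (\<epsilon> *\<^sub>R (A t - A s)) + norm (\<epsilon> *\<^sub>R (W t - W s))"
      unfolding eq using norm_triangle_ineq[of "J + \<epsilon> *\<^sub>R (A t - A s)" "\<epsilon> *\<^sub>R (W t - W s)"] norm_triangle_ineq[of J "\<epsilon> *\<^sub>R (A t - A s)"] by linarith
    ultimately show ?thesis using J unfolding distrib_right by linarith
  qed
qed

section \<open>Proof of the limit theorem\<close>

theorem theorem2p2:
  fixes M :: "'w measure" and F :: "real \<Rightarrow> 'w measure"
    and a :: "real ^ 'd" and \<sigma> :: "real ^ 'r ^ 'd"
    and B :: "real \<Rightarrow> 'w \<Rightarrow> real ^ 'r"
    and N :: "'w \<Rightarrow> (real \<times> (real ^ 'd)) measure" and \<nu> :: "(real ^ 'd) measure"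
    and L :: "real \<Rightarrow> 'w \<Rightarrow> real ^ 'd"
    and \<Theta>\<^sub>0 \<Theta> :: "(real ^ 'p) set" and \<theta>\<^sub>0 :: "real ^ 'p"
    and b :: "real ^ 'd \<Rightarrow> real ^ 'p \<Rightarrow> real ^ 'd"
    and x0 :: "real ^ 'd"
    and X :: "real \<Rightarrow> real \<Rightarrow> 'w \<Rightarrow> real ^ 'd" and X0 :: "real \<Rightarrow> real ^ 'd"
    and \<theta>hat :: "nat \<Rightarrow> real \<Rightarrow> 'w \<Rightarrow> real ^ 'p"
    and S :: "'w \<Rightarrow> real ^ 'p"
  assumes space: "filtered_space M F"
    and noise: "levy_process M F a \<sigma> B N \<nu> L"
    and Theta0: "open \<Theta>\<^sub>0" "bounded \<Theta>\<^sub>0" "convex \<Theta>\<^sub>0"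
    and Theta: "\<Theta> = closure \<Theta>\<^sub>0"
    and true_value: "\<theta>\<^sub>0 \<in> \<Theta>\<^sub>0"
    and X: "\<And>\<epsilon>. \<epsilon> \<in> {0<..1} \<Longrightarrow> strong_solution M F (\<lambda>x. b x \<theta>\<^sub>0) \<epsilon> L x0 (X \<epsilon>)"
    and X0: "ode_solution (\<lambda>x. b x \<theta>\<^sub>0) x0 X0"
    and estimator_measurable:
      "\<And>n \<epsilon>. n \<ge> 1 \<Longrightarrow> \<epsilon> \<in> {0<..1} \<Longrightarrow> \<theta>hat n \<epsilon> \<in> borel_measurable M"
    and estimator:
      "\<And>n \<epsilon> \<omega>. n \<ge> 1 \<Longrightarrow> \<epsilon> \<in> {0<..1} \<Longrightarrow> \<omega> \<in> space M \<Longrightarrow>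
         is_arg_min (lse_contrast b n \<epsilon> (\<lambda>t. X \<epsilon> t \<omega>)) (\<lambda>\<theta>. \<theta> \<in> \<Theta>) (\<theta>hat n \<epsilon> \<omega>)"
    and A1: "\<exists>K\<^sub>0>0. \<forall>x y. \<forall>\<theta>\<in>\<Theta>.
         norm (b x \<theta> - b y \<theta>) \<le> K\<^sub>0 * norm (x - y) \<and> norm (b x \<theta>) \<le> K\<^sub>0 * (1 + norm x)"
    and A2: "\<And>i. (\<lambda>x \<theta>. b x \<theta> $ i) \<in> C_up 2 3 \<Theta>"
    and A3: "\<And>\<theta>. \<theta> \<in> \<Theta> \<Longrightarrow> \<theta> \<noteq> \<theta>\<^sub>0 \<longleftrightarrow> (\<exists>t\<in>{0..1}. b (X0 t) \<theta> \<noteq> b (X0 t) \<theta>\<^sub>0)"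
    and A4: "pos_definite (info_matrix b X0 \<theta>\<^sub>0)"
    and S: "\<And>i. has_stoch_integral M F (\<lambda>s \<omega>. partial_theta b i (X0 s) \<theta>\<^sub>0) L 1 (\<lambda>\<omega>. S \<omega> $ i)"
  shows "tendsto_in_prob M
      (\<lambda>(n, \<epsilon>) \<omega>. (1 / \<epsilon>) *\<^sub>R (\<theta>hat n \<epsilon> \<omega> - \<theta>\<^sub>0))
      (\<lambda>\<omega>. matrix_inv (info_matrix b X0 \<theta>\<^sub>0) *v S \<omega>)
      (inf (at_top \<times>\<^sub>F at_right 0) (filtercomap (\<lambda>(n, \<epsilon>). real n * \<epsilon>) at_top))"
proof -
  interpret prob_space M using space by (simp add: filtered_space_def)
  let ?I = "info_matrix b X0 \<theta>\<^sub>0"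
  let ?Fl = "inf (at_top \<times>\<^sub>F at_right 0) (filtercomap (\<lambda>(n, \<epsilon>). real n * \<epsilon>) at_top) :: (nat \<times> real) filter"
  let ?d = "real CARD('d)" and ?p = "real CARD('p)"
  define f where "f j x = partial_theta b j x \<theta>\<^sub>0" for j x
  have I_eq: "?I = (\<chi> i j. integral {0..1} (\<lambda>s. f i (X0 s) \<bullet> f j (X0 s)))" by (simp add: info_matrix_def f_def)
  have conv: "convex \<Theta>" and comp: "compact \<Theta>" using Theta0 Theta by (auto simp: convex_closure)
  have sub: "\<Theta>\<^sub>0 \<subseteq> \<Theta>" using Theta closure_subset by simp
  have int: "\<theta>\<^sub>0 \<in> interior \<Theta>" using interior_maximal[OF sub Theta0(1)] true_value by blast
  have t0: "\<theta>\<^sub>0 \<in> \<Theta>" using sub true_value by blast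
  obtain r where r: "0 < r" "ball \<theta>\<^sub>0 r \<subseteq> \<Theta>"
    using Theta0(1) true_value sub unfolding open_contains_ball by blast
  obtain K0 where K0: "0 < K0" "\<And>x y. norm (b x \<theta>\<^sub>0 - b y \<theta>\<^sub>0) \<le> K0 * norm (x - y)" "\<And>x. norm (b x \<theta>\<^sub>0) \<le> K0 * (1 + norm x)"
    using A1 t0 by blast
  note reg = drift_regularity[OF A2 conv int]
  have cont: "continuous_on (UNIV \<times> \<Theta>) (\<lambda>(x, \<theta>). b x \<theta>)" by (rule reg(1)[of 0]) simp
  have fm: "(\<lambda>x. f j x $ i) \<in> borel_measurable borel" for i j
  proof (rule C2_on_borel_measurable)
    show "\<exists>K Df. 0 \<le> K \<and> C2_on R K (\<lambda>x. f j x $ i) Df" if "0 \<le> R" for R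
      using reg(2)[OF that] unfolding f_def by blast
  qed

  have X0d: "(X0 has_vector_derivative b (X0 t) \<theta>\<^sub>0) (at t within {0..1})" if "t \<in> {0..1}" for t
    using X0 that by (simp add: ode_solution_def)
  have X0_0: "X0 0 = x0" using X0 by (simp add: ode_solution_def)
  have X0c: "continuous_on {0..1} X0"
    unfolding continuous_on_eq_continuous_within using has_vector_derivative_continuous[OF X0d] by blast
  have y_int: "((\<lambda>s. b (X0 s) \<theta>\<^sub>0) has_integral (X0 t - x0)) {0..t}" if t: "t \<in> {0..1}" for t
    unfolding X0_0[symmetric]
  proof (rule fundamental_theorem_of_calculus)
    show "0 \<le> t" using t by simp
    show "(X0 has_vector_derivative b (X0 s) \<theta>\<^sub>0) (at s within {0..t})" if "s \<in> {0..t}" for s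
      by (rule has_vector_derivative_within_subset[OF X0d]) (use that t in auto)
  qed
  obtain R0 where R0: "\<And>t. t \<in> {0..1} \<Longrightarrow> norm (X0 t) \<le> R0"
    using compact_imp_bounded[OF compact_continuous_image[OF X0c compact_Icc]] unfolding bounded_iff by blast
  have R0_nn: "0 \<le> R0" by (rule order_trans[OF norm_ge_zero R0[of 0]]) simp
  define c0 where "c0 = K0 * (1 + R0)"
  have c0: "0 \<le> c0" unfolding c0_def using K0(1) R0_nn by simp
  have X0i: "norm (X0 t - X0 s) \<le> c0 * (t - s)" if st: "0 \<le> s" "s \<le> t" "t \<le> 1" for s t
  proof -
    have "((\<lambda>s. b (X0 s) \<theta>\<^sub>0) has_integral (X0 t - x0 - (X0 s - x0))) {s..t}" by (rule integral_increment[OF y_int st])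
    moreover have "norm (b (X0 u) \<theta>\<^sub>0) \<le> c0" if "u \<in> {s..t}" for u
    proof -
      have "u \<in> {0..1}" using that st by auto
      from R0[OF this] have "K0 * (1 + norm (X0 u)) \<le> c0" unfolding c0_def using K0(1) by (intro mult_left_mono) auto
      then show ?thesis using K0(3)[of "X0 u"] by linarith
    qed
    ultimately have "norm (X0 t - x0 - (X0 s - x0)) \<le> c0 * measure lborel {s..t}"
      using c0 by (intro has_integral_bound_real[of c0 "{}"]) auto
    then show ?thesis using st by simp
  qed
  obtain l where l: "0 < l" "\<And>v. l * (norm v)\<^sup>2 \<le> v \<bullet> (?I *v v)" using pos_definite_coercive(1)[OF A4] by blast
  have L_ad: "\<And>t. 0 \<le> t \<Longrightarrow> L t \<in> borel_measurable (F t)" and L_cd: "AE \<omega> in M. cadlag_on {0..} (\<lambda>t. L t \<omega>)"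
    using noise by (auto simp: levy_process_def)
  have subF: "\<And>t. 0 \<le> t \<Longrightarrow> subalgebra M (F t)" using space by (simp add: filtered_space_def)
  have L_M: "L t \<in> borel_measurable M" if "0 \<le> t" for t by (rule measurable_from_subalg[OF subF[OF that] L_ad[OF that]])
  have L_cd1: "AE \<omega> in M. cadlag_on {0..1} (\<lambda>t. L t \<omega>)"
  proof (rule eventually_mono[OF L_cd])
    show "cadlag_on {0..1} (\<lambda>t. L t \<omega>)" if "cadlag_on {0..} (\<lambda>t. L t \<omega>)" for \<omega>
      by (rule cadlag_on_subset[OF that]) auto
  qed
  have Sj: "(\<lambda>\<omega>. S \<omega> $ i) \<in> borel_measurable M" for i using S[of i] unfolding has_stoch_integral_def by (elim conjE)
  have S_M: "S \<in> borel_measurable M"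
  proof (rule borel_measurable_euclidean_space[THEN iffD2], rule ballI)
    fix e :: "real ^ 'p" assume "e \<in> Basis"
    then obtain i where "e = axis i 1" by (auto simp: Basis_vec_def)
    then show "(\<lambda>\<omega>. S \<omega> \<bullet> e) \<in> borel_measurable M" using Sj[of i] by (simp add: inner_axis)
  qed

  \<comment> \<open>The filter couples three requirements. Each estimate below depends on just one
    of \<open>\<epsilon>\<close>, \<open>n\<close> and \<open>n * \<epsilon>\<close>, so they are
    handled separately.\<close>
  have lim_\<epsilon>: "filterlim snd (at_right 0) ?Fl" by (rule filterlim_mono[OF filterlim_snd order_refl inf_le1])
  have lim_n: "filterlim fst at_top ?Fl" by (rule filterlim_mono[OF filterlim_fst order_refl inf_le1])
  have lim_x: "filterlim (\<lambda>(n, \<epsilon>). real n * \<epsilon>) at_top ?Fl" by (rule filterlim_mono[OF filterlim_filtercomap order_refl inf_le2])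
  have ev_\<epsilon>: "\<forall>\<^sub>F z in ?Fl. h (snd z) < t" if "(h \<longlongrightarrow> 0) (at_right 0)" "0 < t" for h :: "real \<Rightarrow> real" and t
    using filterlim_compose[OF that(1) lim_\<epsilon>] that(2) by (rule order_tendstoD(2))
  have ev_n: "\<forall>\<^sub>F z in ?Fl. h (fst z) < t" if "h \<longlonglongrightarrow> 0" "0 < t" for h :: "nat \<Rightarrow> real" and t
    using filterlim_compose[OF that(1) lim_n] that(2) by (rule order_tendstoD(2))
  have dec: "((\<lambda>x. k / x) \<longlongrightarrow> 0) at_top" for k :: real
    by (rule tendsto_divide_0[OF tendsto_const filterlim_at_top_imp_at_infinity[OF filterlim_ident]])
  have dec_n: "(\<lambda>n. k / real n) \<longlonglongrightarrow> 0" for k :: real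
    by (rule filterlim_compose[OF dec filterlim_real_sequentially])

  show ?thesis
    unfolding tendsto_in_prob_def
  proof (intro allI impI tendstoI)
    fix \<eta> e :: real assume \<eta>: "0 < \<eta>" and e: "0 < e"
    \<comment> \<open>Seven losses of at most \<open>\<delta>\<close> will occur: one each for
      \<open>G0\<close>, \<open>EL\<close> and \<open>ES\<close>, three in the bound for the set
      \<open>B\<close>, and one for the grid approximation of the integrals.\<close>
    define \<delta> where "\<delta> = e / 8"
    have \<delta>: "0 < \<delta>" using e by (simp add: \<delta>_def)
    obtain A c C W G0 where levy: "0 \<le> c \<and> 0 \<le> C \<and> G0 \<in> sets M \<and> 1 - \<delta> \<le> measure M G0 \<and>
      (\<forall>s t. 0 \<le> s \<longrightarrow> s \<le> t \<longrightarrow> norm (A t - A s) \<le> c * (t - s)) \<and>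
      (\<forall>\<omega>\<in>G0. \<forall>t\<in>{0..1}. L t \<omega> = A t + W t \<omega>) \<and> (\<forall>t\<ge>0. W t \<in> borel_measurable (F t)) \<and>
      (\<forall>s t i. 0 \<le> s \<and> s < t \<longrightarrow> centred_incr M (F s) (C * (t - s)) (\<lambda>\<omega>. (W t \<omega> - W s \<omega> :: real ^ 'd) $ i))"
      using levy_truncation[OF space noise \<delta>] by (elim exE) (rule that)
    then have c: "0 \<le> c" and C: "0 \<le> C" and G0: "G0 \<in> sets M" "1 - \<delta> \<le> measure M G0" by simp_all
    from levy have A: "\<And>s t. 0 \<le> s \<Longrightarrow> s \<le> t \<Longrightarrow> norm (A t - A s) \<le> c * (t - s)"
      and LAW: "\<And>\<omega> t. \<omega> \<in> G0 \<Longrightarrow> t \<in> {0..1} \<Longrightarrow> L t \<omega> = A t + W t \<omega>"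
      and W_ad: "\<And>t. 0 \<le> t \<Longrightarrow> W t \<in> borel_measurable (F t)"
      and W_cent: "\<And>s t i. 0 \<le> s \<Longrightarrow> s < t \<Longrightarrow> centred_incr M (F s) (C * (t - s)) (\<lambda>\<omega>. (W t \<omega> - W s \<omega>) $ i)"
      by simp_all
    interpret W: noise_process M F W C using space C W_ad W_cent by unfold_locales
    obtain R1 EL where R1: "0 \<le> R1" and EL: "EL \<in> sets M" "1 - \<delta> \<le> measure M EL"
      "\<And>\<omega>. \<omega> \<in> EL \<Longrightarrow> cadlag_on {0..1} (\<lambda>t. L t \<omega>)" "\<And>\<omega> t. \<omega> \<in> EL \<Longrightarrow> t \<in> {0..1} \<Longrightarrow> norm (L t \<omega>) \<le> R1"
      using cadlag_bounded_in_probability[of M L, OF prob_space_axioms _ L_cd1 \<delta>] L_M by auto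
    \<comment> \<open>Tightness of \<open>S\<close> is read off the path lemma by viewing
      \<open>S\<close> as a path constant in time.\<close>
    obtain R2 ES where R2: "0 \<le> R2" and ES: "ES \<in> sets M" "1 - \<delta> \<le> measure M ES" "\<And>\<omega>. \<omega> \<in> ES \<Longrightarrow> norm (S \<omega>) \<le> R2"
    proof -
      have "AE \<omega> in M. cadlag_on {0..1} (\<lambda>t::real. S \<omega>)" by (rule AE_I2) (auto simp: cadlag_on_def)
      from cadlag_bounded_in_probability[of M "\<lambda>t. S", OF prob_space_axioms S_M this \<delta>]
      obtain R E where "0 \<le> R" "E \<in> sets M" "1 - \<delta> \<le> measure M E" "\<forall>\<omega>\<in>E. \<forall>t\<in>{0..1::real}. norm (S \<omega>) \<le> R" by blast
      moreover have "(0::real) \<in> {0..1}" by simp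
      ultimately show ?thesis by (intro that[of R E]) blast+
    qed
    define CX where "CX = 2 * exp (2 * K0) * R1"
    have CX: "0 \<le> CX" unfolding CX_def using R1 by simp
    \<comment> \<open>One radius for \<open>X0\<close>, \<open>X\<close> and \<open>W\<close>; the
      last group of summands bounds \<open>L - A\<close> on \<open>[0,1]\<close>.\<close>
    define R where "R = R0 + CX + (R1 + norm (A 0) + c)"
    have R: "0 \<le> R" "R0 \<le> R" "R0 + CX \<le> R" "R1 + norm (A 0) + c \<le> R"
      unfolding R_def using R0_nn CX R1 c by auto
    define c1 where "c1 = K0 * (1 + R) + c"
    have c1: "0 \<le> c1" unfolding c1_def using K0(1) R(1) c by simp
    obtain K where K: "0 \<le> K" and f: "\<And>i j. \<exists>Df. C2_on R K (\<lambda>x. f j x $ i) Df"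
      and g: "\<And>\<theta> i. \<theta> \<in> \<Theta> \<Longrightarrow> \<exists>Dg. C2_on R (K * norm (\<theta> - \<theta>\<^sub>0)) (\<lambda>x. b x \<theta> $ i - b x \<theta>\<^sub>0 $ i) Dg"
      and h: "\<And>\<theta> i. \<theta> \<in> \<Theta> \<Longrightarrow> \<exists>Dh. C2_on R (K * (norm (\<theta> - \<theta>\<^sub>0))\<^sup>2) (\<lambda>x. b x \<theta> $ i - b x \<theta>\<^sub>0 $ i - (\<Sum>j\<in>UNIV. (\<theta> - \<theta>\<^sub>0) $ j * f j x $ i)) Dh"
      using reg(2)[OF R(1)] unfolding f_def by auto
    define q where "q \<theta> = integral {0..1} (\<lambda>s. (norm (b (X0 s) \<theta> - b (X0 s) \<theta>\<^sub>0))\<^sup>2)" for \<theta>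
    have X0R: "norm (X0 t) \<le> R" if "t \<in> {0..1}" for t using R0[OF that] R(2) by linarith
    have A3': "\<exists>t\<in>{0..1}. b (X0 t) \<theta> \<noteq> b (X0 t) \<theta>\<^sub>0" if "\<theta> \<in> \<Theta>" "\<theta> \<noteq> \<theta>\<^sub>0" for \<theta> using A3[OF that(1)] that(2) by blast
    obtain cq Cq where q: "0 < cq" "0 \<le> Cq" "\<And>\<theta>. \<theta> \<in> \<Theta> \<Longrightarrow> cq * (norm (\<theta> - \<theta>\<^sub>0))\<^sup>2 \<le> q \<theta>"
      "\<And>\<theta>. \<theta> \<in> \<Theta> \<Longrightarrow> \<bar>q \<theta> - (\<theta> - \<theta>\<^sub>0) \<bullet> (?I *v (\<theta> - \<theta>\<^sub>0))\<bar> \<le> Cq * norm (\<theta> - \<theta>\<^sub>0) ^ 3"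
      using identification[OF cont X0c X0R comp t0 K f g h A3' l(1) l(2)[unfolded I_eq]] unfolding I_eq q_def by blast
    \<comment> \<open>The constant of \<open>good_event\<close> written out. It must be known before
      the threshold \<open>\<gamma>\<close>, and hence before \<open>n\<close> and
      \<open>\<epsilon>\<close>, are restricted.\<close>
    define Qb where "Qb = ?d * (2 + W.D + ?d * (W.D * (2 * c1\<^sup>2 + 2 * W.D)) +
       6 * ((2 * c1\<^sup>2 + 2 * W.D) * (1 + W.D) + (2 * c1\<^sup>2 + 2 * W.D) + ?d * (W.D * (2 * c1\<^sup>2 + 2 * W.D)))) / \<delta>"
    have Qb: "0 \<le> Qb" unfolding Qb_def using W.D0 \<delta> by (intro divide_nonneg_pos mult_nonneg_nonneg add_nonneg_nonneg) auto
    define Q where "Q = c * (?d * K) + ?d * (K * Qb)"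
    have Q: "0 \<le> Q" unfolding Q_def using c K Qb by simp
    have sym: "transpose ?I = ?I" using A4 by (simp add: pos_definite_def)
    obtain \<gamma> where \<gamma>: "0 < \<gamma>" and argmin: "\<forall>\<gamma>' \<epsilon> s \<theta> \<Delta>. 0 \<le> \<gamma>' \<longrightarrow> \<gamma>' \<le> \<gamma> \<longrightarrow> 0 < \<epsilon> \<longrightarrow> \<epsilon> \<le> \<gamma> \<longrightarrow> norm s \<le> R2 \<longrightarrow> \<theta> \<in> \<Theta> \<longrightarrow>
       \<Delta> \<theta>\<^sub>0 = 0 \<longrightarrow> (\<forall>\<theta>'\<in>\<Theta>. \<Delta> \<theta> \<le> \<Delta> \<theta>') \<longrightarrow>
       (\<forall>\<theta>\<in>\<Theta>. \<bar>\<Delta> \<theta> - q \<theta> + 2 * \<epsilon> * (s \<bullet> (\<theta> - \<theta>\<^sub>0))\<bar> \<le> \<gamma>' * (norm (\<theta> - \<theta>\<^sub>0))\<^sup>2 + 2 * \<epsilon> * (\<gamma>' * norm (\<theta> - \<theta>\<^sub>0) + Q * (norm (\<theta> - \<theta>\<^sub>0))\<^sup>2)) \<longrightarrow>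
       norm ((1 / \<epsilon>) *\<^sub>R (\<theta> - \<theta>\<^sub>0) - matrix_inv ?I *v s) \<le> \<eta>"
      by (rule quadratic_argmin[OF sym l pos_definite_coercive(2)[OF A4] q(3,1,4) r R2 Q q(2) \<eta>, THEN exE])
        (assumption, assumption, elim conjE, rule that)
    \<comment> \<open>The tolerance \<open>\<gamma>\<close> is divided up: the coefficient of the
      parameter distance consists of five pieces of at most \<open>\<gamma> / 6\<close>, that of its
      square of two pieces below \<open>\<gamma> / 2\<close>.\<close>
    define \<tau> where "\<tau> = \<gamma> / (6 * (K0 * (?d * K) + 1))"
    have dK: "0 \<le> K0 * (?d * K)" using K0(1) K by simp
    have \<tau>: "0 < \<tau>" "K0 * \<tau> * (?d * K) \<le> \<gamma> / 6"
    proof -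
      show "0 < \<tau>" unfolding \<tau>_def using dK \<gamma> by simp
      have "K0 * \<tau> * (?d * K) = (K0 * (?d * K)) / (K0 * (?d * K) + 1) * (\<gamma> / 6)" by (simp add: \<tau>_def algebra_simps)
      also have "\<dots> \<le> 1 * (\<gamma> / 6)" using dK \<gamma> by (intro mult_right_mono) auto
      finally show "K0 * \<tau> * (?d * K) \<le> \<gamma> / 6" by simp
    qed
    define \<gamma>a where "\<gamma>a = \<gamma> / (6 * ?p)"
    define \<gamma>b where "\<gamma>b = \<gamma> / (6 * (?p * ?d))"
    have \<gamma>ab: "0 < \<gamma>a" "0 < \<gamma>b" "?p * \<gamma>a = \<gamma> / 6" "?p * (?d * \<gamma>b) = \<gamma> / 6" using \<gamma> by (simp_all add: \<gamma>a_def \<gamma>b_def)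

    define err where "err n j \<omega> = (\<Sum>k<n. f j (X0 (real k / real n)) \<bullet> (L (real (Suc k) / real n) \<omega> - L (real k / real n) \<omega>))" for n j \<omega>
    define B4 where "B4 n j = {\<omega> \<in> space M. dist (err n j \<omega>) (S \<omega> $ j) > \<gamma>a}" for n j
    have err_M: "err n j \<in> borel_measurable M" for n j
      unfolding err_def by (intro borel_measurable_sum borel_measurable_inner borel_measurable_diff borel_measurable_const L_M) simp_all
    have B4: "B4 n j \<in> sets M" for n j
    proof -
      note [measurable] = err_M[of n j] Sj[of j]
      show ?thesis unfolding B4_def by measurable
    qed

    have "\<forall>\<^sub>F z in ?Fl. 1 \<le> fst z" using eventually_compose_filterlim[OF eventually_ge_at_top lim_n] .
    moreover have "\<forall>\<^sub>F z in ?Fl. snd z \<in> {0<..<1}" using eventually_compose_filterlim[OF eventually_at_right_real[of 0 1] lim_\<epsilon>] by simp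
    moreover have "\<forall>\<^sub>F z in ?Fl. snd z < \<gamma>" by (rule ev_\<epsilon>[OF _ \<gamma>]) (rule tendsto_ident_at)
    moreover have "\<forall>\<^sub>F z in ?Fl. 2 * (?d * K)\<^sup>2 * (1 + 2 * R) * (snd z * CX) < \<gamma> / 2"
      by (rule ev_\<epsilon>) (use \<gamma> in \<open>auto intro!: tendsto_eq_intros\<close>)
    moreover have "\<forall>\<^sub>F z in ?Fl. 2 * (?d * K)\<^sup>2 * (1 + 2 * R) * (c0 / real (fst z)) < \<gamma> / 2"
      by (rule ev_n[OF tendsto_mult_right_zero[OF dec_n]]) (use \<gamma> in simp)
    moreover have "\<forall>\<^sub>F z in ?Fl. ?p * (c * (?d * (K * (1 + 2 * R) * (snd z * CX)))) < \<gamma> / 6"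
      by (rule ev_\<epsilon>) (use \<gamma> in \<open>auto intro!: tendsto_eq_intros\<close>)
    \<comment> \<open>The Euler error relative to the noise level: here
      \<open>n * \<epsilon>\<close> tending to infinity is used.\<close>
    moreover have "\<forall>\<^sub>F z in ?Fl. K0 * (c1 / (real (fst z) * snd z)) * (?d * K) < \<gamma> / 6"
    proof -
      have "((\<lambda>x. K0 * (c1 / x) * (?d * K)) \<longlongrightarrow> 0) at_top"
        by (rule tendsto_mult_left_zero[OF tendsto_mult_right_zero[OF dec]])
      from filterlim_compose[OF this lim_x] have "((\<lambda>z. K0 * (c1 / (real (fst z) * snd z)) * (?d * K)) \<longlongrightarrow> 0) ?Fl" by (simp add: case_prod_beta')
      then show ?thesis by (rule order_tendstoD(2)) (use \<gamma> in simp)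
    qed
    moreover have "\<forall>\<^sub>F z in ?Fl. (1 + W.D) * sqrt (2 / real (fst z)) / \<tau> < \<delta>"
    proof (rule ev_n[OF _ \<delta>])
      have "(\<lambda>n. sqrt (2 / real n)) \<longlonglongrightarrow> 0" using tendsto_real_sqrt[OF dec_n[of 2]] by simp
      then show "(\<lambda>n. (1 + W.D) * sqrt (2 / real n) / \<tau>) \<longlonglongrightarrow> 0"
        by (intro tendsto_divide_zero tendsto_mult_right_zero)
    qed
    moreover have "\<forall>\<^sub>F z in ?Fl. ?p * (?d * (W.D * (K * (1 + 2 * R) * (snd z * CX))\<^sup>2 / \<gamma>b\<^sup>2)) < \<delta>"
      by (rule ev_\<epsilon>[OF _ \<delta>]) (use \<gamma>ab in \<open>auto intro!: tendsto_eq_intros\<close>)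
    moreover have "\<forall>\<^sub>F z in ?Fl. \<forall>j. measure M (B4 (fst z) j) < \<delta> / ?p"
    proof (rule eventually_all_finite)
      fix j
      have "tendsto_in_prob M (\<lambda>n \<omega>. err n j \<omega>) (\<lambda>\<omega>. S \<omega> $ j) sequentially"
        unfolding err_def f_def by (rule stoch_integral_grid[OF prob_space_axioms S])
      then have "(\<lambda>n. measure M (B4 n j)) \<longlonglongrightarrow> 0" unfolding tendsto_in_prob_def B4_def using \<gamma>ab(1) by blast
      then show "\<forall>\<^sub>F z in ?Fl. measure M (B4 (fst z) j) < \<delta> / ?p" by (rule ev_n) (use \<delta> in simp)
    qed
    ultimately show "\<forall>\<^sub>F z in ?Fl. dist (measure M {\<omega> \<in> space M. dist ((case z of (n, \<epsilon>) \<Rightarrow> \<lambda>\<omega>. (1 / \<epsilon>) *\<^sub>R (\<theta>hat n \<epsilon> \<omega> - \<theta>\<^sub>0)) \<omega>) (matrix_inv ?I *v S \<omega>) > \<eta>}) 0 < e"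
    proof eventually_elim
      case (elim z)
      define n where "n = fst z"
      define \<epsilon> where "\<epsilon> = snd z"
      have z: "z = (n, \<epsilon>)" by (simp add: n_def \<epsilon>_def)
      note el = elim[folded n_def \<epsilon>_def]
      have n: "0 < n" "n \<ge> 1" and \<epsilon>: "0 < \<epsilon>" "\<epsilon> \<le> 1" "\<epsilon> \<in> {0<..1}" "\<epsilon> \<le> \<gamma>" using el by auto
      have XA: "\<And>t. t \<in> {0..1} \<Longrightarrow> X \<epsilon> t \<in> borel_measurable (F t)"
        and XE: "AE \<omega> in M. cadlag_on {0..1} (\<lambda>t. X \<epsilon> t \<omega>) \<and>
          (\<forall>t\<in>{0..1}. ((\<lambda>s. b (X \<epsilon> s \<omega>) \<theta>\<^sub>0) has_integral (X \<epsilon> t \<omega> - x0 - \<epsilon> *\<^sub>R L t \<omega>)) {0..t})"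
        using X[OF \<epsilon>(3)] unfolding strong_solution_def by blast+
      \<comment> \<open>The exceptional null set depends on \<open>\<epsilon>\<close> and is taken
        after \<open>\<epsilon>\<close> is fixed, so no union over \<open>\<epsilon>\<close> is
        formed.\<close>
      obtain Z where Z: "Z \<in> sets M" "measure M Z = 0" and XZ: "\<And>\<omega>. \<omega> \<in> space M - Z \<Longrightarrow> cadlag_on {0..1} (\<lambda>t. X \<epsilon> t \<omega>)"
         "\<And>\<omega> t. \<omega> \<in> space M - Z \<Longrightarrow> t \<in> {0..1} \<Longrightarrow> ((\<lambda>s. b (X \<epsilon> s \<omega>) \<theta>\<^sub>0) has_integral (X \<epsilon> t \<omega> - x0 - \<epsilon> *\<^sub>R L t \<omega>)) {0..t}"
      proof -
        obtain Z where Z: "{\<omega> \<in> space M. \<not> (cadlag_on {0..1} (\<lambda>t. X \<epsilon> t \<omega>) \<and>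
          (\<forall>t\<in>{0..1}. ((\<lambda>s. b (X \<epsilon> s \<omega>) \<theta>\<^sub>0) has_integral (X \<epsilon> t \<omega> - x0 - \<epsilon> *\<^sub>R L t \<omega>)) {0..t}))} \<subseteq> Z" "emeasure M Z = 0" "Z \<in> sets M"
          using AE_E[OF XE] .
        have "measure M Z = 0" using Z(2) by (simp add: measure_def)
        then show ?thesis using Z(1,3) by (intro that[of Z]) blast+
      qed
      define E where "E = G0 \<inter> EL \<inter> ES \<inter> (space M - Z)"
      have ED: "\<omega> \<in> G0" "\<omega> \<in> EL" "\<omega> \<in> ES" "\<omega> \<in> space M - Z" if "\<omega> \<in> E" for \<omega> using that by (auto simp: E_def)
      have CXR: "R0 + 2 * exp (2 * K0) * R1 \<le> R" using R(3) by (simp add: CX_def)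
      have sol: "t \<in> {0..1} \<Longrightarrow> norm (X \<epsilon> t \<omega> - X0 t) \<le> \<epsilon> * CX" "t \<in> {0..1} \<Longrightarrow> norm (X \<epsilon> t \<omega>) \<le> R"
        "0 \<le> s \<Longrightarrow> s \<le> t \<Longrightarrow> t \<le> 1 \<Longrightarrow> norm (X \<epsilon> t \<omega> - X \<epsilon> s \<omega>) \<le> c1 * (t - s) + \<epsilon> * norm (W t \<omega> - W s \<omega>)"
        if w: "\<omega> \<in> E" for \<omega> s t
      proof -
        note sb = solution_bounds[of "\<lambda>x. b x \<theta>\<^sub>0" K0 "\<lambda>t. X \<epsilon> t \<omega>" x0 \<epsilon> "\<lambda>t. L t \<omega>" X0 R0 R1 A "\<lambda>t. W t \<omega>" c R,
          OF K0(2,3,1) XZ(2)[OF ED(4)[OF w]] y_int XZ(1)[OF ED(4)[OF w]] R0 EL(4)[OF ED(2)[OF w]] LAW[OF ED(1)[OF w]] A c \<epsilon>(1,2) CXR, folded CX_def c1_def]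
        show "norm (X \<epsilon> t \<omega> - X0 t) \<le> \<epsilon> * CX" if "t \<in> {0..1}" by (rule sb(1)) (use that in auto)
        show "norm (X \<epsilon> t \<omega>) \<le> R" if "t \<in> {0..1}" by (rule sb(2)) (use that in auto)
        show "norm (X \<epsilon> t \<omega> - X \<epsilon> s \<omega>) \<le> c1 * (t - s) + \<epsilon> * norm (W t \<omega> - W s \<omega>)" if "0 \<le> s" "s \<le> t" "t \<le> 1"
          by (rule sb(3)) (use that in auto)
      qed
      have WR: "norm (W t \<omega>) \<le> R" if w: "\<omega> \<in> E" and t: "t \<in> {0..1}" for \<omega> t
      proof -
        have t1: "0 \<le> t" "t \<le> 1" using t by auto
        have eq: "W t \<omega> = L t \<omega> - A 0 - (A t - A 0)" using LAW[OF ED(1)[OF w] t] by simp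
        have "norm (W t \<omega>) \<le> norm (L t \<omega>) + norm (A 0) + norm (A t - A 0)"
          unfolding eq using norm_triangle_ineq4[of "L t \<omega> - A 0" "A t - A 0"] norm_triangle_ineq4[of "L t \<omega>" "A 0"] by linarith
        moreover have "norm (A t - A 0) \<le> c" using A[of 0 t] t1 mult_left_mono[OF t1(2) c] by simp
        ultimately show ?thesis using EL(4)[OF ED(2)[OF w] t] R(4) by linarith
      qed
      have Ac: "continuous_on {0..1} A"
      proof (rule lipschitz_on_continuous_on[of c], rule lipschitz_onI[OF _ c])
        show "dist (A s) (A t) \<le> c * dist s t" if "s \<in> {0..1}" "t \<in> {0..1}" for s t
          using A[of s t] A[of t s] that by (cases "s \<le> t") (auto simp: dist_norm norm_minus_commute)
      qed
      have Wcd: "cadlag_on {0..1} (\<lambda>t. W t \<omega>)" if w: "\<omega> \<in> E" for \<omega>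
        by (rule cadlag_on_cong[OF cadlag_on_diff[OF EL(3)[OF ED(2)[OF w]] Ac]]) (simp add: LAW[OF ED(1)[OF w]])
      \<comment> \<open>The discrete estimates are stated with noise increments of coefficient one;
        \<open>\<epsilon> \<le> 1\<close> allows this.\<close>
      have incW: "norm (X \<epsilon> t \<omega> - X \<epsilon> s \<omega>) \<le> c1 * (t - s) + norm (W t \<omega> - W s \<omega>)" if w: "\<omega> \<in> E" and st: "0 \<le> s" "s \<le> t" "t \<le> 1" for \<omega> s t
        using sol(3)[OF w st] mult_right_mono[OF \<epsilon>(2) norm_ge_zero[of "W t \<omega> - W s \<omega>"]] by linarith
      have bad: "\<exists>B\<in>sets M. measure M B \<le> \<delta> + (1 + W.D) * sqrt (2 / real n) / \<tau> + ?p * (?d * (W.D * (K * (1 + 2 * R) * (\<epsilon> * CX))\<^sup>2 / \<gamma>b\<^sup>2)) \<and>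
        (\<forall>\<omega>\<in>E - B.
          (\<forall>i K f Df. C2_on R K f Df \<longrightarrow> \<bar>\<Sum>k<n. f (X \<epsilon> (real k / real n) \<omega>) * (W (real (Suc k) / real n) \<omega> - W (real k / real n) \<omega>) $ i\<bar> \<le> K * Qb) \<and>
          (\<Sum>k<n. integral {real k / real n..real (Suc k) / real n} (\<lambda>s. norm (W s \<omega> - W (real k / real n) \<omega>))) \<le> \<tau> \<and>
          (\<forall>j i. \<bar>\<Sum>k<n. (f j (X \<epsilon> (real k / real n) \<omega>) - f j (X0 (real k / real n))) $ i * (W (real (Suc k) / real n) \<omega> - W (real k / real n) \<omega>) $ i\<bar> \<le> \<gamma>b))" (is "\<exists>B\<in>_. ?P B")
        unfolding Qb_def
      proof (rule W.good_event[OF n(1) \<delta> \<tau>(1) \<gamma>ab(2) R(1) c1 K _ XA _ _ incW Wcd X0R f fm])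
        show "0 \<le> \<epsilon> * CX" using \<epsilon>(1) CX by simp
        show "E \<subseteq> space M" by (auto simp: E_def)
        show "norm (X \<epsilon> t \<omega>) \<le> R \<and> norm (W t \<omega>) \<le> R \<and> norm (X \<epsilon> t \<omega> - X0 t) \<le> \<epsilon> * CX" if w: "\<omega> \<in> E" and t: "t \<in> {0..1}" for \<omega> t
          using sol(1,2)[OF w t] WR[OF w t] by blast
      qed
      from bad obtain B where B1: "B \<in> sets M" "?P B" by (elim bexE) (rule that)
      note B = B1(1) B1(2)[THEN conjunct1] and BP = B1(2)[THEN conjunct2, THEN bspec]
      note BQ = BP[THEN conjunct1, rule_format] and Bosc = BP[THEN conjunct2, THEN conjunct1] and BS = BP[THEN conjunct2, THEN conjunct2, rule_format]
      have main: "norm ((1 / \<epsilon>) *\<^sub>R (\<theta>hat n \<epsilon> \<omega> - \<theta>\<^sub>0) - matrix_inv ?I *v S \<omega>) \<le> \<eta>"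
        if w: "\<omega> \<in> E" and wB: "\<omega> \<notin> B" "\<And>j. \<omega> \<notin> B4 n j" for \<omega>
      proof -
        have wEB: "\<omega> \<in> E - B" using w wB(1) by blast
        define \<Delta> where "\<Delta> \<theta> = \<epsilon>\<^sup>2 * (lse_contrast b n \<epsilon> (\<lambda>t. X \<epsilon> t \<omega>) \<theta> - lse_contrast b n \<epsilon> (\<lambda>t. X \<epsilon> t \<omega>) \<theta>\<^sub>0)" for \<theta>
        have am: "is_arg_min (lse_contrast b n \<epsilon> (\<lambda>t. X \<epsilon> t \<omega>)) (\<lambda>\<theta>. \<theta> \<in> \<Theta>) (\<theta>hat n \<epsilon> \<omega>)"
          by (rule estimator[OF n(2) \<epsilon>(3)]) (use ED(4)[OF w] in blast)
        have hT: "\<theta>hat n \<epsilon> \<omega> \<in> \<Theta>" using am by (simp add: is_arg_min_def)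
        have min: "\<forall>\<theta>'\<in>\<Theta>. \<Delta> (\<theta>hat n \<epsilon> \<omega>) \<le> \<Delta> \<theta>'"
        proof
          fix \<theta>' assume "\<theta>' \<in> \<Theta>"
          then have "lse_contrast b n \<epsilon> (\<lambda>t. X \<epsilon> t \<omega>) (\<theta>hat n \<epsilon> \<omega>) \<le> lse_contrast b n \<epsilon> (\<lambda>t. X \<epsilon> t \<omega>) \<theta>'"
            using am by (auto simp: is_arg_min_def not_less)
          then show "\<Delta> (\<theta>hat n \<epsilon> \<omega>) \<le> \<Delta> \<theta>'" unfolding \<Delta>_def by (intro mult_left_mono) auto
        qed
        have Sa: "\<bar>(\<Sum>k<n. f j (X0 (real k / real n)) \<bullet> (L (real (Suc k) / real n) \<omega> - L (real k / real n) \<omega>)) - S \<omega> $ j\<bar> \<le> \<gamma>a" for j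
          using wB(2)[of j] ED(4)[OF w] by (simp add: B4_def err_def dist_real_def not_less)
        have exp: "\<bar>\<Delta> \<theta> - q \<theta> + 2 * \<epsilon> * (S \<omega> \<bullet> (\<theta> - \<theta>\<^sub>0))\<bar> \<le> \<gamma> * (norm (\<theta> - \<theta>\<^sub>0))\<^sup>2 + 2 * \<epsilon> * (\<gamma> * norm (\<theta> - \<theta>\<^sub>0) + Q * (norm (\<theta> - \<theta>\<^sub>0))\<^sup>2)"
          if t: "\<theta> \<in> \<Theta>" for \<theta>
        proof -
          have "\<bar>\<Delta> \<theta> - q \<theta> + 2 * \<epsilon> * (S \<omega> \<bullet> (\<theta> - \<theta>\<^sub>0))\<bar> \<le>
            2 * (?d * K)\<^sup>2 * (1 + 2 * R) * (\<epsilon> * CX + c0 / real n) * (norm (\<theta> - \<theta>\<^sub>0))\<^sup>2 +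
            2 * \<epsilon> * ((K0 * (c1 / (real n * \<epsilon>) + \<tau>) * (?d * K) +
              ?p * (\<gamma>a + c * (?d * (K * (1 + 2 * R) * (\<epsilon> * CX))) + ?d * \<gamma>b)) * norm (\<theta> - \<theta>\<^sub>0) + Q * (norm (\<theta> - \<theta>\<^sub>0))\<^sup>2)"
            unfolding \<Delta>_def q_def Q_def
            by (rule contrast_path_expansion[OF n(1) \<epsilon>(1) K R(1) less_imp_le[OF K0(1)] c0 CX c1 cont t t0 K0(2) XZ(2)[OF ED(4)[OF w]] LAW[OF ED(1)[OF w]]
                Wcd[OF w] A sol(2)[OF w] sol(1)[OF w] X0R X0c X0i sol(3)[OF w] Bosc[OF wEB] f g[OF t] h[OF t] BQ[OF wEB] Sa BS[OF wEB]])
          also have "\<dots> \<le> \<gamma> * (norm (\<theta> - \<theta>\<^sub>0))\<^sup>2 + 2 * \<epsilon> * (\<gamma> * norm (\<theta> - \<theta>\<^sub>0) + Q * (norm (\<theta> - \<theta>\<^sub>0))\<^sup>2)"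
          proof (intro add_mono mult_right_mono mult_left_mono order_refl)
            show "2 * (?d * K)\<^sup>2 * (1 + 2 * R) * (\<epsilon> * CX + c0 / real n) \<le> \<gamma>" using el unfolding distrib_left by linarith
            have "K0 * (c1 / (real n * \<epsilon>) + \<tau>) * (?d * K) = K0 * (c1 / (real n * \<epsilon>)) * (?d * K) + K0 * \<tau> * (?d * K)"
              by (simp add: algebra_simps)
            then show "K0 * (c1 / (real n * \<epsilon>) + \<tau>) * (?d * K) + ?p * (\<gamma>a + c * (?d * (K * (1 + 2 * R) * (\<epsilon> * CX))) + ?d * \<gamma>b) \<le> \<gamma>"
              using el \<tau>(2) \<gamma>ab(3,4) \<gamma> unfolding distrib_left[of ?p] by linarith
          qed (use \<epsilon>(1) in auto)
          finally show ?thesis .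
        qed
        have \<Delta>0: "\<Delta> \<theta>\<^sub>0 = 0" by (simp add: \<Delta>_def)
        show ?thesis
          by (rule argmin[rule_format, of \<gamma> \<epsilon> "S \<omega>" "\<theta>hat n \<epsilon> \<omega>" \<Delta>, OF less_imp_le[OF \<gamma>] order_refl \<epsilon>(1,4) ES(3)[OF ED(3)[OF w]] hT \<Delta>0])
            (use min exp in auto)
      qed
      \<comment> \<open>Everything excluded on the way; off this set \<open>main\<close> applies, so
        the deviation event lies inside it.\<close>
      define U where "U = (space M - G0) \<union> (space M - EL) \<union> (space M - ES) \<union> Z \<union> B \<union> (\<Union>j. B4 n j)"
      let ?T = "{\<omega> \<in> space M. dist ((1 / \<epsilon>) *\<^sub>R (\<theta>hat n \<epsilon> \<omega> - \<theta>\<^sub>0)) (matrix_inv ?I *v S \<omega>) > \<eta>}"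
      have sub: "?T \<subseteq> U"
      proof
        fix \<omega> assume w: "\<omega> \<in> ?T"
        show "\<omega> \<in> U"
        proof (rule ccontr)
          assume "\<omega> \<notin> U"
          then have "\<omega> \<in> E" "\<omega> \<notin> B" "\<And>j. \<omega> \<notin> B4 n j" using w by (auto simp: U_def E_def)
          from main[OF this] show False using w by (simp add: dist_norm)
        qed
      qed
      have Us: "(\<Union>j. B4 n j) \<in> sets M" using B4 by (intro sets.finite_UN) auto
      have "measure M (\<Union>j. B4 n j) \<le> (\<Sum>j\<in>UNIV. measure M (B4 n j))" using B4 by (intro finite_measure_subadditive_finite) auto
      also have "\<dots> \<le> (\<Sum>j\<in>(UNIV::'p set). \<delta> / ?p)" using el by (intro sum_mono less_imp_le) auto
      finally have m4: "measure M (\<Union>j. B4 n j) \<le> \<delta>" by simp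
      have cs: "space M - H \<in> sets M" "measure M (space M - H) \<le> \<delta>" if "H \<in> sets M" "1 - \<delta> \<le> measure M H" for H
        using that prob_compl[OF that(1)] by auto
      note s = cs(1)[OF G0] cs(1)[OF EL(1,2)] cs(1)[OF ES(1,2)] Z(1) B(1) Us
      note s2 = sets.Un[OF s(1,2)]
      note s3 = sets.Un[OF s2 s(3)]
      note s4 = sets.Un[OF s3 s(4)]
      note s5 = sets.Un[OF s4 s(5)]
      have "measure M U < e"
        using measure_Un_le[OF s(1,2)] measure_Un_le[OF s2 s(3)] measure_Un_le[OF s3 s(4)] measure_Un_le[OF s4 s(5)] measure_Un_le[OF s5 s(6)]
          cs(2)[OF G0] cs(2)[OF EL(1,2)] cs(2)[OF ES(1,2)] Z(2) B(2) m4 el e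
        unfolding U_def \<delta>_def by linarith
      moreover have "measure M ?T \<le> measure M U"
        by (rule finite_measure_mono[OF sub]) (use sets.Un[OF s5 s(6)] in \<open>simp add: U_def\<close>)
      ultimately show ?case unfolding z by simp
    qed
  qed
qed

end
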